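(* Let $n,m\ge 1$, $\lambda_1,\lambda_2>2$, $0<\alpha\le n(\lambda_1-2)/2$ and $0<\beta\le m(\lambda_2-2)/2$. Suppose the kernel $K_{t_1,t_2}$ satisfies Assumptions 1, 2 and 3 (stated in the context). Then for every $f\in L^2(\mathbb{R}^{n+m})$, $$\|g^*_{\lambda_1,\lambda_2}(f)\|_{L^2(\mathbb{R}^{n+m})}\lesssim \|f\|_{L^2(\mathbb{R}^{n+m})},$$ where the implied constant depends only on $n,m,\alpha,\beta,\lambda_1,\lambda_2$ and the constants in the assumptions.
   Context: Norms on $\mathbb{R}^n$ and $\mathbb{R}^m$ are the $\ell^\infty$ norms. Points are written $x=(x_1,x_2)\in\mathbb{R}^{n}\times\mathbb{R}^m$, and $t_1,t_2>0$. For a kernel $K_{t_1,t_2}:\mathbb{R}^{n+m}\times\mathbb{R}^{n+m}\to\mathbb{C}$ set $\theta_{t_1,t_2}f(y_1,y_2)=\iint_{\mathbb{R}^{n+m}}K_{t_1,t_2}((y_1,y_2),(z_1,z_2))f(z_1,z_2)\,dz_1\,dz_2$, and $$g^*_{\lambda_1,\lambda_2}(f)(x)=\Big(\iint_{\mathbb{R}^{m+1}_+}\Big(\tfrac{t_2}{t_2+|x_2-y_2|}\Big)^{m\lambda_2}\iint_{\mathbb{R}^{n+1}_+}\Big(\tfrac{t_1}{t_1+|x_1-y_1|}\Big)^{n\lambda_1}|\theta_{t_1,t_2}f(y_1,y_2)|^2\frac{dy_1dt_1}{t_1^{n+1}}\frac{dy_2dt_2}{t_2^{m+1}}\Big)^{1/2}.$$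 We write $K_{t_1,t_2}(x-y,z_1,z_2)$ for $K_{t_1,t_2}((x_1-y_1,x_2-y_2),(z_1,z_2))$. For a cube $I\subset\mathbb{R}^n$ with side length $\ell(I)$, $\widehat I=I\times(0,\ell(I))$ and $W_I=I\times(\ell(I)/2,\ell(I))$. Assumption 1 (standard estimates), for all $x,y,y'\in\mathbb{R}^{n+m}$, $t_1,t_2>0$: (1) $|K_{t_1,t_2}(x,y)|\lesssim \frac{t_1^\alpha}{(t_1+|x_1-y_1|)^{n+\alpha}}\frac{t_2^\beta}{(t_2+|x_2-y_2|)^{m+\beta}}$; (2) $|K_{t_1,t_2}(x,y)-K_{t_1,t_2}(x,(y_1,y_2'))-K_{t_1,t_2}(x,(y_1',y_2))+K_{t_1,t_2}(x,y')|\lesssim \frac{|y_1-y_1'|^\alpha}{(t_1+|x_1-y_1|)^{n+\alpha}}\frac{|y_2-y_2'|^\beta}{(t_2+|x_2-y_2|)^{m+\beta}}$ whenever $|y_1-y_1'|<t_1/2$, $|y_2-y_2'|<t_2/2$; (3) $|K_{t_1,t_2}(x,y)-K_{t_1,t_2}(x,(y_1,y_2'))|\lesssim \frac{t_1^\alpha}{(t_1+|x_1-y_1|)^{n+\alpha}}\frac{|y_2-y_2'|^\beta}{(t_2+|x_2-y_2|)^{m+\beta}}$ whenever $|y_2-y_2'|<t_2/2$, and $|K_{t_1,t_2}(x,y)-K_{t_1,t_2}(x,(y_1',y_2))|\lesssim \frac{|y_1-y_1'|^\alpha}{(t_1+|x_1-y_1|)^{n+\alpha}}\frac{t_2^\beta}{(t_2+|x_2-y_2|)^{m+\beta}}$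 whenever $|y_1-y_1'|<t_1/2$. Assumption 2, for every cube $I\subset\mathbb{R}^n$, $J\subset\mathbb{R}^m$, all $x_2,y_2,z_2,z_2'\in\mathbb{R}^m$, $x_1,y_1,z_1,z_1'\in\mathbb{R}^n$, $t_1,t_2>0$: (1) $\Big(\iint_{\widehat I}\int_{\mathbb{R}^n}\big|\int_I K_{t_1,t_2}(x-y,z_1,z_2)dz_1\big|^2\big(\tfrac{t_1}{t_1+|y_1|}\big)^{n\lambda_1}\frac{dy_1dx_1dt_1}{t_1^{n+1}}\Big)^{1/2}\lesssim |I|^{1/2}\frac{t_2^\beta}{(t_2+|x_2-y_2-z_2|)^{m+\beta}}$, and symmetrically $\Big(\iint_{\widehat J}\int_{\mathbb{R}^m}\big|\int_J K_{t_1,t_2}(x-y,z_1,z_2)dz_2\big|^2\big(\tfrac{t_2}{t_2+|y_2|}\big)^{m\lambda_2}\frac{dy_2dx_2dt_2}{t_2^{m+1}}\Big)^{1/2}\lesssim |J|^{1/2}\frac{t_1^\alpha}{(t_1+|x_1-y_1-z_1|)^{n+\alpha}}$; (2) $\Big(\iint_{\widehat I}\int_{\mathbb{R}^n}\big|\int_I [K_{t_1,t_2}(x-y,z_1,z_2)-K_{t_1,t_2}(x-y,z_1,z_2')]dz_1\big|^2\big(\tfrac{t_1}{t_1+|y_1|}\big)^{n\lambda_1}\frac{dy_1dx_1dt_1}{t_1^{n+1}}\Big)^{1/2}\lesssim |I|^{1/2}\frac{|z_2-z_2'|^\beta}{(t_2+|x_2-y_2-z_2|)^{m+\beta}}$ whenever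 $|z_2-z_2'|<t_2/2$, and symmetrically $\Big(\iint_{\widehat J}\int_{\mathbb{R}^m}\big|\int_J [K_{t_1,t_2}(x-y,z_1,z_2)-K_{t_1,t_2}(x-y,z_1',z_2)]dz_2\big|^2\big(\tfrac{t_2}{t_2+|y_2|}\big)^{m\lambda_2}\frac{dy_2dx_2dt_2}{t_2^{m+1}}\Big)^{1/2}\lesssim |J|^{1/2}\frac{|z_1-z_1'|^\alpha}{(t_1+|x_1-y_1-z_1|)^{n+\alpha}}$ whenever $|z_1-z_1'|<t_1/2$. Assumption 3 (bi-parameter Carleson condition): For dyadic grids $\mathcal D_n$ in $\mathbb{R}^n$ and $\mathcal D_m$ in $\mathbb{R}^m$ (translates of the standard dyadic grids), $\mathcal D=\mathcal D_n\times\mathcal D_m$, and $I\in\mathcal D_n$, $J\in\mathcal D_m$, let $$C^{\mathcal D}_{IJ}=\iint_{W_J}\iint_{W_I}\iint_{\mathbb{R}^{n+m}}|\theta_{t_1,t_2}\mathbf 1(y_1,y_2)|^2\Big(\tfrac{t_1}{t_1+|x_1-y_1|}\Big)^{n\lambda_1}\Big(\tfrac{t_2}{t_2+|x_2-y_2|}\Big)^{m\lambda_2}\frac{dy_1dy_2}{t_1^nt_2^m}\frac{dx_1dt_1}{t_1}\frac{dx_2dt_2}{t_2}.$$ It is assumed that for every such $\mathcal D$, $\sum_{I\times J\in\mathcal D,\ I\times J\subset\Omega}C^{\mathcal D}_{IJ}\lesssim|\Omega|$ for all sets $\Omega\subset\mathbb{R}^{n+m}$ with $|\Omega|<\infty$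 such that every $x\in\Omega$ lies in some $I\times J\in\mathcal D$ with $I\times J\subset\Omega$. *)

theory Defs
  imports "HOL-Analysis.Analysis"
begin

text \<open>Points of R^n are vectors (real^'n) (dimension n = CARD('n)); the norm is the
  sup norm infnorm. Points of R^(n+m) are pairs (x1,x2).\<close>

definition hcube :: "(real^'n::finite) \<Rightarrow> real \<Rightarrow> (real^'n) set" where
  "hcube a l = {x. \<forall>i. a$i \<le> x$i \<and> x$i < a$i + l}"

text \<open>Standard dyadic grid, cubes indexed by (lower corner, side length).\<close>
definition std_dyadic :: "((real^'n::finite) \<times> real) set" where
  "std_dyadic = {(2 powr (real_of_int k) *\<^sub>R (\<chi> i. real_of_int (j i)), 2 powr (real_of_int k)) |
                 (k::int) (j::'n \<Rightarrow> int). True}"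

definition dyadic_grid :: "(real^'n::finite) \<Rightarrow> ((real^'n) \<times> real) set" where
  "dyadic_grid w = {(a + w, l) | a l. (a, l) \<in> std_dyadic}"

definition ensqrt :: "ennreal \<Rightarrow> ennreal" where
  "ensqrt x = (if x = \<infinity> then \<infinity> else ennreal (sqrt (enn2real x)))"

type_synonym ('n,'m) kernel =
  "real \<Rightarrow> real \<Rightarrow> ((real^'n) \<times> (real^'m)) \<Rightarrow> ((real^'n) \<times> (real^'m)) \<Rightarrow> complex"

definition theta :: "('n::finite,'m::finite) kernel \<Rightarrow> real \<Rightarrow> real \<Rightarrow>
    ((real^'n) \<times> (real^'m) \<Rightarrow> complex) \<Rightarrow> (real^'n) \<times> (real^'m) \<Rightarrow> complex" where
  "theta K t1 t2 f y = (\<integral>z. K t1 t2 y z * f z \<partial>lborel)"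

definition gstar_sq :: "('n::finite,'m::finite) kernel \<Rightarrow> real \<Rightarrow> real \<Rightarrow>
    ((real^'n) \<times> (real^'m) \<Rightarrow> complex) \<Rightarrow> (real^'n) \<times> (real^'m) \<Rightarrow> ennreal" where
  "gstar_sq K l1 l2 f x =
    (\<integral>\<^sup>+ (y2::(real^'m)). \<integral>\<^sup>+ t2. indicator {0<..} t2 *
       ennreal ((t2 / (t2 + infnorm (snd x - y2))) powr (real CARD('m) * l2) / t2 ^ (CARD('m) + 1)) *
       (\<integral>\<^sup>+ (y1::(real^'n)). \<integral>\<^sup>+ t1. indicator {0<..} t1 *
          ennreal ((t1 / (t1 + infnorm (fst x - y1))) powr (real CARD('n) * l1) *
                   (cmod (theta K t1 t2 f (y1, y2)))\<^sup>2 / t1 ^ (CARD('n) + 1))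
        \<partial>lborel \<partial>lborel) \<partial>lborel \<partial>lborel)"

definition gstar :: "('n::finite,'m::finite) kernel \<Rightarrow> real \<Rightarrow> real \<Rightarrow>
    ((real^'n) \<times> (real^'m) \<Rightarrow> complex) \<Rightarrow> (real^'n) \<times> (real^'m) \<Rightarrow> ennreal" where
  "gstar K l1 l2 f x = ensqrt (gstar_sq K l1 l2 f x)"

definition L2 :: "('a::euclidean_space \<Rightarrow> complex) \<Rightarrow> bool" where
  "L2 f \<longleftrightarrow> f \<in> borel_measurable lborel \<and> integrable lborel (\<lambda>x. (cmod (f x))\<^sup>2)"

definition L2norm :: "('a::euclidean_space \<Rightarrow> complex) \<Rightarrow> real" where
  "L2norm f = sqrt (\<integral>x. (cmod (f x))\<^sup>2 \<partial>lborel)"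

definition L2norm_nn :: "('a::euclidean_space \<Rightarrow> ennreal) \<Rightarrow> ennreal" where
  "L2norm_nn g = ensqrt (\<integral>\<^sup>+x. (g x)\<^sup>2 \<partial>lborel)"

definition kernel_measurable :: "('n::finite,'m::finite) kernel \<Rightarrow> bool" where
  "kernel_measurable K \<longleftrightarrow>
    (\<lambda>(t1, t2, x, y). if 0 < t1 \<and> 0 < t2 then K t1 t2 x y else 0)
      \<in> borel_measurable (borel :: (real \<times> real \<times> ((real^'n) \<times> (real^'m)) \<times> ((real^'n) \<times> (real^'m))) measure)"

definition assumption1 :: "real \<Rightarrow> real \<Rightarrow> real \<Rightarrow> ('n::finite,'m::finite) kernel \<Rightarrow> bool" where
  "assumption1 A \<alpha> \<beta> K \<longleftrightarrow>
   (\<forall>t1 t2 (x1::(real^'n)) (x2::(real^'m)) y1 y2 y1' y2'. 0 < t1 \<longrightarrow> 0 < t2 \<longrightarrow>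
     cmod (K t1 t2 (x1, x2) (y1, y2)) \<le>
        A * (t1 powr \<alpha> / (t1 + infnorm (x1 - y1)) powr (real CARD('n) + \<alpha>))
          * (t2 powr \<beta> / (t2 + infnorm (x2 - y2)) powr (real CARD('m) + \<beta>))
   \<and> (infnorm (y1 - y1') < t1 / 2 \<longrightarrow> infnorm (y2 - y2') < t2 / 2 \<longrightarrow>
       cmod (K t1 t2 (x1, x2) (y1, y2) - K t1 t2 (x1, x2) (y1, y2')
             - K t1 t2 (x1, x2) (y1', y2) + K t1 t2 (x1, x2) (y1', y2')) \<le>
        A * (infnorm (y1 - y1') powr \<alpha> / (t1 + infnorm (x1 - y1)) powr (real CARD('n) + \<alpha>))
          * (infnorm (y2 - y2') powr \<beta> / (t2 + infnorm (x2 - y2)) powr (real CARD('m) + \<beta>)))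
   \<and> (infnorm (y2 - y2') < t2 / 2 \<longrightarrow>
       cmod (K t1 t2 (x1, x2) (y1, y2) - K t1 t2 (x1, x2) (y1, y2')) \<le>
        A * (t1 powr \<alpha> / (t1 + infnorm (x1 - y1)) powr (real CARD('n) + \<alpha>))
          * (infnorm (y2 - y2') powr \<beta> / (t2 + infnorm (x2 - y2)) powr (real CARD('m) + \<beta>)))
   \<and> (infnorm (y1 - y1') < t1 / 2 \<longrightarrow>
       cmod (K t1 t2 (x1, x2) (y1, y2) - K t1 t2 (x1, x2) (y1', y2)) \<le>
        A * (infnorm (y1 - y1') powr \<alpha> / (t1 + infnorm (x1 - y1)) powr (real CARD('n) + \<alpha>))
          * (t2 powr \<beta> / (t2 + infnorm (x2 - y2)) powr (real CARD('m) + \<beta>))))"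

definition assumption2 :: "real \<Rightarrow> real \<Rightarrow> real \<Rightarrow> real \<Rightarrow> real \<Rightarrow> ('n::finite,'m::finite) kernel \<Rightarrow> bool" where
  "assumption2 A \<alpha> \<beta> l1 l2 K \<longleftrightarrow>
   (\<forall>(a::(real^'n)) l (x2::(real^'m)) y2 z2 z2' t2. 0 < l \<longrightarrow> 0 < t2 \<longrightarrow>
      ensqrt (\<integral>\<^sup>+ x1. \<integral>\<^sup>+ t1. \<integral>\<^sup>+ y1.
          indicator (hcube a l) x1 * indicator {0<..<l} t1 *
          ennreal ((cmod (\<integral>z1\<in>hcube a l. K t1 t2 (x1 - y1, x2 - y2) (z1, z2) \<partial>lborel))\<^sup>2
                   * (t1 / (t1 + infnorm y1)) powr (real CARD('n) * l1) / t1 ^ (CARD('n) + 1))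
        \<partial>lborel \<partial>lborel \<partial>lborel)
      \<le> ennreal (A * sqrt (measure lborel (hcube a l))
                  * (t2 powr \<beta> / (t2 + infnorm (x2 - y2 - z2)) powr (real CARD('m) + \<beta>)))
    \<and> (infnorm (z2 - z2') < t2 / 2 \<longrightarrow>
      ensqrt (\<integral>\<^sup>+ x1. \<integral>\<^sup>+ t1. \<integral>\<^sup>+ y1.
          indicator (hcube a l) x1 * indicator {0<..<l} t1 *
          ennreal ((cmod (\<integral>z1\<in>hcube a l. (K t1 t2 (x1 - y1, x2 - y2) (z1, z2)
                                            - K t1 t2 (x1 - y1, x2 - y2) (z1, z2')) \<partial>lborel))\<^sup>2
                   * (t1 / (t1 + infnorm y1)) powr (real CARD('n) * l1) / t1 ^ (CARD('n) + 1))
        \<partial>lborel \<partial>lborel \<partial>lborel)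
      \<le> ennreal (A * sqrt (measure lborel (hcube a l))
                  * (infnorm (z2 - z2') powr \<beta> / (t2 + infnorm (x2 - y2 - z2)) powr (real CARD('m) + \<beta>)))))
   \<and>
   (\<forall>(b::(real^'m)) r (x1::(real^'n)) y1 z1 z1' t1. 0 < r \<longrightarrow> 0 < t1 \<longrightarrow>
      ensqrt (\<integral>\<^sup>+ x2. \<integral>\<^sup>+ t2. \<integral>\<^sup>+ y2.
          indicator (hcube b r) x2 * indicator {0<..<r} t2 *
          ennreal ((cmod (\<integral>z2\<in>hcube b r. K t1 t2 (x1 - y1, x2 - y2) (z1, z2) \<partial>lborel))\<^sup>2
                   * (t2 / (t2 + infnorm y2)) powr (real CARD('m) * l2) / t2 ^ (CARD('m) + 1))
        \<partial>lborel \<partial>lborel \<partial>lborel)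
      \<le> ennreal (A * sqrt (measure lborel (hcube b r))
                  * (t1 powr \<alpha> / (t1 + infnorm (x1 - y1 - z1)) powr (real CARD('n) + \<alpha>)))
    \<and> (infnorm (z1 - z1') < t1 / 2 \<longrightarrow>
      ensqrt (\<integral>\<^sup>+ x2. \<integral>\<^sup>+ t2. \<integral>\<^sup>+ y2.
          indicator (hcube b r) x2 * indicator {0<..<r} t2 *
          ennreal ((cmod (\<integral>z2\<in>hcube b r. (K t1 t2 (x1 - y1, x2 - y2) (z1, z2)
                                            - K t1 t2 (x1 - y1, x2 - y2) (z1', z2)) \<partial>lborel))\<^sup>2
                   * (t2 / (t2 + infnorm y2)) powr (real CARD('m) * l2) / t2 ^ (CARD('m) + 1))
        \<partial>lborel \<partial>lborel \<partial>lborel)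
      \<le> ennreal (A * sqrt (measure lborel (hcube b r))
                  * (infnorm (z1 - z1') powr \<alpha> / (t1 + infnorm (x1 - y1 - z1)) powr (real CARD('n) + \<alpha>)))))"

definition carleson_coeff :: "('n::finite,'m::finite) kernel \<Rightarrow> real \<Rightarrow> real \<Rightarrow>
    (real^'n) \<times> real \<Rightarrow> (real^'m) \<times> real \<Rightarrow> ennreal" where
  "carleson_coeff K l1 l2 I J =
    (\<integral>\<^sup>+ x2. \<integral>\<^sup>+ t2. \<integral>\<^sup>+ x1. \<integral>\<^sup>+ t1. \<integral>\<^sup>+ y.
       indicator (hcube (fst J) (snd J)) x2 * indicator {snd J / 2<..<snd J} t2 *
       indicator (hcube (fst I) (snd I)) x1 * indicator {snd I / 2<..<snd I} t1 *
       ennreal ((cmod (theta K t1 t2 (\<lambda>_. 1) y))\<^sup>2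
         * (t1 / (t1 + infnorm (x1 - fst y))) powr (real CARD('n) * l1)
         * (t2 / (t2 + infnorm (x2 - snd y))) powr (real CARD('m) * l2)
         / (t1 ^ CARD('n) * t2 ^ CARD('m)) / t1 / t2)
     \<partial>lborel \<partial>lborel \<partial>lborel \<partial>lborel \<partial>lborel)"

definition assumption3 :: "real \<Rightarrow> real \<Rightarrow> real \<Rightarrow> ('n::finite,'m::finite) kernel \<Rightarrow> bool" where
  "assumption3 A l1 l2 K \<longleftrightarrow>
   (\<forall>(w1::(real^'n)) (w2::(real^'m)) (\<Omega>::((real^'n) \<times> (real^'m)) set).
      \<Omega> \<in> sets lborel \<longrightarrow> emeasure lborel \<Omega> < \<infinity> \<longrightarrow>
      (\<forall>x\<in>\<Omega>. \<exists>I\<in>dyadic_grid w1. \<exists>J\<in>dyadic_grid w2.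
          x \<in> hcube (fst I) (snd I) \<times> hcube (fst J) (snd J)
          \<and> hcube (fst I) (snd I) \<times> hcube (fst J) (snd J) \<subseteq> \<Omega>) \<longrightarrow>
      (\<Sum>\<^sub>\<infinity>IJ\<in>{(I, J). I \<in> dyadic_grid w1 \<and> J \<in> dyadic_grid w2
                    \<and> hcube (fst I) (snd I) \<times> hcube (fst J) (snd J) \<subseteq> \<Omega>}.
          carleson_coeff K l1 l2 (fst IJ) (snd IJ))
        \<le> ennreal A * emeasure lborel \<Omega>)"

end

theory Submission
  imports Defs
begin

text \<open>
  Integrating the weights \<open>(t\<^sub>i / (t\<^sub>i + |x\<^sub>i - y\<^sub>i|))\<close> in \<open>x\<close> first, the squared \<open>L\<^sup>2\<close> norm of \<open>g\<^sup>*\<close> becomes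
  comparable to the vertical square function \<open>\<integral>\<integral>\<integral> |\<theta> f(y)|\<^sup>2 dy dt\<^sub>1/t\<^sub>1 dt\<^sub>2/t\<^sub>2\<close>. In each variable \<open>f\<close> is split
  into its dyadic average \<open>E f\<close> at the scale of \<open>t\<^sub>i\<close>, evaluated at the point \<open>y\<^sub>i\<close>, and the remainder
  \<open>f - E f(y\<^sub>i)\<close>. On the remainder the kernel is almost orthogonal to the martingale differences of \<open>f\<close>,
  with geometric decay in the distance of the scales. This holds for operator-valued kernels, so the
  other variable enters only through the \<open>L\<^sup>2\<close> bound of a one-parameter operator, which is a T1 theorem
  whose Carleson condition comes from Assumption 2 (the part of \<open>1\<close> outside a cube is
  controlled by applying almost orthogonality to the indicator of the cube).

  What is left is the paraproduct \<open>\<theta> 1 \<cdot> E\<^sub>1 E\<^sub>2 f\<close>. It is bounded by a Carleson embedding: the level set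
  \<open>{M f > s}\<close> of the iterated dyadic maximal function contains every dyadic rectangle on which the average of \<open>f\<close>
  exceeds \<open>s\<close>, so Assumption 3 and the layer cake formula reduce the bound to the \<open>L\<^sup>2\<close> boundedness
  of \<open>M\<close>, i.e. to Doob's inequality in each variable.
\<close>

subsection \<open>Cubes and Lebesgue measure\<close>

lemma infnorm_attained_cart: "\<exists>i. infnorm (u::real^'n) = \<bar>u$i\<bar>"
proof -
  have "infnorm u \<in> (\<lambda>i. \<bar>u \<bullet> i\<bar>) ` Basis" unfolding infnorm_Max by (intro Max_in) auto
  then show ?thesis by (auto simp: Basis_vec_def inner_axis)
qed

lemma infnorm_le_iff_cart: "infnorm (u::real^'n) \<le> r \<longleftrightarrow> (\<forall>i. \<bar>u$i\<bar> \<le> r)"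
  using infnorm_attained_cart[of u] component_le_infnorm_cart[of u] order_trans by metis

lemma infnorm_less_iff_cart: "infnorm (u::real^'n) < r \<longleftrightarrow> (\<forall>i. \<bar>u$i\<bar> < r)"
  using infnorm_attained_cart[of u] component_le_infnorm_cart[of u] le_less_trans by metis

lemma borel_measurable_infnorm [measurable]: "infnorm \<in> borel_measurable (borel :: (real^'n) measure)"
  by (intro borel_measurable_continuous_onI continuous_on_infnorm continuous_on_id)

lemma borel_measurable_vec_nth [measurable]: "(\<lambda>x::real^'n. x $ i) \<in> borel_measurable borel"
  by (intro borel_measurable_continuous_onI continuous_intros)

lemma borel_measurable_vec_lambda:
  assumes "\<And>i. (\<lambda>x. f x i) \<in> borel_measurable M"
  shows "(\<lambda>x. (\<chi> i. f x i) :: real^'n) \<in> borel_measurable M"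
  using assms by (subst borel_measurable_euclidean_space) (auto simp: Basis_vec_def inner_axis)

lemma borel_measurable_fst_comp [measurable (raw)]:
  "f \<in> borel_measurable M \<Longrightarrow> (\<lambda>x. fst (f x :: 'a::second_countable_topology \<times> 'b::second_countable_topology)) \<in>
    borel_measurable M"
  unfolding borel_prod[symmetric] by measurable

lemma borel_measurable_snd_comp [measurable (raw)]:
  "f \<in> borel_measurable M \<Longrightarrow> (\<lambda>x. snd (f x :: 'a::second_countable_topology \<times> 'b::second_countable_topology)) \<in>
    borel_measurable M"
  unfolding borel_prod[symmetric] by measurable

lemma emeasure_cbox_cart:
  fixes a b :: "real^'n"
  assumes "\<And>i. a$i \<le> b$i"
  shows "emeasure lborel (cbox a b) = ennreal (\<Prod>i\<in>UNIV. b$i - a$i)"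
proof -
  have "cbox a b \<noteq> {}" using assms by (simp add: interval_ne_empty_cart)
  then show ?thesis
    by (simp add: emeasure_eq_measure2 content_cbox_cart emeasure_lborel_cbox_finite less_top)
qed

lemma sets_hcube [measurable]: "hcube a l \<in> sets borel"
proof -
  have "hcube a l = (\<Inter>i. {x. a$i \<le> x$i \<and> x$i < a$i + l})" by (auto simp: hcube_def)
  also have "\<dots> \<in> sets borel" by (intro sets.finite_INT) (auto, measurable)
  finally show ?thesis .
qed

lemma emeasure_hcube:
  fixes a :: "real^'n"
  assumes "0 \<le> l" shows "emeasure lborel (hcube a l) = ennreal (l ^ CARD('n))"
proof -
  let ?b = "a + (\<chi> i. l)"
  have closed: "emeasure lborel (cbox a ?b) = ennreal (l ^ CARD('n))"
    using assms by (subst emeasure_cbox_cart) auto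
  have "(\<chi> i. l) \<bullet> b = l" if "b \<in> Basis" for b :: "real^'n"
    using that by (auto simp: Basis_vec_def inner_axis)
  then have "open": "emeasure lborel (box a ?b) = ennreal (l ^ CARD('n))"
    using assms by (subst emeasure_lborel_box) (auto simp: inner_add_left)
  have "emeasure lborel (hcube a l) \<le> emeasure lborel (cbox a ?b)"
    by (intro emeasure_mono) (auto simp: hcube_def mem_box_cart less_imp_le)
  moreover have "emeasure lborel (box a ?b) \<le> emeasure lborel (hcube a l)"
    by (intro emeasure_mono) (auto simp: hcube_def mem_box_cart less_imp_le)
  ultimately show ?thesis using closed "open" by simp
qed

lemma infnorm_diff_less_hcube:
  assumes "x \<in> hcube c l" "y \<in> hcube c l"
  shows "infnorm (x - y) < l"
  unfolding infnorm_less_iff_cart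
proof
  fix i
  have "c$i \<le> x$i" "x$i < c$i + l" "c$i \<le> y$i" "y$i < c$i + l" using assms by (auto simp: hcube_def)
  then show "\<bar>(x - y)$i\<bar> < l" by (auto simp: abs_less_iff)
qed

lemma emeasure_infnorm_ball_le:
  assumes "0 \<le> r"
  shows "emeasure lborel {u::real^'n. infnorm u < r} \<le> ennreal ((2 * r) ^ CARD('n))"
proof -
  have "emeasure lborel {u::real^'n. infnorm u < r} \<le> emeasure lborel (cbox (\<chi> i. - r) (\<chi> i. r) :: (real^'n) set)"
    by (intro emeasure_mono) (auto simp: infnorm_less_iff_cart mem_box_cart abs_less_iff less_imp_le
        minus_less_iff[of _ r])
  also have "\<dots> = ennreal ((2 * r) ^ CARD('n))"
    using assms by (subst emeasure_cbox_cart) auto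
  finally show ?thesis .
qed

lemma emeasure_hcube_Int_ball_ge:
  fixes u :: "real^'n"
  assumes u: "u \<in> hcube c l" and t: "0 < t" "t < l"
  shows "ennreal (t ^ CARD('n)) \<le> emeasure lborel {x \<in> hcube c l. infnorm (x - u) \<le> t}"
proof -
  let ?d = "\<chi> i. if t \<le> u$i - c$i then u$i - t else c$i"
  have "hcube ?d t \<subseteq> {x \<in> hcube c l. infnorm (x - u) \<le> t}"
    unfolding hcube_def infnorm_le_iff_cart
  proof (clarsimp, intro conjI allI)
    fix x i
    assume x: "\<forall>i. (t \<le> u$i - c$i \<longrightarrow> u$i - t \<le> x$i \<and> x$i < u$i) \<and> (\<not> t \<le> u$i - c$i \<longrightarrow> c$i \<le> x$i \<and> x$i < c$i + t)"
    have "c$i \<le> u$i" "u$i < c$i + l" using u by (auto simp: hcube_def)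
    then show "c$i \<le> x$i" "x$i < c$i + l" "\<bar>x$i - u$i\<bar> \<le> t"
      using spec[OF x, of i] t by (cases "t \<le> u$i - c$i"; auto)+
  qed
  then have "emeasure lborel (hcube ?d t) \<le> emeasure lborel {x \<in> hcube c l. infnorm (x - u) \<le> t}"
    by (intro emeasure_mono) auto
  then show ?thesis using t by (simp add: emeasure_hcube)
qed

lemma emeasure_hcube_shift_slab:
  fixes a u :: "real^'n"
  assumes l: "0 < l"
  shows "emeasure lborel {x \<in> hcube a l. \<not> (a$i \<le> x$i + u$i \<and> x$i + u$i < a$i + l)}
     \<le> ennreal (\<bar>u$i\<bar> / l * l ^ CARD('n))"
    (is "emeasure _ ?S \<le> _")
proof -
  have slab_volume: "(\<Prod>j\<in>UNIV. if j = i then c else l) = c / l * l ^ CARD('n)" for c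
  proof -
    have "(\<Prod>j\<in>UNIV. if j = i then c else l) = c * (\<Prod>j\<in>UNIV-{i}. if j = i then c else l)"
      by (subst prod.remove[of UNIV i]) auto
    also have "(\<Prod>j\<in>UNIV-{i}. if j = i then c else l) = (\<Prod>j\<in>UNIV-{i}. l)" by (rule prod.cong) auto
    also have "\<dots> = l ^ CARD('n) / l"
      using l by (simp add: card_Diff_singleton power_diff)
    finally show ?thesis by simp
  qed
  let ?A = "\<chi> j. if j = i \<and> 0 \<le> u$i then a$i + l - \<bar>u$i\<bar> else a$j"
  let ?B = "\<chi> j. if j = i \<and> u$i < 0 then a$i + \<bar>u$i\<bar> else a$j + l"
  have "?S \<subseteq> cbox ?A ?B"
    by (auto simp: hcube_def mem_box_cart less_imp_le) (smt (verit))+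
  then have "emeasure lborel ?S \<le> emeasure lborel (cbox ?A ?B)"
    by (intro emeasure_mono) auto
  also have "\<dots> = ennreal (\<Prod>j\<in>UNIV. ?B$j - ?A$j)"
    using l by (intro emeasure_cbox_cart) auto
  also have "(\<Prod>j\<in>UNIV. ?B$j - ?A$j) = (\<Prod>j\<in>UNIV. if j = i then \<bar>u$i\<bar> else l)"
    by (rule prod.cong) auto
  finally show ?thesis by (simp add: slab_volume)
qed

lemma nn_integral_lborel_isometry:
  fixes u :: "'a::euclidean_space"
  assumes [measurable]: "f \<in> borel_measurable borel" and c: "\<bar>c\<bar> = 1"
  shows "(\<integral>\<^sup>+x. f (u + c *\<^sub>R x) \<partial>lborel) = (\<integral>\<^sup>+x. f x \<partial>lborel)"
proof -
  have "(lborel :: 'a measure) = distr lborel borel (\<lambda>x. u + c *\<^sub>R x)"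
    using lborel_affine[of c u] c by (auto simp: density_1)
  then have "(\<integral>\<^sup>+x. f x \<partial>lborel) = (\<integral>\<^sup>+x. f x \<partial>distr lborel borel (\<lambda>x. u + c *\<^sub>R x))" by simp
  also have "\<dots> = (\<integral>\<^sup>+x. f (u + c *\<^sub>R x) \<partial>lborel)" by (rule nn_integral_distr) measurable
  finally show ?thesis by simp
qed

lemma nn_integral_lborel_translate:
  fixes u :: "'a::euclidean_space"
  shows "f \<in> borel_measurable borel \<Longrightarrow> (\<integral>\<^sup>+x. f (u + x) \<partial>lborel) = (\<integral>\<^sup>+x. f x \<partial>lborel)"
  using nn_integral_lborel_isometry[of f 1 u] by simp

lemma nn_integral_lborel_reflect:
  fixes u :: "'a::euclidean_space"
  shows "f \<in> borel_measurable borel \<Longrightarrow> (\<integral>\<^sup>+x. f (u - x) \<partial>lborel) = (\<integral>\<^sup>+x. f x \<partial>lborel)"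
  using nn_integral_lborel_isometry[of f "-1" u] by simp

subsection \<open>Square integrable functions\<close>

abbreviation energy :: "'a measure \<Rightarrow> ('a \<Rightarrow> real) \<Rightarrow> ennreal" where
  "energy M h \<equiv> \<integral>\<^sup>+x. ennreal ((h x)\<^sup>2) \<partial>M"

definition square_integrable :: "'a measure \<Rightarrow> ('a \<Rightarrow> real) \<Rightarrow> bool" where
  "square_integrable M h \<longleftrightarrow> h \<in> borel_measurable M \<and> energy M h < \<infinity>"

lemma borel_measurable_square_integrable: "square_integrable M h \<Longrightarrow> h \<in> borel_measurable M"
  by (simp add: square_integrable_def)

lemma borel_measurable_square_integrable_lborel:
  "square_integrable lborel h \<Longrightarrow> h \<in> borel_measurable borel"
  by (simp add: square_integrable_def)

lemma energy_finite: "square_integrable M h \<Longrightarrow> energy M h < \<infinity>"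
  by (simp add: square_integrable_def)

lemma square_add_le: "((a::real) + b)\<^sup>2 \<le> 2 * a\<^sup>2 + 2 * b\<^sup>2"
  using sum_squares_bound[of a b] by (simp add: power2_sum)

lemma square_diff_le: "((a::real) - b)\<^sup>2 \<le> 2 * a\<^sup>2 + 2 * b\<^sup>2"
  using square_add_le[of a "- b"] by simp

lemma ennreal_square_add_le: "ennreal ((a + b)\<^sup>2) \<le> 2 * ennreal (a\<^sup>2) + 2 * ennreal (b\<^sup>2)"
  using ennreal_leI[OF square_add_le[of a b]] by (simp add: ennreal_mult)

lemma ennreal_square_diff_le: "ennreal ((a - b)\<^sup>2) \<le> 2 * ennreal (a\<^sup>2) + 2 * ennreal (b\<^sup>2)"
  using ennreal_square_add_le[of a "- b"] by simp

lemma energy_cmult: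
  "f \<in> borel_measurable M \<Longrightarrow> energy M (\<lambda>x. c * f x) = ennreal (c\<^sup>2) * energy M f"
  by (simp add: power_mult_distrib ennreal_mult nn_integral_cmult)

lemma energy_mono: "(\<And>x. x \<in> space M \<Longrightarrow> \<bar>f x\<bar> \<le> \<bar>g x\<bar>) \<Longrightarrow> energy M f \<le> energy M g"
  by (intro nn_integral_mono ennreal_leI) (simp add: abs_le_square_iff)

lemma energy_add_le:
  assumes [measurable]: "f \<in> borel_measurable M" "g \<in> borel_measurable M"
  shows "energy M (\<lambda>x. f x + g x) \<le> 2 * energy M f + 2 * energy M g"
proof -
  have "energy M (\<lambda>x. f x + g x) \<le> (\<integral>\<^sup>+x. 2 * ennreal ((f x)\<^sup>2) + 2 * ennreal ((g x)\<^sup>2) \<partial>M)"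
    by (intro nn_integral_mono ennreal_square_add_le)
  then show ?thesis by (simp add: nn_integral_add nn_integral_cmult)
qed

lemma energy_diff_le:
  assumes "f \<in> borel_measurable M" "g \<in> borel_measurable M"
  shows "energy M (\<lambda>x. f x - g x) \<le> 2 * energy M f + 2 * energy M g"
  using energy_add_le[of f M "\<lambda>x. - g x"] assms by simp

lemma square_integrable_bound:
  assumes "f \<in> borel_measurable M" "square_integrable M g" "\<And>x. x \<in> space M \<Longrightarrow> \<bar>f x\<bar> \<le> \<bar>g x\<bar>"
  shows "square_integrable M f"
  using assms energy_mono[of M f g] by (auto simp: square_integrable_def intro: le_less_trans)

lemma square_integrable_cmult: "square_integrable M f \<Longrightarrow> square_integrable M (\<lambda>x. c * f x)"
  by (auto simp: square_integrable_def energy_cmult ennreal_mult_less_top)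

lemma square_integrable_diff:
  assumes "square_integrable M f" "square_integrable M g"
  shows "square_integrable M (\<lambda>x. f x - g x)"
  using assms energy_diff_le[of f M g]
  by (auto simp: square_integrable_def ennreal_mult_less_top intro: le_less_trans)

lemma square_integrable_mult:
  assumes f: "square_integrable M f" and g: "square_integrable M g"
  shows "integrable M (\<lambda>x. f x * g x)"
proof (rule integrableI_bounded)
  note [measurable] = f[THEN borel_measurable_square_integrable] g[THEN borel_measurable_square_integrable]
  show "(\<lambda>x. f x * g x) \<in> borel_measurable M" by measurable
  have "(\<integral>\<^sup>+x. ennreal (norm (f x * g x)) \<partial>M) \<le> (\<integral>\<^sup>+x. ennreal ((f x)\<^sup>2) + ennreal ((g x)\<^sup>2) \<partial>M)"
  proof (intro nn_integral_mono)
    fix x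
    have "norm (f x * g x) \<le> (f x)\<^sup>2 + (g x)\<^sup>2"
      using sum_squares_bound[of "\<bar>f x\<bar>" "\<bar>g x\<bar>"] mult_nonneg_nonneg[of "\<bar>f x\<bar>" "\<bar>g x\<bar>"]
      unfolding real_norm_def abs_mult power2_abs by linarith
    then show "ennreal (norm (f x * g x)) \<le> ennreal ((f x)\<^sup>2) + ennreal ((g x)\<^sup>2)"
      by (simp add: ennreal_plus[symmetric] del: ennreal_plus)
  qed
  also have "\<dots> < \<infinity>" using f g by (subst nn_integral_add) (auto simp: square_integrable_def)
  finally show "(\<integral>\<^sup>+x. ennreal (norm (f x * g x)) \<partial>M) < \<infinity>" .
qed

lemma square_integrable_power2: "square_integrable M f \<Longrightarrow> integrable M (\<lambda>x. (f x)\<^sup>2)"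
  using square_integrable_mult[of M f f] by (simp add: power2_eq_square)

lemma energy_eq_integral: "square_integrable M f \<Longrightarrow> energy M f = ennreal (\<integral>x. (f x)\<^sup>2 \<partial>M)"
  by (intro nn_integral_eq_integral square_integrable_power2) auto

context pair_sigma_finite
begin

lemma energy_fst:
  "f \<in> borel_measurable (M1 \<Otimes>\<^sub>M M2) \<Longrightarrow> (\<integral>\<^sup>+x. energy M2 (\<lambda>y. f (x, y)) \<partial>M1) = energy (M1 \<Otimes>\<^sub>M M2) f"
  using M2.nn_integral_fst[of "\<lambda>p. ennreal ((f p)\<^sup>2)" M1] by simp

lemma energy_snd:
  "f \<in> borel_measurable (M1 \<Otimes>\<^sub>M M2) \<Longrightarrow> (\<integral>\<^sup>+y. energy M1 (\<lambda>x. f (x, y)) \<partial>M2) = energy (M1 \<Otimes>\<^sub>M M2) f"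
  using nn_integral_snd[of "\<lambda>p. ennreal ((f p)\<^sup>2)"] by simp

lemma nn_integral_tensor:
  fixes f g :: "_ \<Rightarrow> ennreal"
  assumes [measurable]: "f \<in> borel_measurable M1" "g \<in> borel_measurable M2"
  shows "(\<integral>\<^sup>+p. f (fst p) * g (snd p) \<partial>(M1 \<Otimes>\<^sub>M M2)) = (\<integral>\<^sup>+x. f x \<partial>M1) * (\<integral>\<^sup>+y. g y \<partial>M2)"
  by (subst M2.nn_integral_fst[symmetric]) (simp_all add: nn_integral_cmult nn_integral_multc)

lemma integrable_tensor:
  fixes f g :: "_ \<Rightarrow> real"
  assumes f: "integrable M1 f" and g: "integrable M2 g"
  shows "integrable (M1 \<Otimes>\<^sub>M M2) (\<lambda>p. f (fst p) * g (snd p))"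
proof -
  note [measurable] = borel_measurable_integrable[OF f] borel_measurable_integrable[OF g]
  have "(\<integral>\<^sup>+p. ennreal (norm (f (fst p) * g (snd p))) \<partial>(M1 \<Otimes>\<^sub>M M2))
    = (\<integral>\<^sup>+x. ennreal \<bar>f x\<bar> \<partial>M1) * (\<integral>\<^sup>+y. ennreal \<bar>g y\<bar> \<partial>M2)"
    by (subst nn_integral_tensor[symmetric]) (simp_all add: abs_mult ennreal_mult)
  also have "\<dots> < \<infinity>" using f g by (simp add: integrable_iff_bounded ennreal_mult_less_top)
  finally show ?thesis by (intro integrableI_bounded) measurable
qed

lemma square_integrable_tensor:
  assumes f: "square_integrable M1 f" and g: "square_integrable M2 g"
  shows "square_integrable (M1 \<Otimes>\<^sub>M M2) (\<lambda>p. f (fst p) * g (snd p))"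
proof -
  note [measurable] = f[THEN borel_measurable_square_integrable] g[THEN borel_measurable_square_integrable]
  have "energy (M1 \<Otimes>\<^sub>M M2) (\<lambda>p. f (fst p) * g (snd p)) = energy M1 f * energy M2 g"
    by (subst nn_integral_tensor[symmetric]) (simp_all add: power_mult_distrib ennreal_mult)
  then show ?thesis using f g by (simp add: square_integrable_def ennreal_mult_less_top)
qed

lemma AE_square_integrable_section:
  assumes f: "square_integrable (M1 \<Otimes>\<^sub>M M2) f"
  shows "AE y in M2. square_integrable M1 (\<lambda>x. f (x, y))"
proof -
  have f_measurable[measurable]: "f \<in> borel_measurable (M1 \<Otimes>\<^sub>M M2)"
    using f by (rule borel_measurable_square_integrable)
  have "AE y in M2. energy M1 (\<lambda>x. f (x, y)) \<noteq> \<infinity>"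
    using energy_finite[OF f] by (intro nn_integral_PInf_AE) (auto simp: energy_snd[OF f_measurable])
  then show ?thesis
    by (rule AE_mp) (auto intro!: AE_I2 simp: square_integrable_def less_top)
qed

end

lemma ennreal_abs_integral_le: "ennreal \<bar>\<integral>x. f x \<partial>M\<bar> \<le> (\<integral>\<^sup>+x. ennreal \<bar>f x\<bar> \<partial>M)"
  for f :: "'a \<Rightarrow> real"
  using integral_norm_bound_ennreal[of M f] not_integrable_integral_eq[of M f]
  by (cases "integrable M f") auto

lemma weighted_Cauchy_Schwarz:
  assumes [measurable]: "w \<in> borel_measurable M" "f \<in> borel_measurable M" and w: "\<And>z. 0 \<le> w z"
  shows "ennreal ((\<integral>z. w z * f z \<partial>M)\<^sup>2) \<le> (\<integral>\<^sup>+z. ennreal (w z) \<partial>M) * (\<integral>\<^sup>+z. ennreal (w z) * ennreal ((f z)\<^sup>2) \<partial>M)"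
proof -
  have "ennreal \<bar>\<integral>z. w z * f z \<partial>M\<bar> \<le> (\<integral>\<^sup>+z. ennreal \<bar>w z * f z\<bar> \<partial>M)"
    by (rule ennreal_abs_integral_le)
  also have "\<dots> = (\<integral>\<^sup>+z. ennreal (sqrt (w z)) * ennreal (sqrt (w z) * \<bar>f z\<bar>) \<partial>M)"
    using w by (intro nn_integral_cong) (auto simp: ennreal_mult[symmetric] abs_mult mult.assoc[symmetric])
  finally have "(ennreal \<bar>\<integral>z. w z * f z \<partial>M\<bar>)\<^sup>2 \<le> (\<integral>\<^sup>+z. ennreal (sqrt (w z)) * ennreal (sqrt (w z) * \<bar>f z\<bar>) \<partial>M)\<^sup>2"
    by (rule power_mono) auto
  also have "\<dots> \<le> (\<integral>\<^sup>+z. ennreal (sqrt (w z)) ^ 2 \<partial>M) * (\<integral>\<^sup>+z. ennreal (sqrt (w z) * \<bar>f z\<bar>) ^ 2 \<partial>M)"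
    by (rule Cauchy_Schwarz_nn_integral) measurable
  also have "\<dots> = (\<integral>\<^sup>+z. ennreal (w z) \<partial>M) * (\<integral>\<^sup>+z. ennreal (w z) * ennreal ((f z)\<^sup>2) \<partial>M)"
    using w by (intro arg_cong2[where f="(*)"] nn_integral_cong)
      (auto simp: ennreal_power power_mult_distrib ennreal_mult)
  finally show ?thesis by (simp add: ennreal_power)
qed

lemma (in pair_sigma_finite) weighted_Cauchy_Schwarz_section:
  assumes [measurable]: "f \<in> borel_measurable (M1 \<Otimes>\<^sub>M M2)" "p \<in> borel_measurable M1"
    and p: "\<And>z. 0 < p z"
  shows "ennreal ((\<integral>q. f q \<partial>(M1 \<Otimes>\<^sub>M M2))\<^sup>2)
    \<le> (\<integral>\<^sup>+z. ennreal (p z) \<partial>M1) * (\<integral>\<^sup>+z. ennreal (1 / p z) * ennreal ((\<integral>w. f (z, w) \<partial>M2)\<^sup>2) \<partial>M1)"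
proof -
  let ?S = "\<lambda>z. \<integral>w. f (z, w) \<partial>M2"
  have "ennreal ((\<integral>q. f q \<partial>(M1 \<Otimes>\<^sub>M M2))\<^sup>2) \<le> ennreal ((\<integral>z. p z * (?S z / p z) \<partial>M1)\<^sup>2)"
  proof (cases "integrable (M1 \<Otimes>\<^sub>M M2) f")
    case True
    then show ?thesis using p by (subst integral_fst'[OF True, symmetric]) (simp add: less_imp_neq[symmetric])
  qed (simp add: not_integrable_integral_eq)
  also have "\<dots> \<le> (\<integral>\<^sup>+z. ennreal (p z) \<partial>M1) * (\<integral>\<^sup>+z. ennreal (p z) * ennreal ((?S z / p z)\<^sup>2) \<partial>M1)"
    using p by (intro weighted_Cauchy_Schwarz) (auto simp: less_imp_le)
  also have "(\<integral>\<^sup>+z. ennreal (p z) * ennreal ((?S z / p z)\<^sup>2) \<partial>M1) = (\<integral>\<^sup>+z. ennreal (1 / p z) * ennreal ((?S z)\<^sup>2) \<partial>M1)"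
    using p by (intro nn_integral_cong) (simp add: ennreal_mult[symmetric] less_imp_le power_divide power2_eq_square)
  finally show ?thesis .
qed

lemma geometric_Cauchy_Schwarz:
  fixes x :: "nat \<Rightarrow> real"
  assumes q: "0 < q" "q < 1"
  shows "(\<Sum>i<N. x i)\<^sup>2 \<le> 1 / (1 - q) * (\<Sum>i<N. (x i)\<^sup>2 / q ^ i)"
proof -
  have "(\<Sum>i<N. x i) = (\<Sum>i<N. sqrt (q ^ i) * (x i / sqrt (q ^ i)))" using q by simp
  then have "(\<Sum>i<N. x i)\<^sup>2 \<le> (\<Sum>i<N. (sqrt (q ^ i))\<^sup>2) * (\<Sum>i<N. (x i / sqrt (q ^ i))\<^sup>2)"
    by (simp only: Cauchy_Schwarz_ineq_sum)
  also have "\<dots> = (\<Sum>i<N. q ^ i) * (\<Sum>i<N. (x i)\<^sup>2 / q ^ i)" using q by (simp add: power_divide)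
  also have "\<dots> \<le> 1 / (1 - q) * (\<Sum>i<N. (x i)\<^sup>2 / q ^ i)"
  proof (intro mult_right_mono sum_nonneg)
    show "(\<Sum>i<N. q ^ i) \<le> 1 / (1 - q)"
      using q by (subst sum_gp_strict) (auto simp: divide_right_mono)
  qed (use q in auto)
  finally show ?thesis .
qed

lemma ennreal_le_of_geometric_error:
  assumes "\<And>N::nat. (X::ennreal) \<le> S + ennreal (c * r ^ N)" "0 < r" "r < 1"
  shows "X \<le> S"
proof (rule tendsto_lowerbound[OF _ always_eventually])
  have "(\<lambda>N. c * r ^ N) \<longlonglongrightarrow> c * 0" using assms by (intro tendsto_intros LIMSEQ_power_zero) auto
  then have "(\<lambda>N. ennreal (c * r ^ N)) \<longlonglongrightarrow> ennreal 0" by (intro tendsto_ennrealI) simp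
  then show "(\<lambda>N. S + ennreal (c * r ^ N)) \<longlonglongrightarrow> S" using tendsto_add[OF tendsto_const[of S]] by fastforce
qed (use assms in auto)

lemma energy_sum_add_le:
  assumes q: "0 < q" "q < 1"
    and [measurable]: "\<And>i. x i \<in> borel_measurable M" "b \<in> borel_measurable M"
  shows "energy M (\<lambda>y. (\<Sum>i<N. x i y) + b y)
    \<le> ennreal (2 / (1 - q)) * (\<Sum>i<N. ennreal (1 / q ^ i) * energy M (x i)) + 2 * energy M b"
proof -
  have pointwise: "ennreal (((\<Sum>i<N. x i y) + b y)\<^sup>2)
    \<le> ennreal (2 / (1 - q)) * (\<Sum>i<N. ennreal (1 / q ^ i) * ennreal ((x i y)\<^sup>2)) + 2 * ennreal ((b y)\<^sup>2)" for y
  proof -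
    have "2 * (\<Sum>i<N. x i y)\<^sup>2 \<le> 2 * (1 / (1 - q) * (\<Sum>i<N. (x i y)\<^sup>2 / q ^ i))"
      by (intro mult_left_mono geometric_Cauchy_Schwarz q) simp
    then have "ennreal (2 * (\<Sum>i<N. x i y)\<^sup>2) \<le> ennreal (2 / (1 - q) * (\<Sum>i<N. 1 / q ^ i * (x i y)\<^sup>2))"
      by (intro ennreal_leI) simp
    also have "\<dots> = ennreal (2 / (1 - q)) * ennreal (\<Sum>i<N. 1 / q ^ i * (x i y)\<^sup>2)"
      using q by (intro ennreal_mult sum_nonneg) auto
    also have "ennreal (\<Sum>i<N. 1 / q ^ i * (x i y)\<^sup>2) = (\<Sum>i<N. ennreal (1 / q ^ i) * ennreal ((x i y)\<^sup>2))"
      using q by (simp only: ennreal_mult[symmetric] zero_le_divide_1_iff zero_le_power less_imp_le zero_le_power2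
        sum_ennreal
          mult_nonneg_nonneg)
    finally have sum: "2 * ennreal ((\<Sum>i<N. x i y)\<^sup>2)
      \<le> ennreal (2 / (1 - q)) * (\<Sum>i<N. ennreal (1 / q ^ i) * ennreal ((x i y)\<^sup>2))" by (simp add: ennreal_mult)
    show ?thesis
      by (rule order_trans[OF ennreal_square_add_le add_right_mono[OF sum]])
  qed
  have "energy M (\<lambda>y. (\<Sum>i<N. x i y) + b y)
    \<le> (\<integral>\<^sup>+y. ennreal (2 / (1 - q)) * (\<Sum>i<N. ennreal (1 / q ^ i) * ennreal ((x i y)\<^sup>2)) + 2 * ennreal ((b y)\<^sup>2) \<partial>M)"
    by (intro nn_integral_mono pointwise)
  then show ?thesis by (simp add: nn_integral_add nn_integral_cmult nn_integral_sum)
qed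

text \<open>Decay \<open>q\<^sup>2\<^sup>i\<close> of the energies leaves a spare factor \<open>q\<^sup>i\<close> after the weighted Cauchy--Schwarz inequality.\<close>

lemma energy_geometric_series_le:
  assumes q: "0 < q" "q < 1" and c: "0 \<le> c" "0 \<le> c'"
    and [measurable]: "\<And>i. x i \<in> borel_measurable M" "\<And>N. b N \<in> borel_measurable M"
    and split: "\<And>N y. y \<in> space M \<Longrightarrow> X y = (\<Sum>i<N. x i y) + b N y"
    and summand: "\<And>i. energy M (x i) \<le> ennreal (c * (q ^ i)\<^sup>2) * d i"
    and remainder: "\<And>N. energy M (b N) \<le> ennreal (c' * (q ^ N)\<^sup>2)"
  shows "energy M X \<le> ennreal (2 * c / (1 - q)) * (\<Sum>i. ennreal (q ^ i) * d i)"
proof (rule ennreal_le_of_geometric_error)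
  fix N
  have "energy M X = energy M (\<lambda>y. (\<Sum>i<N. x i y) + b N y)"
    by (intro nn_integral_cong) (simp add: split[of _ N])
  also have "\<dots> \<le> ennreal (2 / (1 - q)) * (\<Sum>i<N. ennreal (1 / q ^ i) * energy M (x i)) + 2 * energy M (b N)"
    by (intro energy_sum_add_le q) measurable
  also have "\<dots> \<le> ennreal (2 / (1 - q)) * (\<Sum>i<N. ennreal c * (ennreal (q ^ i) * d i)) + 2 * ennreal (c' * (q ^ N)\<^sup>2)"
  proof (intro add_mono mult_left_mono sum_mono remainder)
    fix i
    have "ennreal (1 / q ^ i) * energy M (x i) \<le> ennreal (1 / q ^ i) * (ennreal (c * (q ^ i)\<^sup>2) * d i)"
      by (intro mult_left_mono summand) simp
    also have "\<dots> = ennreal (1 / q ^ i * (c * (q ^ i)\<^sup>2)) * d i"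
      using q c by (subst ennreal_mult) (auto simp: mult.assoc)
    also have "1 / q ^ i * (c * (q ^ i)\<^sup>2) = c * q ^ i" using q by (simp add: power2_eq_square)
    also have "ennreal (c * q ^ i) * d i = ennreal c * (ennreal (q ^ i) * d i)"
      using q c by (simp add: ennreal_mult mult.assoc)
    finally show "ennreal (1 / q ^ i) * energy M (x i) \<le> ennreal c * (ennreal (q ^ i) * d i)" .
  qed auto
  also have "\<dots> \<le> ennreal (2 / (1 - q)) * (ennreal c * (\<Sum>i. ennreal (q ^ i) * d i)) + 2 * ennreal (c' * (q ^ N)\<^sup>2)"
    unfolding sum_distrib_left[symmetric] by (intro add_right_mono mult_left_mono sum_le_suminf) auto
  also have "2 * ennreal (c' * (q ^ N)\<^sup>2) = ennreal (2 * c' * (q\<^sup>2) ^ N)"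
    using c ennreal_mult[of 2 "c' * (q ^ N)\<^sup>2"] by (simp add: mult.assoc power_mult[symmetric] mult.commute[of N])
  also have "ennreal (2 / (1 - q)) * (ennreal c * (\<Sum>i. ennreal (q ^ i) * d i))
    = ennreal (2 * c / (1 - q)) * (\<Sum>i. ennreal (q ^ i) * d i)"
    using q c ennreal_mult[of "2 / (1 - q)" c] by (simp add: mult.assoc[symmetric])
  finally show "energy M X \<le> ennreal (2 * c / (1 - q)) * (\<Sum>i. ennreal (q ^ i) * d i) + ennreal (2 * c' * (q\<^sup>2) ^ N)" .
qed (use q in \<open>auto simp: abs_square_less_1\<close>)

subsection \<open>The measure \<open>dt / t\<close> on dyadic scales\<close>

definition scale_measure :: "real measure" where
  "scale_measure = density lborel (\<lambda>t. indicator {0<..} t * ennreal (1 / t))"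

lemma sets_scale_measure [simp, measurable_cong]: "sets scale_measure = sets borel"
  by (simp add: scale_measure_def)

interpretation scale_measure: sigma_finite_measure scale_measure
proof -
  have "(\<lambda>t::real. indicator {0<..} t * ennreal (1 / t)) \<in> borel_measurable lborel" by measurable
  then show "sigma_finite_measure scale_measure"
    unfolding scale_measure_def
    by (rule sigma_finite_measure.sigma_finite_iff_density_finite[OF sigma_finite_lborel, THEN iffD2])
      (auto simp: indicator_def)
qed

interpretation lborel_scale: pair_sigma_finite lborel scale_measure ..
interpretation scale_lborel: pair_sigma_finite scale_measure lborel ..
interpretation scale_scale: pair_sigma_finite scale_measure scale_measure ..

lemma nn_integral_scale_measure:
  assumes "f \<in> borel_measurable borel"
  shows "(\<integral>\<^sup>+t. f t \<partial>scale_measure) = (\<integral>\<^sup>+t. indicator {0<..} t * ennreal (1 / t) * f t \<partial>lborel)"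
  unfolding scale_measure_def using assms by (subst nn_integral_density) auto

lemma AE_scale_measure: "(AE t in scale_measure. P t) \<longleftrightarrow> (AE t in lborel. 0 < t \<longrightarrow> P t)"
  unfolding scale_measure_def by (subst AE_density) (auto simp: indicator_def)

lemma AE_scale_measure_pos: "AE t in scale_measure. 0 < t"
  by (simp add: AE_scale_measure)

lemma nn_integral_scale_mono:
  assumes "\<And>t. 0 < t \<Longrightarrow> f t \<le> g t"
  shows "(\<integral>\<^sup>+t. f t \<partial>scale_measure) \<le> (\<integral>\<^sup>+t. g t \<partial>scale_measure)"
  using AE_scale_measure_pos by (intro nn_integral_mono_AE, eventually_elim) (rule assms)

lemma nn_integral_scale_cong:
  assumes "\<And>t. 0 < t \<Longrightarrow> f t = g t"
  shows "(\<integral>\<^sup>+t. f t \<partial>scale_measure) = (\<integral>\<^sup>+t. g t \<partial>scale_measure)"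
  using AE_scale_measure_pos by (intro nn_integral_cong_AE, eventually_elim) (rule assms)

abbreviation side_length :: "int \<Rightarrow> real" where
  "side_length k \<equiv> 2 powr real_of_int k"

definition scale_index :: "real \<Rightarrow> int" where
  "scale_index t = \<lceil>log 2 t\<rceil>"

lemma scale_index_bounds:
  assumes t: "0 < t"
  shows "side_length (scale_index t) / 2 < t" "t \<le> side_length (scale_index t)"
proof -
  have "real_of_int (scale_index t) - 1 < log 2 t" "log 2 t \<le> real_of_int (scale_index t)"
    unfolding scale_index_def by linarith+
  then show "side_length (scale_index t) / 2 < t" "t \<le> side_length (scale_index t)"
    using t by (simp_all add: less_log_iff log_le_iff powr_diff)
qed

lemma scale_index_le_iff: "0 < t \<Longrightarrow> scale_index t \<le> k \<longleftrightarrow> t \<le> side_length k"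
  unfolding scale_index_def by (simp add: ceiling_le_iff log_le_iff)

lemma measurable_scale_index [measurable]: "scale_index \<in> borel \<rightarrow>\<^sub>M count_space UNIV"
  unfolding scale_index_def[abs_def] by measurable

lemma AE_less_side_length_scale_index: "AE t in scale_measure. t < side_length (scale_index t)"
proof -
  have "AE t in lborel. t \<notin> range (\<lambda>k. side_length k)"
    by (rule AE_not_in) (rule countable_imp_null_set_lborel, simp)
  then show ?thesis
    unfolding AE_scale_measure
  proof eventually_elim
    case (elim t)
    then have "t \<noteq> side_length (scale_index t)" by auto
    then show ?case using scale_index_bounds(2)[of t] by (simp add: le_less)
  qed
qed

lemma emeasure_scale_index_le_1: "emeasure scale_measure {t. 0 < t \<and> scale_index t = k} \<le> 1"
proof -
  let ?r = "side_length k"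
  have "emeasure scale_measure {t. 0 < t \<and> scale_index t = k}
      = (\<integral>\<^sup>+t. indicator {0<..} t * ennreal (1 / t) * indicator {t. 0 < t \<and> scale_index t = k} t \<partial>lborel)"
    unfolding scale_measure_def by (rule emeasure_density) measurable
  also have "\<dots> \<le> (\<integral>\<^sup>+t. ennreal (2 / ?r) * indicator {?r / 2<..?r} t \<partial>lborel)"
  proof (rule nn_integral_mono)
    fix t :: real
    show "indicator {0<..} t * ennreal (1 / t) * indicator {t. 0 < t \<and> scale_index t = k} t
      \<le> ennreal (2 / ?r) * indicator {?r / 2<..?r} t"
    proof (cases "0 < t \<and> scale_index t = k")
      case True
      then have t: "?r / 2 < t" "t \<le> ?r" using scale_index_bounds[of t] by auto
      then have "1 / t \<le> 2 / ?r" using True by (simp add: field_simps)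
      then show ?thesis using t True by (simp add: ennreal_leI)
    qed simp
  qed
  also have "\<dots> = ennreal (2 / ?r) * ennreal (?r - ?r / 2)"
    by (subst nn_integral_cmult_indicator) auto
  also have "\<dots> = 1" by (simp add: ennreal_mult[symmetric])
  finally show ?thesis .
qed

lemma nn_integral_scale_index_le:
  fixes g :: "int \<Rightarrow> ennreal"
  shows "(\<integral>\<^sup>+t. g (scale_index t) \<partial>scale_measure) \<le> (\<integral>\<^sup>+k. g k \<partial>count_space UNIV)"
proof -
  interpret pair_sigma_finite scale_measure "count_space (UNIV :: int set)"
    by (intro pair_sigma_finite.intro scale_measure.sigma_finite_measure_axioms sigma_finite_measure_count_space)
  let ?I = "\<lambda>k t. indicator {t. 0 < t \<and> scale_index t = k} t :: ennreal"
  have "(\<integral>\<^sup>+t. g (scale_index t) \<partial>scale_measure) = (\<integral>\<^sup>+t. \<integral>\<^sup>+k. ?I k t * g k \<partial>count_space UNIV \<partial>scale_measure)"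
  proof (rule nn_integral_scale_cong)
    fix t :: real assume "0 < t"
    moreover have "(\<integral>\<^sup>+k. ?I k t * g k \<partial>count_space UNIV) = (\<Sum>k\<in>{scale_index t}. ?I k t * g k)"
      by (rule nn_integral_count_space') auto
    ultimately show "g (scale_index t) = (\<integral>\<^sup>+k. ?I k t * g k \<partial>count_space UNIV)"
      by (simp add: indicator_def)
  qed
  also have "\<dots> = (\<integral>\<^sup>+k. \<integral>\<^sup>+t. ?I k t * g k \<partial>scale_measure \<partial>count_space UNIV)"
    by (rule Fubini'[symmetric]) measurable
  also have "\<dots> \<le> (\<integral>\<^sup>+k. 1 * g k \<partial>count_space UNIV)"
  proof (rule nn_integral_mono)
    fix k :: int
    have "(\<integral>\<^sup>+t. ?I k t * g k \<partial>scale_measure) = emeasure scale_measure {t. 0 < t \<and> scale_index t = k} * g k"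
      by (subst nn_integral_multc) simp_all
    also have "\<dots> \<le> 1 * g k" by (intro mult_right_mono emeasure_scale_index_le_1) simp
    finally show "(\<integral>\<^sup>+t. ?I k t * g k \<partial>scale_measure) \<le> 1 * g k" .
  qed
  finally show ?thesis by simp
qed

subsection \<open>Integrals over the integers and over level sets\<close>

lemma nn_integral_int_shift:
  fixes g :: "int \<Rightarrow> ennreal"
  shows "(\<integral>\<^sup>+k. g (k + s) \<partial>count_space UNIV) = (\<integral>\<^sup>+k. g k \<partial>count_space UNIV)"
  by (rule nn_integral_bij_count_space) (auto intro!: bij_betwI[where g="\<lambda>k. k - s"])

lemma nn_integral_int_le:
  fixes g :: "int \<Rightarrow> ennreal"
  assumes "\<And>N k. (\<Sum>i<N. g (k + int i)) \<le> B"
  shows "(\<integral>\<^sup>+k. g k \<partial>count_space UNIV) \<le> B"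
proof -
  let ?f = "\<lambda>N::nat. \<lambda>k. g k * indicator {- int N..<int N} k"
  have "g k = (SUP N. ?f N k)" for k
  proof (rule antisym)
    have "k \<in> {- int (nat \<bar>k\<bar> + 1)..<int (nat \<bar>k\<bar> + 1)}" by auto
    then have "g k = ?f (nat \<bar>k\<bar> + 1) k" by simp
    then show "g k \<le> (SUP N. ?f N k)" using SUP_upper[of "nat \<bar>k\<bar> + 1" UNIV "\<lambda>N. ?f N k"] by simp
  qed (auto intro!: SUP_least simp: indicator_def)
  then have "(\<integral>\<^sup>+k. g k \<partial>count_space UNIV) = (\<integral>\<^sup>+k. (SUP N. ?f N k) \<partial>count_space UNIV)" by simp
  also have "\<dots> = (SUP N. \<integral>\<^sup>+k. ?f N k \<partial>count_space UNIV)"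
    by (rule nn_integral_monotone_convergence_SUP) (auto simp: incseq_def le_fun_def indicator_def)
  also have "\<dots> \<le> B"
  proof (rule SUP_least)
    fix N :: nat
    have "(\<integral>\<^sup>+k. ?f N k \<partial>count_space UNIV) = (\<Sum>k\<in>{- int N..<int N}. ?f N k)"
      by (rule nn_integral_count_space') (auto simp: indicator_def)
    also have "\<dots> = (\<Sum>k\<in>{- int N..<int N}. g k)" by (rule sum.cong) auto
    also have "\<dots> = (\<Sum>i<2 * N. g (- int N + int i))"
      by (rule sum.reindex_bij_witness[of _ "\<lambda>i. - int N + int i" "\<lambda>k. nat (k + int N)"]) auto
    also have "\<dots> \<le> B" by (rule assms)
    finally show "(\<integral>\<^sup>+k. ?f N k \<partial>count_space UNIV) \<le> B" .
  qed
  finally show ?thesis .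
qed

lemma nn_integral_count_space_le_infsum:
  fixes f :: "'a \<Rightarrow> ennreal"
  assumes X: "countable X"
  shows "(\<integral>\<^sup>+x. f x \<partial>count_space X) \<le> (\<Sum>\<^sub>\<infinity>x\<in>X. f x)"
proof -
  have finite_le: "(\<Sum>x\<in>F. f x) \<le> (\<Sum>\<^sub>\<infinity>x\<in>X. f x)" if "finite F" "F \<subseteq> X" for F
    using that by (subst nonneg_infsum_complete) (auto intro!: SUP_upper)
  show ?thesis
  proof (cases "finite X")
    case True
    then show ?thesis using finite_le[of X] by (simp add: nn_integral_count_space_finite)
  next
    case False
    let ?e = "from_nat_into X"
    have e: "bij_betw ?e UNIV X" using X False by (rule bij_betw_from_nat_into)
    have "(\<integral>\<^sup>+x. f x \<partial>count_space X) = (\<integral>\<^sup>+i. f (?e i) \<partial>count_space UNIV)"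
      by (rule nn_integral_bij_count_space[OF e, symmetric])
    also have "\<dots> = (SUP N. \<Sum>i<N. f (?e i))"
      by (simp add: nn_integral_count_space_nat suminf_eq_SUP)
    also have "\<dots> \<le> (\<Sum>\<^sub>\<infinity>x\<in>X. f x)"
    proof (rule SUP_least)
      fix N
      have "inj_on ?e {..<N}" using e by (auto simp: bij_betw_def intro: inj_on_subset)
      then have "(\<Sum>i<N. f (?e i)) = (\<Sum>x\<in>?e ` {..<N}. f x)" by (simp add: sum.reindex)
      also have "\<dots> \<le> (\<Sum>\<^sub>\<infinity>x\<in>X. f x)" using e by (intro finite_le) (auto simp: bij_betw_def)
      finally show "(\<Sum>i<N. f (?e i)) \<le> (\<Sum>\<^sub>\<infinity>x\<in>X. f x)" .
    qed
    finally show ?thesis .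
  qed
qed

lemma nn_integral_indicator_less_ennreal:
  "(\<integral>\<^sup>+s. indicator {0<..} s * indicator {s. ennreal s < G} s \<partial>lborel) = (G::ennreal)"
proof (cases G)
  case (real r)
  have "(\<integral>\<^sup>+s. indicator {0<..} s * indicator {s. ennreal s < G} s \<partial>lborel) = (\<integral>\<^sup>+s. indicator {0<..<r} s \<partial>lborel)"
    using real by (intro nn_integral_cong) (auto simp: indicator_def ennreal_less_iff)
  also have "\<dots> = ennreal r" using real by simp
  finally show ?thesis using real by simp
next
  case top
  have "(\<integral>\<^sup>+s. indicator {0<..} s * indicator {s. ennreal s < G} s \<partial>lborel)
    = (\<integral>\<^sup>+s. indicator {0<..} (s::real) \<partial>lborel)"
    using top by (intro nn_integral_cong) (auto simp: indicator_def)
  also have "\<dots> = emeasure lborel {0::real<..}" by simp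
  also have "\<dots> = \<infinity>"
  proof (rule ccontr)
    assume "emeasure lborel {0::real<..} \<noteq> \<infinity>"
    then obtain r where r: "emeasure lborel {0::real<..} = ennreal r" "0 \<le> r"
      by (cases "emeasure lborel {0::real<..}") auto
    have "ennreal (r + 1) = emeasure lborel {0<..<r + 1}" using r by simp
    also have "\<dots> \<le> emeasure lborel {0::real<..}" by (intro emeasure_mono) auto
    finally show False using r by simp
  qed
  finally show ?thesis using top by simp
qed

lemma layer_cake_weighted:
  assumes "sigma_finite_measure M"
    and [measurable]: "w \<in> borel_measurable M" "u \<in> borel_measurable M"
  shows "(\<integral>\<^sup>+x. w x * u x \<partial>M)
    = (\<integral>\<^sup>+s. indicator {0<..} s * (\<integral>\<^sup>+x. w x * indicator {x. ennreal s < u x} x \<partial>M) \<partial>lborel)"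
proof -
  interpret M: sigma_finite_measure M by fact
  interpret pair_sigma_finite lborel M ..
  let ?I = "\<lambda>s x. w x * (indicator {0<..} s * indicator {s. ennreal s < u x} s) :: ennreal"
  have "(\<integral>\<^sup>+x. w x * u x \<partial>M) = (\<integral>\<^sup>+x. \<integral>\<^sup>+s. ?I s x \<partial>lborel \<partial>M)"
    by (simp add: nn_integral_cmult nn_integral_indicator_less_ennreal)
  also have "\<dots> = (\<integral>\<^sup>+s. \<integral>\<^sup>+x. ?I s x \<partial>M \<partial>lborel)"
    by (rule Fubini') measurable
  also have "\<dots> = (\<integral>\<^sup>+s. indicator {0<..} s * (\<integral>\<^sup>+x. w x * indicator {x. ennreal s < u x} x \<partial>M) \<partial>lborel)"
  proof (intro nn_integral_cong)
    fix s :: real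
    have "(\<integral>\<^sup>+x. ?I s x \<partial>M) = (\<integral>\<^sup>+x. indicator {0<..} s * (w x * indicator {x. ennreal s < u x} x) \<partial>M)"
      by (intro nn_integral_cong) (simp add: indicator_def mult_ac)
    then show "(\<integral>\<^sup>+x. ?I s x \<partial>M) = indicator {0<..} s * (\<integral>\<^sup>+x. w x * indicator {x. ennreal s < u x} x \<partial>M)"
      by (simp add: nn_integral_cmult)
  qed
  finally show ?thesis .
qed

lemma nn_integral_le_of_level_sets:
  assumes P: "sigma_finite_measure P" and N: "sigma_finite_measure N"
    and [measurable]: "w \<in> borel_measurable P" "u \<in> borel_measurable P" "G \<in> borel_measurable N"
    and level: "\<And>s. 0 < s \<Longrightarrow> (\<integral>\<^sup>+p. w p * indicator {p. ennreal s < u p} p \<partial>P)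
      \<le> B * emeasure N {y \<in> space N. ennreal s < G y}"
  shows "(\<integral>\<^sup>+p. w p * u p \<partial>P) \<le> B * (\<integral>\<^sup>+y. G y \<partial>N)"
proof -
  have "(\<integral>\<^sup>+p. w p * u p \<partial>P)
    = (\<integral>\<^sup>+s. indicator {0<..} s * (\<integral>\<^sup>+p. w p * indicator {p. ennreal s < u p} p \<partial>P) \<partial>lborel)"
    by (rule layer_cake_weighted[OF P]) measurable
  also have "\<dots> \<le> (\<integral>\<^sup>+s. indicator {0<..} s * (\<integral>\<^sup>+y. B * indicator {y. ennreal s < G y} y \<partial>N) \<partial>lborel)"
  proof (intro nn_integral_mono)
    fix s :: real
    have "(\<integral>\<^sup>+y. B * indicator {y. ennreal s < G y} y \<partial>N) = (\<integral>\<^sup>+y. B * indicator {y \<in> space N. ennreal s < G y} y \<partial>N)"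
      by (intro nn_integral_cong) (simp add: indicator_def)
    also have "\<dots> = B * emeasure N {y \<in> space N. ennreal s < G y}"
      by (rule nn_integral_cmult_indicator) measurable
    finally show "indicator {0<..} s * (\<integral>\<^sup>+p. w p * indicator {p. ennreal s < u p} p \<partial>P)
      \<le> indicator {0<..} s * (\<integral>\<^sup>+y. B * indicator {y. ennreal s < G y} y \<partial>N)"
      using level[of s] by (cases "0 < s") simp_all
  qed
  also have "\<dots> = (\<integral>\<^sup>+y. B * G y \<partial>N)"
    by (rule layer_cake_weighted[OF N, symmetric]) measurable
  also have "\<dots> = B * (\<integral>\<^sup>+y. G y \<partial>N)" by (rule nn_integral_cmult) measurable
  finally show ?thesis .
qed

lemma emeasure_level_set_finite:
  assumes [measurable]: "G \<in> borel_measurable M" and G: "(\<integral>\<^sup>+x. G x \<partial>M) < \<infinity>" and s: "0 < s"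
  shows "emeasure M {x \<in> space M. ennreal s < G x} < \<infinity>"
proof -
  have "ennreal s * emeasure M {x \<in> space M. ennreal s < G x}
    = (\<integral>\<^sup>+x. ennreal s * indicator {x \<in> space M. ennreal s < G x} x \<partial>M)"
    by (rule nn_integral_cmult_indicator[symmetric]) measurable
  also have "\<dots> \<le> (\<integral>\<^sup>+x. G x \<partial>M)" by (rule nn_integral_mono) (auto simp: indicator_def)
  also have "\<dots> < \<infinity>" by (rule G)
  finally show ?thesis using s by (auto simp: ennreal_mult_less_top ennreal_mult_eq_top_iff less_top)
qed

lemma nn_integral_le_of_dominated_level_sets:
  fixes u :: "'k::countable \<Rightarrow> 'b \<Rightarrow> ennreal"
  assumes P: "sigma_finite_measure P" and N: "sigma_finite_measure N"
    and [measurable]: "w \<in> borel_measurable P" "(\<lambda>p. u (\<kappa> p) (\<eta> p)) \<in> borel_measurable P"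
      "\<And>k. u k \<in> borel_measurable N" "G \<in> borel_measurable N"
    and dominated: "\<And>k y. u k y \<le> G y" and finite: "(\<integral>\<^sup>+y. G y \<partial>N) < \<infinity>"
    and level: "\<And>s. 0 < s \<Longrightarrow> emeasure N (\<Union>k. {y \<in> space N. ennreal s < u k y}) < \<infinity> \<Longrightarrow>
      (\<integral>\<^sup>+p. w p * indicator {p. ennreal s < u (\<kappa> p) (\<eta> p)} p \<partial>P)
        \<le> B * emeasure N (\<Union>k. {y \<in> space N. ennreal s < u k y})"
  shows "(\<integral>\<^sup>+p. w p * u (\<kappa> p) (\<eta> p) \<partial>P) \<le> B * (\<integral>\<^sup>+y. G y \<partial>N)"
proof (rule nn_integral_le_of_level_sets[OF P N])
  fix s :: real assume s: "0 < s"
  let ?U = "\<Union>k. {y \<in> space N. ennreal s < u k y}"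
  have "?U \<subseteq> {y \<in> space N. ennreal s < G y}" using dominated by (auto intro: less_le_trans)
  then have U: "emeasure N ?U \<le> emeasure N {y \<in> space N. ennreal s < G y}" by (rule emeasure_mono) measurable
  also have "\<dots> < \<infinity>" by (rule emeasure_level_set_finite[OF _ finite s]) measurable
  finally have "(\<integral>\<^sup>+p. w p * indicator {p. ennreal s < u (\<kappa> p) (\<eta> p)} p \<partial>P) \<le> B * emeasure N ?U" by (rule level[OF s])
  also have "\<dots> \<le> B * emeasure N {y \<in> space N. ennreal s < G y}" by (intro mult_left_mono U) simp
  finally show "(\<integral>\<^sup>+p. w p * indicator {p. ennreal s < u (\<kappa> p) (\<eta> p)} p \<partial>P)
    \<le> B * emeasure N {y \<in> space N. ennreal s < G y}" .
qed measurable

subsection \<open>The Poisson-type majorant\<close>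

definition poisson :: "real \<Rightarrow> real \<Rightarrow> real^'n \<Rightarrow> real" where
  "poisson a t u = t powr a / (t + infnorm u) powr (real CARD('n) + a)"

definition poisson_mass :: "nat \<Rightarrow> real \<Rightarrow> real" where
  "poisson_mass n a = 2 ^ n * 2 powr (real n + a) * (1 / (1 - 2 powr (- a)))"

abbreviation holder_poisson :: "real \<Rightarrow> real \<Rightarrow> real^'n \<Rightarrow> real^'n \<Rightarrow> real" where
  "holder_poisson a t d u \<equiv> (infnorm d / t) powr a * poisson a t u"

lemma poisson_mass_pos: "0 < a \<Longrightarrow> 0 < poisson_mass n a"
  by (simp add: poisson_mass_def powr_less_one)

lemma borel_measurable_poisson [measurable (raw)]:
  assumes "T \<in> borel_measurable M" "u \<in> borel_measurable M"
  shows "(\<lambda>x. poisson a (T x) (u x :: real^'n)) \<in> borel_measurable M"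
  using assms unfolding poisson_def by measurable

lemma poisson_pos: "0 < t \<Longrightarrow> 0 < poisson a t u"
  unfolding poisson_def using infnorm_pos_le[of u]
  by (intro divide_pos_pos) (auto intro!: powr_gt_zero[THEN iffD2] simp del: infnorm_pos_le)

lemma poisson_nonneg [simp]: "0 \<le> poisson a t u"
  unfolding poisson_def by simp

lemma poisson_minus: "poisson a t (- u) = poisson a t u"
  by (simp add: poisson_def infnorm_neg)

lemma holder_poisson_pos:
  assumes "0 < t" "z \<noteq> z'" shows "0 < holder_poisson a t (z - z') u"
proof -
  have "0 < infnorm (z - z')" using assms by (simp add: infnorm_pos_lt)
  then show ?thesis using assms poisson_pos[of t a u] by simp
qed

lemma holder_poisson_eq:
  fixes u :: "real^'n"
  assumes "0 < t"
  shows "infnorm d powr a / (t + infnorm u) powr (real CARD('n) + a) = holder_poisson a t d u"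
  using assms by (simp add: poisson_def powr_divide infnorm_pos_le)

lemma poisson_le:
  assumes "0 < t" "0 \<le> a" shows "poisson a t (u::real^'n) \<le> 1 / t ^ CARD('n)"
proof -
  have "t powr (real CARD('n) + a) \<le> (t + infnorm u) powr (real CARD('n) + a)"
    using assms infnorm_pos_le[of u] by (intro powr_mono2) auto
  then have "poisson a t u \<le> t powr a / t powr (real CARD('n) + a)"
    unfolding poisson_def using assms by (intro divide_left_mono) (auto intro!: mult_pos_pos)
  also have "\<dots> = 1 / t ^ CARD('n)" using assms by (simp add: powr_add powr_realpow)
  finally show ?thesis .
qed

lemma poisson_le_shell:
  assumes "0 < t" "0 < a"
  shows "\<exists>i::nat. infnorm (u::real^'n) < 2 ^ i * t \<and>
    poisson a t u \<le> (2 powr (real CARD('n) + a) / t ^ CARD('n)) * (2 powr (real CARD('n) + a)) powr (- real i)"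
proof -
  let ?s = "real CARD('n) + a"
  define i where "i = (LEAST i::nat. infnorm u < 2 ^ i * t)"
  have "\<exists>i::nat. infnorm u < 2 ^ i * t"
    using real_arch_pow[of 2 "infnorm u / t"] assms by (auto simp: field_simps)
  then have i: "infnorm u < 2 ^ i * t" unfolding i_def by (rule LeastI_ex)
  have "poisson a t u \<le> (2 powr ?s / t ^ CARD('n)) * (2 powr ?s) powr (- real i)"
  proof (cases i)
    case 0
    have "1 \<le> 2 powr ?s" using assms by (intro ge_one_powr_ge_zero) auto
    then have "1 / t ^ CARD('n) \<le> 2 powr ?s / t ^ CARD('n)" using assms by (intro divide_right_mono) auto
    then show ?thesis using 0 poisson_le[of t a u] assms by simp
  next
    case (Suc j)
    have "\<not> infnorm u < 2 ^ j * t" using not_less_Least[of j "\<lambda>i. infnorm u < 2 ^ i * t"] Suc by (simp add: i_def)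
    then have "(2 ^ j * t) powr ?s \<le> (t + infnorm u) powr ?s"
      using assms by (intro powr_mono2) auto
    then have "poisson a t u \<le> t powr a / (2 ^ j * t) powr ?s"
      unfolding poisson_def using assms by (intro divide_left_mono) (auto intro!: mult_pos_pos)
    also have "\<dots> = (1 / t ^ CARD('n)) * (1 / (2 ^ j) powr ?s)"
      using assms by (simp add: powr_mult powr_add powr_realpow)
    also have "1 / (2 ^ j) powr ?s = 2 powr ?s * (2 powr ?s) powr (- real i)"
      unfolding Suc by (simp add: powr_powr powr_realpow[symmetric] powr_minus[symmetric]
        powr_add[symmetric] inverse_eq_divide[symmetric] algebra_simps)
    finally show ?thesis by simp
  qed
  with i show ?thesis by blast
qed

lemma nn_integral_poisson_le:
  assumes "0 < t" "0 < a"
  shows "(\<integral>\<^sup>+u. ennreal (poisson a t (u::real^'n)) \<partial>lborel) \<le> ennreal (poisson_mass CARD('n) a)"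
proof -
  let ?s = "real CARD('n) + a"
  let ?c = "\<lambda>i::nat. (2 powr ?s / t ^ CARD('n)) * (2 powr ?s) powr (- real i)"
  let ?B = "\<lambda>i::nat. {u::real^'n. infnorm u < 2 ^ i * t}"
  have c_nonneg: "0 \<le> ?c i" for i using assms by simp
  have "ennreal (poisson a t u) \<le> (\<Sum>i. ennreal (?c i) * indicator (?B i) u)" for u :: "real^'n"
  proof -
    obtain i where i: "infnorm u < 2 ^ i * t" "poisson a t u \<le> ?c i" using poisson_le_shell[OF assms] by blast
    have "ennreal (poisson a t u) \<le> ennreal (?c i) * indicator (?B i) u"
      using i by (simp add: ennreal_leI)
    also have "\<dots> \<le> (\<Sum>i. ennreal (?c i) * indicator (?B i) u)"
      using sum_le_suminf[of "\<lambda>i. ennreal (?c i) * indicator (?B i) u" "{i}"] by (simp del: sum_mult_indicator)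
    finally show ?thesis .
  qed
  then have "(\<integral>\<^sup>+u. ennreal (poisson a t (u::real^'n)) \<partial>lborel)
    \<le> (\<integral>\<^sup>+u. (\<Sum>i. ennreal (?c i) * indicator (?B i) u) \<partial>lborel)"
    by (intro nn_integral_mono)
  also have "\<dots> = (\<Sum>i. ennreal (?c i) * emeasure lborel (?B i))"
    by (subst nn_integral_suminf) (auto simp: nn_integral_cmult_indicator)
  also have "\<dots> \<le> (\<Sum>i. ennreal (2 ^ CARD('n) * 2 powr ?s * (2 powr (- a)) ^ i))"
  proof (intro suminf_le allI)
    fix i :: nat
    have "ennreal (?c i) * emeasure lborel (?B i) \<le> ennreal (?c i) * ennreal ((2 * (2 ^ i * t)) ^ CARD('n))"
      using assms by (intro mult_left_mono emeasure_infnorm_ball_le) auto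
    also have "\<dots> = ennreal (?c i * (2 * (2 ^ i * t)) ^ CARD('n))"
      using c_nonneg[of i] assms by (subst ennreal_mult) auto
    also have "?c i * (2 * (2 ^ i * t)) ^ CARD('n)
      = 2 ^ CARD('n) * 2 powr ?s * ((2 powr ?s) powr (- real i) * (2 ^ i) ^ CARD('n))"
      using assms by (simp add: power_mult_distrib field_simps)
    also have "(2 powr ?s) powr (- real i) * (2 ^ i) ^ CARD('n) = (2 powr (- a)) ^ i"
      by (simp add: powr_powr powr_realpow[symmetric] powr_add[symmetric] algebra_simps)
    finally show "ennreal (?c i) * emeasure lborel (?B i) \<le> ennreal (2 ^ CARD('n) * 2 powr ?s * (2 powr (- a)) ^ i)" .
  qed auto
  also have "\<dots> = ennreal (poisson_mass CARD('n) a)"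
    using assms unfolding poisson_mass_def
    by (intro suminf_ennreal_eq sums_mult geometric_sums) (auto simp: powr_less_one)
  finally show ?thesis .
qed

lemma nn_integral_poisson_shift_le:
  assumes "0 < t" "0 < a"
  shows "(\<integral>\<^sup>+y. ennreal (poisson a t (y - (z::real^'n))) \<partial>lborel) \<le> ennreal (poisson_mass CARD('n) a)"
    "(\<integral>\<^sup>+y. ennreal (poisson a t ((z::real^'n) - y)) \<partial>lborel) \<le> ennreal (poisson_mass CARD('n) a)"
proof -
  show reflected: "(\<integral>\<^sup>+y. ennreal (poisson a t (z - y)) \<partial>lborel) \<le> ennreal (poisson_mass CARD('n) a)"
    using nn_integral_poisson_le[OF assms] by (subst nn_integral_lborel_reflect) simp_all
  then show "(\<integral>\<^sup>+y. ennreal (poisson a t (y - z)) \<partial>lborel) \<le> ennreal (poisson_mass CARD('n) a)"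
    using poisson_minus[of a t "z - _"] by simp
qed

lemma nn_integral_poisson_shift_finite:
  "0 < t \<Longrightarrow> 0 < a \<Longrightarrow> (\<integral>\<^sup>+z. ennreal (poisson a t ((y::real^'n) - z)) \<partial>lborel) < \<infinity>"
  using nn_integral_poisson_shift_le(2)[of t a y] by (auto intro: le_less_trans)

lemma integrable_poisson:
  "0 < t \<Longrightarrow> 0 < a \<Longrightarrow> integrable lborel (\<lambda>z::real^'n. poisson a t (y - z))"
  by (rule integrableI_bounded) (use nn_integral_poisson_shift_finite[of t a y] in auto)

lemma integral_poisson_le:
  assumes "0 < t" "0 < a"
  shows "(\<integral>z. poisson a t ((y::real^'n) - z) \<partial>lborel) \<le> poisson_mass CARD('n) a"
proof -
  have "ennreal (\<integral>z. poisson a t (y - z) \<partial>lborel) = (\<integral>\<^sup>+z. ennreal (poisson a t (y - z)) \<partial>lborel)"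
    by (rule nn_integral_eq_integral[symmetric]) (auto intro: integrable_poisson assms)
  also have "\<dots> \<le> ennreal (poisson_mass CARD('n) a)" by (rule nn_integral_poisson_shift_le(2)[OF assms])
  finally show ?thesis using poisson_mass_pos[OF assms(2), of "CARD('n)"] by simp
qed

lemma square_integrable_poisson:
  assumes "0 < t" "0 < a"
  shows "square_integrable lborel (\<lambda>z::real^'n. poisson a t (y - z))"
proof -
  have "energy lborel (\<lambda>z::real^'n. poisson a t (y - z))
    \<le> (\<integral>\<^sup>+z. ennreal (1 / t ^ CARD('n)) * ennreal (poisson a t (y - z)) \<partial>lborel)"
  proof (intro nn_integral_mono)
    fix z :: "real^'n"
    show "ennreal ((poisson a t (y - z))\<^sup>2) \<le> ennreal (1 / t ^ CARD('n)) * ennreal (poisson a t (y - z))"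
      unfolding power2_eq_square
      using mult_right_mono[OF poisson_le[of t a "y - z"] poisson_nonneg[of a t "y - z"]] assms
      by (subst ennreal_mult[symmetric]) (auto intro!: ennreal_leI)
  qed
  also have "\<dots> < \<infinity>"
    using nn_integral_poisson_shift_finite[OF assms, of y] by (simp add: nn_integral_cmult ennreal_mult_less_top)
  finally show ?thesis unfolding square_integrable_def by simp
qed

lemma poisson_le_nearby:
  assumes t: "0 < t" and a: "0 < a" and near: "infnorm (z - z') < 2 * t"
  shows "poisson a t (y - z') \<le> 3 powr (real CARD('n) + a) * poisson a t (y - (z::real^'n))"
proof -
  let ?s = "real CARD('n) + a"
  have "infnorm (y - z) \<le> infnorm (y - z') + infnorm (z - z')"
    using infnorm_triangle[of "y - z'" "z' - z"] infnorm_sub[of z z'] by simp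
  then have triangle: "t + infnorm (y - z) \<le> 3 * (t + infnorm (y - z'))"
    using near t infnorm_pos_le[of "y - z'"] unfolding distrib_left by simp
  have pos: "0 < t + infnorm (y - z')" "0 < t + infnorm (y - z)"
    using t infnorm_pos_le[of "y - z'"] infnorm_pos_le[of "y - z"] by linarith+
  have "(t + infnorm (y - z)) powr ?s \<le> 3 powr ?s * (t + infnorm (y - z')) powr ?s"
    using triangle pos a by (subst powr_mult[symmetric]) (auto intro!: powr_mono2)
  then have "1 / (t + infnorm (y - z')) powr ?s \<le> 3 powr ?s / (t + infnorm (y - z)) powr ?s"
    using pos by (simp add: field_simps)
  from mult_left_mono[OF this, of "t powr a"] show ?thesis
    unfolding poisson_def by (simp add: mult_ac)
qed

lemma poisson_times_powr_le:
  assumes "0 < t" "t \<le> r" "0 < s"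
  shows "poisson a t (u::real^'n) * (infnorm u / r) powr s \<le> poisson (a - s) t u"
proof -
  have u: "0 \<le> infnorm u" by (simp add: infnorm_pos_le)
  have "(infnorm u / r) powr s \<le> ((t + infnorm u) / t) powr s"
    using assms u by (intro powr_mono2 frac_le) auto
  then have "poisson a t u * (infnorm u / r) powr s \<le> poisson a t u * ((t + infnorm u) / t) powr s"
    by (intro mult_left_mono poisson_nonneg)
  also have "\<dots> = (t powr a / t powr s) / ((t + infnorm u) powr (real CARD('n) + a) / (t + infnorm u) powr s)"
    using assms u by (simp add: poisson_def powr_divide)
  also have "\<dots> = poisson (a - s) t u"
    unfolding poisson_def powr_diff[symmetric] by (simp add: algebra_simps)
  finally show ?thesis .
qed

subsection \<open>Dyadic averages\<close>

text \<open>A dyadic cube of side \<open>2\<^sup>k\<close> is identified with its lower corner.\<close>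

definition dyadic_corner :: "int \<Rightarrow> real^'n \<Rightarrow> real^'n" where
  "dyadic_corner k x = (\<chi> i. side_length k * real_of_int \<lfloor>x$i / side_length k\<rfloor>)"

definition dyadic_cube :: "int \<Rightarrow> real^'n \<Rightarrow> (real^'n) set" where
  "dyadic_cube k x = {z. dyadic_corner k z = dyadic_corner k x}"

definition dyadic_kernel :: "int \<Rightarrow> real^'n \<Rightarrow> real^'n \<Rightarrow> real" where
  "dyadic_kernel k x z = (if dyadic_corner k x = dyadic_corner k z then (1 / side_length k) ^ CARD('n) else 0)"

definition dyadic_average :: "int \<Rightarrow> (real^'n \<Rightarrow> real) \<Rightarrow> real^'n \<Rightarrow> real" where
  "dyadic_average k h x = (\<integral>z. dyadic_kernel k x z * h z \<partial>lborel)"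

definition dyadic_constant :: "int \<Rightarrow> (real^'n \<Rightarrow> 'b) \<Rightarrow> bool" where
  "dyadic_constant k g \<longleftrightarrow> (\<forall>x z. dyadic_corner k x = dyadic_corner k z \<longrightarrow> g x = g z)"

lemma dyadic_corner_eq_iff:
  "dyadic_corner k x = dyadic_corner k z \<longleftrightarrow> (\<forall>i. \<lfloor>x$i / side_length k\<rfloor> = \<lfloor>z$i / side_length k\<rfloor>)"
  by (simp add: dyadic_corner_def vec_eq_iff)

lemma dyadic_corner_eq_mono:
  assumes "k \<le> j" "dyadic_corner k x = dyadic_corner k z"
  shows "dyadic_corner j x = dyadic_corner j z"
proof -
  define b :: int where "b = 2 ^ nat (j - k)"
  have b: "side_length j = side_length k * real_of_int b"
    using assms by (simp add: b_def powr_realpow[symmetric] powr_add[symmetric])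
  have "\<lfloor>y / side_length j\<rfloor> = \<lfloor>y / side_length k\<rfloor> div b" for y
    using floor_divide_real_eq_div[of b "y / side_length k"] unfolding b by (simp add: b_def field_simps)
  then show ?thesis using assms by (simp add: dyadic_corner_eq_iff)
qed

lemma dyadic_constantD: "dyadic_constant k g \<Longrightarrow> dyadic_corner k x = dyadic_corner k z \<Longrightarrow> g x = g z"
  unfolding dyadic_constant_def by blast

lemma dyadic_constant_comp: "dyadic_constant k g \<Longrightarrow> dyadic_constant k (\<lambda>x. F (g x))"
  unfolding dyadic_constant_def by metis

lemma dyadic_constant_mono: "dyadic_constant j g \<Longrightarrow> k \<le> j \<Longrightarrow> dyadic_constant k g"
  unfolding dyadic_constant_def using dyadic_corner_eq_mono by blast

lemma dyadic_cube_eq_hcube: "dyadic_cube k x = hcube (dyadic_corner k x) (side_length k)"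
proof -
  have "\<lfloor>z / p\<rfloor> = \<lfloor>x / p\<rfloor> \<longleftrightarrow> p * real_of_int \<lfloor>x / p\<rfloor> \<le> z \<and> z < p * real_of_int \<lfloor>x / p\<rfloor> + p"
    if "p > 0" for x z p :: real
    using that by (simp add: floor_eq_iff field_simps)
  then show ?thesis
    by (auto simp: dyadic_cube_def hcube_def dyadic_corner_eq_iff set_eq_iff) (auto simp: dyadic_corner_def)
qed

lemma mem_dyadic_cube [simp]: "z \<in> dyadic_cube k x \<longleftrightarrow> dyadic_corner k z = dyadic_corner k x"
  by (simp add: dyadic_cube_def)

lemma sets_dyadic_cube [measurable]: "dyadic_cube k x \<in> sets borel"
  unfolding dyadic_cube_eq_hcube by measurable

lemma emeasure_dyadic_cube: "emeasure lborel (dyadic_cube k (x::real^'n)) = ennreal (side_length k ^ CARD('n))"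
  unfolding dyadic_cube_eq_hcube by (simp add: emeasure_hcube)

lemma dyadic_corner_dyadic_corner [simp]: "dyadic_corner k (dyadic_corner k x) = dyadic_corner k x"
  unfolding mem_dyadic_cube[symmetric] dyadic_cube_eq_hcube by (simp add: hcube_def)

lemma infnorm_diff_less_dyadic:
  assumes "dyadic_corner k x = dyadic_corner k z" shows "infnorm (x - z) < side_length k"
  by (rule infnorm_diff_less_hcube[of _ "dyadic_corner k z"])
    (use assms in \<open>simp_all add: dyadic_cube_eq_hcube[symmetric]\<close>)

lemma borel_measurable_dyadic_corner [measurable]: "dyadic_corner k \<in> borel_measurable borel"
  unfolding dyadic_corner_def[abs_def] by (intro borel_measurable_vec_lambda) measurable

lemma borel_measurable_dyadic_kernel [measurable (raw)]:
  assumes [measurable]: "f \<in> borel_measurable M" "g \<in> borel_measurable M"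
  shows "(\<lambda>x. dyadic_kernel k (f x) (g x)) \<in> borel_measurable M"
  unfolding dyadic_kernel_def by measurable

lemma borel_measurable_dyadic_average [measurable (raw)]:
  assumes [measurable]: "f \<in> borel_measurable M" "case_prod g \<in> borel_measurable (M \<Otimes>\<^sub>M lborel)"
  shows "(\<lambda>x. dyadic_average k (g x) (f x)) \<in> borel_measurable M"
  unfolding dyadic_average_def by measurable

lemma dyadic_kernel_nonneg [simp]: "0 \<le> dyadic_kernel k x z"
  by (simp add: dyadic_kernel_def)

lemma dyadic_kernel_le: "dyadic_kernel k x (z::real^'n) \<le> (1 / side_length k) ^ CARD('n)"
  by (auto simp: dyadic_kernel_def)

lemma nn_integral_dyadic_kernel_mult:
  assumes [measurable]: "\<phi> \<in> borel_measurable borel"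
  shows "(\<integral>\<^sup>+z. ennreal (dyadic_kernel k (x::real^'n) z) * \<phi> z \<partial>lborel)
    = ennreal ((1 / side_length k) ^ CARD('n)) * (\<integral>\<^sup>+z. indicator (dyadic_cube k x) z * \<phi> z \<partial>lborel)"
proof -
  have "(\<integral>\<^sup>+z. ennreal (dyadic_kernel k x z) * \<phi> z \<partial>lborel)
    = (\<integral>\<^sup>+z. ennreal ((1 / side_length k) ^ CARD('n)) * (indicator (dyadic_cube k x) z * \<phi> z) \<partial>lborel)"
    by (intro nn_integral_cong) (auto simp: dyadic_kernel_def indicator_def)
  then show ?thesis by (simp add: nn_integral_cmult)
qed

lemma nn_integral_dyadic_kernel [simp]: "(\<integral>\<^sup>+z. ennreal (dyadic_kernel k (x::real^'n) z) \<partial>lborel) = 1"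
  using nn_integral_dyadic_kernel_mult[of "\<lambda>_. 1" k x]
  by (simp add: emeasure_dyadic_cube ennreal_mult[symmetric] power_mult_distrib[symmetric])

lemma integral_dyadic_kernel [simp]: "(\<integral>z. dyadic_kernel k x z \<partial>lborel) = 1"
  using nn_integral_dyadic_kernel[of k x] by (subst integral_eq_nn_integral) auto

lemma nn_integral_dyadic_constant_mult:
  assumes [measurable]: "\<psi> \<in> borel_measurable borel" "\<phi> \<in> borel_measurable borel"
    and \<psi>: "dyadic_constant k \<psi>"
  shows "(\<integral>\<^sup>+x. \<psi> x * \<phi> x \<partial>lborel) = (\<integral>\<^sup>+z. \<psi> z * (\<integral>\<^sup>+x. ennreal (dyadic_kernel k z x) * \<phi> x \<partial>lborel) \<partial>lborel)"
proof -
  have "(\<integral>\<^sup>+x. \<psi> x * \<phi> x \<partial>lborel) = (\<integral>\<^sup>+x. (\<integral>\<^sup>+z. \<psi> x * \<phi> x * ennreal (dyadic_kernel k x z) \<partial>lborel) \<partial>lborel)"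
    by (subst nn_integral_cmult) auto
  also have "\<dots> = (\<integral>\<^sup>+z. (\<integral>\<^sup>+x. \<psi> x * \<phi> x * ennreal (dyadic_kernel k x z) \<partial>lborel) \<partial>lborel)"
    by (rule lborel_pair.Fubini') measurable
  also have "\<dots> = (\<integral>\<^sup>+z. (\<integral>\<^sup>+x. \<psi> z * (ennreal (dyadic_kernel k z x) * \<phi> x) \<partial>lborel) \<partial>lborel)"
  proof (intro nn_integral_cong)
    fix x z :: "real^'a"
    show "\<psi> x * \<phi> x * ennreal (dyadic_kernel k x z) = \<psi> z * (ennreal (dyadic_kernel k z x) * \<phi> x)"
      using dyadic_constantD[OF \<psi>, of x z]
      by (cases "dyadic_corner k x = dyadic_corner k z") (simp_all add: dyadic_kernel_def mult_ac)
  qed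
  also have "\<dots> = (\<integral>\<^sup>+z. \<psi> z * (\<integral>\<^sup>+x. ennreal (dyadic_kernel k z x) * \<phi> x \<partial>lborel) \<partial>lborel)"
    by (intro nn_integral_cong nn_integral_cmult) measurable
  finally show ?thesis .
qed

lemma nn_integral_nn_integral_dyadic_kernel:
  assumes "\<phi> \<in> borel_measurable borel"
  shows "(\<integral>\<^sup>+z. (\<integral>\<^sup>+x. ennreal (dyadic_kernel k z x) * \<phi> x \<partial>lborel) \<partial>lborel) = (\<integral>\<^sup>+x. \<phi> x \<partial>lborel)"
  using nn_integral_dyadic_constant_mult[of "\<lambda>_. 1" \<phi> k] assms by (simp add: dyadic_constant_def)

lemma square_integrable_dyadic_kernel: "square_integrable lborel (dyadic_kernel k x)"
proof -
  have "energy lborel (dyadic_kernel k x)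
    \<le> (\<integral>\<^sup>+z. ennreal ((1 / side_length k) ^ CARD('a)) * ennreal (dyadic_kernel k x z) \<partial>lborel)"
  proof (intro nn_integral_mono)
    fix z show "ennreal ((dyadic_kernel k x z)\<^sup>2)
      \<le> ennreal ((1 / side_length k) ^ CARD('a)) * ennreal (dyadic_kernel k x z)"
      unfolding power2_eq_square using dyadic_kernel_le[of k x z]
      by (subst ennreal_mult[symmetric]) (auto intro!: ennreal_leI mult_right_mono)
  qed
  also have "\<dots> < \<infinity>" by (subst nn_integral_cmult) auto
  finally show ?thesis unfolding square_integrable_def by simp
qed

lemma dyadic_constant_dyadic_average: "dyadic_constant k (dyadic_average k h)"
  unfolding dyadic_constant_def dyadic_average_def dyadic_kernel_def by simp

lemma dyadic_average_nonneg: "(\<And>x. 0 \<le> h x) \<Longrightarrow> 0 \<le> dyadic_average k h x"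
  unfolding dyadic_average_def by (intro Bochner_Integration.integral_nonneg) auto

lemma dyadic_average_abs_le:
  "ennreal \<bar>dyadic_average k h x\<bar> \<le> (\<integral>\<^sup>+z. ennreal (dyadic_kernel k x z) * ennreal \<bar>h z\<bar> \<partial>lborel)"
  using ennreal_abs_integral_le[of lborel "\<lambda>z. dyadic_kernel k x z * h z"]
  by (simp add: dyadic_average_def abs_mult ennreal_mult)

lemma dyadic_average_square_le:
  assumes [measurable]: "h \<in> borel_measurable borel"
  shows "ennreal ((dyadic_average k h x)\<^sup>2) \<le> (\<integral>\<^sup>+z. ennreal (dyadic_kernel k x z) * ennreal ((h z)\<^sup>2) \<partial>lborel)"
  using weighted_Cauchy_Schwarz[of "dyadic_kernel k x" lborel h] by (simp add: dyadic_average_def)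

lemma dyadic_average_square_le_energy:
  assumes [measurable]: "h \<in> borel_measurable borel"
  shows "ennreal ((dyadic_average k h (x::real^'n))\<^sup>2) \<le> ennreal ((1 / side_length k) ^ CARD('n)) * energy lborel h"
proof -
  have "(\<integral>\<^sup>+z. ennreal (dyadic_kernel k x z) * ennreal ((h z)\<^sup>2) \<partial>lborel)
    \<le> (\<integral>\<^sup>+z. ennreal ((1 / side_length k) ^ CARD('n)) * ennreal ((h z)\<^sup>2) \<partial>lborel)"
    by (intro nn_integral_mono mult_right_mono ennreal_leI dyadic_kernel_le) auto
  also have "\<dots> = ennreal ((1 / side_length k) ^ CARD('n)) * energy lborel h"
    by (intro nn_integral_cmult) measurable
  finally show ?thesis using dyadic_average_square_le[of h k x] by simp
qed

lemma energy_dyadic_average_le: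
  assumes [measurable]: "h \<in> borel_measurable borel"
  shows "energy lborel (dyadic_average k h) \<le> energy lborel h"
proof -
  have "energy lborel (dyadic_average k h)
    \<le> (\<integral>\<^sup>+x. (\<integral>\<^sup>+z. ennreal (dyadic_kernel k x z) * ennreal ((h z)\<^sup>2) \<partial>lborel) \<partial>lborel)"
    by (intro nn_integral_mono dyadic_average_square_le) measurable
  also have "\<dots> = energy lborel h"
    by (rule nn_integral_nn_integral_dyadic_kernel) measurable
  finally show ?thesis .
qed

lemma square_integrable_dyadic_average:
  "square_integrable lborel h \<Longrightarrow> square_integrable lborel (dyadic_average k h)"
  using energy_dyadic_average_le[of h k] unfolding square_integrable_def by (auto intro: le_less_trans)

lemma integrable_dyadic_kernel_mult:
  fixes \<phi> h :: "real^'n \<Rightarrow> real"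
  assumes "square_integrable lborel \<phi>" "square_integrable lborel h"
  shows "integrable (lborel \<Otimes>\<^sub>M lborel) (\<lambda>(x, z). \<phi> x * (dyadic_kernel k x z * h z))"
proof -
  note [measurable] = assms[THEN borel_measurable_square_integrable_lborel]
  let ?r = "\<lambda>x z. sqrt (dyadic_kernel k x z)"
  have "energy (lborel \<Otimes>\<^sub>M lborel) (\<lambda>(x, z). ?r x z * \<phi> x)
    = (\<integral>\<^sup>+x. \<integral>\<^sup>+z. ennreal ((\<phi> x)\<^sup>2) * ennreal (dyadic_kernel k x z) \<partial>lborel \<partial>lborel)"
    by (subst lborel_pair.energy_fst[symmetric]) (simp_all add: power_mult_distrib ennreal_mult mult.commute)
  also have "\<dots> = energy lborel \<phi>" by (simp add: nn_integral_cmult)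
  finally have \<phi>: "square_integrable (lborel \<Otimes>\<^sub>M lborel) (\<lambda>(x, z). ?r x z * \<phi> x)"
    using assms(1) by (simp add: square_integrable_def)
  have "energy (lborel \<Otimes>\<^sub>M lborel) (\<lambda>(x, z). ?r x z * h z)
    = (\<integral>\<^sup>+x. \<integral>\<^sup>+z. ennreal (dyadic_kernel k x z) * ennreal ((h z)\<^sup>2) \<partial>lborel \<partial>lborel)"
    by (subst lborel_pair.energy_fst[symmetric]) (simp_all add: power_mult_distrib ennreal_mult)
  also have "\<dots> = energy lborel h" by (simp add: nn_integral_nn_integral_dyadic_kernel)
  finally have h: "square_integrable (lborel \<Otimes>\<^sub>M lborel) (\<lambda>(x, z). ?r x z * h z)"
    using assms(2) by (simp add: square_integrable_def)
  have "(\<lambda>(x, z). \<phi> x * (dyadic_kernel k x z * h z))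
    = (\<lambda>p. (case p of (x, z) \<Rightarrow> ?r x z * \<phi> x) * (case p of (x, z) \<Rightarrow> ?r x z * h z))"
  proof
    fix p :: "(real^'n) \<times> (real^'n)"
    obtain x z where p: "p = (x, z)" by (cases p)
    have "?r x z * \<phi> x * (?r x z * h z) = (?r x z * ?r x z) * (\<phi> x * h z)" by (simp only: mult_ac)
    also have "\<dots> = \<phi> x * (dyadic_kernel k x z * h z)" by (simp add: mult.left_commute)
    finally show "(case p of (x, z) \<Rightarrow> \<phi> x * (dyadic_kernel k x z * h z))
      = (case p of (x, z) \<Rightarrow> ?r x z * \<phi> x) * (case p of (x, z) \<Rightarrow> ?r x z * h z)"
      unfolding p prod.case by (rule sym)
  qed
  then show ?thesis using square_integrable_mult[OF \<phi> h] by simp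
qed

lemma integral_dyadic_constant_mult_average:
  assumes "square_integrable lborel \<phi>" "square_integrable lborel h" "dyadic_constant k \<phi>"
  shows "(\<integral>x. \<phi> x * dyadic_average k h x \<partial>lborel) = (\<integral>x. \<phi> x * h x \<partial>lborel)"
proof -
  have "(\<integral>x. \<phi> x * dyadic_average k h x \<partial>lborel) = (\<integral>x. (\<integral>z. \<phi> x * (dyadic_kernel k x z * h z) \<partial>lborel) \<partial>lborel)"
    by (simp add: dyadic_average_def)
  also have "\<dots> = (\<integral>z. (\<integral>x. \<phi> x * (dyadic_kernel k x z * h z) \<partial>lborel) \<partial>lborel)"
    using lborel_pair.Fubini_integral[OF integrable_dyadic_kernel_mult[OF assms(1,2)]] by simp
  also have "\<dots> = (\<integral>z. (\<integral>x. (\<phi> z * h z) * dyadic_kernel k z x \<partial>lborel) \<partial>lborel)"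
  proof (intro Bochner_Integration.integral_cong refl)
    fix x z :: "real^'a"
    show "\<phi> x * (dyadic_kernel k x z * h z) = \<phi> z * h z * dyadic_kernel k z x"
      using dyadic_constantD[OF assms(3), of x z]
      by (cases "dyadic_corner k x = dyadic_corner k z") (simp_all add: dyadic_kernel_def)
  qed
  also have "\<dots> = (\<integral>z. \<phi> z * h z \<partial>lborel)" by simp
  finally show ?thesis .
qed

subsection \<open>Martingale differences\<close>

definition dyadic_difference :: "int \<Rightarrow> (real^'n \<Rightarrow> real) \<Rightarrow> real^'n \<Rightarrow> real" where
  "dyadic_difference k h x = dyadic_average k h x - dyadic_average (k + 1) h x"

definition dyadic_cancellation :: "int \<Rightarrow> (real^'n \<Rightarrow> real) \<Rightarrow> bool" where
  "dyadic_cancellation k h \<longleftrightarrow>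
    (\<forall>\<phi>. square_integrable lborel \<phi> \<longrightarrow> dyadic_constant k \<phi> \<longrightarrow> (\<integral>z. \<phi> z * h z \<partial>lborel) = 0)"

lemma borel_measurable_dyadic_difference [measurable (raw)]:
  assumes [measurable]: "f \<in> borel_measurable M" "case_prod g \<in> borel_measurable (M \<Otimes>\<^sub>M lborel)"
  shows "(\<lambda>x. dyadic_difference k (g x) (f x)) \<in> borel_measurable M"
  unfolding dyadic_difference_def by measurable

lemma square_integrable_dyadic_difference:
  "square_integrable lborel h \<Longrightarrow> square_integrable lborel (dyadic_difference k h)"
  unfolding dyadic_difference_def[abs_def] by (intro square_integrable_diff square_integrable_dyadic_average)

lemma dyadic_constant_dyadic_difference: "dyadic_constant k (dyadic_difference k h)"
proof -
  have "dyadic_constant k (dyadic_average (k + 1) h)"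
    by (rule dyadic_constant_mono[OF dyadic_constant_dyadic_average]) simp
  then show ?thesis
    unfolding dyadic_difference_def[abs_def] dyadic_constant_def
    using dyadic_constantD[OF dyadic_constant_dyadic_average[of k h]] by metis
qed

lemma dyadic_cancellation_minus_average:
  assumes h: "square_integrable lborel h"
  shows "dyadic_cancellation k (\<lambda>z. h z - dyadic_average k h z)"
  unfolding dyadic_cancellation_def
proof (intro allI impI)
  fix \<phi> :: "real^'a \<Rightarrow> real" assume \<phi>: "square_integrable lborel \<phi>" "dyadic_constant k \<phi>"
  show "(\<integral>z. \<phi> z * (h z - dyadic_average k h z) \<partial>lborel) = 0"
    using integral_dyadic_constant_mult_average[OF \<phi>(1) h \<phi>(2)] square_integrable_mult[OF \<phi>(1) h]
      square_integrable_mult[OF \<phi>(1) square_integrable_dyadic_average[OF h]]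
    by (simp add: right_diff_distrib)
qed

lemma dyadic_cancellation_dyadic_difference:
  assumes h: "square_integrable lborel h"
  shows "dyadic_cancellation (k + 1) (dyadic_difference k h)"
  unfolding dyadic_cancellation_def
proof (intro allI impI)
  fix \<phi> :: "real^'a \<Rightarrow> real" assume \<phi>: "square_integrable lborel \<phi>" "dyadic_constant (k + 1) \<phi>"
  then have "dyadic_constant k \<phi>" by (auto intro: dyadic_constant_mono)
  then have "(\<integral>z. \<phi> z * dyadic_average k h z \<partial>lborel) = (\<integral>z. \<phi> z * dyadic_average (k + 1) h z \<partial>lborel)"
    using \<phi> h by (simp add: integral_dyadic_constant_mult_average)
  then show "(\<integral>z. \<phi> z * dyadic_difference k h z \<partial>lborel) = 0"
    using square_integrable_mult[OF \<phi>(1) square_integrable_dyadic_average[OF h]]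
    by (simp add: dyadic_difference_def right_diff_distrib)
qed

lemma integral_power2_dyadic_difference:
  assumes h: "square_integrable lborel h"
  shows "(\<integral>x. (dyadic_difference k h x)\<^sup>2 \<partial>lborel) + (\<integral>x. (dyadic_average (k + 1) h x)\<^sup>2 \<partial>lborel)
    = (\<integral>x. (dyadic_average k h x)\<^sup>2 \<partial>lborel)"
proof -
  let ?E = "dyadic_average k h" and ?E' = "dyadic_average (k + 1) h" and ?D = "dyadic_difference k h"
  note sq = square_integrable_dyadic_average[OF h] square_integrable_dyadic_difference[OF h]
  have orthogonal: "(\<integral>x. ?E' x * ?D x \<partial>lborel) = 0"
    using dyadic_cancellation_dyadic_difference[OF h] sq dyadic_constant_dyadic_average
    unfolding dyadic_cancellation_def by blast
  have "(\<integral>x. (?E x)\<^sup>2 \<partial>lborel) = (\<integral>x. (?D x)\<^sup>2 + (?E' x)\<^sup>2 + 2 * (?E' x * ?D x) \<partial>lborel)"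
    by (intro Bochner_Integration.integral_cong refl) (simp add: dyadic_difference_def power2_eq_square algebra_simps)
  also have "\<dots> = (\<integral>x. (?D x)\<^sup>2 \<partial>lborel) + (\<integral>x. (?E' x)\<^sup>2 \<partial>lborel)"
    using sq orthogonal square_integrable_mult[OF sq(1) sq(2)] by (simp add: square_integrable_power2)
  finally show ?thesis by simp
qed

lemma sum_energy_dyadic_difference_le:
  assumes h: "square_integrable lborel h"
  shows "(\<Sum>i<N. energy lborel (dyadic_difference (k + int i) h)) \<le> energy lborel h"
proof -
  let ?e = "\<lambda>k. \<integral>x. (dyadic_average k h x)\<^sup>2 \<partial>lborel"
  have difference: "(\<integral>x. (dyadic_difference (k + int i) h x)\<^sup>2 \<partial>lborel) = ?e (k + int i) - ?e (k + int (Suc i))" for i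
    using integral_power2_dyadic_difference[OF h, of "k + int i"] by (simp add: algebra_simps)
  have "(\<Sum>i<N. energy lborel (dyadic_difference (k + int i) h))
    = ennreal (\<Sum>i<N. \<integral>x. (dyadic_difference (k + int i) h x)\<^sup>2 \<partial>lborel)"
    using h by (subst sum_ennreal[symmetric]) (auto simp: energy_eq_integral square_integrable_dyadic_difference)
  also have "(\<Sum>i<N. \<integral>x. (dyadic_difference (k + int i) h x)\<^sup>2 \<partial>lborel) = ?e k - ?e (k + int N)"
    unfolding difference by (subst sum_lessThan_telescope') simp
  also have "ennreal \<dots> \<le> ennreal (?e k)" by (intro ennreal_leI) simp
  also have "\<dots> = energy lborel (dyadic_average k h)"
    using h by (simp add: energy_eq_integral square_integrable_dyadic_average)
  also have "\<dots> \<le> energy lborel h"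
    using h by (intro energy_dyadic_average_le borel_measurable_square_integrable_lborel)
  finally show ?thesis .
qed

lemma dyadic_average_telescope:
  "dyadic_average k h x = (\<Sum>i<N. dyadic_difference (k + int i) h x) + dyadic_average (k + int N) h x"
  by (induction N) (auto simp: dyadic_difference_def algebra_simps)

lemma dyadic_average_telescope_down:
  "dyadic_average (k - int N) h x = (\<Sum>i<N. dyadic_difference (k - 1 - int i) h x) + dyadic_average k h x"
proof (induction N)
  case (Suc N)
  have "dyadic_difference (k - 1 - int N) h x = dyadic_average (k - int (Suc N)) h x - dyadic_average (k - int N) h x"
    by (simp add: dyadic_difference_def algebra_simps)
  then show ?case using Suc by simp
qed simp

subsection \<open>Translations of dyadic averages\<close>

lemma emeasure_hcube_shift_boundary_le:
  fixes c u :: "real^'n"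
  assumes l: "0 < l"
  shows "emeasure lborel {x \<in> hcube c l. x + u \<notin> hcube c l} \<le> ennreal (real CARD('n) * (infnorm u / l * l ^ CARD('n)))"
proof -
  let ?S = "\<lambda>i. {x \<in> hcube c l. \<not> (c$i \<le> x$i + u$i \<and> x$i + u$i < c$i + l)}"
  have sets_S[measurable]: "?S i \<in> sets borel" for i by measurable
  have "{x \<in> hcube c l. x + u \<notin> hcube c l} = (\<Union>i. ?S i)" by (auto simp: hcube_def)
  then have "emeasure lborel {x \<in> hcube c l. x + u \<notin> hcube c l} \<le> (\<Sum>i\<in>UNIV. emeasure lborel (?S i))"
    by (simp only:) (intro emeasure_subadditive_finite, auto)
  also have "\<dots> \<le> (\<Sum>i\<in>(UNIV::'n set). ennreal (infnorm u / l * l ^ CARD('n)))"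
  proof (intro sum_mono)
    fix i :: 'n
    have "emeasure lborel (?S i) \<le> ennreal (\<bar>u$i\<bar> / l * l ^ CARD('n))"
      by (rule emeasure_hcube_shift_slab[OF l])
    also have "\<dots> \<le> ennreal (infnorm u / l * l ^ CARD('n))"
      using l by (intro ennreal_leI mult_right_mono divide_right_mono component_le_infnorm_cart) auto
    finally show "emeasure lborel (?S i) \<le> ennreal (infnorm u / l * l ^ CARD('n))" .
  qed
  also have "\<dots> = ennreal (real CARD('n) * (infnorm u / l * l ^ CARD('n)))"
    using l by (simp only: sum_constant ennreal_of_nat_eq_real_of_nat)
      (rule ennreal_mult[symmetric], auto simp: infnorm_pos_le)
  finally show ?thesis .
qed

lemma nn_integral_dyadic_kernel_boundary_linear:
  fixes u z :: "real^'n"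
  shows "(\<integral>\<^sup>+x. ennreal (dyadic_kernel j z x) * indicator {x. dyadic_corner j (x + u) \<noteq> dyadic_corner j x} x \<partial>lborel)
     \<le> ennreal (real CARD('n) * (infnorm u / side_length j))"
proof -
  let ?l = "side_length j" and ?Q = "dyadic_cube j z"
  let ?S = "{x \<in> ?Q. x + u \<notin> ?Q}" and ?r = "infnorm u / side_length j"
  have "ennreal (dyadic_kernel j z x) * indicator {x. dyadic_corner j (x + u) \<noteq> dyadic_corner j x} x
    = ennreal ((1 / ?l) ^ CARD('n)) * indicator ?S x" for x
    by (auto simp: dyadic_kernel_def split: split_indicator)
  then have "(\<integral>\<^sup>+x. ennreal (dyadic_kernel j z x) * indicator {x. dyadic_corner j (x + u) \<noteq> dyadic_corner j x} x \<partial>lborel)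
    = (\<integral>\<^sup>+x. ennreal ((1 / ?l) ^ CARD('n)) * indicator ?S x \<partial>lborel)" by simp
  also have "\<dots> = ennreal ((1 / ?l) ^ CARD('n)) * emeasure lborel ?S"
    by (rule nn_integral_cmult_indicator) measurable
  also have "\<dots> \<le> ennreal ((1 / ?l) ^ CARD('n)) * ennreal (real CARD('n) * (?r * ?l ^ CARD('n)))"
    unfolding dyadic_cube_eq_hcube by (intro mult_left_mono emeasure_hcube_shift_boundary_le) auto
  also have "\<dots> = ennreal (real CARD('n) * ?r)"
    by (subst ennreal_mult[symmetric]) (auto simp: power_divide infnorm_pos_le)
  finally show ?thesis .
qed

lemma nn_integral_dyadic_kernel_boundary:
  fixes u z :: "real^'n"
  assumes s: "0 < s" "s \<le> 1"
  shows "(\<integral>\<^sup>+x. ennreal (dyadic_kernel j z x) * indicator {x. dyadic_corner j (x + u) \<noteq> dyadic_corner j x} x \<partial>lborel)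
     \<le> ennreal (real CARD('n) * (infnorm u / side_length j) powr s)" (is "?I \<le> _")
proof -
  let ?r = "infnorm u / side_length j"
  have r_nonneg: "0 \<le> ?r" by (simp add: infnorm_pos_le)
  show ?thesis
  proof (cases "1 \<le> ?r")
    case True
    have "?I \<le> (\<integral>\<^sup>+x. ennreal (dyadic_kernel j z x) \<partial>lborel)"
      by (intro nn_integral_mono) (auto split: split_indicator)
    also have "\<dots> = ennreal 1" by simp
    also have "\<dots> \<le> ennreal (real CARD('n) * ?r powr s)"
    proof (intro ennreal_leI)
      have "1 \<le> ?r powr s" using True s by (intro ge_one_powr_ge_zero) auto
      moreover have "1 \<le> real CARD('n)" using one_le_card_finite by (simp add: Suc_le_eq)
      ultimately show "1 \<le> real CARD('n) * ?r powr s"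
        using mult_mono[of 1 "real CARD('n)" 1 "?r powr s"] by simp
    qed
    finally show ?thesis .
  next
    case False
    have "?r \<le> ?r powr s"
      using False s r_nonneg powr_mono'[of s 1 ?r] by (cases "?r = 0") (auto simp: infnorm_pos_le)
    then have "ennreal (real CARD('n) * ?r) \<le> ennreal (real CARD('n) * ?r powr s)"
      by (intro ennreal_leI mult_left_mono) auto
    then show ?thesis by (rule order_trans[OF nn_integral_dyadic_kernel_boundary_linear])
  qed
qed

lemma nn_integral_dyadic_constant_boundary:
  fixes u :: "real^'n"
  assumes [measurable]: "\<psi> \<in> borel_measurable borel" and \<psi>: "dyadic_constant j \<psi>" and s: "0 < s" "s \<le> 1"
  shows "(\<integral>\<^sup>+y. \<psi> y * indicator {x. dyadic_corner j (x + u) \<noteq> dyadic_corner j x} y \<partial>lborel)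
    \<le> ennreal (real CARD('n) * (infnorm u / side_length j) powr s) * (\<integral>\<^sup>+y. \<psi> y \<partial>lborel)"
    (is "?I \<le> ?c * _")
proof -
  have "?I = (\<integral>\<^sup>+z. \<psi> z * (\<integral>\<^sup>+x. ennreal (dyadic_kernel j z x)
    * indicator {x. dyadic_corner j (x + u) \<noteq> dyadic_corner j x} x \<partial>lborel) \<partial>lborel)"
    using \<psi> by (intro nn_integral_dyadic_constant_mult) auto
  also have "\<dots> \<le> (\<integral>\<^sup>+z. \<psi> z * ?c \<partial>lborel)"
    by (intro nn_integral_mono mult_left_mono nn_integral_dyadic_kernel_boundary s) auto
  also have "\<dots> = ?c * (\<integral>\<^sup>+y. \<psi> y \<partial>lborel)" by (subst nn_integral_multc) (auto simp: mult.commute)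
  finally show ?thesis .
qed

lemma energy_shift_dyadic_constant_le:
  fixes u :: "real^'n" and h :: "real^'n \<Rightarrow> real"
  assumes [measurable]: "h \<in> borel_measurable borel" and h: "dyadic_constant j h" and s: "0 < s" "s \<le> 1"
  shows "energy lborel (\<lambda>y. h (y + u) - h y)
     \<le> ennreal (4 * real CARD('n) * (infnorm u / side_length j) powr s) * energy lborel h"
proof -
  let ?c = "ennreal (real CARD('n) * (infnorm u / side_length j) powr s)"
  let ?X = "\<lambda>u y. indicator {x. dyadic_corner j (x + u) \<noteq> dyadic_corner j x} y :: ennreal"
  have boundary: "(\<integral>\<^sup>+y. ennreal ((h y)\<^sup>2) * ?X v y \<partial>lborel) \<le> ?c * energy lborel h" if "infnorm v = infnorm u" for v
  proof -
    have "dyadic_constant j (\<lambda>y. ennreal ((h y)\<^sup>2))" using h unfolding dyadic_constant_def by metis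
    then show ?thesis
      using nn_integral_dyadic_constant_boundary[of "\<lambda>y. ennreal ((h y)\<^sup>2)" j s v] s that by simp
  qed
  have pointwise: "ennreal ((h (y + u) - h y)\<^sup>2)
    \<le> 2 * (ennreal ((h (u + y))\<^sup>2) * ?X (-u) (u + y)) + 2 * (ennreal ((h y)\<^sup>2) * ?X u y)" for y
  proof (cases "dyadic_corner j (y + u) = dyadic_corner j y")
    case True
    then have "h (y + u) = h y" using h unfolding dyadic_constant_def by blast
    then show ?thesis by simp
  next
    case False
    then show ?thesis
      using ennreal_square_diff_le[of "h (y + u)" "h y"]
      by (simp add: add.commute[of u y] eq_commute[of "dyadic_corner j y"])
  qed
  have "energy lborel (\<lambda>y. h (y + u) - h y)
    \<le> (\<integral>\<^sup>+y. 2 * (ennreal ((h (u + y))\<^sup>2) * ?X (-u) (u + y)) + 2 * (ennreal ((h y)\<^sup>2) * ?X u y) \<partial>lborel)"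
    by (intro nn_integral_mono pointwise)
  also have "\<dots> = 2 * (\<integral>\<^sup>+y. ennreal ((h (u + y))\<^sup>2) * ?X (-u) (u + y) \<partial>lborel)
    + 2 * (\<integral>\<^sup>+y. ennreal ((h y)\<^sup>2) * ?X u y \<partial>lborel)"
    by (simp add: nn_integral_add nn_integral_cmult)
  also have "(\<integral>\<^sup>+y. ennreal ((h (u + y))\<^sup>2) * ?X (-u) (u + y) \<partial>lborel) = (\<integral>\<^sup>+y. ennreal ((h y)\<^sup>2) * ?X (-u) y \<partial>lborel)"
    by (rule nn_integral_lborel_translate) auto
  also have "2 * (\<integral>\<^sup>+y. ennreal ((h y)\<^sup>2) * ?X (-u) y \<partial>lborel) + 2 * (\<integral>\<^sup>+y. ennreal ((h y)\<^sup>2) * ?X u y \<partial>lborel)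
    \<le> 2 * (?c * energy lborel h) + 2 * (?c * energy lborel h)"
    by (intro add_mono mult_left_mono boundary) (auto simp: infnorm_neg)
  also have "\<dots> = 4 * ?c * energy lborel h" by (simp add: mult.assoc flip: distrib_right)
  also have "4 * ?c = ennreal (4 * real CARD('n) * (infnorm u / side_length j) powr s)"
    by (simp add: ennreal_mult mult.assoc)
  finally show ?thesis .
qed

text \<open>Any exponent \<open>\<delta>\<close> with \<open>0 < 2 * \<delta> < min a 1\<close> would do.\<close>

definition decay_exponent :: "real \<Rightarrow> real" where
  "decay_exponent a = min a 1 / 4"

definition decay_rate :: "real \<Rightarrow> real" where
  "decay_rate a = 2 powr (- decay_exponent a)"

definition shift_const :: "nat \<Rightarrow> real \<Rightarrow> real" where
  "shift_const n a = 8 * real n / (1 - decay_rate a)"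

definition oscillation_const :: "nat \<Rightarrow> real \<Rightarrow> real" where
  "oscillation_const n a = shift_const n a * poisson_mass n (a - 2 * decay_exponent a)"

lemma decay_exponent_bounds:
  "0 < a \<Longrightarrow> 0 < decay_exponent a" "2 * decay_exponent a \<le> 1" "0 < a \<Longrightarrow> 2 * decay_exponent a < a"
  by (auto simp: decay_exponent_def min_def)

lemma decay_rate_bounds: "0 < decay_rate a" "0 < a \<Longrightarrow> decay_rate a < 1"
  using decay_exponent_bounds[of a] by (auto simp: decay_rate_def powr_less_one)

lemma decay_rate_power: "decay_rate a ^ i = 2 powr (- decay_exponent a * real i)"
  by (simp add: decay_rate_def powr_powr powr_realpow[symmetric])

lemma shift_const_nonneg: "0 < a \<Longrightarrow> 0 \<le> shift_const n a"
  using decay_rate_bounds(2)[of a] by (simp add: shift_const_def)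

lemma oscillation_const_nonneg: "0 < a \<Longrightarrow> 0 \<le> oscillation_const n a"
  unfolding oscillation_const_def using decay_exponent_bounds(3)[of a]
  by (auto intro!: mult_nonneg_nonneg shift_const_nonneg less_imp_le[OF poisson_mass_pos])

lemma powr_decay_exponent_coarser_scale:
  assumes "0 \<le> r"
  shows "(r / side_length (k + int i)) powr (2 * decay_exponent a)
    = (r / side_length k) powr (2 * decay_exponent a) * (decay_rate a ^ i)\<^sup>2"
proof -
  have "r / side_length (k + int i) = (r / side_length k) * 2 powr (- real i)"
    by (simp add: powr_add powr_minus field_simps)
  then have "(r / side_length (k + int i)) powr (2 * decay_exponent a)
    = (r / side_length k) powr (2 * decay_exponent a) * (2 powr (- real i)) powr (2 * decay_exponent a)"
    using assms by (simp only:) (subst powr_mult, auto)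
  also have "(2 powr (- real i)) powr (2 * decay_exponent a) = (decay_rate a ^ i)\<^sup>2"
    by (simp add: decay_rate_power powr_powr power2_eq_square powr_add[symmetric] algebra_simps)
  finally show ?thesis .
qed

lemma energy_shift_dyadic_average_le:
  fixes u :: "real^'n"
  assumes h: "square_integrable lborel h" and a: "0 < a"
  shows "energy lborel (\<lambda>y. dyadic_average k h (y + u) - dyadic_average k h y)
     \<le> ennreal (shift_const CARD('n) a * (infnorm u / side_length k) powr (2 * decay_exponent a)) *
        (\<Sum>i. ennreal (decay_rate a ^ i) * energy lborel (dyadic_difference (k + int i) h))"
    (is "_ \<le> ennreal (_ * ?U) * _")
proof -
  let ?q = "decay_rate a" and ?c = "4 * real CARD('n) * ?U" and ?H = "\<integral>y. (h y)\<^sup>2 \<partial>lborel"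
  note [measurable] = borel_measurable_square_integrable_lborel[OF h]
  have q: "0 < ?q" "?q < 1" using decay_rate_bounds a by auto
  have shift: "energy lborel (\<lambda>y. g (y + u) - g y) \<le> ennreal (?c * (?q ^ i)\<^sup>2) * energy lborel g"
    if "square_integrable lborel g" "dyadic_constant (k + int i) g" for g i
    using energy_shift_dyadic_constant_le[of g "k + int i" "2 * decay_exponent a" u] that decay_exponent_bounds[of a]
      a
    unfolding powr_decay_exponent_coarser_scale[OF infnorm_pos_le]
    by (simp add: mult.assoc borel_measurable_square_integrable_lborel)
  have "energy lborel (\<lambda>y. dyadic_average k h (y + u) - dyadic_average k h y)
    \<le> ennreal (2 * ?c / (1 - ?q)) * (\<Sum>i. ennreal (?q ^ i) * energy lborel (dyadic_difference (k + int i) h))"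
  proof (rule energy_geometric_series_le[where c'="?c * ?H", OF q])
    fix N
    show "dyadic_average k h (y + u) - dyadic_average k h y
      = (\<Sum>i<N. dyadic_difference (k + int i) h (y + u) - dyadic_difference (k + int i) h y)
        + (dyadic_average (k + int N) h (y + u) - dyadic_average (k + int N) h y)" for y
      using dyadic_average_telescope[of k h "y + u" N] dyadic_average_telescope[of k h y N]
      by (simp add: sum_subtractf)
    show "energy lborel (\<lambda>y. dyadic_difference (k + int N) h (y + u) - dyadic_difference (k + int N) h y)
      \<le> ennreal (?c * (?q ^ N)\<^sup>2) * energy lborel (dyadic_difference (k + int N) h)"
      by (intro shift square_integrable_dyadic_difference dyadic_constant_dyadic_difference h)
    have "energy lborel (\<lambda>y. dyadic_average (k + int N) h (y + u) - dyadic_average (k + int N) h y)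
      \<le> ennreal (?c * (?q ^ N)\<^sup>2) * energy lborel (dyadic_average (k + int N) h)"
      by (intro shift square_integrable_dyadic_average dyadic_constant_dyadic_average h)
    also have "\<dots> \<le> ennreal (?c * (?q ^ N)\<^sup>2) * ennreal ?H"
      unfolding energy_eq_integral[OF h, symmetric] by (intro mult_left_mono energy_dyadic_average_le) auto
    also have "\<dots> = ennreal (?c * ?H * (?q ^ N)\<^sup>2)"
      by (subst ennreal_mult[symmetric]) (auto simp: mult_ac)
    finally show "energy lborel (\<lambda>y. dyadic_average (k + int N) h (y + u) - dyadic_average (k + int N) h y) \<le> \<dots>" .
  qed (auto, measurable)
  then show ?thesis by (simp add: shift_const_def mult.assoc)
qed

lemma dyadic_average_oscillation_le:
  fixes h :: "real^'n \<Rightarrow> real"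
  assumes h: "square_integrable lborel h" and a: "0 < a" and t: "0 < t" "t \<le> side_length k"
  shows "(\<integral>\<^sup>+y. \<integral>\<^sup>+z. ennreal (poisson a t (y - z))
    * ennreal ((dyadic_average k h z - dyadic_average k h y)\<^sup>2) \<partial>lborel \<partial>lborel)
     \<le> ennreal (oscillation_const CARD('n) a) *
       (\<Sum>i. ennreal (decay_rate a ^ i) * energy lborel (dyadic_difference (k + int i) h))"
    (is "?X \<le> _ * ?S")
proof -
  let ?d = "2 * decay_exponent a" and ?E = "dyadic_average k h"
  let ?sc = "shift_const CARD('n) a"
  note [measurable] = borel_measurable_square_integrable_lborel[OF h]
  have d: "0 < ?d" "?d < a" using decay_exponent_bounds[of a] a by auto
  have translate: "(\<integral>\<^sup>+z. ennreal (poisson a t (y - z)) * ennreal ((?E z - ?E y)\<^sup>2) \<partial>lborel)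
    = (\<integral>\<^sup>+u. ennreal (poisson a t u) * ennreal ((?E (y + u) - ?E y)\<^sup>2) \<partial>lborel)" for y
    by (subst nn_integral_lborel_translate[of _ y, symmetric]) (simp_all add: poisson_minus)
  have weight: "ennreal (poisson a t u) * energy lborel (\<lambda>y. ?E (y + u) - ?E y)
    \<le> ennreal (poisson (a - ?d) t u) * (ennreal ?sc * ?S)" for u :: "real^'n"
  proof -
    let ?U = "(infnorm u / side_length k) powr ?d"
    have "ennreal (poisson a t u) * energy lborel (\<lambda>y. ?E (y + u) - ?E y)
      \<le> ennreal (poisson a t u) * (ennreal (?sc * ?U) * ?S)"
      by (intro mult_left_mono energy_shift_dyadic_average_le h a) simp
    also have "\<dots> = ennreal (poisson a t u * ?U) * (ennreal ?sc * ?S)"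
      using shift_const_nonneg[OF a] by (simp add: ennreal_mult mult_ac)
    also have "\<dots> \<le> ennreal (poisson (a - ?d) t u) * (ennreal ?sc * ?S)"
      by (intro mult_right_mono ennreal_leI poisson_times_powr_le t d) simp
    finally show ?thesis .
  qed
  have "?X = (\<integral>\<^sup>+u. \<integral>\<^sup>+y. ennreal (poisson a t u) * ennreal ((?E (y + u) - ?E y)\<^sup>2) \<partial>lborel \<partial>lborel)"
    unfolding translate by (rule lborel_pair.Fubini') measurable
  also have "\<dots> = (\<integral>\<^sup>+u. ennreal (poisson a t u) * energy lborel (\<lambda>y. ?E (y + u) - ?E y) \<partial>lborel)"
    by (intro nn_integral_cong nn_integral_cmult) measurable
  also have "\<dots> \<le> (\<integral>\<^sup>+u. ennreal (poisson (a - ?d) t (u::real^'n)) * (ennreal ?sc * ?S) \<partial>lborel)"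
    by (intro nn_integral_mono weight)
  also have "\<dots> = (\<integral>\<^sup>+u. ennreal (poisson (a - ?d) t (u::real^'n)) \<partial>lborel) * (ennreal ?sc * ?S)"
    by (rule nn_integral_multc) measurable
  also have "\<dots> \<le> ennreal (poisson_mass CARD('n) (a - ?d)) * (ennreal ?sc * ?S)"
    using d t by (intro mult_right_mono nn_integral_poisson_le) auto
  also have "\<dots> = ennreal (oscillation_const CARD('n) a) * ?S"
    unfolding oscillation_const_def
    using shift_const_nonneg[OF a, of "CARD('n)"] poisson_mass_pos[of "a - ?d" "CARD('n)"] d
    by (simp add: ennreal_mult less_imp_le mult_ac)
  finally show ?thesis .
qed

subsection \<open>Almost orthogonality for operator-valued kernels\<close>

lemma Schur_energy_le:
  fixes k :: "'a \<times> 'v \<times> 'w \<Rightarrow> real"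
  assumes L: "sigma_finite_measure L" and M: "sigma_finite_measure M" and N: "sigma_finite_measure N"
    and [measurable]: "k \<in> borel_measurable (L \<Otimes>\<^sub>M N \<Otimes>\<^sub>M M)" "g \<in> borel_measurable (L \<Otimes>\<^sub>M M)" "p \<in> borel_measurable L"
    and p: "\<And>z. 0 < p z" "(\<integral>\<^sup>+z. ennreal (p z) \<partial>L) \<le> ennreal c" and c: "0 \<le> c"
    and op: "\<And>z h. z \<in> space L \<Longrightarrow> h \<in> borel_measurable M \<Longrightarrow>
      energy N (\<lambda>v. \<integral>w. k (z, v, w) * h w \<partial>M) \<le> ennreal ((B * p z)\<^sup>2) * energy M h"
  shows "energy N (\<lambda>v. \<integral>q. k (fst q, v, snd q) * g q \<partial>(L \<Otimes>\<^sub>M M))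
    \<le> ennreal (c * B\<^sup>2) * (\<integral>\<^sup>+z. ennreal (p z) * energy M (\<lambda>w. g (z, w)) \<partial>L)"
proof -
  interpret L: sigma_finite_measure L by fact
  interpret M: sigma_finite_measure M by fact
  interpret N: sigma_finite_measure N by fact
  interpret LM: pair_sigma_finite L M ..
  interpret NL: pair_sigma_finite N L ..
  let ?S = "\<lambda>v z. \<integral>w. k (z, v, w) * g (z, w) \<partial>M"
  have pointwise: "ennreal ((\<integral>q. k (fst q, v, snd q) * g q \<partial>(L \<Otimes>\<^sub>M M))\<^sup>2)
    \<le> ennreal c * (\<integral>\<^sup>+z. ennreal (1 / p z) * ennreal ((?S v z)\<^sup>2) \<partial>L)" if [measurable]: "v \<in> space N" for v
  proof -
    have "(\<lambda>q. k (fst q, v, snd q) * g q) \<in> borel_measurable (L \<Otimes>\<^sub>M M)" by measurable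
    from LM.weighted_Cauchy_Schwarz_section[OF this _ p(1)] show ?thesis
      by (rule order_trans) (use p(2) in \<open>auto intro: mult_right_mono\<close>)
  qed
  have op_section: "ennreal (1 / p z) * energy N (\<lambda>v. ?S v z)
    \<le> ennreal (B\<^sup>2) * (ennreal (p z) * energy M (\<lambda>w. g (z, w)))"
    if z: "z \<in> space L" for z
  proof -
    have "ennreal (1 / p z) * energy N (\<lambda>v. ?S v z)
      \<le> ennreal (1 / p z) * (ennreal ((B * p z)\<^sup>2) * energy M (\<lambda>w. g (z, w)))"
      using z by (intro mult_left_mono op) auto
    also have "ennreal (1 / p z) * (ennreal ((B * p z)\<^sup>2) * energy M (\<lambda>w. g (z, w)))
      = ennreal (1 / p z * (B * p z)\<^sup>2) * energy M (\<lambda>w. g (z, w))"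
      using p(1)[of z] by (subst ennreal_mult) (auto simp: mult.assoc)
    also have "1 / p z * (B * p z)\<^sup>2 = B\<^sup>2 * p z" using p(1)[of z] by (simp add: power2_eq_square)
    finally show ?thesis using p(1)[of z] by (simp add: ennreal_mult mult.assoc)
  qed
  have "energy N (\<lambda>v. \<integral>q. k (fst q, v, snd q) * g q \<partial>(L \<Otimes>\<^sub>M M))
    \<le> (\<integral>\<^sup>+v. ennreal c * (\<integral>\<^sup>+z. ennreal (1 / p z) * ennreal ((?S v z)\<^sup>2) \<partial>L) \<partial>N)"
    by (intro nn_integral_mono pointwise)
  also have "\<dots> = ennreal c * (\<integral>\<^sup>+v. \<integral>\<^sup>+z. ennreal (1 / p z) * ennreal ((?S v z)\<^sup>2) \<partial>L \<partial>N)"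
    by (rule nn_integral_cmult) measurable
  also have "(\<integral>\<^sup>+v. \<integral>\<^sup>+z. ennreal (1 / p z) * ennreal ((?S v z)\<^sup>2) \<partial>L \<partial>N)
    = (\<integral>\<^sup>+z. \<integral>\<^sup>+v. ennreal (1 / p z) * ennreal ((?S v z)\<^sup>2) \<partial>N \<partial>L)"
    by (rule NL.Fubini'[symmetric]) measurable
  also have "\<dots> = (\<integral>\<^sup>+z. ennreal (1 / p z) * energy N (\<lambda>v. ?S v z) \<partial>L)"
    by (intro nn_integral_cong nn_integral_cmult) measurable
  also have "\<dots> \<le> (\<integral>\<^sup>+z. ennreal (B\<^sup>2) * (ennreal (p z) * energy M (\<lambda>w. g (z, w))) \<partial>L)"
    by (intro nn_integral_mono op_section)
  also have "\<dots> = ennreal (B\<^sup>2) * (\<integral>\<^sup>+z. ennreal (p z) * energy M (\<lambda>w. g (z, w)) \<partial>L)"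
    by (rule nn_integral_cmult) measurable
  finally show ?thesis using c by (simp add: ennreal_mult mult.assoc mult_left_mono)
qed

definition kernel_op ::
  "'w measure \<Rightarrow> ((real^'n) \<times> (real^'n) \<times> 'v \<times> 'w \<Rightarrow> real) \<Rightarrow> ((real^'n) \<times> (real^'n) \<times> 'w \<Rightarrow> real) \<Rightarrow> (real^'n) \<times> 'v \<Rightarrow>
    real" where
  "kernel_op M K g q = (\<integral>p. K (fst q, fst p, snd q, snd p) * g (fst q, p) \<partial>(lborel \<Otimes>\<^sub>M M))"

lemma borel_measurable_kernel_op:
  assumes M: "sigma_finite_measure M"
    and [measurable]: "K \<in> borel_measurable (lborel \<Otimes>\<^sub>M lborel \<Otimes>\<^sub>M N \<Otimes>\<^sub>M M)"
      "g \<in> borel_measurable (lborel \<Otimes>\<^sub>M lborel \<Otimes>\<^sub>M M)"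
  shows "kernel_op M K g \<in> borel_measurable (lborel \<Otimes>\<^sub>M N)"
proof -
  interpret M: sigma_finite_measure M by fact
  interpret pair_sigma_finite "lborel :: (real^'n) measure" M ..
  show ?thesis unfolding kernel_op_def by measurable
qed

lemma energy_kernel_op_le:
  fixes K :: "(real^'n) \<times> (real^'n) \<times> 'v \<times> 'w \<Rightarrow> real"
  assumes M: "sigma_finite_measure M" and N: "sigma_finite_measure N"
    and K[measurable]: "K \<in> borel_measurable (lborel \<Otimes>\<^sub>M lborel \<Otimes>\<^sub>M N \<Otimes>\<^sub>M M)"
    and g[measurable]: "g \<in> borel_measurable (lborel \<Otimes>\<^sub>M lborel \<Otimes>\<^sub>M M)"
    and a: "0 < a" and t: "0 < t"
    and op: "\<And>y z h. h \<in> borel_measurable M \<Longrightarrow>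
      energy N (\<lambda>v. \<integral>w. K (y, z, v, w) * h w \<partial>M) \<le> ennreal ((B * poisson a t (y - z))\<^sup>2) * energy M h"
  shows "energy (lborel \<Otimes>\<^sub>M N) (kernel_op M K g)
    \<le> ennreal (poisson_mass CARD('n) a * B\<^sup>2)
      * (\<integral>\<^sup>+y. \<integral>\<^sup>+z. ennreal (poisson a t (y - z)) * energy M (\<lambda>w. g (y, z, w)) \<partial>lborel \<partial>lborel)"
proof -
  interpret M: sigma_finite_measure M by fact
  interpret N: sigma_finite_measure N by fact
  interpret LN: pair_sigma_finite "lborel :: (real^'n) measure" N ..
  let ?c = "poisson_mass CARD('n) a"
  let ?R = "\<lambda>y. \<integral>\<^sup>+z. ennreal (poisson a t (y - z)) * energy M (\<lambda>w. g (y, z, w)) \<partial>lborel"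
  have fibre: "energy N (\<lambda>v. kernel_op M K g (y, v)) \<le> ennreal (?c * B\<^sup>2) * ?R y" for y
    unfolding kernel_op_def fst_conv snd_conv
    by (rule Schur_energy_le[OF sigma_finite_lborel M N, where k="\<lambda>q. K (y, q)" and g="\<lambda>q. g (y, q)"])
      (use poisson_pos[OF t] nn_integral_poisson_shift_le(2)[OF t a] poisson_mass_pos[OF a] op
        in \<open>auto simp: less_imp_le\<close>)
  have "energy (lborel \<Otimes>\<^sub>M N) (kernel_op M K g) = (\<integral>\<^sup>+y. energy N (\<lambda>v. kernel_op M K g (y, v)) \<partial>lborel)"
    by (rule LN.energy_fst[symmetric]) (intro borel_measurable_kernel_op M K g)
  also have "\<dots> \<le> (\<integral>\<^sup>+y. ennreal (?c * B\<^sup>2) * ?R y \<partial>lborel)"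
    by (intro nn_integral_mono fibre)
  also have "\<dots> = ennreal (?c * B\<^sup>2) * (\<integral>\<^sup>+y. ?R y \<partial>lborel)"
    by (rule nn_integral_cmult) measurable
  finally show ?thesis .
qed

lemma energy_kernel_op_bounded:
  fixes K :: "(real^'n) \<times> (real^'n) \<times> 'v \<times> 'w \<Rightarrow> real"
  assumes M: "sigma_finite_measure M" and N: "sigma_finite_measure N"
    and K: "K \<in> borel_measurable (lborel \<Otimes>\<^sub>M lborel \<Otimes>\<^sub>M N \<Otimes>\<^sub>M M)"
    and g[measurable]: "g \<in> borel_measurable (lborel \<Otimes>\<^sub>M M)"
    and a: "0 < a" and t: "0 < t"
    and op: "\<And>y z h. h \<in> borel_measurable M \<Longrightarrow>
      energy N (\<lambda>v. \<integral>w. K (y, z, v, w) * h w \<partial>M) \<le> ennreal ((B * poisson a t (y - z))\<^sup>2) * energy M h"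
  shows "energy (lborel \<Otimes>\<^sub>M N) (kernel_op M K (\<lambda>q. g (snd q)))
    \<le> ennreal ((poisson_mass CARD('n) a * B)\<^sup>2) * energy (lborel \<Otimes>\<^sub>M M) g"
proof -
  interpret M: sigma_finite_measure M by fact
  interpret LM: pair_sigma_finite "lborel :: (real^'n) measure" M ..
  let ?c = "poisson_mass CARD('n) a" and ?G = "\<lambda>z. energy M (\<lambda>w. g (z, w))"
  have c: "0 \<le> ?c" using poisson_mass_pos[OF a] less_imp_le by blast
  have "energy (lborel \<Otimes>\<^sub>M N) (kernel_op M K (\<lambda>q. g (snd q)))
    \<le> ennreal (?c * B\<^sup>2) * (\<integral>\<^sup>+y. \<integral>\<^sup>+z. ennreal (poisson a t (y - z)) * ?G z \<partial>lborel \<partial>lborel)"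
    using energy_kernel_op_le[OF M N K _ a t op, of "\<lambda>q. g (snd q)"] by simp
  also have "(\<integral>\<^sup>+y. \<integral>\<^sup>+z. ennreal (poisson a t (y - z)) * ?G z \<partial>lborel \<partial>lborel)
    = (\<integral>\<^sup>+z. (\<integral>\<^sup>+y. ennreal (poisson a t (y - z)) \<partial>lborel) * ?G z \<partial>lborel)"
    by (subst lborel_pair.Fubini') (simp_all add: nn_integral_multc, measurable)
  also have "\<dots> \<le> (\<integral>\<^sup>+z. ennreal ?c * ?G z \<partial>lborel)"
    by (intro nn_integral_mono mult_right_mono nn_integral_poisson_shift_le t a) auto
  also have "\<dots> = ennreal ?c * energy (lborel \<Otimes>\<^sub>M M) g"
    by (simp add: nn_integral_cmult LM.energy_fst)
  also have "ennreal (?c * B\<^sup>2) * (ennreal ?c * energy (lborel \<Otimes>\<^sub>M M) g) = ennreal ((?c * B)\<^sup>2) * energy (lborel \<Otimes>\<^sub>M M) g"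
  proof -
    have "(?c * B)\<^sup>2 = ?c * B\<^sup>2 * ?c" by (simp add: power2_eq_square mult_ac)
    then have "ennreal ((?c * B)\<^sup>2) = ennreal (?c * B\<^sup>2) * ennreal ?c" using c by (simp add: ennreal_mult)
    then show ?thesis by (simp add: mult.assoc)
  qed
  finally show ?thesis by (simp add: mult_left_mono)
qed

definition holder_const :: "nat \<Rightarrow> real \<Rightarrow> real" where
  "holder_const n a = 2 * 2 powr a * 3 powr (real n + a)"

definition orthogonality_const :: "nat \<Rightarrow> real \<Rightarrow> real" where
  "orthogonality_const n a = 2 * poisson_mass n a * oscillation_const n a
    + 4 * (poisson_mass n a * holder_const n a * 2 powr a)\<^sup>2 / (1 - decay_rate a)"

lemma holder_const_ge_1: "0 < a \<Longrightarrow> 1 \<le> holder_const n a"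
proof -
  assume a: "0 < a"
  have "1 \<le> 2 powr a" "1 \<le> 3 powr (real n + a)" using a by (auto intro!: ge_one_powr_ge_zero)
  then have "1 * 1 \<le> 2 powr a * 3 powr (real n + a)" by (intro mult_mono) auto
  then show ?thesis unfolding holder_const_def by simp
qed

lemma orthogonality_const_nonneg: "0 < a \<Longrightarrow> 0 \<le> orthogonality_const n a"
  unfolding orthogonality_const_def
  using poisson_mass_pos[of a n] oscillation_const_nonneg[of a n] decay_rate_bounds(2)[of a]
  by (intro add_nonneg_nonneg mult_nonneg_nonneg divide_nonneg_nonneg) auto

lemma le_ennreal_mult_of_finite:
  assumes "0 < c" "X < \<infinity> \<Longrightarrow> L \<le> ennreal c * X" shows "L \<le> ennreal c * X"
  using assms by (cases "X < \<infinity>") (auto simp: not_less top_unique ennreal_mult_eq_top_iff)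

text \<open>
  \<open>K (y, z, v, w)\<close> is the kernel of an operator \<open>L\<^sup>2(M) \<rightarrow> L\<^sup>2(N)\<close> attached to the pair \<open>(y, z)\<close>. The bound
  \<open>dom\<close> only serves to make the integrals converge; all estimates come from \<open>op_size\<close> and \<open>op_holder\<close>.
\<close>

locale operator_kernel =
  fixes M :: "'w measure" and N :: "'v measure"
    and K :: "(real^'n) \<times> (real^'n) \<times> 'v \<times> 'w \<Rightarrow> real"
    and b :: "'v \<Rightarrow> 'w \<Rightarrow> real" and A a t :: real and k :: int
  assumes sigma_finite_M: "sigma_finite_measure M" and sigma_finite_N: "sigma_finite_measure N"
    and K_measurable[measurable]: "K \<in> borel_measurable (lborel \<Otimes>\<^sub>M lborel \<Otimes>\<^sub>M N \<Otimes>\<^sub>M M)"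
    and A_pos: "0 < A" and a_pos: "0 < a"
    and t_lower: "side_length k / 2 < t" and t_upper: "t \<le> side_length k"
    and dom: "\<And>y z v w. \<bar>K (y, z, v, w)\<bar> \<le> poisson a t (y - z) * b v w"
    and square_integrable_b: "\<And>v. square_integrable M (b v)"
    and op_size: "\<And>y z h. square_integrable M h \<Longrightarrow>
        energy N (\<lambda>v. \<integral>w. K (y, z, v, w) * h w \<partial>M) \<le> ennreal ((A * poisson a t (y - z))\<^sup>2) * energy M h"
    and op_holder: "\<And>y z z' h. square_integrable M h \<Longrightarrow> infnorm (z - z') < t / 2 \<Longrightarrow> z \<noteq> z' \<Longrightarrow>
        energy N (\<lambda>v. \<integral>w. (K (y, z, v, w) - K (y, z', v, w)) * h w \<partial>M)
        \<le> ennreal ((A * holder_poisson a t (z - z') (y - z))\<^sup>2) * energy M h"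
begin

sublocale M: sigma_finite_measure M by (rule sigma_finite_M)
sublocale N: sigma_finite_measure N by (rule sigma_finite_N)
sublocale LM: pair_sigma_finite "lborel :: (real^'n) measure" M ..

lemma t_pos: "0 < t"
  using t_lower powr_gt_zero[of 2 "real_of_int k"] by linarith

lemma b_nonneg: "0 \<le> b v w"
proof -
  have "0 \<le> poisson a t (0 - 0 :: real^'n) * b v w" using dom[of 0 0 v w] abs_ge_zero order_trans by blast
  then show ?thesis using poisson_pos[OF t_pos, of a "0 - 0 :: real^'n"] by (simp add: zero_le_mult_iff)
qed

lemma op_size_measurable:
  assumes "h \<in> borel_measurable M"
  shows "energy N (\<lambda>v. \<integral>w. K (y, z, v, w) * h w \<partial>M) \<le> ennreal ((A * poisson a t (y - z))\<^sup>2) * energy M h"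
proof (rule le_ennreal_mult_of_finite)
  show "0 < (A * poisson a t (y - z))\<^sup>2" using A_pos poisson_pos[OF t_pos, of a "y - z"] by simp
  assume "energy M h < \<infinity>"
  with assms show "energy N (\<lambda>v. \<integral>w. K (y, z, v, w) * h w \<partial>M) \<le> ennreal ((A * poisson a t (y - z))\<^sup>2) * energy M h"
    by (intro op_size) (simp add: square_integrable_def)
qed

lemma square_integrable_section:
  assumes [measurable]: "v \<in> space N"
  shows "square_integrable M (\<lambda>w. K (y, z, v, w))"
proof (rule square_integrable_bound[OF _ square_integrable_cmult[OF square_integrable_b]])
  show "\<bar>K (y, z, v, w)\<bar> \<le> \<bar>poisson a t (y - z) * b v w\<bar>" for w
    using dom[of y z v w] b_nonneg[of v w] by (simp add: abs_mult)
qed measurable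

lemma square_integrable_dominated:
  fixes f :: "(real^'n) \<times> 'w \<Rightarrow> real"
  assumes "f \<in> borel_measurable (lborel \<Otimes>\<^sub>M M)" "0 \<le> c"
    and f: "\<And>z w. \<bar>f (z, w)\<bar> \<le> c * (poisson a t (y - z) * b v w)"
  shows "square_integrable (lborel \<Otimes>\<^sub>M M) f"
proof (rule square_integrable_bound[OF assms(1)])
  show "square_integrable (lborel \<Otimes>\<^sub>M M) (\<lambda>p. c * (poisson a t (y - fst p) * b v (snd p)))"
    by (intro square_integrable_cmult LM.square_integrable_tensor[of "\<lambda>z. poisson a t (y - z)"]
        square_integrable_poisson square_integrable_b t_pos a_pos)
  show "\<bar>f p\<bar> \<le> \<bar>c * (poisson a t (y - fst p) * b v (snd p))\<bar>" for p
    using f[of "fst p" "snd p"] by simp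
qed

lemma integrable_kernel_mult:
  assumes g: "square_integrable (lborel \<Otimes>\<^sub>M M) g" and [measurable]: "v \<in> space N"
  shows "integrable (lborel \<Otimes>\<^sub>M M) (\<lambda>p. K (y, fst p, v, snd p) * g p)"
  using dom[of y _ v] by (intro square_integrable_mult[OF square_integrable_dominated[where c=1 and y=y and v=v] g])
    auto

lemma integrable_kernel_mult_snd:
  assumes h: "square_integrable M h" and v[measurable]: "v \<in> space N"
  shows "integrable (lborel \<Otimes>\<^sub>M M) (\<lambda>p. K (y, fst p, v, snd p) * h (snd p))"
proof (rule Bochner_Integration.integrable_bound)
  note [measurable] = borel_measurable_square_integrable[OF h]
  show "(\<lambda>p. K (y, fst p, v, snd p) * h (snd p)) \<in> borel_measurable (lborel \<Otimes>\<^sub>M M)" by measurable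
  show "integrable (lborel \<Otimes>\<^sub>M M) (\<lambda>p. poisson a t (y - fst p) * (b v (snd p) * h (snd p)))"
    by (intro LM.integrable_tensor[of "\<lambda>z. poisson a t (y - z)" "\<lambda>w. b v w * h w"]
        integrable_poisson square_integrable_mult[OF square_integrable_b h] t_pos a_pos)
  show "AE p in lborel \<Otimes>\<^sub>M M. norm (K (y, fst p, v, snd p) * h (snd p))
    \<le> norm (poisson a t (y - fst p) * (b v (snd p) * h (snd p)))"
    using dom[of y _ v] b_nonneg
    by (intro AE_I2) (auto simp: abs_mult mult.assoc[symmetric] intro!: mult_right_mono)
qed

lemma op_difference_near:
  assumes h: "square_integrable M h" and d: "infnorm (z - z') \<le> r" "r < t / 2" "0 < r"
  shows "energy N (\<lambda>v. \<integral>w. (K (y, z, v, w) - K (y, z', v, w)) * h w \<partial>M)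
    \<le> ennreal ((A * ((r / t) powr a * poisson a t (y - z)))\<^sup>2) * energy M h"
proof (cases "z = z'")
  case False
  have "energy N (\<lambda>v. \<integral>w. (K (y, z, v, w) - K (y, z', v, w)) * h w \<partial>M)
    \<le> ennreal ((A * holder_poisson a t (z - z') (y - z))\<^sup>2) * energy M h"
    using d False by (intro op_holder h) auto
  also have "\<dots> \<le> ennreal ((A * ((r / t) powr a * poisson a t (y - z)))\<^sup>2) * energy M h"
    using d t_pos a_pos A_pos
    by (intro mult_right_mono ennreal_leI power_mono mult_left_mono powr_mono2 divide_right_mono)
      (auto simp: infnorm_pos_le)
  finally show ?thesis .
qed simp

lemma op_difference_far:
  assumes h: "square_integrable M h" and d: "infnorm (z - z') < 2 * t"
  shows "energy N (\<lambda>v. \<integral>w. (K (y, z, v, w) - K (y, z', v, w)) * h w \<partial>M)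
    \<le> ennreal ((2 * A * 3 powr (real CARD('n) + a) * poisson a t (y - z))\<^sup>2) * energy M h"
proof -
  note [measurable] = borel_measurable_square_integrable[OF h]
  let ?k = "poisson a t (y - z)" and ?k' = "poisson a t (y - z')" and ?s = "3 powr (real CARD('n) + a)"
  let ?T = "\<lambda>z v. \<integral>w. K (y, z, v, w) * h w \<partial>M"
  have "energy N (\<lambda>v. \<integral>w. (K (y, z, v, w) - K (y, z', v, w)) * h w \<partial>M) = energy N (\<lambda>v. ?T z v - ?T z' v)"
  proof (intro nn_integral_cong)
    fix v assume "v \<in> space N"
    note integrable_Kh = square_integrable_mult[OF square_integrable_section[OF this] h]
    show "ennreal ((\<integral>w. (K (y, z, v, w) - K (y, z', v, w)) * h w \<partial>M)\<^sup>2) = ennreal ((?T z v - ?T z' v)\<^sup>2)"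
      by (simp add: left_diff_distrib Bochner_Integration.integral_diff[OF integrable_Kh integrable_Kh])
  qed
  also have "\<dots> \<le> 2 * energy N (?T z) + 2 * energy N (?T z')"
    by (rule energy_diff_le) measurable
  also have "\<dots> \<le> 2 * (ennreal ((A * ?k)\<^sup>2) * energy M h) + 2 * (ennreal ((A * ?k')\<^sup>2) * energy M h)"
    by (intro add_mono mult_left_mono op_size h) auto
  also have "\<dots> = ennreal (2 * (A * ?k)\<^sup>2 + 2 * (A * ?k')\<^sup>2) * energy M h"
    by (simp add: ennreal_mult distrib_right mult.assoc)
  also have "\<dots> \<le> ennreal ((2 * A * ?s * ?k)\<^sup>2) * energy M h"
  proof (intro mult_right_mono ennreal_leI)
    have "1 \<le> ?s" using a_pos by (intro ge_one_powr_ge_zero) auto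
    then have "(A * ?k)\<^sup>2 \<le> (A * (?s * ?k))\<^sup>2"
      using A_pos mult_right_mono[of 1 ?s ?k] by (intro power_mono mult_left_mono) auto
    moreover have "(A * ?k')\<^sup>2 \<le> (A * (?s * ?k))\<^sup>2"
      using A_pos by (intro power_mono mult_left_mono poisson_le_nearby t_pos a_pos d) auto
    ultimately have "2 * (A * ?k)\<^sup>2 + 2 * (A * ?k')\<^sup>2 \<le> 4 * (A * (?s * ?k))\<^sup>2" by linarith
    then show "2 * (A * ?k)\<^sup>2 + 2 * (A * ?k')\<^sup>2 \<le> (2 * A * ?s * ?k)\<^sup>2" by (simp add: power2_eq_square)
  qed auto
  finally show ?thesis .
qed

lemma op_difference:
  assumes h: "h \<in> borel_measurable M" and d: "infnorm (z - z') \<le> r" "r < 2 * t" "0 < r"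
  shows "energy N (\<lambda>v. \<integral>w. (K (y, z, v, w) - K (y, z', v, w)) * h w \<partial>M)
    \<le> ennreal ((A * holder_const CARD('n) a * (r / t) powr a * poisson a t (y - z))\<^sup>2) * energy M h"
    (is "?L \<le> ennreal (?c\<^sup>2) * ?H")
proof (rule le_ennreal_mult_of_finite)
  let ?s = "3 powr (real CARD('n) + a)" and ?k = "poisson a t (y - z)"
  have k: "0 < ?k" using t_pos by (rule poisson_pos)
  have holder: "1 \<le> holder_const CARD('n) a" using a_pos by (rule holder_const_ge_1)
  have "0 < ?c" using A_pos k holder t_pos d by (intro mult_pos_pos) auto
  then show "0 < ?c\<^sup>2" by (rule zero_less_power)
  assume "?H < \<infinity>"
  with h have h: "square_integrable M h" by (simp add: square_integrable_def)
  show "?L \<le> ennreal (?c\<^sup>2) * ?H"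
  proof (cases "r < t / 2")
    case True
    have "A * ((r / t) powr a * ?k) \<le> ?c"
      using A_pos k holder mult_right_mono[of 1 "holder_const CARD('n) a" "A * ((r / t) powr a * ?k)"]
      by (simp add: mult_ac)
    then have "ennreal ((A * ((r / t) powr a * ?k))\<^sup>2) * ?H \<le> ennreal (?c\<^sup>2) * ?H"
      using A_pos k by (intro mult_right_mono ennreal_leI power_mono) auto
    then show ?thesis by (rule order_trans[OF op_difference_near[OF h d(1) True d(3)]])
  next
    case False
    have "(1 / 2) powr a \<le> (r / t) powr a" using False t_pos a_pos by (intro powr_mono2) (auto simp: field_simps)
    then have "1 \<le> 2 powr a * (r / t) powr a" by (simp add: powr_divide field_simps)
    then have "2 * A * ?s * ?k * 1 \<le> 2 * A * ?s * ?k * (2 powr a * (r / t) powr a)"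
      using A_pos k by (intro mult_left_mono) auto
    then have "2 * A * ?s * ?k \<le> ?c" by (simp add: holder_const_def mult_ac)
    then have "ennreal ((2 * A * ?s * ?k)\<^sup>2) * ?H \<le> ennreal (?c\<^sup>2) * ?H"
      using A_pos k by (intro mult_right_mono ennreal_leI power_mono) auto
    then show ?thesis using d by (intro order_trans[OF op_difference_far[OF h]]) auto
  qed
qed

end

definition section_average :: "int \<Rightarrow> ((real^'n) \<times> 'w \<Rightarrow> real) \<Rightarrow> (real^'n) \<times> 'w \<Rightarrow> real" where
  "section_average k F p = dyadic_average k (\<lambda>z. F (z, snd p)) (fst p)"

definition section_difference :: "int \<Rightarrow> ((real^'n) \<times> 'w \<Rightarrow> real) \<Rightarrow> (real^'n) \<times> 'w \<Rightarrow> real" where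
  "section_difference k F p = dyadic_difference k (\<lambda>z. F (z, snd p)) (fst p)"

definition frozen_average :: "int \<Rightarrow> ((real^'n) \<times> 'w \<Rightarrow> real) \<Rightarrow> (real^'n) \<times> (real^'n) \<times> 'w \<Rightarrow> real" where
  "frozen_average k F q = dyadic_average k (\<lambda>z. F (z, snd (snd q))) (fst q)"

context
  fixes M :: "'w measure" and F :: "(real^'n) \<times> 'w \<Rightarrow> real"
  assumes M: "sigma_finite_measure M" and F: "square_integrable (lborel \<Otimes>\<^sub>M M) F"
begin

interpretation M: sigma_finite_measure M by (rule M)
interpretation LM: pair_sigma_finite "lborel :: (real^'n) measure" M ..

lemma borel_measurable_section_average: "section_average k F \<in> borel_measurable (lborel \<Otimes>\<^sub>M M)"
  using borel_measurable_square_integrable[OF F] unfolding section_average_def by measurable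

lemma borel_measurable_section_difference: "section_difference k F \<in> borel_measurable (lborel \<Otimes>\<^sub>M M)"
  using borel_measurable_square_integrable[OF F] unfolding section_difference_def by measurable

lemma borel_measurable_frozen_average: "frozen_average k F \<in> borel_measurable (lborel \<Otimes>\<^sub>M lborel \<Otimes>\<^sub>M M)"
  using borel_measurable_square_integrable[OF F] unfolding frozen_average_def by measurable

lemma energy_section_average_le: "energy (lborel \<Otimes>\<^sub>M M) (section_average k F) \<le> energy (lborel \<Otimes>\<^sub>M M) F"
proof -
  note [measurable] = borel_measurable_square_integrable[OF F]
  have "energy (lborel \<Otimes>\<^sub>M M) (section_average k F) = (\<integral>\<^sup>+w. energy lborel (dyadic_average k (\<lambda>z. F (z, w))) \<partial>M)"
    using LM.energy_snd[OF borel_measurable_section_average] by (simp add: section_average_def)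
  also have "\<dots> \<le> (\<integral>\<^sup>+w. energy lborel (\<lambda>z. F (z, w)) \<partial>M)"
    by (intro nn_integral_mono energy_dyadic_average_le) simp
  finally show ?thesis by (simp add: LM.energy_snd)
qed

lemma square_integrable_section_average: "square_integrable (lborel \<Otimes>\<^sub>M M) (section_average k F)"
  using energy_section_average_le[of k] F borel_measurable_section_average
  by (auto simp: square_integrable_def intro: le_less_trans)

lemma square_integrable_section_difference: "square_integrable (lborel \<Otimes>\<^sub>M M) (section_difference k F)"
proof -
  have "section_difference k F = (\<lambda>p. section_average k F p - section_average (k + 1) F p)"
    by (simp add: fun_eq_iff section_difference_def section_average_def dyadic_difference_def)
  then show ?thesis by (simp add: square_integrable_diff square_integrable_section_average)
qed

lemma square_integrable_minus_section_average:
  "square_integrable (lborel \<Otimes>\<^sub>M M) (\<lambda>p. F p - section_average k F p)"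
  by (intro square_integrable_diff F square_integrable_section_average)

lemma energy_minus_section_average_le:
  "energy (lborel \<Otimes>\<^sub>M M) (\<lambda>p. F p - section_average k F p) \<le> 4 * energy (lborel \<Otimes>\<^sub>M M) F"
proof -
  have "energy (lborel \<Otimes>\<^sub>M M) (\<lambda>p. F p - section_average k F p)
    \<le> 2 * energy (lborel \<Otimes>\<^sub>M M) F + 2 * energy (lborel \<Otimes>\<^sub>M M) (section_average k F)"
    by (intro energy_diff_le borel_measurable_square_integrable[OF F] borel_measurable_section_average)
  also have "\<dots> \<le> 2 * energy (lborel \<Otimes>\<^sub>M M) F + 2 * energy (lborel \<Otimes>\<^sub>M M) F"
    by (intro add_left_mono mult_left_mono energy_section_average_le) simp
  finally show ?thesis by (simp flip: distrib_right)
qed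

lemma square_integrable_frozen_average: "square_integrable M (\<lambda>w. frozen_average k F (y, z, w))"
proof -
  note [measurable] = borel_measurable_square_integrable[OF F]
  let ?c = "ennreal ((1 / side_length k) ^ CARD('n))"
  have "energy M (\<lambda>w. frozen_average k F (y, z, w)) \<le> (\<integral>\<^sup>+w. ?c * energy lborel (\<lambda>z. F (z, w)) \<partial>M)"
    unfolding frozen_average_def fst_conv snd_conv
    by (intro nn_integral_mono dyadic_average_square_le_energy) simp
  also have "\<dots> = ?c * energy (lborel \<Otimes>\<^sub>M M) F"
    by (simp add: nn_integral_cmult LM.energy_snd)
  also have "\<dots> < \<infinity>" using energy_finite[OF F] by (simp add: ennreal_mult_less_top)
  finally show ?thesis unfolding square_integrable_def frozen_average_def by simp
qed

lemma AE_cancellation_minus_section_average: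
  "AE w in M. dyadic_cancellation k (\<lambda>z. F (z, w) - section_average k F (z, w))"
  using LM.AE_square_integrable_section[OF F]
  by eventually_elim (simp add: section_average_def dyadic_cancellation_minus_average)

lemma AE_cancellation_section_difference:
  "AE w in M. dyadic_cancellation (k + 1) (\<lambda>z. section_difference k F (z, w))"
  using LM.AE_square_integrable_section[OF F]
  by eventually_elim (simp add: section_difference_def dyadic_cancellation_dyadic_difference)

lemma nn_integral_energy_section_difference_le:
  "(\<integral>\<^sup>+j. energy (lborel \<Otimes>\<^sub>M M) (section_difference j F) \<partial>count_space UNIV) \<le> energy (lborel \<Otimes>\<^sub>M M) F"
proof (rule nn_integral_int_le)
  fix N and k :: int
  note [measurable] = borel_measurable_square_integrable[OF F]
  let ?e = "\<lambda>i w. energy lborel (dyadic_difference (k + int i) (\<lambda>z. F (z, w)))"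
  have "(\<Sum>i<N. energy (lborel \<Otimes>\<^sub>M M) (section_difference (k + int i) F)) = (\<Sum>i<N. \<integral>\<^sup>+w. ?e i w \<partial>M)"
    using LM.energy_snd[OF borel_measurable_section_difference] by (simp add: section_difference_def)
  also have "\<dots> = (\<integral>\<^sup>+w. (\<Sum>i<N. ?e i w) \<partial>M)"
    by (rule nn_integral_sum[symmetric]) measurable
  also have "\<dots> \<le> (\<integral>\<^sup>+w. energy lborel (\<lambda>z. F (z, w)) \<partial>M)"
    using LM.AE_square_integrable_section[OF F]
    by (intro nn_integral_mono_AE, eventually_elim) (rule sum_energy_dyadic_difference_le)
  finally show "(\<Sum>i<N. energy (lborel \<Otimes>\<^sub>M M) (section_difference (k + int i) F)) \<le> energy (lborel \<Otimes>\<^sub>M M) F"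
    by (simp add: LM.energy_snd)
qed

end

context operator_kernel
begin

lemma dyadic_scale_le: "j \<le> k \<Longrightarrow> side_length j < 2 * t"
proof -
  assume "j \<le> k"
  then have "side_length j \<le> side_length k" by simp
  then show ?thesis using t_lower by linarith
qed

lemma kernel_corner_bound:
  assumes "j \<le> k"
  shows "\<bar>K (y, dyadic_corner j z, v, w)\<bar> \<le> 3 powr (real CARD('n) + a) * (poisson a t (y - z) * b v w)"
proof -
  have "infnorm (z - dyadic_corner j z) < 2 * t"
    using infnorm_diff_less_dyadic[of j z "dyadic_corner j z"] dyadic_scale_le[OF assms] by simp
  then have "poisson a t (y - dyadic_corner j z) * b v w \<le> 3 powr (real CARD('n) + a) * poisson a t (y - z) * b v w"
    by (intro mult_right_mono poisson_le_nearby b_nonneg t_pos a_pos)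
  then show ?thesis using dom[of y "dyadic_corner j z" v w] by (simp add: mult.assoc)
qed

lemma square_integrable_kernel_corner:
  assumes "j \<le> k" and [measurable]: "v \<in> space N" "w \<in> space M"
  shows "square_integrable lborel (\<lambda>z. K (y, dyadic_corner j z, v, w))"
proof (rule square_integrable_bound[OF _ square_integrable_cmult[OF square_integrable_poisson[OF t_pos a_pos]]])
  show "\<bar>K (y, dyadic_corner j z, v, w)\<bar> \<le> \<bar>3 powr (real CARD('n) + a) * b v w * poisson a t (y - z)\<bar>" for z
    using kernel_corner_bound[OF assms(1), of y z v w] b_nonneg[of v w] by (simp add: abs_mult mult_ac)
qed measurable

lemma integrable_kernel_corner_mult:
  assumes j: "j \<le> k" and g: "square_integrable (lborel \<Otimes>\<^sub>M M) g" and [measurable]: "v \<in> space N"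
  shows "integrable (lborel \<Otimes>\<^sub>M M) (\<lambda>p. K (y, dyadic_corner j (fst p), v, snd p) * g p)"
proof (rule square_integrable_mult[OF square_integrable_dominated g])
  show "\<bar>K (y, dyadic_corner j (fst (z, w)), v, snd (z, w))\<bar>
    \<le> 3 powr (real CARD('n) + a) * (poisson a t (y - z) * b v w)" for z w
    using kernel_corner_bound[OF j, of y z v w] by simp
qed (simp_all, measurable)

lemma integral_kernel_corner_cancellation:
  assumes j: "j \<le> k" and g: "square_integrable (lborel \<Otimes>\<^sub>M M) g" and v: "v \<in> space N"
    and cancel: "AE w in M. dyadic_cancellation j (\<lambda>z. g (z, w))"
  shows "(\<integral>p. K (y, dyadic_corner j (fst p), v, snd p) * g p \<partial>(lborel \<Otimes>\<^sub>M M)) = 0"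
proof -
  note [measurable] = borel_measurable_square_integrable[OF g] v
  have "(\<integral>p. K (y, dyadic_corner j (fst p), v, snd p) * g p \<partial>(lborel \<Otimes>\<^sub>M M))
    = (\<integral>p. (\<lambda>(z, w). K (y, dyadic_corner j z, v, w) * g (z, w)) p \<partial>(lborel \<Otimes>\<^sub>M M))"
    by (simp add: split_beta')
  also have "\<dots> = (\<integral>w. (\<integral>z. K (y, dyadic_corner j z, v, w) * g (z, w) \<partial>lborel) \<partial>M)"
    using integrable_kernel_corner_mult[OF j g v] by (intro LM.integral_snd[symmetric]) (simp add: split_beta')
  also have "\<dots> = (\<integral>w. 0 \<partial>M)"
  proof (rule integral_cong_AE)
    show "AE w in M. (\<integral>z. K (y, dyadic_corner j z, v, w) * g (z, w) \<partial>lborel) = 0"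
      using cancel AE_space
    proof eventually_elim
      case (elim w)
      have "dyadic_constant j (\<lambda>z. K (y, dyadic_corner j z, v, w))" by (auto simp: dyadic_constant_def)
      then show ?case
        using elim square_integrable_kernel_corner[OF j v] by (simp add: dyadic_cancellation_def)
    qed
  qed measurable
  finally show ?thesis by simp
qed

lemma energy_kernel_op_cancellation_le:
  assumes j: "j \<le> k" and g: "square_integrable (lborel \<Otimes>\<^sub>M M) g"
    and cancel: "AE w in M. dyadic_cancellation j (\<lambda>z. g (z, w))"
  shows "energy (lborel \<Otimes>\<^sub>M N) (kernel_op M K (\<lambda>q. g (snd q)))
     \<le> ennreal ((poisson_mass CARD('n) a * (A * holder_const CARD('n) a * (side_length j / t) powr a))\<^sup>2)
        * energy (lborel \<Otimes>\<^sub>M M) g"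
proof -
  define K' where "K' = (\<lambda>q. K q - K (fst q, dyadic_corner j (fst (snd q)), snd (snd q)))"
  have K'_measurable: "K' \<in> borel_measurable (lborel \<Otimes>\<^sub>M lborel \<Otimes>\<^sub>M N \<Otimes>\<^sub>M M)"
    unfolding K'_def by measurable
  have "kernel_op M K (\<lambda>q. g (snd q)) (y, v) = kernel_op M K' (\<lambda>q. g (snd q)) (y, v)" if v: "v \<in> space N" for y v
    using integrable_kernel_mult[OF g v] integrable_kernel_corner_mult[OF j g v]
      integral_kernel_corner_cancellation[OF j g v cancel]
    by (simp add: kernel_op_def K'_def left_diff_distrib)
  then have "energy (lborel \<Otimes>\<^sub>M N) (kernel_op M K (\<lambda>q. g (snd q)))
    = energy (lborel \<Otimes>\<^sub>M N) (kernel_op M K' (\<lambda>q. g (snd q)))"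
    by (intro nn_integral_cong) (auto simp: space_pair_measure)
  also have "\<dots> \<le> ennreal ((poisson_mass CARD('n) a * (A * holder_const CARD('n) a * (side_length j / t) powr a))\<^sup>2)
      * energy (lborel \<Otimes>\<^sub>M M) g"
  proof (rule energy_kernel_op_bounded[OF sigma_finite_M sigma_finite_N K'_measurable _ a_pos t_pos])
    show "g \<in> borel_measurable (lborel \<Otimes>\<^sub>M M)" using g by (rule borel_measurable_square_integrable)
    fix y z :: "real^'n" and h :: "'w \<Rightarrow> real" assume h: "h \<in> borel_measurable M"
    have "infnorm (z - dyadic_corner j z) \<le> side_length j"
      by (intro less_imp_le infnorm_diff_less_dyadic) simp
    then show "energy N (\<lambda>v. \<integral>w. K' (y, z, v, w) * h w \<partial>M)
      \<le> ennreal ((A * holder_const CARD('n) a * (side_length j / t) powr a * poisson a t (y - z))\<^sup>2) * energy M h"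
      unfolding K'_def using op_difference[OF h _ dyadic_scale_le[OF j], of z "dyadic_corner j z" y] by simp
  qed
  finally show ?thesis .
qed

lemma side_length_ratio_powr_le:
  "((side_length (k - int i) / t) powr a)\<^sup>2 \<le> (2 powr a)\<^sup>2 * (decay_rate a ^ i)\<^sup>2"
proof -
  have "side_length (k - int i) = 2 * 2 powr (- real i) * (side_length k / 2)"
    by (simp add: powr_diff powr_minus field_simps)
  also have "\<dots> \<le> 2 * 2 powr (- real i) * t" using t_lower by (intro mult_left_mono) auto
  finally have "side_length (k - int i) / t \<le> 2 * 2 powr (- real i)" using t_pos by (simp add: field_simps)
  then have "(side_length (k - int i) / t) powr a \<le> (2 * 2 powr (- real i)) powr a"
    using a_pos t_pos by (intro powr_mono2) auto
  also have "\<dots> = 2 powr a * 2 powr (- (a * real i))" by (simp add: powr_mult powr_powr mult.commute)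
  also have "\<dots> \<le> 2 powr a * decay_rate a ^ i"
    unfolding decay_rate_power using decay_exponent_bounds(1,3)[OF a_pos]
    by (intro mult_left_mono powr_mono) (auto intro!: mult_right_mono)
  finally have "((side_length (k - int i) / t) powr a)\<^sup>2 \<le> (2 powr a * decay_rate a ^ i)\<^sup>2"
    by (intro power_mono) auto
  then show ?thesis by (simp add: power_mult_distrib)
qed

lemma energy_kernel_op_fine_cancellation_le:
  assumes g: "square_integrable (lborel \<Otimes>\<^sub>M M) g"
    and cancel: "AE w in M. dyadic_cancellation (k - int i) (\<lambda>z. g (z, w))"
  shows "energy (lborel \<Otimes>\<^sub>M N) (kernel_op M K (\<lambda>q. g (snd q)))
     \<le> ennreal ((poisson_mass CARD('n) a * holder_const CARD('n) a * 2 powr a)\<^sup>2 * A\<^sup>2 * (decay_rate a ^ i)\<^sup>2)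
        * energy (lborel \<Otimes>\<^sub>M M) g"
proof -
  let ?c = "poisson_mass CARD('n) a" and ?h = "holder_const CARD('n) a"
  have "(?c * (A * ?h * (side_length (k - int i) / t) powr a))\<^sup>2
    = (?c * ?h)\<^sup>2 * A\<^sup>2 * ((side_length (k - int i) / t) powr a)\<^sup>2" by (simp add: power_mult_distrib)
  also have "\<dots> \<le> (?c * ?h)\<^sup>2 * A\<^sup>2 * ((2 powr a)\<^sup>2 * (decay_rate a ^ i)\<^sup>2)"
    by (intro mult_left_mono side_length_ratio_powr_le) auto
  also have "\<dots> = (?c * ?h * 2 powr a)\<^sup>2 * A\<^sup>2 * (decay_rate a ^ i)\<^sup>2" by (simp add: power_mult_distrib)
  finally have "ennreal ((?c * (A * ?h * (side_length (k - int i) / t) powr a))\<^sup>2)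
    \<le> ennreal ((?c * ?h * 2 powr a)\<^sup>2 * A\<^sup>2 * (decay_rate a ^ i)\<^sup>2)" by (rule ennreal_leI)
  then show ?thesis
    using energy_kernel_op_cancellation_le[OF _ g cancel] by (auto intro: order_trans[OF _ mult_right_mono])
qed

lemma energy_kernel_op_oscillation_le:
  assumes F: "square_integrable (lborel \<Otimes>\<^sub>M M) F"
  shows "energy (lborel \<Otimes>\<^sub>M N) (kernel_op M K (\<lambda>q. section_average k F (snd q) - frozen_average k F q))
    \<le> ennreal (poisson_mass CARD('n) a * oscillation_const CARD('n) a * A\<^sup>2)
      * (\<Sum>i. ennreal (decay_rate a ^ i) * energy (lborel \<Otimes>\<^sub>M M) (section_difference (k + int i) F))"
    (is "?X \<le> _ * ?S")
proof -
  let ?c = "poisson_mass CARD('n) a" and ?osc = "oscillation_const CARD('n) a"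
  let ?G = "\<lambda>y z w. dyadic_average k (\<lambda>z. F (z, w)) z - dyadic_average k (\<lambda>z. F (z, w)) y"
  note [measurable] = borel_measurable_square_integrable[OF F]
  have c: "0 < ?c" "0 \<le> ?osc" using a_pos by (rule poisson_mass_pos, rule oscillation_const_nonneg)
  have difference_measurable: "section_difference j F \<in> borel_measurable (lborel \<Otimes>\<^sub>M M)" for j
    unfolding section_difference_def by measurable
  have "(\<lambda>q. section_average k F (snd q) - frozen_average k F q) \<in> borel_measurable (lborel \<Otimes>\<^sub>M lborel \<Otimes>\<^sub>M M)"
    unfolding section_average_def frozen_average_def by measurable
  from energy_kernel_op_le[OF sigma_finite_M sigma_finite_N K_measurable this a_pos t_pos op_size_measurable]
  have "?X \<le> ennreal (?c * A\<^sup>2) * (\<integral>\<^sup>+y. \<integral>\<^sup>+z. ennreal (poisson a t (y - z)) * energy M (?G y z) \<partial>lborel \<partial>lborel)"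
    by (simp add: section_average_def frozen_average_def)
  also have "(\<integral>\<^sup>+y. \<integral>\<^sup>+z. ennreal (poisson a t (y - z)) * energy M (?G y z) \<partial>lborel \<partial>lborel)
     = (\<integral>\<^sup>+y. \<integral>\<^sup>+z. \<integral>\<^sup>+w. ennreal (poisson a t (y - z)) * ennreal ((?G y z w)\<^sup>2) \<partial>M \<partial>lborel \<partial>lborel)"
    by (intro nn_integral_cong nn_integral_cmult[symmetric]) measurable
  also have "\<dots> = (\<integral>\<^sup>+y. \<integral>\<^sup>+w. \<integral>\<^sup>+z. ennreal (poisson a t (y - z)) * ennreal ((?G y z w)\<^sup>2) \<partial>lborel \<partial>M \<partial>lborel)"
    by (intro nn_integral_cong LM.Fubini'[symmetric]) measurable
  also have "\<dots> = (\<integral>\<^sup>+w. \<integral>\<^sup>+y. \<integral>\<^sup>+z. ennreal (poisson a t (y - z)) * ennreal ((?G y z w)\<^sup>2) \<partial>lborel \<partial>lborel \<partial>M)"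
    by (intro LM.Fubini'[symmetric]) measurable
  also have "\<dots> \<le> (\<integral>\<^sup>+w. ennreal ?osc *
      (\<Sum>i. ennreal (decay_rate a ^ i) * energy lborel (\<lambda>z. section_difference (k + int i) F (z, w))) \<partial>M)"
    using LM.AE_square_integrable_section[OF F]
    by (intro nn_integral_mono_AE, eventually_elim)
      (drule dyadic_average_oscillation_le[OF _ a_pos t_pos t_upper], simp add: section_difference_def)
  also have "\<dots> = ennreal ?osc * ?S"
    using difference_measurable by (simp add: nn_integral_cmult nn_integral_suminf LM.energy_snd)
  finally have "?X \<le> ennreal (?c * A\<^sup>2) * (ennreal ?osc * ?S)" by (simp add: mult_left_mono)
  then show ?thesis using c by (simp add: ennreal_mult mult_ac)
qed

lemma borel_measurable_kernel_op_snd: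
  assumes "square_integrable (lborel \<Otimes>\<^sub>M M) g"
  shows "kernel_op M K (\<lambda>q. g (snd q)) \<in> borel_measurable (lborel \<Otimes>\<^sub>M N)"
  by (intro borel_measurable_kernel_op sigma_finite_M K_measurable
      measurable_compose[OF measurable_snd borel_measurable_square_integrable[OF assms]])

lemma kernel_op_sum:
  assumes "\<And>i. i < L \<Longrightarrow> square_integrable (lborel \<Otimes>\<^sub>M M) (g i)" "square_integrable (lborel \<Otimes>\<^sub>M M) r" "v \<in> space N"
  shows "kernel_op M K (\<lambda>q. (\<Sum>i<L. g i (snd q)) + r (snd q)) (y, v)
    = (\<Sum>i<L. kernel_op M K (\<lambda>q. g i (snd q)) (y, v)) + kernel_op M K (\<lambda>q. r (snd q)) (y, v)"
proof -
  have "integrable (lborel \<Otimes>\<^sub>M M) (\<lambda>p. \<Sum>i<L. K (y, fst p, v, snd p) * g i p)"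
    by (intro Bochner_Integration.integrable_sum integrable_kernel_mult assms) simp
  then show ?thesis
    using integrable_kernel_mult[OF assms(1,3)] integrable_kernel_mult[OF assms(2,3)]
    by (simp add: kernel_op_def distrib_left sum_distrib_left Bochner_Integration.integral_sum)
qed

lemma energy_kernel_op_minus_average_le:
  assumes F: "square_integrable (lborel \<Otimes>\<^sub>M M) F"
  shows "energy (lborel \<Otimes>\<^sub>M N) (kernel_op M K (\<lambda>q. F (snd q) - section_average k F (snd q)))
    \<le> ennreal (2 * ((poisson_mass CARD('n) a * holder_const CARD('n) a * 2 powr a)\<^sup>2 * A\<^sup>2) / (1 - decay_rate a))
      * (\<Sum>i. ennreal (decay_rate a ^ i) * energy (lborel \<Otimes>\<^sub>M M) (section_difference (k - 1 - int i) F))"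
proof -
  let ?C = "(poisson_mass CARD('n) a * holder_const CARD('n) a * 2 powr a)\<^sup>2 * A\<^sup>2"
  let ?D = "\<lambda>i p. section_difference (k - 1 - int i) F p" and ?R = "\<lambda>L p. F p - section_average (k - int L) F p"
  define H where "H = (\<integral>p. (F p)\<^sup>2 \<partial>(lborel \<Otimes>\<^sub>M M))"
  have H: "energy (lborel \<Otimes>\<^sub>M M) F = ennreal H" unfolding H_def by (rule energy_eq_integral[OF F])
  note sq = square_integrable_section_difference[OF sigma_finite_M F]
    square_integrable_minus_section_average[OF sigma_finite_M F]
  show ?thesis
  proof (rule energy_geometric_series_le[where x="\<lambda>i. kernel_op M K (\<lambda>q. ?D i (snd q))"
        and b="\<lambda>L. kernel_op M K (\<lambda>q. ?R L (snd q))" and c'="?C * (4 * H)"])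
    fix L and q :: "(real^'n) \<times> 'v" assume "q \<in> space (lborel \<Otimes>\<^sub>M N)"
    then obtain y v where q: "q = (y, v)" "v \<in> space N" by (auto simp: space_pair_measure)
    have "F p - section_average k F p = (\<Sum>i<L. ?D i p) + ?R L p" for p
      using dyadic_average_telescope_down[of k L "\<lambda>z. F (z, snd p)" "fst p"]
      by (simp add: section_average_def section_difference_def)
    then show "kernel_op M K (\<lambda>q. F (snd q) - section_average k F (snd q)) q
      = (\<Sum>i<L. kernel_op M K (\<lambda>q. ?D i (snd q)) q) + kernel_op M K (\<lambda>q. ?R L (snd q)) q"
      unfolding q by (simp only: kernel_op_sum[OF sq q(2)])
  next
    fix i
    have "AE w in M. dyadic_cancellation (k - int i) (\<lambda>z. ?D i (z, w))"
      using AE_cancellation_section_difference[OF sigma_finite_M F, of "k - 1 - int i"] by simp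
    then show "energy (lborel \<Otimes>\<^sub>M N) (kernel_op M K (\<lambda>q. ?D i (snd q)))
      \<le> ennreal (?C * (decay_rate a ^ i)\<^sup>2) * energy (lborel \<Otimes>\<^sub>M M) (?D i)"
      by (intro energy_kernel_op_fine_cancellation_le sq)
  next
    fix L
    have R_energy: "energy (lborel \<Otimes>\<^sub>M M) (?R L) \<le> ennreal (4 * H)"
      using energy_minus_section_average_le[OF sigma_finite_M F] by (simp add: H H_def ennreal_mult)
    have "energy (lborel \<Otimes>\<^sub>M N) (kernel_op M K (\<lambda>q. ?R L (snd q)))
      \<le> ennreal (?C * (decay_rate a ^ L)\<^sup>2) * energy (lborel \<Otimes>\<^sub>M M) (?R L)"
      by (intro energy_kernel_op_fine_cancellation_le sq AE_cancellation_minus_section_average sigma_finite_M F)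
    also have "\<dots> \<le> ennreal (?C * (decay_rate a ^ L)\<^sup>2) * ennreal (4 * H)"
      by (intro mult_left_mono R_energy) simp
    also have "\<dots> = ennreal (?C * (4 * H) * (decay_rate a ^ L)\<^sup>2)"
      by (subst ennreal_mult[symmetric]) (auto simp: H_def mult_ac)
    finally show "energy (lborel \<Otimes>\<^sub>M N) (kernel_op M K (\<lambda>q. ?R L (snd q))) \<le> \<dots>" .
  qed (use decay_rate_bounds a_pos sq in \<open>auto simp: H_def intro: borel_measurable_kernel_op_snd\<close>)
qed

lemma kernel_op_minus_frozen_average:
  assumes F: "square_integrable (lborel \<Otimes>\<^sub>M M) F" and v: "v \<in> space N"
  shows "kernel_op M K (\<lambda>q. F (snd q) - frozen_average k F q) (y, v)
    = kernel_op M K (\<lambda>q. F (snd q) - section_average k F (snd q)) (y, v)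
      + kernel_op M K (\<lambda>q. section_average k F (snd q) - frozen_average k F q) (y, v)"
proof -
  have "integrable (lborel \<Otimes>\<^sub>M M) (\<lambda>p. K (y, fst p, v, snd p) * frozen_average k F (y, 0, snd p))"
    by (rule integrable_kernel_mult_snd[OF square_integrable_frozen_average[OF sigma_finite_M F] v])
  then have "integrable (lborel \<Otimes>\<^sub>M M) (\<lambda>p. K (y, fst p, v, snd p) * frozen_average k F (y, p))"
    by (simp add: frozen_average_def)
  then have "integrable (lborel \<Otimes>\<^sub>M M) (\<lambda>p. K (y, fst p, v, snd p)
    * (section_average k F p - frozen_average k F (y, p)))"
    using integrable_kernel_mult[OF square_integrable_section_average[OF sigma_finite_M F, of k] v, of y]
    by (simp add: right_diff_distrib)
  from Bochner_Integration.integral_add[OF integrable_kernel_mult[OF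
    square_integrable_minus_section_average[OF sigma_finite_M F, of k] v, of y] this]
  show ?thesis by (simp add: kernel_op_def distrib_left[symmetric])
qed

text \<open>The sum below the scale \<open>k\<close> uses cancellation of the martingale differences against the smooth kernel, the sum
  above it the smallness of the oscillation of dyadic averages at distance \<open>t\<close>.\<close>

theorem almost_orthogonality:
  assumes F: "square_integrable (lborel \<Otimes>\<^sub>M M) F"
  defines "d \<equiv> \<lambda>j. energy (lborel \<Otimes>\<^sub>M M) (section_difference j F)"
  shows "energy (lborel \<Otimes>\<^sub>M N) (kernel_op M K (\<lambda>q. F (snd q) - frozen_average k F q))
     \<le> ennreal (orthogonality_const CARD('n) a * A\<^sup>2)
       * (\<Sum>i. ennreal (decay_rate a ^ i) * (d (k + int i) + d (k - 1 - int i)))"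
proof -
  let ?c = "2 * (poisson_mass CARD('n) a * oscillation_const CARD('n) a * A\<^sup>2)"
  let ?C = "2 * (2 * ((poisson_mass CARD('n) a * holder_const CARD('n) a * 2 powr a)\<^sup>2 * A\<^sup>2) / (1 - decay_rate a))"
  let ?below = "\<Sum>i. ennreal (decay_rate a ^ i) * d (k - 1 - int i)"
    and ?above = "\<Sum>i. ennreal (decay_rate a ^ i) * d (k + int i)"
  let ?T = "kernel_op M K (\<lambda>q. F (snd q) - section_average k F (snd q))"
  let ?O = "kernel_op M K (\<lambda>q. section_average k F (snd q) - frozen_average k F q)"
  note [measurable] = borel_measurable_square_integrable[OF F]
    borel_measurable_section_average[OF sigma_finite_M F] borel_measurable_frozen_average[OF sigma_finite_M F]
  have c: "0 \<le> ?c" "0 \<le> ?C" "?c + ?C = orthogonality_const CARD('n) a * A\<^sup>2"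
    using poisson_mass_pos[OF a_pos, of "CARD('n)"] oscillation_const_nonneg[OF a_pos, of "CARD('n)"]
      decay_rate_bounds(2)[OF a_pos]
    by (simp_all add: orthogonality_const_def algebra_simps add_divide_distrib diff_divide_distrib)
  have double: "ennreal (2 * x) = 2 * ennreal x" for x by (simp add: ennreal_mult')
  have "energy (lborel \<Otimes>\<^sub>M N) (kernel_op M K (\<lambda>q. F (snd q) - frozen_average k F q))
    = energy (lborel \<Otimes>\<^sub>M N) (\<lambda>q. ?T q + ?O q)"
    by (intro nn_integral_cong) (auto simp: space_pair_measure kernel_op_minus_frozen_average[OF F])
  also have "\<dots> \<le> 2 * energy (lborel \<Otimes>\<^sub>M N) ?T + 2 * energy (lborel \<Otimes>\<^sub>M N) ?O"
    by (intro energy_add_le borel_measurable_kernel_op sigma_finite_M K_measurable) measurable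
  also have "\<dots> \<le> ennreal ?C * ?below + ennreal ?c * ?above"
    unfolding d_def double mult.assoc[of "2 :: ennreal"]
    by (intro add_mono mult_left_mono energy_kernel_op_minus_average_le energy_kernel_op_oscillation_le F) auto
  also have "\<dots> \<le> ennreal (?c + ?C) * ?below + ennreal (?c + ?C) * ?above"
    using c(1,2) by (intro add_mono mult_right_mono ennreal_leI) auto
  also have "\<dots> = ennreal (?c + ?C) * (\<Sum>i. ennreal (decay_rate a ^ i) * (d (k + int i) + d (k - 1 - int i)))"
    unfolding distrib_left[symmetric] by (subst suminf_add) (simp_all add: distrib_left add.commute)
  finally show ?thesis unfolding c(3) .
qed

end

definition square_orthogonality_const :: "nat \<Rightarrow> real \<Rightarrow> real" where
  "square_orthogonality_const n a = orthogonality_const n a * (2 / (1 - decay_rate a))"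

lemma square_orthogonality_const_nonneg: "0 < a \<Longrightarrow> 0 \<le> square_orthogonality_const n a"
  unfolding square_orthogonality_const_def using orthogonality_const_nonneg[of a n] decay_rate_bounds(2)[of a] by simp

theorem square_function_almost_orthogonality:
  fixes F :: "(real^'n) \<times> 'w \<Rightarrow> real" and K :: "real \<Rightarrow> (real^'n) \<times> (real^'n) \<times> 'v \<times> 'w \<Rightarrow> real"
  assumes op: "\<And>t. 0 < t \<Longrightarrow> operator_kernel M N (K t) (b t) A a t (scale_index t)"
    and F: "square_integrable (lborel \<Otimes>\<^sub>M M) F"
  shows "(\<integral>\<^sup>+t. energy (lborel \<Otimes>\<^sub>M N) (kernel_op M (K t) (\<lambda>q. F (snd q) - frozen_average (scale_index t) F q))
    \<partial>scale_measure)
     \<le> ennreal (square_orthogonality_const CARD('n) a * A\<^sup>2) * energy (lborel \<Otimes>\<^sub>M M) F"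
    (is "?X \<le> _ * ?H")
proof -
  interpret unit_scale: operator_kernel M N "K 1" "b 1" A a 1 "scale_index 1" by (rule op) simp
  let ?q = "decay_rate a" and ?c = "orthogonality_const CARD('n) a * A\<^sup>2"
  let ?d = "\<lambda>j. energy (lborel \<Otimes>\<^sub>M M) (section_difference j F)"
  have q: "0 < ?q" "?q < 1" using decay_rate_bounds unit_scale.a_pos by auto
  have Bessel: "(\<integral>\<^sup>+k. ?d (k + s) \<partial>count_space UNIV) \<le> ?H" for s
    unfolding nn_integral_int_shift[of ?d]
    by (rule nn_integral_energy_section_difference_le[OF unit_scale.sigma_finite_M F])
  have "?X \<le> (\<integral>\<^sup>+t. ennreal ?c * (\<Sum>i. ennreal (?q ^ i) * (?d (scale_index t + int i) + ?d (scale_index t - 1 - int i)))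
    \<partial>scale_measure)"
    by (intro nn_integral_scale_mono operator_kernel.almost_orthogonality[OF op F])
  also have "\<dots> \<le> (\<integral>\<^sup>+k. ennreal ?c * (\<Sum>i. ennreal (?q ^ i) * (?d (k + int i) + ?d (k - 1 - int i))) \<partial>count_space UNIV)"
    by (rule nn_integral_scale_index_le)
  also have "\<dots> = ennreal ?c * (\<Sum>i. ennreal (?q ^ i)
    * ((\<integral>\<^sup>+k. ?d (k + int i) \<partial>count_space UNIV) + (\<integral>\<^sup>+k. ?d (k - 1 - int i) \<partial>count_space UNIV)))"
    by (simp add: nn_integral_cmult nn_integral_suminf nn_integral_add)
  also have "\<dots> \<le> ennreal ?c * (\<Sum>i. ennreal (?q ^ i) * (2 * ?H))"
  proof (intro mult_left_mono suminf_le allI)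
    fix i
    have "(\<integral>\<^sup>+k. ?d (k + int i) \<partial>count_space UNIV) + (\<integral>\<^sup>+k. ?d (k - 1 - int i) \<partial>count_space UNIV) \<le> ?H + ?H"
      using Bessel[of "int i"] Bessel[of "- 1 - int i"] by (intro add_mono) (simp_all add: algebra_simps)
    then show "(\<integral>\<^sup>+k. ?d (k + int i) \<partial>count_space UNIV) + (\<integral>\<^sup>+k. ?d (k - 1 - int i) \<partial>count_space UNIV) \<le> 2 * ?H"
      by (simp add: mult_2)
  qed auto
  also have "(\<Sum>i. ennreal (?q ^ i) * (2 * ?H)) = (\<Sum>i. ennreal (?q ^ i)) * (2 * ?H)"
    by simp
  also have "(\<Sum>i. ennreal (?q ^ i)) = ennreal (1 / (1 - ?q))"
    using q by (intro suminf_ennreal_eq geometric_sums) auto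
  also have "ennreal ?c * (ennreal (1 / (1 - ?q)) * (2 * ?H))
    = ennreal (square_orthogonality_const CARD('n) a * A\<^sup>2) * ?H"
  proof -
    have "square_orthogonality_const CARD('n) a * A\<^sup>2 = ?c * (1 / (1 - ?q) * 2)"
      by (simp add: square_orthogonality_const_def mult_ac)
    moreover have "ennreal (?c * (1 / (1 - ?q) * 2)) = ennreal ?c * (ennreal (1 / (1 - ?q)) * 2)"
      using q orthogonality_const_nonneg[OF unit_scale.a_pos, of "CARD('n)"]
      by (simp add: ennreal_mult[symmetric] ennreal_mult''[symmetric] flip: ennreal_numeral)
    ultimately show ?thesis by (simp add: mult.assoc)
  qed
  finally show ?thesis .
qed

subsection \<open>The dyadic maximal function\<close>

definition finite_maximal :: "int set \<Rightarrow> (real^'n \<Rightarrow> real) \<Rightarrow> real^'n \<Rightarrow> real" where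
  "finite_maximal J h x = (MAX k\<in>J. dyadic_average k h x)"

definition dyadic_maximal :: "(real^'n \<Rightarrow> ennreal) \<Rightarrow> real^'n \<Rightarrow> ennreal" where
  "dyadic_maximal f x = (SUP k. \<integral>\<^sup>+z. ennreal (dyadic_kernel k x z) * f z \<partial>lborel)"

lemma finite_maximal_singleton: "finite_maximal {k} h = dyadic_average k h"
  by (simp add: finite_maximal_def fun_eq_iff)

lemma finite_maximal_insert:
  "finite J \<Longrightarrow> J \<noteq> {} \<Longrightarrow> finite_maximal (insert k J) h = (\<lambda>x. max (dyadic_average k h x) (finite_maximal J h x))"
  by (simp add: finite_maximal_def fun_eq_iff)

lemma dyadic_average_le_finite_maximal:
  "finite J \<Longrightarrow> k \<in> J \<Longrightarrow> dyadic_average k h x \<le> finite_maximal J h x"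
  by (simp add: finite_maximal_def)

lemma finite_maximal_attained:
  assumes "finite J" "J \<noteq> {}"
  obtains k where "k \<in> J" "finite_maximal J h x = dyadic_average k h x"
proof -
  have "finite_maximal J h x \<in> (\<lambda>k. dyadic_average k h x) ` J"
    unfolding finite_maximal_def using assms by (intro Max_in) auto
  then show ?thesis using that by auto
qed

lemma finite_maximal_nonneg:
  assumes "finite J" "J \<noteq> {}" "\<And>x. 0 \<le> h x" shows "0 \<le> finite_maximal J h x"
  by (rule finite_maximal_attained[OF assms(1,2), of h x]) (simp add: dyadic_average_nonneg assms(3))

lemma finite_maximal_mono:
  "finite J' \<Longrightarrow> J \<noteq> {} \<Longrightarrow> J \<subseteq> J' \<Longrightarrow> finite_maximal J h x \<le> finite_maximal J' h x"
  unfolding finite_maximal_def by (intro Max_mono) auto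

lemma square_integrable_max:
  assumes f: "square_integrable M f" and g: "square_integrable M g"
  shows "square_integrable M (\<lambda>x. max (f x) (g x))"
proof -
  note [measurable] = f[THEN borel_measurable_square_integrable] g[THEN borel_measurable_square_integrable]
  have "energy M (\<lambda>x. max (f x) (g x)) \<le> (\<integral>\<^sup>+x. ennreal ((f x)\<^sup>2) + ennreal ((g x)\<^sup>2) \<partial>M)"
    by (intro nn_integral_mono) (auto simp: max_def)
  also have "\<dots> < \<infinity>" using f g by (subst nn_integral_add) (auto simp: square_integrable_def)
  finally show ?thesis unfolding square_integrable_def by simp
qed

lemma square_integrable_finite_maximal:
  assumes "finite J" "J \<noteq> {}" and h: "square_integrable lborel h"
  shows "square_integrable lborel (finite_maximal J h)"
  using assms(1,2)
proof (induction rule: finite_ne_induct)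
  case (insert k J)
  then show ?case
    by (simp add: finite_maximal_insert square_integrable_max square_integrable_dyadic_average[OF h])
qed (simp add: finite_maximal_singleton square_integrable_dyadic_average[OF h])

lemma dyadic_constant_finite_maximal:
  assumes "\<And>j. j \<in> J \<Longrightarrow> k \<le> j" shows "dyadic_constant k (finite_maximal J h)"
proof -
  have "dyadic_average j h x = dyadic_average j h z" if "j \<in> J" "dyadic_corner k x = dyadic_corner k z" for j x z
    using dyadic_constantD[OF dyadic_constant_mono[OF dyadic_constant_dyadic_average assms[OF that(1)]] that(2)] .
  then show ?thesis unfolding dyadic_constant_def finite_maximal_def by (metis (mono_tags, lifting) image_cong)
qed

text \<open>
  Doob's inequality: when a finer scale is added, the increment of the maximum is constant on the finer cubes, so
  there the new average may be replaced by \<open>h\<close>.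
\<close>

lemma integral_finite_maximal_square_le:
  assumes "finite J" "J \<noteq> {}" and h: "square_integrable lborel h"
  shows "(\<integral>x. (finite_maximal J h x)\<^sup>2 \<partial>lborel) \<le> 2 * (\<integral>x. finite_maximal J h x * h x \<partial>lborel)"
  using assms(1,2)
proof (induction rule: finite_linorder_min_induct)
  case (insert k J)
  let ?X = "dyadic_average k h"
  have X: "square_integrable lborel ?X" by (rule square_integrable_dyadic_average[OF h])
  show ?case
  proof (cases "J = {}")
    case True
    have "(\<integral>x. (?X x)\<^sup>2 \<partial>lborel) = (\<integral>x. ?X x * h x \<partial>lborel)"
      unfolding power2_eq_square by (rule integral_dyadic_constant_mult_average[OF X h
        dyadic_constant_dyadic_average])
    moreover have "0 \<le> (\<integral>x. (?X x)\<^sup>2 \<partial>lborel)" by simp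
    ultimately show ?thesis unfolding True finite_maximal_singleton by linarith
  next
    case False
    let ?S = "finite_maximal J h" and ?S' = "finite_maximal (insert k J) h"
    have S: "square_integrable lborel ?S" "square_integrable lborel ?S'"
      using insert.hyps False by (auto intro: square_integrable_finite_maximal[OF _ _ h])
    have D: "square_integrable lborel (\<lambda>x. ?S' x - ?S x)" by (rule square_integrable_diff[OF S(2,1)])
    have "dyadic_constant k ?S" "dyadic_constant k ?S'"
      using insert.hyps by (intro dyadic_constant_finite_maximal; force)+
    then have "dyadic_constant k (\<lambda>x. ?S' x - ?S x)" unfolding dyadic_constant_def by metis
    note increment = integral_dyadic_constant_mult_average[OF D h this]
    have "(?S' x)\<^sup>2 \<le> (?S x)\<^sup>2 + 2 * ((?S' x - ?S x) * ?X x)" for x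
      using zero_le_power2[of "?X x - ?S x"] insert.hyps(1) False
      by (auto simp: finite_maximal_insert max_def power2_eq_square algebra_simps)
    then have "(\<integral>x. (?S' x)\<^sup>2 \<partial>lborel) \<le> (\<integral>x. (?S x)\<^sup>2 + 2 * ((?S' x - ?S x) * ?X x) \<partial>lborel)"
      using S X D by (intro integral_mono Bochner_Integration.integrable_add integrable_mult_right
          square_integrable_power2 square_integrable_mult)
    also have "\<dots> = (\<integral>x. (?S x)\<^sup>2 \<partial>lborel) + 2 * (\<integral>x. (?S' x - ?S x) * h x \<partial>lborel)"
      using square_integrable_power2[OF S(1)] square_integrable_mult[OF D X] by (simp add: increment)
    also have "(\<integral>x. (?S' x - ?S x) * h x \<partial>lborel) = (\<integral>x. ?S' x * h x \<partial>lborel) - (\<integral>x. ?S x * h x \<partial>lborel)"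
      using square_integrable_mult[OF S(2) h] square_integrable_mult[OF S(1) h] by (simp add: left_diff_distrib)
    finally show ?thesis using insert.IH[OF False] by (simp add: algebra_simps)
  qed
qed simp

lemma energy_finite_maximal_le:
  assumes J: "finite J" "J \<noteq> {}" and h: "square_integrable lborel h"
  shows "energy lborel (finite_maximal J h) \<le> 4 * energy lborel h"
proof -
  let ?S = "finite_maximal J h"
  note S = square_integrable_finite_maximal[OF J h]
  have "2 * (\<integral>x. ?S x * h x \<partial>lborel) = (\<integral>x. 2 * (?S x * h x) \<partial>lborel)" by simp
  also have "\<dots> \<le> (\<integral>x. (1/2) * (?S x)\<^sup>2 + 2 * (h x)\<^sup>2 \<partial>lborel)"
  proof (rule integral_mono)
    fix x
    have "0 \<le> (?S x - 2 * h x)\<^sup>2" by simp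
    then show "2 * (?S x * h x) \<le> (1/2) * (?S x)\<^sup>2 + 2 * (h x)\<^sup>2" by (simp add: power2_eq_square algebra_simps)
  qed (use square_integrable_mult[OF S h] square_integrable_power2[OF S] square_integrable_power2[OF h] in auto)
  also have "\<dots> = (1/2) * (\<integral>x. (?S x)\<^sup>2 \<partial>lborel) + 2 * (\<integral>x. (h x)\<^sup>2 \<partial>lborel)"
    using square_integrable_power2[OF S] square_integrable_power2[OF h] by simp
  finally have "(\<integral>x. (?S x)\<^sup>2 \<partial>lborel) \<le> 4 * (\<integral>x. (h x)\<^sup>2 \<partial>lborel)"
    using integral_finite_maximal_square_le[OF J h] by linarith
  from ennreal_leI[OF this] show ?thesis
    by (simp add: energy_eq_integral[OF S] energy_eq_integral[OF h] ennreal_mult)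
qed

lemma borel_measurable_dyadic_maximal [measurable (raw)]:
  assumes [measurable]: "f \<in> borel_measurable M" "case_prod g \<in> borel_measurable (M \<Otimes>\<^sub>M lborel)"
  shows "(\<lambda>x. dyadic_maximal (g x) (f x)) \<in> borel_measurable M"
  unfolding dyadic_maximal_def by measurable

lemma dyadic_average_abs_le_maximal: "ennreal \<bar>dyadic_average k h x\<bar> \<le> dyadic_maximal (\<lambda>z. ennreal \<bar>h z\<bar>) x"
  unfolding dyadic_maximal_def by (rule order_trans[OF dyadic_average_abs_le]) (rule SUP_upper, simp)

lemma SUP_power2_ennreal:
  fixes g :: "'a \<Rightarrow> ennreal"
  assumes "I \<noteq> {}"
  shows "(SUP i\<in>I. g i)\<^sup>2 = (SUP i\<in>I. (g i)\<^sup>2)"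
proof (rule antisym)
  have "(SUP i\<in>I. g i)\<^sup>2 = (SUP j\<in>I. SUP i\<in>I. g i * g j)"
    unfolding power2_eq_square using assms by (simp add: SUP_mult_right_ennreal SUP_mult_left_ennreal)
  also have "\<dots> \<le> (SUP i\<in>I. (g i)\<^sup>2)"
  proof (intro SUP_least)
    fix i j assume "i \<in> I" "j \<in> I"
    then have "max (g i) (g j) \<in> g ` I" by (simp add: max_def)
    then obtain k where "k \<in> I" "g k = max (g i) (g j)" by (metis imageE)
    then show "g i * g j \<le> (SUP i\<in>I. (g i)\<^sup>2)"
      unfolding power2_eq_square by (intro SUP_upper2[of k]) (auto intro: mult_mono)
  qed
  finally show "(SUP i\<in>I. g i)\<^sup>2 \<le> (SUP i\<in>I. (g i)\<^sup>2)" .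
qed (auto intro!: SUP_least power_mono SUP_upper)

lemma dyadic_maximal_eq_SUP_finite:
  assumes h: "square_integrable lborel h" and h_nonneg: "\<And>x. 0 \<le> h x"
  shows "dyadic_maximal (\<lambda>z. ennreal (h z)) x = (SUP N. ennreal (finite_maximal {- int N..int N} h x))"
proof -
  have average: "(\<integral>\<^sup>+z. ennreal (dyadic_kernel k x z) * ennreal (h z) \<partial>lborel) = ennreal (dyadic_average k h x)" for k
    unfolding dyadic_average_def using h_nonneg
    by (subst nn_integral_eq_integral[symmetric])
      (auto intro!: square_integrable_mult square_integrable_dyadic_kernel h simp: ennreal_mult)
  show ?thesis unfolding dyadic_maximal_def average
  proof (rule antisym)
    show "(SUP k. ennreal (dyadic_average k h x)) \<le> (SUP N. ennreal (finite_maximal {- int N..int N} h x))"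
    proof (rule SUP_least)
      fix k :: int
      have "k \<in> {- int (nat \<bar>k\<bar>)..int (nat \<bar>k\<bar>)}" by auto
      then have "ennreal (dyadic_average k h x) \<le> ennreal (finite_maximal {- int (nat \<bar>k\<bar>)..int (nat \<bar>k\<bar>)} h x)"
        by (intro ennreal_leI dyadic_average_le_finite_maximal) auto
      also have "\<dots> \<le> (SUP N. ennreal (finite_maximal {- int N..int N} h x))" by (rule SUP_upper) simp
      finally show "ennreal (dyadic_average k h x) \<le> (SUP N. ennreal (finite_maximal {- int N..int N} h x))" .
    qed
    show "(SUP N. ennreal (finite_maximal {- int N..int N} h x)) \<le> (SUP k. ennreal (dyadic_average k h x))"
    proof (rule SUP_least)
      fix N :: nat
      obtain k where "finite_maximal {- int N..int N} h x = dyadic_average k h x"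
        by (rule finite_maximal_attained[of "{- int N..int N}" h x]) auto
      then show "ennreal (finite_maximal {- int N..int N} h x) \<le> (SUP k. ennreal (dyadic_average k h x))"
        using SUP_upper[of k UNIV "\<lambda>k. ennreal (dyadic_average k h x)"] by simp
    qed
  qed
qed

lemma nn_integral_dyadic_maximal_square_integrable:
  assumes h: "square_integrable lborel h" and h_nonneg: "\<And>x. 0 \<le> h x"
  shows "(\<integral>\<^sup>+x. (dyadic_maximal (\<lambda>z. ennreal (h z)) x)\<^sup>2 \<partial>lborel) \<le> 4 * energy lborel h"
proof -
  let ?S = "\<lambda>N. finite_maximal {- int N..int N} h"
  have S_nonneg: "0 \<le> ?S N x" for N x using h_nonneg by (intro finite_maximal_nonneg) auto
  have "incseq (\<lambda>N x. ennreal ((?S N x)\<^sup>2))"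
    unfolding incseq_def le_fun_def
    by (intro allI impI ennreal_leI power_mono finite_maximal_mono S_nonneg) auto
  moreover have "(\<lambda>x. ennreal ((?S N x)\<^sup>2)) \<in> borel_measurable lborel" for N
    using borel_measurable_square_integrable[OF square_integrable_finite_maximal[OF _ _ h], of "{- int N..int N}"]
    by simp
  ultimately have "(\<integral>\<^sup>+x. (SUP N. ennreal ((?S N x)\<^sup>2)) \<partial>lborel) = (SUP N. energy lborel (?S N))"
    by (rule nn_integral_monotone_convergence_SUP)
  also have "\<dots> \<le> 4 * energy lborel h"
    by (intro SUP_least energy_finite_maximal_le h) auto
  finally show ?thesis
    by (simp add: dyadic_maximal_eq_SUP_finite[OF h h_nonneg] SUP_power2_ennreal ennreal_power S_nonneg)
qed

theorem nn_integral_dyadic_maximal_square_le: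
  assumes [measurable]: "f \<in> borel_measurable borel"
  shows "(\<integral>\<^sup>+x. (dyadic_maximal f x)\<^sup>2 \<partial>lborel) \<le> 4 * (\<integral>\<^sup>+x. (f x)\<^sup>2 \<partial>lborel)"
proof (cases "(\<integral>\<^sup>+x. (f x)\<^sup>2 \<partial>lborel) = \<infinity>")
  case True
  then show ?thesis by (simp add: ennreal_mult_top)
next
  case False
  define h where "h = (\<lambda>x. enn2real (f x))"
  have h_nonneg: "0 \<le> h x" for x by (simp add: h_def)
  have "AE x in lborel. (f x)\<^sup>2 \<noteq> \<infinity>" using False by (intro nn_integral_PInf_AE) auto
  then have AE: "AE x in lborel. f x = ennreal (h x)"
    by eventually_elim (auto simp: h_def power2_eq_square ennreal_mult_eq_top_iff less_top)
  have energy: "(\<integral>\<^sup>+x. (f x)\<^sup>2 \<partial>lborel) = energy lborel h"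
    by (rule nn_integral_cong_AE) (use AE in eventually_elim, simp add: ennreal_power h_nonneg)
  then have h: "square_integrable lborel h"
    using False unfolding square_integrable_def by (simp add: less_top h_def)
  have "dyadic_maximal f = dyadic_maximal (\<lambda>z. ennreal (h z))"
    unfolding dyadic_maximal_def
    by (intro ext SUP_cong refl nn_integral_cong_AE) (use AE in eventually_elim, simp)
  then show ?thesis
    using nn_integral_dyadic_maximal_square_integrable[OF h h_nonneg] by (simp add: energy)
qed

subsection \<open>Carleson embedding\<close>

lemma nn_integral_dyadic_constant_set_le:
  assumes [measurable]: "R \<in> sets borel" "m \<in> borel_measurable borel"
    and const: "dyadic_constant k (\<lambda>y. y \<in> R)"
    and le: "\<And>x. (\<integral>\<^sup>+y\<in>dyadic_cube k x. m y \<partial>lborel) \<le> B * ennreal (side_length k ^ CARD('n))"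
  shows "(\<integral>\<^sup>+y\<in>R. m y \<partial>lborel) \<le> B * emeasure lborel (R :: (real^'n) set)"
proof -
  have "dyadic_constant k (indicator R :: _ \<Rightarrow> ennreal)"
    using dyadic_constant_comp[OF const, of of_bool] by (simp add: indicator_def[abs_def])
  then have "(\<integral>\<^sup>+y\<in>R. m y \<partial>lborel) = (\<integral>\<^sup>+x. indicator R x * (\<integral>\<^sup>+y. ennreal (dyadic_kernel k x y) * m y \<partial>lborel) \<partial>lborel)"
    by (subst mult.commute) (intro nn_integral_dyadic_constant_mult assms(2), auto)
  also have "\<dots> \<le> (\<integral>\<^sup>+x. indicator R x * B \<partial>lborel)"
  proof (intro nn_integral_mono mult_left_mono)
    fix x :: "real^'n"
    have "(\<integral>\<^sup>+y. ennreal (dyadic_kernel k x y) * m y \<partial>lborel)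
      = ennreal ((1 / side_length k) ^ CARD('n)) * (\<integral>\<^sup>+y\<in>dyadic_cube k x. m y \<partial>lborel)"
      by (subst nn_integral_dyadic_kernel_mult) (simp_all add: mult.commute)
    also have "\<dots> \<le> ennreal ((1 / side_length k) ^ CARD('n)) * (B * ennreal (side_length k ^ CARD('n)))"
      by (intro mult_left_mono le) simp
    also have "\<dots> = B * (ennreal ((1 / side_length k) ^ CARD('n)) * ennreal (side_length k ^ CARD('n)))"
      by (simp only: mult.left_commute)
    also have "ennreal ((1 / side_length k) ^ CARD('n)) * ennreal (side_length k ^ CARD('n)) = 1"
      by (simp add: ennreal_mult[symmetric] power_divide)
    finally show "(\<integral>\<^sup>+y. ennreal (dyadic_kernel k x y) * m y \<partial>lborel) \<le> B" by simp
  qed simp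
  also have "\<dots> = B * emeasure lborel R"
    by (simp add: nn_integral_cmult_indicator mult.commute)
  finally show ?thesis .
qed

lemma dyadic_cube_subset: "dyadic_constant k (\<lambda>y. y \<in> S) \<Longrightarrow> y \<in> S \<Longrightarrow> dyadic_cube k y \<subseteq> S"
  unfolding dyadic_constant_def dyadic_cube_def by blast

text \<open>A point of a union of finite measure lies in only boundedly large dyadic cubes contained in it.\<close>

lemma maximal_dyadic_scale:
  fixes y :: "real^'n" and S :: "int \<Rightarrow> (real^'n) set"
  assumes [measurable]: "\<And>k. S k \<in> sets borel" and const: "\<And>k. dyadic_constant k (\<lambda>y. y \<in> S k)"
    and finite: "emeasure lborel (\<Union>k. S k) < \<infinity>" and y: "y \<in> S k"
  obtains K where "y \<in> S K" "\<And>j. K < j \<Longrightarrow> y \<notin> S j"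
proof -
  obtain c where c: "emeasure lborel (\<Union>k. S k) = ennreal c" "0 \<le> c" using finite
    by (cases "emeasure lborel (\<Union>k. S k)") auto
  obtain N :: nat where N: "c < 2 ^ N" using real_arch_pow[of 2 c] by auto
  have bounded: "j < int N" if "y \<in> S j" for j
  proof (rule ccontr)
    assume j: "\<not> j < int N"
    have "dyadic_cube j y \<subseteq> (\<Union>k. S k)" using dyadic_cube_subset[OF const that] by blast
    then have "emeasure lborel (dyadic_cube j y) \<le> ennreal c" unfolding c(1)[symmetric] by (intro emeasure_mono) auto
    then have "side_length j ^ CARD('n) \<le> c" using c(2) by (simp add: emeasure_dyadic_cube)
    moreover have "2 ^ N \<le> side_length j" using j by (simp add: powr_realpow[symmetric])
    moreover have "side_length j ^ 1 \<le> side_length j ^ CARD('n)"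
      using j by (intro power_increasing ge_one_powr_ge_zero) (auto simp: Suc_le_eq)
    ultimately show False using N by simp
  qed
  let ?J = "{j \<in> {k..<int N}. y \<in> S j}"
  have J: "finite ?J" "?J \<noteq> {}" using y bounded[OF y] by (auto intro: finite_subset[of _ "{k..<int N}"])
  show ?thesis
  proof (rule that[of "Max ?J"])
    show "y \<in> S (Max ?J)" using Max_in[OF J] by blast
    show "y \<notin> S j" if "Max ?J < j" for j
      using that Max_in[OF J] Max_ge[OF J(1), of j] bounded[of j] by fastforce
  qed
qed

definition maximal_part :: "(int \<Rightarrow> 'a set) \<Rightarrow> int \<Rightarrow> 'a set" where
  "maximal_part S k = {y \<in> S k. \<forall>j\<in>{k<..}. y \<notin> S j}"

lemma sets_maximal_part [measurable]:
  assumes [measurable]: "\<And>k. S k \<in> sets borel"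
  shows "maximal_part S k \<in> sets borel"
  unfolding maximal_part_def by measurable

lemma disjoint_family_maximal_part: "disjoint_family (maximal_part S)"
  unfolding disjoint_family_on_def maximal_part_def by auto (metis greaterThan_iff linorder_neqE)

lemma dyadic_constant_maximal_part:
  fixes S :: "int \<Rightarrow> (real^'n) set"
  assumes const: "\<And>k. dyadic_constant k (\<lambda>y. y \<in> S k)"
  shows "dyadic_constant k (\<lambda>y. y \<in> maximal_part S k)"
  unfolding dyadic_constant_def
proof (intro allI impI)
  fix x z :: "real^'n" assume same_cube: "dyadic_corner k x = dyadic_corner k z"
  have "x \<in> S j \<longleftrightarrow> z \<in> S j" if "k \<le> j" for j
    using dyadic_constantD[OF const dyadic_corner_eq_mono[OF that same_cube]] .
  then show "x \<in> maximal_part S k \<longleftrightarrow> z \<in> maximal_part S k" by (simp add: maximal_part_def)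
qed

lemma UN_maximal_part:
  fixes S :: "int \<Rightarrow> (real^'n) set"
  assumes S: "\<And>k. S k \<in> sets borel" and const: "\<And>k. dyadic_constant k (\<lambda>y. y \<in> S k)"
    and finite: "emeasure lborel (\<Union>k. S k) < \<infinity>"
  shows "(\<Union>k. maximal_part S k) = (\<Union>k. S k)"
proof (intro equalityI subsetI)
  fix y assume "y \<in> (\<Union>k. S k)"
  then obtain k where "y \<in> S k" by blast
  then obtain K where "y \<in> S K" "\<And>j. K < j \<Longrightarrow> y \<notin> S j"
    using maximal_dyadic_scale[OF S const finite] by metis
  then show "y \<in> (\<Union>k. maximal_part S k)" unfolding maximal_part_def by blast
qed (auto simp: maximal_part_def)

lemma carleson_measure_saturated_le:
  fixes \<mu> :: "real \<times> (real^'n) \<Rightarrow> ennreal"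
  assumes \<mu>[measurable]: "\<mu> \<in> borel_measurable (borel \<Otimes>\<^sub>M borel)"
    and cube: "\<And>k x. (\<integral>\<^sup>+y\<in>dyadic_cube k x. (\<integral>\<^sup>+t\<in>{0<..side_length k}. \<mu> (t, y) \<partial>scale_measure) \<partial>lborel)
      \<le> B * ennreal (side_length k ^ CARD('n))"
    and S[measurable]: "\<And>k. S k \<in> sets borel" and const: "\<And>k. dyadic_constant k (\<lambda>y. y \<in> S k)"
    and finite: "emeasure lborel (\<Union>k. S k) < \<infinity>"
  shows "(\<integral>\<^sup>+y. \<integral>\<^sup>+t. \<mu> (t, y) * indicator (S (scale_index t)) y \<partial>scale_measure \<partial>lborel)
    \<le> B * emeasure lborel (\<Union>k. S k)"
proof -
  let ?F = "\<lambda>y. \<integral>\<^sup>+t. \<mu> (t, y) * indicator (S (scale_index t)) y \<partial>scale_measure"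
  let ?R = "maximal_part S"
  note union = UN_maximal_part[OF S const finite]
  have part: "(\<integral>\<^sup>+y\<in>?R k. ?F y \<partial>lborel) \<le> B * emeasure lborel (?R k)" for k
  proof -
    have "?F y \<le> (\<integral>\<^sup>+t\<in>{0<..side_length k}. \<mu> (t, y) \<partial>scale_measure)" if y: "y \<in> ?R k" for y
    proof (rule nn_integral_scale_mono)
      fix t :: real assume t: "0 < t"
      have "scale_index t \<le> k" if "y \<in> S (scale_index t)" using y that by (force simp: maximal_part_def)
      then show "\<mu> (t, y) * indicator (S (scale_index t)) y \<le> \<mu> (t, y) * indicator {0<..side_length k} t"
        using t by (auto simp: indicator_def scale_index_le_iff)
    qed
    then have "(\<integral>\<^sup>+y\<in>?R k. ?F y \<partial>lborel) \<le> (\<integral>\<^sup>+y\<in>?R k. (\<integral>\<^sup>+t\<in>{0<..side_length k}. \<mu> (t, y) \<partial>scale_measure) \<partial>lborel)"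
      by (intro nn_integral_mono) (simp add: indicator_def)
    also have "\<dots> \<le> B * emeasure lborel (?R k)"
      by (rule nn_integral_dyadic_constant_set_le[OF _ _ dyadic_constant_maximal_part[OF const] cube]) measurable
    finally show ?thesis .
  qed
  have "(\<integral>\<^sup>+y. ?F y \<partial>lborel) = (\<integral>\<^sup>+y\<in>(\<Union>k. ?R k). ?F y \<partial>lborel)"
    unfolding union by (intro nn_integral_cong) (auto simp: indicator_def)
  also have "\<dots> = emeasure (density lborel ?F) (\<Union>k. ?R k)"
    by (rule emeasure_density[symmetric]) measurable
  also have "\<dots> = (\<integral>\<^sup>+k. emeasure (density lborel ?F) (?R k) \<partial>count_space UNIV)"
    using disjoint_family_maximal_part by (intro emeasure_UN_countable) auto
  also have "\<dots> \<le> (\<integral>\<^sup>+k. B * emeasure lborel (?R k) \<partial>count_space UNIV)"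
    by (intro nn_integral_mono) (simp add: emeasure_density part)
  also have "\<dots> = B * emeasure lborel (\<Union>k. ?R k)"
    using disjoint_family_maximal_part[of S] by (simp add: nn_integral_cmult emeasure_UN_countable)
  finally show ?thesis unfolding union .
qed

theorem carleson_embedding:
  fixes h :: "real^'n \<Rightarrow> real" and \<mu> :: "real \<times> (real^'n) \<Rightarrow> ennreal"
  assumes \<mu>[measurable]: "\<mu> \<in> borel_measurable (borel \<Otimes>\<^sub>M borel)" and h: "square_integrable lborel h"
    and cube: "\<And>k x. (\<integral>\<^sup>+y\<in>dyadic_cube k x. (\<integral>\<^sup>+t\<in>{0<..side_length k}. \<mu> (t, y) \<partial>scale_measure) \<partial>lborel)
        \<le> B * ennreal (side_length k ^ CARD('n))"
  shows "(\<integral>\<^sup>+y. \<integral>\<^sup>+t. \<mu> (t, y) * ennreal ((dyadic_average (scale_index t) h y)\<^sup>2) \<partial>scale_measure \<partial>lborel)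
    \<le> B * (4 * energy lborel h)"
proof -
  note [measurable] = borel_measurable_square_integrable_lborel[OF h]
  let ?w = "\<lambda>p. \<mu> (snd p, fst p)" and ?u = "\<lambda>k y. ennreal ((dyadic_average k h y)\<^sup>2)"
  let ?G = "\<lambda>y. (dyadic_maximal (\<lambda>z. ennreal \<bar>h z\<bar>) y)\<^sup>2"
  have maximal: "(\<integral>\<^sup>+y. ?G y \<partial>lborel) \<le> 4 * energy lborel h"
    using nn_integral_dyadic_maximal_square_le[of "\<lambda>z. ennreal \<bar>h z\<bar>"] by (simp add: ennreal_power)
  also have "\<dots> < \<infinity>" using energy_finite[OF h] by (simp add: ennreal_mult_less_top)
  finally have finite: "(\<integral>\<^sup>+y. ?G y \<partial>lborel) < \<infinity>" .
  have "(\<integral>\<^sup>+y. \<integral>\<^sup>+t. \<mu> (t, y) * ?u (scale_index t) y \<partial>scale_measure \<partial>lborel)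
    = (\<integral>\<^sup>+p. ?w p * ?u (scale_index (snd p)) (fst p) \<partial>(lborel \<Otimes>\<^sub>M scale_measure))"
    by (subst scale_measure.nn_integral_fst[symmetric]) simp_all
  also have "\<dots> \<le> B * (\<integral>\<^sup>+y. ?G y \<partial>lborel)"
  proof (rule nn_integral_le_of_dominated_level_sets[OF lborel_scale.sigma_finite_measure_axioms sigma_finite_lborel])
    show "?u k y \<le> ?G y" for k y
      using power_mono[OF dyadic_average_abs_le_maximal, of k h y 2] by (simp add: ennreal_power)
    fix s :: real
    let ?S = "\<lambda>k. {y \<in> space lborel. ennreal s < ?u k y}"
    have S: "?S k \<in> sets borel" for k by measurable
    have const: "dyadic_constant k (\<lambda>y. y \<in> ?S k)" for k
      using dyadic_constant_comp[OF dyadic_constant_dyadic_average, where F="\<lambda>c. ennreal s < ennreal (c\<^sup>2)"] by simp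
    assume "emeasure lborel (\<Union>k. ?S k) < \<infinity>"
    from carleson_measure_saturated_le[OF \<mu> cube S const this]
    show "(\<integral>\<^sup>+p. ?w p * indicator {p. ennreal s < ?u (scale_index (snd p)) (fst p)} p \<partial>(lborel \<Otimes>\<^sub>M scale_measure))
      \<le> B * emeasure lborel (\<Union>k. ?S k)"
      by (subst scale_measure.nn_integral_fst[symmetric]) (simp_all add: indicator_def)
  qed (use finite in measurable)
  also have "\<dots> \<le> B * (4 * energy lborel h)" by (intro mult_left_mono maximal) simp
  finally show ?thesis .
qed

subsection \<open>The one-parameter square function estimate\<close>

definition carleson_const :: "nat \<Rightarrow> real \<Rightarrow> real" where
  "carleson_const n a = 2 + 2 * square_orthogonality_const n a"

definition square_function_const :: "nat \<Rightarrow> real \<Rightarrow> real" where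
  "square_function_const n a = 2 * square_orthogonality_const n a + 8 * carleson_const n a"

lemma carleson_const_pos: "0 < a \<Longrightarrow> 0 < carleson_const n a"
  using square_orthogonality_const_nonneg[of a n] by (simp add: carleson_const_def)

lemma square_function_const_pos: "0 < a \<Longrightarrow> 0 < square_function_const n a"
  using square_orthogonality_const_nonneg[of a n] carleson_const_pos[of a n]
  by (simp add: square_function_const_def)

definition cube_testing :: "(real \<times> (real^'n) \<times> (real^'n) \<Rightarrow> real) \<Rightarrow> real \<Rightarrow> bool" where
  "cube_testing L B \<longleftrightarrow> (\<forall>k x. (\<integral>\<^sup>+y\<in>dyadic_cube k x. (\<integral>\<^sup>+t\<in>{0<..side_length k}.
      ennreal ((\<integral>z. indicator (dyadic_cube k x) z * L (t, y, z) \<partial>lborel)\<^sup>2) \<partial>scale_measure) \<partial>lborel)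
    \<le> ennreal (B\<^sup>2 * side_length k ^ CARD('n)))"

lemma nn_integral_unit: "(\<integral>\<^sup>+v. f v \<partial>count_space (UNIV :: unit set)) = f ()"
  by (subst nn_integral_count_space_finite) (auto simp: UNIV_unit)

lemma integral_unit: "(\<integral>v. f v \<partial>count_space (UNIV :: unit set)) = (f () :: real)"
  by (subst lebesgue_integral_count_space_finite) (auto simp: UNIV_unit)

lemma nn_integral_pair_unit:
  assumes [measurable]: "f \<in> borel_measurable (M \<Otimes>\<^sub>M count_space (UNIV :: unit set))"
  shows "(\<integral>\<^sup>+q. f q \<partial>(M \<Otimes>\<^sub>M count_space (UNIV :: unit set))) = (\<integral>\<^sup>+y. f (y, ()) \<partial>M)"
  by (subst sigma_finite_measure.nn_integral_fst[OF sigma_finite_measure_count_space, symmetric])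
    (simp_all add: nn_integral_unit)

lemma distr_fst_unit: "distr (M \<Otimes>\<^sub>M count_space (UNIV :: unit set)) M fst = M"
proof (rule measure_eqI)
  fix A assume "A \<in> sets (distr (M \<Otimes>\<^sub>M count_space (UNIV :: unit set)) M fst)"
  then have A[measurable]: "A \<in> sets M" by simp
  have "emeasure (distr (M \<Otimes>\<^sub>M count_space (UNIV :: unit set)) M fst) A
    = (\<integral>\<^sup>+q. indicator A (fst q) \<partial>(M \<Otimes>\<^sub>M count_space (UNIV :: unit set)))"
    by (simp add: nn_integral_indicator[symmetric] nn_integral_distr del: nn_integral_indicator)
  then show "emeasure (distr (M \<Otimes>\<^sub>M count_space (UNIV :: unit set)) M fst) A = emeasure M A"
    by (simp add: nn_integral_pair_unit)
qed simp

lemma integral_pair_unit: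
  fixes f :: "'a \<Rightarrow> real"
  assumes [measurable]: "f \<in> borel_measurable M"
  shows "(\<integral>p. f (fst p) \<partial>(M \<Otimes>\<^sub>M count_space (UNIV :: unit set))) = (\<integral>z. f z \<partial>M)"
proof -
  have "(\<integral>z. f z \<partial>distr (M \<Otimes>\<^sub>M count_space (UNIV :: unit set)) M fst)
    = (\<integral>p. f (fst p) \<partial>(M \<Otimes>\<^sub>M count_space (UNIV :: unit set)))"
    by (rule integral_distr) measurable
  then show ?thesis by (simp only: distr_fst_unit)
qed

lemma energy_indicator_dyadic_cube:
  "energy lborel (indicator (dyadic_cube k (x::real^'n))) = ennreal (side_length k ^ CARD('n))"
proof -
  have "energy lborel (indicator (dyadic_cube k x)) = (\<integral>\<^sup>+z. indicator (dyadic_cube k x) z \<partial>lborel)"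
    by (intro nn_integral_cong) (auto simp: indicator_def)
  then show ?thesis by (simp add: emeasure_dyadic_cube)
qed

lemma square_integrable_indicator_dyadic_cube: "square_integrable lborel (indicator (dyadic_cube k x))"
  unfolding square_integrable_def energy_indicator_dyadic_cube by (simp add: borel_measurable_indicator)

lemma dyadic_average_indicator_dyadic_cube:
  assumes "y \<in> dyadic_cube k x" "j \<le> k"
  shows "dyadic_average j (indicator (dyadic_cube k x)) y = 1"
proof -
  have "dyadic_kernel j y z * indicator (dyadic_cube k x) z = dyadic_kernel j y z" for z
    using assms dyadic_corner_eq_mono[of j k y z] by (auto simp: dyadic_kernel_def indicator_def)
  then show ?thesis unfolding dyadic_average_def by (simp only: integral_dyadic_kernel)
qed

locale one_parameter_kernel =
  fixes L :: "real \<times> (real^'n) \<times> (real^'n) \<Rightarrow> real" and B a :: real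
  assumes L_measurable[measurable]: "L \<in> borel_measurable borel" and B_pos: "0 < B" and a_pos: "0 < a"
    and size: "\<And>t y z. 0 < t \<Longrightarrow> \<bar>L (t, y, z)\<bar> \<le> B * poisson a t (y - z)"
    and holder: "\<And>t y z z'. 0 < t \<Longrightarrow> infnorm (z - z') < t / 2 \<Longrightarrow> z \<noteq> z' \<Longrightarrow>
        \<bar>L (t, y, z) - L (t, y, z')\<bar> \<le> B * holder_poisson a t (z - z') (y - z)"
    and testing: "cube_testing L B"
begin

lemma integrable_L: "0 < t \<Longrightarrow> integrable lborel (\<lambda>z. L (t, y, z))"
  by (rule Bochner_Integration.integrable_bound[OF integrable_mult_right[OF integrable_poisson[of t a y], of B]])
    (use size a_pos in \<open>auto intro!: AE_I2 order_trans[OF size]\<close>)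

lemma square_integrable_L: "0 < t \<Longrightarrow> square_integrable lborel (\<lambda>z. L (t, y, z))"
  using size B_pos
  by (intro square_integrable_bound[OF _
    square_integrable_cmult[OF square_integrable_poisson[OF _ a_pos, of _ y], of _ B]])
    (auto simp: abs_mult)

lemma integral_L_minus_const:
  "0 < t \<Longrightarrow> square_integrable lborel h \<Longrightarrow>
    (\<integral>z. L (t, y, z) * (h z - c) \<partial>lborel) = (\<integral>z. L (t, y, z) * h z \<partial>lborel) - (\<integral>z. L (t, y, z) \<partial>lborel) * c"
  using integrable_L[of t y] square_integrable_mult[OF square_integrable_L[of t y]] by (simp add: right_diff_distrib)

text \<open>A scalar kernel is an operator between one-dimensional spaces \<open>L\<^sup>2(unit)\<close>.\<close>

lemma operator_kernel_unit:
  assumes t: "0 < t"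
  shows "operator_kernel (count_space (UNIV :: unit set)) (count_space (UNIV :: unit set))
    (\<lambda>q. L (t, fst q, fst (snd q))) (\<lambda>_ _. B) B a t (scale_index t)"
proof (rule operator_kernel.intro)
  show "square_integrable (count_space (UNIV :: unit set)) (\<lambda>_. B)"
    by (simp add: square_integrable_def nn_integral_unit)
  show "\<bar>L (t, fst (y, z, v, w), fst (snd (y, z, v, w)))\<bar> \<le> poisson a t (y - z) * B" for y z and v w :: unit
    using size[OF t, of y z] by (simp add: mult.commute)
  fix y z :: "real^'n" and h :: "unit \<Rightarrow> real"
  have scalar: "ennreal ((c * h ())\<^sup>2) \<le> ennreal (C\<^sup>2) * ennreal ((h ())\<^sup>2)" if "\<bar>c\<bar> \<le> C" for c C
    using power_mono[OF that, of 2]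
    by (simp add: ennreal_mult[symmetric] power_mult_distrib mult_right_mono ennreal_leI)
  show "energy (count_space UNIV) (\<lambda>v :: unit. \<integral>w. L (t, fst (y, z, v, w), fst (snd (y, z, v, w)))
    * h w \<partial>count_space UNIV)
    \<le> ennreal ((B * poisson a t (y - z))\<^sup>2) * energy (count_space UNIV) h"
    using scalar[OF size[OF t, of y z]] by (simp add: nn_integral_unit integral_unit)
  fix z' :: "real^'n" assume d: "infnorm (z - z') < t / 2" "z \<noteq> z'"
  show "energy (count_space UNIV) (\<lambda>v :: unit. \<integral>w. (L (t, fst (y, z, v, w), fst (snd (y, z, v, w)))
      - L (t, fst (y, z', v, w), fst (snd (y, z', v, w)))) * h w \<partial>count_space UNIV)
    \<le> ennreal ((B * holder_poisson a t (z - z') (y - z))\<^sup>2) * energy (count_space UNIV) h"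
    using scalar[OF holder[OF t d, of y]] by (simp add: nn_integral_unit integral_unit)
qed (use B_pos a_pos scale_index_bounds[OF t] in \<open>auto intro: sigma_finite_measure_count_space\<close>)

lemma almost_orthogonality:
  assumes h: "square_integrable lborel h"
  shows "(\<integral>\<^sup>+y. energy scale_measure (\<lambda>t. \<integral>z. L (t, y, z)
    * (h z - dyadic_average (scale_index t) h y) \<partial>lborel) \<partial>lborel)
    \<le> ennreal (square_orthogonality_const CARD('n) a * B\<^sup>2) * energy lborel h"
proof -
  note [measurable] = borel_measurable_square_integrable_lborel[OF h]
  let ?U = "count_space (UNIV :: unit set)" and ?F = "\<lambda>p. h (fst p)"
  let ?T = "\<lambda>t y. \<integral>z. L (t, y, z) * (h z - dyadic_average (scale_index t) h y) \<partial>lborel"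
  have kernel_op: "kernel_op ?U (\<lambda>q. L (t, fst q, fst (snd q))) (\<lambda>q. ?F (snd q)
    - frozen_average (scale_index t) ?F q) q
    = ?T t (fst q)" for t and q :: "(real^'n) \<times> unit"
    using integral_pair_unit[of "\<lambda>z. L (t, fst q, z) * (h z - dyadic_average (scale_index t) h (fst q))" lborel]
    by (simp add: kernel_op_def frozen_average_def)
  have F: "square_integrable (lborel \<Otimes>\<^sub>M ?U) ?F"
    using h by (simp add: square_integrable_def nn_integral_pair_unit)
  have "(\<integral>\<^sup>+y. energy scale_measure (\<lambda>t. ?T t y) \<partial>lborel) = (\<integral>\<^sup>+t. energy lborel (?T t) \<partial>scale_measure)"
    by (rule scale_lborel.Fubini') measurable
  also have "\<dots> \<le> ennreal (square_orthogonality_const CARD('n) a * B\<^sup>2) * energy lborel h"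
    using square_function_almost_orthogonality[OF operator_kernel_unit F]
    by (simp add: kernel_op nn_integral_pair_unit)
  finally show ?thesis .
qed

text \<open>On the cube \<open>Q\<close> the function \<open>1\<close> is compared with the indicator of \<open>Q\<close>,
  whose averages over small subcubes of \<open>Q\<close> equal \<open>1\<close>.\<close>

lemma carleson_condition:
  "(\<integral>\<^sup>+y\<in>dyadic_cube k x. (\<integral>\<^sup>+t\<in>{0<..side_length k}. ennreal ((\<integral>z. L (t, y, z) \<partial>lborel)\<^sup>2) \<partial>scale_measure) \<partial>lborel)
    \<le> ennreal (carleson_const CARD('n) a * B\<^sup>2) * ennreal (side_length k ^ CARD('n))"
proof -
  let ?Q = "dyadic_cube k x" and ?p = "side_length k" and ?c = "square_orthogonality_const CARD('n) a"
  let ?h = "indicator ?Q :: real^'n \<Rightarrow> real"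
  let ?I = "\<lambda>t y. \<integral>z. ?h z * L (t, y, z) \<partial>lborel"
  let ?O = "\<lambda>t y. \<integral>z. L (t, y, z) * (?h z - dyadic_average (scale_index t) ?h y) \<partial>lborel"
  have h: "square_integrable lborel ?h" by (rule square_integrable_indicator_dyadic_cube)
  have pointwise: "ennreal ((\<integral>z. L (t, y, z) \<partial>lborel)\<^sup>2) \<le> 2 * ennreal ((?I t y)\<^sup>2) + 2 * ennreal ((?O t y)\<^sup>2)"
    if "y \<in> ?Q" "0 < t" "t \<le> ?p" for t y
  proof -
    have "dyadic_average (scale_index t) ?h y = 1"
      using that by (intro dyadic_average_indicator_dyadic_cube) (auto simp: scale_index_le_iff)
    then have "(\<integral>z. L (t, y, z) \<partial>lborel) = ?I t y - ?O t y"
      using integral_L_minus_const[OF that(2) h, of y 1] by (simp add: mult.commute)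
    then show ?thesis by (simp only: ennreal_square_diff_le)
  qed
  have "(\<integral>\<^sup>+y\<in>?Q. (\<integral>\<^sup>+t\<in>{0<..?p}. ennreal ((\<integral>z. L (t, y, z) \<partial>lborel)\<^sup>2) \<partial>scale_measure) \<partial>lborel)
    \<le> (\<integral>\<^sup>+y. 2 * ((\<integral>\<^sup>+t\<in>{0<..?p}. ennreal ((?I t y)\<^sup>2) \<partial>scale_measure) * indicator ?Q y)
        + 2 * energy scale_measure (\<lambda>t. ?O t y) \<partial>lborel)"
  proof (rule nn_integral_mono)
    fix y
    have "(\<integral>\<^sup>+t\<in>{0<..?p}. ennreal ((\<integral>z. L (t, y, z) \<partial>lborel)\<^sup>2) \<partial>scale_measure)
      \<le> (\<integral>\<^sup>+t. 2 * (ennreal ((?I t y)\<^sup>2) * indicator {0<..?p} t) + 2 * ennreal ((?O t y)\<^sup>2) \<partial>scale_measure)" if "y \<in> ?Q"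
      using pointwise[OF that] by (intro nn_integral_mono) (auto simp: indicator_def)
    also have "\<dots> = 2 * (\<integral>\<^sup>+t\<in>{0<..?p}. ennreal ((?I t y)\<^sup>2) \<partial>scale_measure) + 2 * energy scale_measure (\<lambda>t. ?O t y)"
      by (simp add: nn_integral_add nn_integral_cmult)
    finally show "(\<integral>\<^sup>+t\<in>{0<..?p}. ennreal ((\<integral>z. L (t, y, z) \<partial>lborel)\<^sup>2) \<partial>scale_measure) * indicator ?Q y
      \<le> 2 * ((\<integral>\<^sup>+t\<in>{0<..?p}. ennreal ((?I t y)\<^sup>2) \<partial>scale_measure) * indicator ?Q y)
        + 2 * energy scale_measure (\<lambda>t. ?O t y)"
      by (cases "y \<in> ?Q") simp_all
  qed
  also have "\<dots> = 2 * (\<integral>\<^sup>+y\<in>?Q. (\<integral>\<^sup>+t\<in>{0<..?p}. ennreal ((?I t y)\<^sup>2) \<partial>scale_measure) \<partial>lborel)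
     + 2 * (\<integral>\<^sup>+y. energy scale_measure (\<lambda>t. ?O t y) \<partial>lborel)"
    by (simp add: nn_integral_add nn_integral_cmult)
  also have "\<dots> \<le> 2 * ennreal (B\<^sup>2 * ?p ^ CARD('n)) + 2 * (ennreal (?c * B\<^sup>2) * ennreal (?p ^ CARD('n)))"
    using testing almost_orthogonality[OF h] unfolding cube_testing_def energy_indicator_dyadic_cube
    by (intro add_mono mult_left_mono) auto
  also have "\<dots> = ennreal (carleson_const CARD('n) a * B\<^sup>2) * ennreal (?p ^ CARD('n))"
    using square_orthogonality_const_nonneg[OF a_pos, of "CARD('n)"]
    by (simp add: carleson_const_def distrib_right ennreal_mult mult.assoc)
  finally show ?thesis .
qed

lemma paraproduct_bound:
  assumes h: "square_integrable lborel h"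
  shows "(\<integral>\<^sup>+y. energy scale_measure (\<lambda>t. (\<integral>z. L (t, y, z) \<partial>lborel) * dyadic_average (scale_index t) h y) \<partial>lborel)
    \<le> ennreal (4 * carleson_const CARD('n) a * B\<^sup>2) * energy lborel h"
proof -
  have "(\<lambda>p. ennreal ((\<integral>z. L (fst p, snd p, z) \<partial>lborel)\<^sup>2)) \<in> borel_measurable (borel \<Otimes>\<^sub>M borel)" by measurable
  from carleson_embedding[OF this h, of "ennreal (carleson_const CARD('n) a * B\<^sup>2)"]
  have "(\<integral>\<^sup>+y. energy scale_measure (\<lambda>t. (\<integral>z. L (t, y, z) \<partial>lborel) * dyadic_average (scale_index t) h y) \<partial>lborel)
    \<le> ennreal (carleson_const CARD('n) a * B\<^sup>2) * (4 * energy lborel h)"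
    using carleson_condition by (simp add: power_mult_distrib ennreal_mult)
  also have "\<dots> = ennreal (4 * carleson_const CARD('n) a * B\<^sup>2) * energy lborel h"
    using carleson_const_pos[OF a_pos, of "CARD('n)"] by (simp add: ennreal_mult mult_ac)
  finally show ?thesis .
qed

theorem square_function_bound:
  assumes h: "square_integrable lborel h"
  shows "(\<integral>\<^sup>+y. energy scale_measure (\<lambda>t. \<integral>z. L (t, y, z) * h z \<partial>lborel) \<partial>lborel)
    \<le> ennreal (square_function_const CARD('n) a * B\<^sup>2) * energy lborel h"
proof -
  note [measurable] = borel_measurable_square_integrable_lborel[OF h]
  let ?O = "\<lambda>t y. \<integral>z. L (t, y, z) * (h z - dyadic_average (scale_index t) h y) \<partial>lborel"
  let ?P = "\<lambda>t y. (\<integral>z. L (t, y, z) \<partial>lborel) * dyadic_average (scale_index t) h y"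
  have "(\<integral>\<^sup>+y. energy scale_measure (\<lambda>t. \<integral>z. L (t, y, z) * h z \<partial>lborel) \<partial>lborel)
    = (\<integral>\<^sup>+y. energy scale_measure (\<lambda>t. ?O t y + ?P t y) \<partial>lborel)"
    by (intro nn_integral_cong nn_integral_scale_cong) (simp add: integral_L_minus_const[OF _ h])
  also have "\<dots> \<le> (\<integral>\<^sup>+y. 2 * energy scale_measure (\<lambda>t. ?O t y) + 2 * energy scale_measure (\<lambda>t. ?P t y) \<partial>lborel)"
    by (intro nn_integral_mono energy_add_le) measurable
  also have "\<dots> = 2 * (\<integral>\<^sup>+y. energy scale_measure (\<lambda>t. ?O t y) \<partial>lborel)
    + 2 * (\<integral>\<^sup>+y. energy scale_measure (\<lambda>t. ?P t y) \<partial>lborel)"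
    by (simp add: nn_integral_add nn_integral_cmult)
  also have "\<dots> \<le> 2 * (ennreal (square_orthogonality_const CARD('n) a * B\<^sup>2) * energy lborel h)
      + 2 * (ennreal (4 * carleson_const CARD('n) a * B\<^sup>2) * energy lborel h)"
    by (intro add_mono mult_left_mono almost_orthogonality paraproduct_bound h) auto
  also have "\<dots> = ennreal (square_function_const CARD('n) a * B\<^sup>2) * energy lborel h"
    using square_orthogonality_const_nonneg[OF a_pos, of "CARD('n)"] carleson_const_pos[OF a_pos, of "CARD('n)"]
    by (simp add: square_function_const_def ennreal_mult distrib_right mult.assoc)
  finally show ?thesis .
qed

lemma energy_square_function_le:
  assumes h: "square_integrable lborel h"
  shows "energy (lborel \<Otimes>\<^sub>M scale_measure) (\<lambda>v. \<integral>z. (if 0 < snd v then L (snd v, fst v, z) else 0) * h z \<partial>lborel)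
    \<le> ennreal ((sqrt (square_function_const CARD('n) a) * B)\<^sup>2) * energy lborel h"
proof -
  note [measurable] = borel_measurable_square_integrable_lborel[OF h]
  have "energy (lborel \<Otimes>\<^sub>M scale_measure) (\<lambda>v. \<integral>z. (if 0 < snd v then L (snd v, fst v, z) else 0) * h z \<partial>lborel)
    = (\<integral>\<^sup>+y. energy scale_measure (\<lambda>t. \<integral>z. (if 0 < t then L (t, y, z) else 0) * h z \<partial>lborel) \<partial>lborel)"
    by (subst lborel_scale.energy_fst[symmetric]) (simp_all cong: if_cong)
  also have "\<dots> = (\<integral>\<^sup>+y. energy scale_measure (\<lambda>t. \<integral>z. L (t, y, z) * h z \<partial>lborel) \<partial>lborel)"
    by (intro nn_integral_cong nn_integral_scale_cong) simp
  also have "\<dots> \<le> ennreal (square_function_const CARD('n) a * B\<^sup>2) * energy lborel h"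
    by (rule square_function_bound[OF h])
  finally show ?thesis
    using square_function_const_pos[OF a_pos, of "CARD('n)"] by (simp add: power_mult_distrib)
qed

lemma energy_paraproduct_le:
  assumes h: "square_integrable lborel h"
  shows "energy (lborel \<Otimes>\<^sub>M scale_measure) (\<lambda>v. \<integral>w.
      (if 0 < snd v then (\<integral>z. L (snd v, fst v, z) \<partial>lborel) * dyadic_kernel (scale_index (snd v)) (fst v) w else 0)
        * h w \<partial>lborel)
    \<le> ennreal ((sqrt (4 * carleson_const CARD('n) a) * B)\<^sup>2) * energy lborel h"
proof -
  note [measurable] = borel_measurable_square_integrable_lborel[OF h]
  have "energy (lborel \<Otimes>\<^sub>M scale_measure) (\<lambda>v. \<integral>w.
      (if 0 < snd v then (\<integral>z. L (snd v, fst v, z) \<partial>lborel) * dyadic_kernel (scale_index (snd v)) (fst v) w else 0)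
        * h w \<partial>lborel)
    = (\<integral>\<^sup>+y. energy scale_measure (\<lambda>t. \<integral>w.
      (if 0 < t then (\<integral>z. L (t, y, z) \<partial>lborel) * dyadic_kernel (scale_index t) y w else 0) * h w \<partial>lborel) \<partial>lborel)"
    by (subst lborel_scale.energy_fst[symmetric]) (simp_all cong: if_cong)
  also have "\<dots> = (\<integral>\<^sup>+y. energy scale_measure (\<lambda>t. (\<integral>z. L (t, y, z) \<partial>lborel)
    * dyadic_average (scale_index t) h y) \<partial>lborel)"
    by (intro nn_integral_cong nn_integral_scale_cong) (simp add: dyadic_average_def mult.assoc)
  also have "\<dots> \<le> ennreal (4 * carleson_const CARD('n) a * B\<^sup>2) * energy lborel h"
    by (rule paraproduct_bound[OF h])
  finally show ?thesis
    using carleson_const_pos[OF a_pos, of "CARD('n)"] by (simp add: power_mult_distrib)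
qed

end

subsection \<open>Bi-parameter kernels\<close>

definition swap_kernel ::
  "(real \<times> real \<times> ('a \<times> 'b) \<times> ('a \<times> 'b) \<Rightarrow> real) \<Rightarrow> real \<times> real \<times> ('b \<times> 'a) \<times> ('b \<times> 'a) \<Rightarrow> real" where
  "swap_kernel K = (\<lambda>(t2, t1, y, z). K (t1, t2, prod.swap y, prod.swap z))"

lemma swap_kernel_apply [simp]: "swap_kernel K (t2, t1, y, z) = K (t1, t2, prod.swap y, prod.swap z)"
  by (simp add: swap_kernel_def)

locale product_kernel =
  fixes K :: "real \<times> real \<times> ((real^'n) \<times> (real^'m)) \<times> ((real^'n) \<times> (real^'m)) \<Rightarrow> real" and A a b :: real
  assumes K_measurable[measurable]: "K \<in> borel_measurable borel"
    and A_pos: "0 < A" and a_pos: "0 < a" and b_pos: "0 < b"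
    and size: "\<And>t1 t2 y1 y2 z1 z2. 0 < t1 \<Longrightarrow> 0 < t2 \<Longrightarrow>
      \<bar>K (t1, t2, (y1, y2), (z1, z2))\<bar> \<le> A * poisson a t1 (y1 - z1) * poisson b t2 (y2 - z2)"
    and holder1: "\<And>t1 t2 y1 y2 z1 z2 z1'. 0 < t1 \<Longrightarrow> 0 < t2 \<Longrightarrow> infnorm (z1 - z1') < t1 / 2 \<Longrightarrow>
      \<bar>K (t1, t2, (y1, y2), (z1, z2)) - K (t1, t2, (y1, y2), (z1', z2))\<bar>
        \<le> A * holder_poisson a t1 (z1 - z1') (y1 - z1) * poisson b t2 (y2 - z2)"
    and holder2: "\<And>t1 t2 y1 y2 z1 z2 z2'. 0 < t1 \<Longrightarrow> 0 < t2 \<Longrightarrow> infnorm (z2 - z2') < t2 / 2 \<Longrightarrow>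
      \<bar>K (t1, t2, (y1, y2), (z1, z2)) - K (t1, t2, (y1, y2), (z1, z2'))\<bar>
        \<le> A * poisson a t1 (y1 - z1) * holder_poisson b t2 (z2 - z2') (y2 - z2)"
    and holder12: "\<And>t1 t2 y1 y2 z1 z2 z1' z2'. 0 < t1 \<Longrightarrow> 0 < t2 \<Longrightarrow>
      infnorm (z1 - z1') < t1 / 2 \<Longrightarrow> infnorm (z2 - z2') < t2 / 2 \<Longrightarrow>
      \<bar>K (t1, t2, (y1, y2), (z1, z2)) - K (t1, t2, (y1, y2), (z1, z2'))
        - K (t1, t2, (y1, y2), (z1', z2)) + K (t1, t2, (y1, y2), (z1', z2'))\<bar>
        \<le> A * holder_poisson a t1 (z1 - z1') (y1 - z1) * holder_poisson b t2 (z2 - z2') (y2 - z2)"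
begin

lemma product_kernel_swap: "product_kernel (swap_kernel K) A b a"
proof (rule product_kernel.intro)
  show "swap_kernel K \<in> borel_measurable borel"
    unfolding swap_kernel_def prod.swap_def borel_prod[symmetric] by measurable
  show "\<bar>swap_kernel K (t2, t1, (y2, y1), (z2, z1)) - swap_kernel K (t2, t1, (y2, y1), (z2, z1'))
      - swap_kernel K (t2, t1, (y2, y1), (z2', z1)) + swap_kernel K (t2, t1, (y2, y1), (z2', z1'))\<bar>
    \<le> A * holder_poisson b t2 (z2 - z2') (y2 - z2) * holder_poisson a t1 (z1 - z1') (y1 - z1)"
    if "0 < t2" "0 < t1" "infnorm (z2 - z2') < t2 / 2" "infnorm (z1 - z1') < t1 / 2" for t1 t2 y1 y2 z1 z2 z1' z2'
    using holder12[OF that(2,1,4,3), of y1 y2] by (simp add: algebra_simps)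
qed (use A_pos a_pos b_pos size holder1 holder2 in \<open>simp_all add: mult_ac\<close>)

definition first_slice :: "real \<Rightarrow> (real^'m) \<times> (real^'m) \<times> ((real^'n) \<times> real) \<times> (real^'n) \<Rightarrow> real" where
  "first_slice t2 = (\<lambda>(y2, z2, v, z1). if 0 < snd v then K (snd v, t2, (fst v, y2), (z1, z2)) else 0)"

definition first_integral :: "real \<Rightarrow> real \<Rightarrow> real^'n \<Rightarrow> real^'m \<Rightarrow> real^'m \<Rightarrow> real" where
  "first_integral t1 t2 y1 y2 z2 = (\<integral>z1. K (t1, t2, (y1, y2), (z1, z2)) \<partial>lborel)"

definition first_paraproduct :: "real \<Rightarrow> (real^'m) \<times> (real^'m) \<times> ((real^'n) \<times> real) \<times> (real^'n) \<Rightarrow> real" where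
  "first_paraproduct t2 = (\<lambda>(y2, z2, v, z1). if 0 < snd v
    then first_integral (snd v) t2 (fst v) y2 z2 * dyadic_kernel (scale_index (snd v)) (fst v) z1 else 0)"

lemma borel_measurable_first_integral [measurable (raw)]:
  assumes [measurable]: "T1 \<in> borel_measurable M" "T2 \<in> borel_measurable M" "f \<in> borel_measurable M"
    "g \<in> borel_measurable M" "h \<in> borel_measurable M"
  shows "(\<lambda>x. first_integral (T1 x) (T2 x) (f x) (g x) (h x)) \<in> borel_measurable M"
  unfolding first_integral_def by measurable

lemma borel_measurable_first_slice:
  "first_slice t2 \<in> borel_measurable (lborel \<Otimes>\<^sub>M lborel \<Otimes>\<^sub>M (lborel \<Otimes>\<^sub>M scale_measure) \<Otimes>\<^sub>M lborel)"
  unfolding first_slice_def by measurable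

lemma borel_measurable_first_paraproduct:
  "first_paraproduct t2 \<in> borel_measurable (lborel \<Otimes>\<^sub>M lborel \<Otimes>\<^sub>M (lborel \<Otimes>\<^sub>M scale_measure) \<Otimes>\<^sub>M lborel)"
  unfolding first_paraproduct_def by measurable

lemma integrable_first_variable:
  assumes t: "0 < t1" "0 < t2"
  shows "integrable lborel (\<lambda>z1. K (t1, t2, (y1, y2), (z1, z2)))"
proof (rule Bochner_Integration.integrable_bound)
  show "integrable lborel (\<lambda>z1. (A * poisson b t2 (y2 - z2)) * poisson a t1 (y1 - z1))"
    by (intro integrable_mult_right integrable_poisson t a_pos)
  show "AE z1 in lborel. norm (K (t1, t2, (y1, y2), (z1, z2)))
    \<le> norm ((A * poisson b t2 (y2 - z2)) * poisson a t1 (y1 - z1))"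
    using size[OF t, of y1 y2 _ z2] A_pos by (simp add: abs_mult mult_ac)
qed measurable

lemma first_integral_abs_le:
  assumes t: "0 < t1" "0 < t2"
  shows "\<bar>first_integral t1 t2 y1 y2 z2\<bar> \<le> A * poisson_mass CARD('n) a * poisson b t2 (y2 - z2)"
proof -
  have "\<bar>first_integral t1 t2 y1 y2 z2\<bar> \<le> (\<integral>z1. \<bar>K (t1, t2, (y1, y2), (z1, z2))\<bar> \<partial>lborel)"
    unfolding first_integral_def by (rule integral_abs_bound)
  also have "\<dots> \<le> (\<integral>z1. (A * poisson b t2 (y2 - z2)) * poisson a t1 (y1 - z1) \<partial>lborel)"
    using size[OF t, of y1 y2 _ z2]
    by (intro integral_mono integrable_abs integrable_first_variable t integrable_mult_right integrable_poisson a_pos)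
      (simp add: mult_ac)
  also have "\<dots> \<le> (A * poisson b t2 (y2 - z2)) * poisson_mass CARD('n) a"
    using A_pos by (simp add: mult_left_mono integral_poisson_le[OF t(1) a_pos])
  finally show ?thesis by (simp add: mult_ac)
qed

end

text \<open>Only the testing conditions in the first variable; those in the second one are stated for the swapped kernel.\<close>

locale first_variable_kernel = product_kernel K A a b
  for K :: "real \<times> real \<times> ((real^'n) \<times> (real^'m)) \<times> ((real^'n) \<times> (real^'m)) \<Rightarrow> real" and A a b +
  assumes testing: "\<And>t2 y2 z2. 0 < t2 \<Longrightarrow>
      cube_testing (\<lambda>(t1, y1, z1). K (t1, t2, (y1, y2), (z1, z2))) (A * poisson b t2 (y2 - z2))"
    and testing_difference: "\<And>t2 y2 z2 z2'. 0 < t2 \<Longrightarrow> infnorm (z2 - z2') < t2 / 2 \<Longrightarrow> z2 \<noteq> z2' \<Longrightarrow>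
      cube_testing (\<lambda>(t1, y1, z1). K (t1, t2, (y1, y2), (z1, z2)) - K (t1, t2, (y1, y2), (z1, z2')))
        (A * holder_poisson b t2 (z2 - z2') (y2 - z2))"
begin

lemma one_parameter_slice:
  assumes t2: "0 < t2"
  shows "one_parameter_kernel (\<lambda>(t1, y1, z1). K (t1, t2, (y1, y2), (z1, z2))) (A * poisson b t2 (y2 - z2)) a"
proof (rule one_parameter_kernel.intro)
  show "(\<lambda>(t1, y1, z1). K (t1, t2, (y1, y2), (z1, z2))) \<in> borel_measurable borel"
    unfolding borel_prod[symmetric] by measurable
  show "0 < A * poisson b t2 (y2 - z2)" using A_pos poisson_pos[OF t2, of b "y2 - z2"] by simp
qed (use a_pos size[OF _ t2] holder1[OF _ t2] testing[OF t2] in \<open>simp_all add: mult_ac\<close>)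

lemma one_parameter_slice_difference:
  assumes t2: "0 < t2" and d: "infnorm (z2 - z2') < t2 / 2" "z2 \<noteq> z2'"
  shows "one_parameter_kernel (\<lambda>(t1, y1, z1). K (t1, t2, (y1, y2), (z1, z2)) - K (t1, t2, (y1, y2), (z1, z2')))
    (A * holder_poisson b t2 (z2 - z2') (y2 - z2)) a"
proof (rule one_parameter_kernel.intro)
  show "(\<lambda>(t1, y1, z1). K (t1, t2, (y1, y2), (z1, z2)) - K (t1, t2, (y1, y2), (z1, z2'))) \<in> borel_measurable borel"
    unfolding borel_prod[symmetric] by measurable
  show "0 < A * holder_poisson b t2 (z2 - z2') (y2 - z2)" using A_pos holder_poisson_pos[OF t2 d(2)] by simp
  fix t1 :: real and y1 z1 z1' :: "real^'n" assume t1: "0 < t1" and d1: "infnorm (z1 - z1') < t1 / 2"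
  show "\<bar>(case (t1, y1, z1) of (t1, y1, z1) \<Rightarrow> K (t1, t2, (y1, y2), (z1, z2)) - K (t1, t2, (y1, y2), (z1, z2')))
     - (case (t1, y1, z1') of (t1, y1, z1) \<Rightarrow> K (t1, t2, (y1, y2), (z1, z2)) - K (t1, t2, (y1, y2), (z1, z2')))\<bar>
     \<le> A * holder_poisson b t2 (z2 - z2') (y2 - z2) * holder_poisson a t1 (z1 - z1') (y1 - z1)"
    using holder12[OF t1 t2 d1 d(1), of y1 y2] by (simp add: algebra_simps)
qed (use a_pos holder2[OF _ t2 d(1)] testing_difference[OF t2 d] in \<open>simp_all add: mult_ac\<close>)

lemma operator_kernel_first_slice:
  assumes t2: "0 < t2"
  shows "operator_kernel lborel (lborel \<Otimes>\<^sub>M scale_measure) (first_slice t2)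
    (\<lambda>v z1. if 0 < snd v then A * poisson a (snd v) (fst v - z1) else 0)
    (A * sqrt (square_function_const CARD('n) a)) b t2 (scale_index t2)"
proof (rule operator_kernel.intro)
  show "0 < A * sqrt (square_function_const CARD('n) a)" using A_pos square_function_const_pos[OF a_pos] by simp
  show "\<bar>first_slice t2 (y, z, v, w)\<bar>
    \<le> poisson b t2 (y - z) * (if 0 < snd v then A * poisson a (snd v) (fst v - w) else 0)" for y z v w
    using size[OF _ t2, of "snd v" "fst v" y w z] by (simp add: first_slice_def mult_ac)
  show "square_integrable lborel (\<lambda>z1. if 0 < snd v then A * poisson a (snd v) (fst v - z1) else 0)"
    for v :: "(real^'n) \<times> real"
    using square_integrable_cmult[OF square_integrable_poisson[OF _ a_pos, of "snd v" "fst v"], of A]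
    by (cases "0 < snd v") (simp_all add: square_integrable_def)
  fix y z :: "real^'m" and h :: "real^'n \<Rightarrow> real" assume h: "square_integrable lborel h"
  show "energy (lborel \<Otimes>\<^sub>M scale_measure) (\<lambda>v. \<integral>w. first_slice t2 (y, z, v, w) * h w \<partial>lborel)
    \<le> ennreal ((A * sqrt (square_function_const CARD('n) a) * poisson b t2 (y - z))\<^sup>2) * energy lborel h"
    using one_parameter_kernel.energy_square_function_le[OF one_parameter_slice[OF t2, of y z] h]
    by (simp add: first_slice_def mult_ac cong: if_cong)
  fix z' assume d: "infnorm (z - z') < t2 / 2" "z \<noteq> z'"
  have "first_slice t2 (y, z, v, w) - first_slice t2 (y, z', v, w)
    = (if 0 < snd v then K (snd v, t2, (fst v, y), (w, z)) - K (snd v, t2, (fst v, y), (w, z')) else 0)" for v w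
    by (simp add: first_slice_def)
  then show "energy (lborel \<Otimes>\<^sub>M scale_measure) (\<lambda>v. \<integral>w. (first_slice t2 (y, z, v, w) - first_slice t2 (y, z', v, w))
    * h w \<partial>lborel)
    \<le> ennreal ((A * sqrt (square_function_const CARD('n) a) * holder_poisson b t2 (z - z') (y - z))\<^sup>2)
      * energy lborel h"
    using one_parameter_kernel.energy_square_function_le[OF one_parameter_slice_difference[OF t2 d, of y] h]
    by (simp add: mult_ac cong: if_cong)
qed (use b_pos borel_measurable_first_slice scale_index_bounds[OF t2] lborel_scale.sigma_finite_measure_axioms in
    \<open>auto intro: sigma_finite_lborel\<close>)

lemma operator_kernel_first_paraproduct:
  assumes t2: "0 < t2"
  shows "operator_kernel lborel (lborel \<Otimes>\<^sub>M scale_measure) (first_paraproduct t2)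
    (\<lambda>v z1. if 0 < snd v then A * poisson_mass CARD('n) a * dyadic_kernel (scale_index (snd v)) (fst v) z1 else 0)
    (A * sqrt (4 * carleson_const CARD('n) a)) b t2 (scale_index t2)"
proof (rule operator_kernel.intro)
  show "0 < A * sqrt (4 * carleson_const CARD('n) a)" using A_pos carleson_const_pos[OF a_pos] by simp
  show "\<bar>first_paraproduct t2 (y, z, v, w)\<bar> \<le> poisson b t2 (y - z)
      * (if 0 < snd v then A * poisson_mass CARD('n) a * dyadic_kernel (scale_index (snd v)) (fst v) w else 0)"
        for y z v w
    using mult_right_mono[OF first_integral_abs_le[OF _ t2, of "snd v" "fst v" y z]
      dyadic_kernel_nonneg[of "scale_index (snd v)" "fst v" w]]
    by (simp add: first_paraproduct_def abs_mult mult_ac)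
  show "square_integrable lborel
      (\<lambda>z1. if 0 < snd v then A * poisson_mass CARD('n) a * dyadic_kernel (scale_index (snd v)) (fst v) z1 else 0)"
        for v :: "(real^'n) \<times> real"
    using square_integrable_cmult[OF square_integrable_dyadic_kernel[of "scale_index (snd v)" "fst v"],
      of "A * poisson_mass CARD('n) a"]
    by (cases "0 < snd v") (simp_all add: square_integrable_def)
  fix y z :: "real^'m" and h :: "real^'n \<Rightarrow> real" assume h: "square_integrable lborel h"
  show "energy (lborel \<Otimes>\<^sub>M scale_measure) (\<lambda>v. \<integral>w. first_paraproduct t2 (y, z, v, w) * h w \<partial>lborel)
    \<le> ennreal ((A * sqrt (4 * carleson_const CARD('n) a) * poisson b t2 (y - z))\<^sup>2) * energy lborel h"
    using one_parameter_kernel.energy_paraproduct_le[OF one_parameter_slice[OF t2, of y z] h]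
    by (simp add: first_paraproduct_def first_integral_def mult_ac cong: if_cong)
  fix z' assume d: "infnorm (z - z') < t2 / 2" "z \<noteq> z'"
  have "first_paraproduct t2 (y, z, v, w) - first_paraproduct t2 (y, z', v, w)
    = (if 0 < snd v then (\<integral>z1. K (snd v, t2, (fst v, y), (z1, z)) - K (snd v, t2, (fst v, y), (z1, z')) \<partial>lborel)
        * dyadic_kernel (scale_index (snd v)) (fst v) w else 0)" for v w
    using t2 by (simp add: first_paraproduct_def first_integral_def left_diff_distrib integrable_first_variable)
  then show "energy (lborel \<Otimes>\<^sub>M scale_measure)
    (\<lambda>v. \<integral>w. (first_paraproduct t2 (y, z, v, w) - first_paraproduct t2 (y, z', v, w)) * h w \<partial>lborel)
    \<le> ennreal ((A * sqrt (4 * carleson_const CARD('n) a) * holder_poisson b t2 (z - z') (y - z))\<^sup>2) * energy lborel h"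
    using one_parameter_kernel.energy_paraproduct_le[OF one_parameter_slice_difference[OF t2 d, of y] h]
    by (simp add: mult_ac cong: if_cong)
qed (use b_pos borel_measurable_first_paraproduct scale_index_bounds[OF t2]
  lborel_scale.sigma_finite_measure_axioms in
    \<open>auto intro: sigma_finite_lborel\<close>)

end

subsection \<open>Bi-parameter energies\<close>

abbreviation scale_energy :: "(real \<Rightarrow> real \<Rightarrow> 'a::euclidean_space \<Rightarrow> real) \<Rightarrow> ennreal" where
  "scale_energy T \<equiv> \<integral>\<^sup>+t1. \<integral>\<^sup>+t2. energy lborel (T t1 t2) \<partial>scale_measure \<partial>scale_measure"

definition second_fluctuation :: "int \<Rightarrow> ('a \<times> (real^'m) \<Rightarrow> real) \<Rightarrow> real^'m \<Rightarrow> 'a \<times> (real^'m) \<Rightarrow> real" where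
  "second_fluctuation k f y2 p = f p - dyadic_average k (\<lambda>z. f (fst p, z)) y2"

lemma nn_integral_lborel_fst:
  fixes f :: "'a::euclidean_space \<times> 'b::euclidean_space \<Rightarrow> ennreal"
  shows "f \<in> borel_measurable borel \<Longrightarrow> (\<integral>\<^sup>+y. f y \<partial>lborel) = (\<integral>\<^sup>+y1. \<integral>\<^sup>+y2. f (y1, y2) \<partial>lborel \<partial>lborel)"
  unfolding lborel_prod[symmetric] by (subst lborel.nn_integral_fst) (simp_all add: lborel_prod)

lemma nn_integral_lborel_snd:
  fixes f :: "'a::euclidean_space \<times> 'b::euclidean_space \<Rightarrow> ennreal"
  shows "f \<in> borel_measurable borel \<Longrightarrow> (\<integral>\<^sup>+y. f y \<partial>lborel) = (\<integral>\<^sup>+y2. \<integral>\<^sup>+y1. f (y1, y2) \<partial>lborel \<partial>lborel)"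
  unfolding lborel_prod[symmetric] by (subst lborel_pair.nn_integral_snd) (simp_all add: lborel_prod)

lemma energy_lborel_swap:
  fixes f :: "'a::euclidean_space \<times> 'b::euclidean_space \<Rightarrow> real"
  assumes [measurable]: "f \<in> borel_measurable borel"
  shows "energy lborel (\<lambda>y. f (prod.swap y)) = energy lborel f"
proof -
  have [measurable]: "(\<lambda>y. f (prod.swap y)) \<in> borel_measurable borel"
    unfolding prod.swap_def by measurable
  show ?thesis by (subst nn_integral_lborel_fst, simp) (simp add: nn_integral_lborel_snd[of "\<lambda>y. ennreal ((f y)\<^sup>2)"])
qed

lemma measurable_compose_curried3:
  assumes "(\<lambda>(x, y, z). T x y z) \<in> M1 \<Otimes>\<^sub>M M2 \<Otimes>\<^sub>M M3 \<rightarrow>\<^sub>M N" "f \<in> M \<rightarrow>\<^sub>M M1" "g \<in> M \<rightarrow>\<^sub>M M2" "h \<in> M \<rightarrow>\<^sub>M M3"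
  shows "(\<lambda>x. T (f x) (g x) (h x)) \<in> M \<rightarrow>\<^sub>M N"
  using measurable_compose[OF measurable_Pair[OF assms(2) measurable_Pair[OF assms(3,4)]] assms(1)] by simp

lemma scale_energy_swap:
  fixes T :: "real \<Rightarrow> real \<Rightarrow> 'a::euclidean_space \<times> 'b::euclidean_space \<Rightarrow> real"
  assumes T: "(\<lambda>(t1, t2, y). T t1 t2 y) \<in> borel_measurable (borel \<Otimes>\<^sub>M borel \<Otimes>\<^sub>M borel)"
  shows "scale_energy (\<lambda>t2 t1 y. T t1 t2 (prod.swap y)) = scale_energy T"
proof -
  note [measurable (raw)] = measurable_compose_curried3[OF T]
  have "T t1 t2 \<in> borel_measurable borel" for t1 t2 by measurable
  then have "scale_energy (\<lambda>t2 t1 y. T t1 t2 (prod.swap y))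
    = (\<integral>\<^sup>+t2. \<integral>\<^sup>+t1. energy lborel (T t1 t2) \<partial>scale_measure \<partial>scale_measure)"
    by (simp add: energy_lborel_swap)
  also have "\<dots> = scale_energy T"
    by (rule scale_scale.Fubini') measurable
  finally show ?thesis .
qed

lemma scale_energy_eq_slices:
  fixes T :: "real \<Rightarrow> real \<Rightarrow> 'a::euclidean_space \<times> 'b::euclidean_space \<Rightarrow> real"
  assumes T: "(\<lambda>(t1, t2, y). T t1 t2 y) \<in> borel_measurable (borel \<Otimes>\<^sub>M borel \<Otimes>\<^sub>M borel)"
  shows "scale_energy T
    = (\<integral>\<^sup>+t2. energy (lborel \<Otimes>\<^sub>M (lborel \<Otimes>\<^sub>M scale_measure)) (\<lambda>q. T (snd (snd q)) t2 (fst (snd q), fst q))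
      \<partial>scale_measure)"
proof -
  note [measurable (raw)] = measurable_compose_curried3[OF T]
  interpret target: pair_sigma_finite "lborel :: 'b measure" "(lborel :: 'a measure) \<Otimes>\<^sub>M scale_measure"
    by (intro pair_sigma_finite.intro sigma_finite_lborel lborel_scale.sigma_finite_measure_axioms)
  have "scale_energy T = (\<integral>\<^sup>+t2. \<integral>\<^sup>+t1. energy lborel (T t1 t2) \<partial>scale_measure \<partial>scale_measure)"
    by (rule scale_scale.Fubini') measurable
  also have "\<dots> = (\<integral>\<^sup>+t2. energy (lborel \<Otimes>\<^sub>M (lborel \<Otimes>\<^sub>M scale_measure)) (\<lambda>q. T (snd (snd q)) t2 (fst (snd q), fst q))
    \<partial>scale_measure)"
  proof (rule nn_integral_cong)
    fix t2
    have "(\<integral>\<^sup>+t1. energy lborel (T t1 t2) \<partial>scale_measure)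
      = (\<integral>\<^sup>+t1. \<integral>\<^sup>+y2. \<integral>\<^sup>+y1. ennreal ((T t1 t2 (y1, y2))\<^sup>2) \<partial>lborel \<partial>lborel \<partial>scale_measure)"
      by (intro nn_integral_cong nn_integral_lborel_snd) measurable
    also have "\<dots> = (\<integral>\<^sup>+y2. \<integral>\<^sup>+t1. \<integral>\<^sup>+y1. ennreal ((T t1 t2 (y1, y2))\<^sup>2) \<partial>lborel \<partial>scale_measure \<partial>lborel)"
      by (rule lborel_scale.Fubini') measurable
    also have "\<dots> = (\<integral>\<^sup>+y2. \<integral>\<^sup>+y1. \<integral>\<^sup>+t1. ennreal ((T t1 t2 (y1, y2))\<^sup>2) \<partial>scale_measure \<partial>lborel \<partial>lborel)"
      by (intro nn_integral_cong lborel_scale.Fubini') measurable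
    also have "\<dots> = (\<integral>\<^sup>+y2. energy (lborel \<Otimes>\<^sub>M scale_measure) (\<lambda>v. T (snd v) t2 (fst v, y2)) \<partial>lborel)"
      by (intro nn_integral_cong) (subst lborel_scale.energy_fst[symmetric], simp_all)
    also have "\<dots> = energy (lborel \<Otimes>\<^sub>M (lborel \<Otimes>\<^sub>M scale_measure)) (\<lambda>q. T (snd (snd q)) t2 (fst (snd q), fst q))"
      by (subst target.energy_fst[symmetric]) simp_all
    finally show "(\<integral>\<^sup>+t1. energy lborel (T t1 t2) \<partial>scale_measure)
      = energy (lborel \<Otimes>\<^sub>M (lborel \<Otimes>\<^sub>M scale_measure)) (\<lambda>q. T (snd (snd q)) t2 (fst (snd q), fst q))" .
  qed
  finally show ?thesis .
qed

lemma borel_measurable_second_fluctuation [measurable (raw)]: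
  fixes f :: "'a::euclidean_space \<times> (real^'m) \<Rightarrow> real"
  assumes [measurable]: "f \<in> borel_measurable borel" "T \<in> borel_measurable M" "g \<in> borel_measurable M"
    "p \<in> borel_measurable M"
  shows "(\<lambda>x. second_fluctuation (scale_index (T x)) f (g x) (p x)) \<in> borel_measurable M"
  unfolding second_fluctuation_def by measurable

lemma scale_energy_second_fluctuation_le:
  fixes f :: "(real^'n) \<times> (real^'m) \<Rightarrow> real"
    and P :: "real \<Rightarrow> (real^'m) \<times> (real^'m) \<times> ((real^'n) \<times> real) \<times> (real^'n) \<Rightarrow> real"
  assumes f: "square_integrable lborel f"
    and P[measurable]: "(\<lambda>(t2, q). P t2 q) \<in> borel_measurable (borel \<Otimes>\<^sub>M borel)"
    and op: "\<And>t2. 0 < t2 \<Longrightarrow> operator_kernel lborel (lborel \<Otimes>\<^sub>M scale_measure) (P t2) (\<phi> t2) C b t2 (scale_index t2)"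
  shows "scale_energy (\<lambda>t1 t2 y. \<integral>p. P t2 (snd y, snd p, (fst y, t1), fst p)
    * second_fluctuation (scale_index t2) f (snd y) p \<partial>lborel)
    \<le> ennreal (square_orthogonality_const CARD('m) b * C\<^sup>2) * energy lborel f"
    (is "scale_energy ?T \<le> _")
proof -
  note [measurable] = borel_measurable_square_integrable_lborel[OF f]
  let ?F = "\<lambda>p. f (snd p, fst p)"
  have kernel_op: "kernel_op lborel (P t2) (\<lambda>q. ?F (snd q) - frozen_average (scale_index t2) ?F q) q
    = ?T (snd (snd q)) t2 (fst (snd q), fst q)" for t2 and q :: "(real^'m) \<times> (real^'n) \<times> real"
  proof -
    let ?g = "\<lambda>p. P t2 (fst q, snd p, snd q, fst p) * second_fluctuation (scale_index t2) f (fst q) p"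
    have "?g \<in> borel_measurable lborel" by measurable
    then have "?g \<in> borel_measurable (lborel \<Otimes>\<^sub>M lborel)" unfolding lborel_prod .
    from lborel_pair.integral_product_swap[OF this]
    show ?thesis
      by (simp add: kernel_op_def frozen_average_def second_fluctuation_def split_beta' lborel_prod)
  qed
  have energy: "energy (lborel \<Otimes>\<^sub>M lborel) ?F = energy lborel f"
    using energy_lborel_swap[of f] by (simp add: prod.swap_def lborel_prod)
  then have F: "square_integrable (lborel \<Otimes>\<^sub>M lborel) ?F"
    using energy_finite[OF f] by (simp add: square_integrable_def)
  have "scale_energy ?T = (\<integral>\<^sup>+t2. energy (lborel \<Otimes>\<^sub>M (lborel \<Otimes>\<^sub>M scale_measure))
    (\<lambda>q. ?T (snd (snd q)) t2 (fst (snd q), fst q)) \<partial>scale_measure)"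
    by (rule scale_energy_eq_slices) measurable
  also have "\<dots> \<le> ennreal (square_orthogonality_const CARD('m) b * C\<^sup>2) * energy (lborel \<Otimes>\<^sub>M lborel) ?F"
    using square_function_almost_orthogonality[OF op F] by (simp only: kernel_op)
  finally show ?thesis unfolding energy .
qed

context first_variable_kernel
begin

lemma first_slice_almost_orthogonality:
  assumes f: "square_integrable lborel f"
  shows "scale_energy (\<lambda>t1 t2 y. \<integral>p. K (t1, t2, y, p) * second_fluctuation (scale_index t2) f (snd y) p \<partial>lborel)
    \<le> ennreal (square_orthogonality_const CARD('m) b * (A * sqrt (square_function_const CARD('n) a))\<^sup>2)
      * energy lborel f"
proof -
  have "(\<lambda>(t2, q). first_slice t2 q) \<in> borel_measurable (borel \<Otimes>\<^sub>M borel)"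
    unfolding first_slice_def by measurable
  from scale_energy_second_fluctuation_le[OF f this operator_kernel_first_slice]
  have "scale_energy (\<lambda>t1 t2 y. \<integral>p. first_slice t2 (snd y, snd p, (fst y, t1), fst p)
      * second_fluctuation (scale_index t2) f (snd y) p \<partial>lborel)
    \<le> ennreal (square_orthogonality_const CARD('m) b * (A * sqrt (square_function_const CARD('n) a))\<^sup>2)
      * energy lborel f" .
  moreover have "scale_energy (\<lambda>t1 t2 y. \<integral>p. K (t1, t2, y, p)
    * second_fluctuation (scale_index t2) f (snd y) p \<partial>lborel)
    = scale_energy (\<lambda>t1 t2 y. \<integral>p. first_slice t2 (snd y, snd p, (fst y, t1), fst p)
      * second_fluctuation (scale_index t2) f (snd y) p \<partial>lborel)"
    by (intro nn_integral_scale_cong) (simp add: first_slice_def)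
  ultimately show ?thesis by simp
qed

lemma first_paraproduct_almost_orthogonality:
  assumes f: "square_integrable lborel f"
  shows "scale_energy (\<lambda>t1 t2 y. \<integral>p. first_integral t1 t2 (fst y) (snd y) (snd p)
    * dyadic_kernel (scale_index t1) (fst y) (fst p)
      * second_fluctuation (scale_index t2) f (snd y) p \<partial>lborel)
    \<le> ennreal (square_orthogonality_const CARD('m) b * (A * sqrt (4 * carleson_const CARD('n) a))\<^sup>2) * energy lborel f"
proof -
  have "(\<lambda>(t2, q). first_paraproduct t2 q) \<in> borel_measurable (borel \<Otimes>\<^sub>M borel)"
    unfolding first_paraproduct_def by measurable
  from scale_energy_second_fluctuation_le[OF f this operator_kernel_first_paraproduct]
  have "scale_energy (\<lambda>t1 t2 y. \<integral>p. first_paraproduct t2 (snd y, snd p, (fst y, t1), fst p)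
      * second_fluctuation (scale_index t2) f (snd y) p \<partial>lborel)
    \<le> ennreal (square_orthogonality_const CARD('m) b * (A * sqrt (4 * carleson_const CARD('n) a))\<^sup>2)
      * energy lborel f" .
  moreover have "scale_energy (\<lambda>t1 t2 y. \<integral>p. first_integral t1 t2 (fst y) (snd y) (snd p)
    * dyadic_kernel (scale_index t1) (fst y) (fst p)
      * second_fluctuation (scale_index t2) f (snd y) p \<partial>lborel)
    = scale_energy (\<lambda>t1 t2 y. \<integral>p. first_paraproduct t2 (snd y, snd p, (fst y, t1), fst p)
      * second_fluctuation (scale_index t2) f (snd y) p \<partial>lborel)"
    by (intro nn_integral_scale_cong) (simp add: first_paraproduct_def)
  ultimately show ?thesis by simp
qed

end

subsection \<open>Rectangle averages and the strong maximal function\<close>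

definition rectangle_average :: "int \<Rightarrow> int \<Rightarrow> ((real^'n) \<times> (real^'m) \<Rightarrow> real) \<Rightarrow> (real^'n) \<times> (real^'m) \<Rightarrow> real" where
  "rectangle_average k1 k2 f y = dyadic_average k1 (\<lambda>w. dyadic_average k2 (\<lambda>z. f (w, z)) (snd y)) (fst y)"

definition strong_dyadic_maximal :: "((real^'n) \<times> (real^'m) \<Rightarrow> ennreal) \<Rightarrow> (real^'n) \<times> (real^'m) \<Rightarrow> ennreal" where
  "strong_dyadic_maximal f y = dyadic_maximal (\<lambda>w. dyadic_maximal (\<lambda>z. f (w, z)) (snd y)) (fst y)"

lemma rectangle_average_cong:
  assumes "dyadic_corner k1 (fst y) = dyadic_corner k1 (fst z)" "dyadic_corner k2 (snd y) = dyadic_corner k2 (snd z)"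
  shows "rectangle_average k1 k2 f y = rectangle_average k1 k2 f z"
  unfolding rectangle_average_def
  using dyadic_constantD[OF dyadic_constant_dyadic_average assms(1)]
    dyadic_constantD[OF dyadic_constant_dyadic_average assms(2)]
  by simp

lemma rectangle_average_level_set_saturated:
  assumes "y \<in> {y. P (rectangle_average k1 k2 f y)}"
  shows "dyadic_cube k1 (fst y) \<times> dyadic_cube k2 (snd y) \<subseteq> {y. P (rectangle_average k1 k2 f y)}"
proof
  fix z assume "z \<in> dyadic_cube k1 (fst y) \<times> dyadic_cube k2 (snd y)"
  then have "rectangle_average k1 k2 f z = rectangle_average k1 k2 f y" by (intro rectangle_average_cong) auto
  then show "z \<in> {y. P (rectangle_average k1 k2 f y)}" using assms by simp
qed

lemma rectangle_average_abs_le: "ennreal \<bar>rectangle_average k1 k2 f y\<bar> \<le> strong_dyadic_maximal (\<lambda>z. ennreal \<bar>f z\<bar>) y"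
proof -
  have "ennreal \<bar>rectangle_average k1 k2 f y\<bar>
    \<le> (\<integral>\<^sup>+w. ennreal (dyadic_kernel k1 (fst y) w) * ennreal \<bar>dyadic_average k2 (\<lambda>z. f (w, z)) (snd y)\<bar> \<partial>lborel)"
    unfolding rectangle_average_def by (rule dyadic_average_abs_le)
  also have "\<dots> \<le> (\<integral>\<^sup>+w. ennreal (dyadic_kernel k1 (fst y) w)
    * dyadic_maximal (\<lambda>z. ennreal \<bar>f (w, z)\<bar>) (snd y) \<partial>lborel)"
    by (intro nn_integral_mono mult_left_mono dyadic_average_abs_le_maximal) simp
  also have "\<dots> \<le> strong_dyadic_maximal (\<lambda>z. ennreal \<bar>f z\<bar>) y"
    unfolding strong_dyadic_maximal_def dyadic_maximal_def[of _ "fst y"] by (rule SUP_upper) simp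
  finally show ?thesis .
qed

lemma borel_measurable_strong_dyadic_maximal [measurable]:
  assumes [measurable]: "f \<in> borel_measurable borel"
  shows "strong_dyadic_maximal f \<in> borel_measurable borel"
  unfolding strong_dyadic_maximal_def[abs_def] borel_prod[symmetric] by measurable

lemma borel_measurable_rectangle_average [measurable]:
  assumes [measurable]: "f \<in> borel_measurable borel"
  shows "rectangle_average k1 k2 f \<in> borel_measurable borel"
  unfolding rectangle_average_def[abs_def] borel_prod[symmetric] by measurable

theorem nn_integral_strong_dyadic_maximal_square_le:
  fixes f :: "(real^'n) \<times> (real^'m) \<Rightarrow> ennreal"
  assumes [measurable]: "f \<in> borel_measurable borel"
  shows "(\<integral>\<^sup>+y. (strong_dyadic_maximal f y)\<^sup>2 \<partial>lborel) \<le> 16 * (\<integral>\<^sup>+y. (f y)\<^sup>2 \<partial>lborel)"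
proof -
  let ?g = "\<lambda>y2 w. dyadic_maximal (\<lambda>z. f (w, z)) y2"
  have "(\<integral>\<^sup>+y. (strong_dyadic_maximal f y)\<^sup>2 \<partial>lborel) = (\<integral>\<^sup>+y2. \<integral>\<^sup>+y1. (dyadic_maximal (?g y2) y1)\<^sup>2 \<partial>lborel \<partial>lborel)"
    by (subst nn_integral_lborel_snd) (simp_all add: strong_dyadic_maximal_def)
  also have "\<dots> \<le> (\<integral>\<^sup>+y2. 4 * (\<integral>\<^sup>+w. (?g y2 w)\<^sup>2 \<partial>lborel) \<partial>lborel)"
    by (intro nn_integral_mono nn_integral_dyadic_maximal_square_le) measurable
  also have "\<dots> = 4 * (\<integral>\<^sup>+y2. \<integral>\<^sup>+w. (?g y2 w)\<^sup>2 \<partial>lborel \<partial>lborel)"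
    by (rule nn_integral_cmult) measurable
  also have "(\<integral>\<^sup>+y2. \<integral>\<^sup>+w. (?g y2 w)\<^sup>2 \<partial>lborel \<partial>lborel) = (\<integral>\<^sup>+w. \<integral>\<^sup>+y2. (?g y2 w)\<^sup>2 \<partial>lborel \<partial>lborel)"
    by (rule lborel_pair.Fubini') measurable
  also have "\<dots> \<le> (\<integral>\<^sup>+w. 4 * (\<integral>\<^sup>+z. (f (w, z))\<^sup>2 \<partial>lborel) \<partial>lborel)"
    by (intro nn_integral_mono nn_integral_dyadic_maximal_square_le) measurable
  also have "\<dots> = 4 * (\<integral>\<^sup>+y. (f y)\<^sup>2 \<partial>lborel)"
    by (subst nn_integral_lborel_fst) (simp_all add: nn_integral_cmult)
  finally show ?thesis by (simp add: mult_left_mono mult.assoc[symmetric])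
qed

subsection \<open>The bi-parameter square function estimate\<close>

definition rectangle_carleson ::
  "(real \<times> real \<times> ((real^'n) \<times> (real^'m)) \<times> ((real^'n) \<times> (real^'m)) \<Rightarrow> real) \<Rightarrow> real \<Rightarrow> bool" where
  "rectangle_carleson K D \<longleftrightarrow> (\<forall>S. (\<forall>k1 k2. S k1 k2 \<in> sets borel)
    \<longrightarrow> (\<forall>k1 k2. \<forall>y\<in>S k1 k2. dyadic_cube k1 (fst y) \<times> dyadic_cube k2 (snd y) \<subseteq> S k1 k2)
    \<longrightarrow> emeasure lborel (\<Union>k1 k2. S k1 k2) < \<infinity>
    \<longrightarrow> (\<integral>\<^sup>+t1. \<integral>\<^sup>+t2. (\<integral>\<^sup>+y\<in>S (scale_index t1) (scale_index t2). ennreal ((\<integral>z. K (t1, t2, y, z) \<partial>lborel)\<^sup>2) \<partial>lborel)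
          \<partial>scale_measure \<partial>scale_measure)
        \<le> ennreal D * emeasure lborel (\<Union>k1 k2. S k1 k2))"

definition first_fluctuation :: "int \<Rightarrow> ((real^'n) \<times> 'b \<Rightarrow> real) \<Rightarrow> real^'n \<Rightarrow> (real^'n) \<times> 'b \<Rightarrow> real" where
  "first_fluctuation k f y1 p = f p - dyadic_average k (\<lambda>z. f (z, snd p)) y1"

lemma borel_measurable_first_fluctuation [measurable (raw)]:
  fixes f :: "(real^'n) \<times> 'b::euclidean_space \<Rightarrow> real"
  assumes [measurable]: "f \<in> borel_measurable borel" "T \<in> borel_measurable M" "g \<in> borel_measurable M"
    "p \<in> borel_measurable M"
  shows "(\<lambda>x. first_fluctuation (scale_index (T x)) f (g x) (p x)) \<in> borel_measurable M"
  unfolding first_fluctuation_def by measurable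

lemma nn_integral_scale_scale_lborel:
  fixes f :: "real \<times> real \<times> 'a::euclidean_space \<Rightarrow> ennreal"
  assumes [measurable]: "f \<in> borel_measurable (scale_measure \<Otimes>\<^sub>M scale_measure \<Otimes>\<^sub>M lborel)"
  shows "(\<integral>\<^sup>+p. f p \<partial>(scale_measure \<Otimes>\<^sub>M scale_measure \<Otimes>\<^sub>M lborel))
    = (\<integral>\<^sup>+t1. \<integral>\<^sup>+t2. \<integral>\<^sup>+y. f (t1, t2, y) \<partial>lborel \<partial>scale_measure \<partial>scale_measure)"
  by (subst sigma_finite_measure.nn_integral_fst[OF scale_lborel.sigma_finite_measure_axioms, symmetric], simp, intro
    nn_integral_cong)
    (subst lborel.nn_integral_fst[symmetric], simp_all)

lemma rectangle_carleson_embedding: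
  fixes f :: "(real^'n) \<times> (real^'m) \<Rightarrow> real"
  assumes K[measurable]: "K \<in> borel_measurable borel" and carleson: "rectangle_carleson K D"
    and f: "square_integrable lborel f"
  shows "scale_energy (\<lambda>t1 t2 y. (\<integral>z. K (t1, t2, y, z) \<partial>lborel)
    * rectangle_average (scale_index t1) (scale_index t2) f y)
    \<le> ennreal D * (16 * energy lborel f)"
proof -
  note [measurable] = borel_measurable_square_integrable_lborel[OF f]
  let ?P = "scale_measure \<Otimes>\<^sub>M scale_measure \<Otimes>\<^sub>M (lborel :: ((real^'n) \<times> (real^'m)) measure)"
  let ?w = "\<lambda>p. ennreal ((\<integral>z. K (fst p, fst (snd p), snd (snd p), z) \<partial>lborel)\<^sup>2)"
  let ?u = "\<lambda>k y. ennreal ((rectangle_average (fst k) (snd k) f y)\<^sup>2)"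
    and ?k = "\<lambda>p. (scale_index (fst p), scale_index (fst (snd p)))" and ?y = "\<lambda>p. snd (snd p)"
  let ?G = "\<lambda>y. (strong_dyadic_maximal (\<lambda>z. ennreal \<bar>f z\<bar>) y)\<^sup>2"
  have maximal: "(\<integral>\<^sup>+y. ?G y \<partial>lborel) \<le> 16 * energy lborel f"
    using nn_integral_strong_dyadic_maximal_square_le[of "\<lambda>z. ennreal \<bar>f z\<bar>"] by (simp add: ennreal_power)
  also have "\<dots> < \<infinity>" using energy_finite[OF f] by (simp add: ennreal_mult_less_top)
  finally have finite: "(\<integral>\<^sup>+y. ?G y \<partial>lborel) < \<infinity>" .
  have "scale_energy (\<lambda>t1 t2 y. (\<integral>z. K (t1, t2, y, z) \<partial>lborel)
    * rectangle_average (scale_index t1) (scale_index t2) f y)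
    = (\<integral>\<^sup>+p. ?w p * ?u (?k p) (?y p) \<partial>?P)"
    by (subst nn_integral_scale_scale_lborel) (simp_all add: power_mult_distrib ennreal_mult)
  also have "\<dots> \<le> ennreal D * (\<integral>\<^sup>+y. ?G y \<partial>lborel)"
  proof (rule nn_integral_le_of_dominated_level_sets[OF _ sigma_finite_lborel])
    interpret pair_sigma_finite scale_measure "scale_measure \<Otimes>\<^sub>M (lborel :: ((real^'n) \<times> (real^'m)) measure)"
      by (intro pair_sigma_finite.intro scale_measure.sigma_finite_measure_axioms
        scale_lborel.sigma_finite_measure_axioms)
    show "sigma_finite_measure ?P" by unfold_locales
    show "?u k y \<le> ?G y" for k y
      using power_mono[OF rectangle_average_abs_le, of "fst k" "snd k" f y 2] by (simp add: ennreal_power)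
    fix s :: real
    define S where "S = (\<lambda>k1 k2. {y. ennreal s < ennreal ((rectangle_average k1 k2 f y)\<^sup>2)})"
    have S: "S k1 k2 \<in> sets borel" for k1 k2 unfolding S_def by measurable
    have saturated: "dyadic_cube k1 (fst y) \<times> dyadic_cube k2 (snd y) \<subseteq> S k1 k2" if "y \<in> S k1 k2" for k1 k2 y
      using that unfolding S_def by (rule rectangle_average_level_set_saturated)
    have union: "(\<Union>k. {y \<in> space lborel. ennreal s < ?u k y}) = (\<Union>k1 k2. S k1 k2)" by (auto simp: S_def) blast
    assume "emeasure lborel (\<Union>k. {y \<in> space lborel. ennreal s < ?u k y}) < \<infinity>"
    then have "(\<integral>\<^sup>+t1. \<integral>\<^sup>+t2. (\<integral>\<^sup>+y\<in>S (scale_index t1) (scale_index t2).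
      ennreal ((\<integral>z. K (t1, t2, y, z) \<partial>lborel)\<^sup>2) \<partial>lborel) \<partial>scale_measure \<partial>scale_measure)
      \<le> ennreal D * emeasure lborel (\<Union>k1 k2. S k1 k2)"
      using carleson S saturated unfolding rectangle_carleson_def union by blast
    then show "(\<integral>\<^sup>+p. ?w p * indicator {p. ennreal s < ?u (?k p) (?y p)} p \<partial>?P)
      \<le> ennreal D * emeasure lborel (\<Union>k. {y \<in> space lborel. ennreal s < ?u k y})"
      unfolding union by (subst nn_integral_scale_scale_lborel) (simp_all add: S_def indicator_def)
  qed (use finite in measurable)
  also have "\<dots> \<le> ennreal D * (16 * energy lborel f)" by (intro mult_left_mono maximal) simp
  finally show ?thesis .
qed

lemma integral_lborel_snd:
  fixes g :: "'a::euclidean_space \<times> 'b::euclidean_space \<Rightarrow> real"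
  assumes "integrable lborel g"
  shows "(\<integral>p. g p \<partial>lborel) = (\<integral>z2. \<integral>z1. g (z1, z2) \<partial>lborel \<partial>lborel)"
  using lborel_pair.integral_snd[of "\<lambda>z1 z2. g (z1, z2)"] assms by (simp add: lborel_prod)

lemma integral_lborel_swap:
  fixes g :: "'a::euclidean_space \<times> 'b::euclidean_space \<Rightarrow> real"
  assumes "g \<in> borel_measurable borel"
  shows "(\<integral>p. g (prod.swap p) \<partial>lborel) = (\<integral>p. g p \<partial>lborel)"
  using lborel_pair.integral_product_swap[of g] assms by (simp add: lborel_prod split_beta' prod.swap_def)

context product_kernel
begin

context
  fixes t1 t2 :: real
  assumes t: "0 < t1" "0 < t2"
begin

lemma kernel_abs_le_tensor:
  "\<bar>K (t1, t2, y, p)\<bar> \<le> A * (poisson a t1 (fst y - fst p) * poisson b t2 (snd y - snd p))"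
  using size[OF t, of "fst y" "snd y" "fst p" "snd p"] by (simp add: mult.assoc)

lemma square_integrable_kernel: "square_integrable lborel (\<lambda>p. K (t1, t2, y, p))"
proof (rule square_integrable_bound)
  have "square_integrable (lborel \<Otimes>\<^sub>M lborel) (\<lambda>p. A * (poisson a t1 (fst y - fst p) * poisson b t2 (snd y - snd p)))"
    by (intro square_integrable_cmult
      lborel_pair.square_integrable_tensor[of "\<lambda>z. poisson a t1 (fst y - z)" "\<lambda>z. poisson b t2 (snd y - z)"]
        square_integrable_poisson t a_pos b_pos)
  then show "square_integrable lborel (\<lambda>p. A * (poisson a t1 (fst y - fst p) * poisson b t2 (snd y - snd p)))"
    by (simp add: lborel_prod)
  show "\<bar>K (t1, t2, y, p)\<bar> \<le> \<bar>A * (poisson a t1 (fst y - fst p) * poisson b t2 (snd y - snd p))\<bar>" for p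
    using kernel_abs_le_tensor[of y p] A_pos by (simp add: abs_mult)
qed measurable

lemma integrable_kernel_mult:
  "square_integrable lborel f \<Longrightarrow> integrable lborel (\<lambda>p. K (t1, t2, y, p) * f p)"
  by (intro square_integrable_mult square_integrable_kernel)

lemma integrable_kernel_mult_snd:
  assumes [measurable]: "h \<in> borel_measurable borel" and h: "integrable lborel (\<lambda>z. poisson b t2 (snd y - z) * h z)"
  shows "integrable lborel (\<lambda>p. K (t1, t2, y, p) * h (snd p))"
proof (rule Bochner_Integration.integrable_bound)
  have "integrable (lborel \<Otimes>\<^sub>M lborel) (\<lambda>p. A
    * (poisson a t1 (fst y - fst p) * (poisson b t2 (snd y - snd p) * h (snd p))))"
    by (intro integrable_mult_right h integrable_poisson t a_pos
        lborel_pair.integrable_tensor[of "\<lambda>z. poisson a t1 (fst y - z)" "\<lambda>z. poisson b t2 (snd y - z) * h z"])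
  then show "integrable lborel (\<lambda>p. A * (poisson a t1 (fst y - fst p) * (poisson b t2 (snd y - snd p) * h (snd p))))"
    by (simp add: lborel_prod)
  show "AE p in lborel. norm (K (t1, t2, y, p) * h (snd p))
    \<le> norm (A * (poisson a t1 (fst y - fst p) * (poisson b t2 (snd y - snd p) * h (snd p))))"
  proof (rule AE_I2)
    fix p :: "(real^'n) \<times> (real^'m)"
    show "norm (K (t1, t2, y, p) * h (snd p))
      \<le> norm (A * (poisson a t1 (fst y - fst p) * (poisson b t2 (snd y - snd p) * h (snd p))))"
      using mult_right_mono[OF kernel_abs_le_tensor[of y p], of "\<bar>h (snd p)\<bar>"] A_pos
      by (simp add: abs_mult mult.assoc)
  qed
qed measurable

lemma integrable_kernel: "integrable lborel (\<lambda>z. K (t1, t2, y, z))"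
  using integrable_kernel_mult_snd[of "\<lambda>_. 1" y] integrable_poisson[OF t(2) b_pos, of "snd y"] by simp

lemma integral_kernel_mult_snd:
  assumes "h \<in> borel_measurable borel" "integrable lborel (\<lambda>z. poisson b t2 (snd y - z) * h z)"
  shows "(\<integral>p. K (t1, t2, y, p) * h (snd p) \<partial>lborel) = (\<integral>z2. first_integral t1 t2 (fst y) (snd y) z2 * h z2 \<partial>lborel)"
  by (subst integral_lborel_snd[OF integrable_kernel_mult_snd[OF assms]]) (simp add: first_integral_def)

lemma integral_kernel: "(\<integral>z. K (t1, t2, y, z) \<partial>lborel) = (\<integral>z2. first_integral t1 t2 (fst y) (snd y) z2 \<partial>lborel)"
  using integral_kernel_mult_snd[of "\<lambda>_. 1" y] integrable_poisson[OF t(2) b_pos, of "snd y"] by simp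

lemma square_integrable_first_integral: "square_integrable lborel (first_integral t1 t2 y1 y2)"
  using first_integral_abs_le[OF t, of y1 y2] A_pos poisson_mass_pos[OF a_pos, of "CARD('n)"]
  by (intro square_integrable_bound[OF _
    square_integrable_cmult[OF square_integrable_poisson[OF t(2) b_pos, of y2], of "A * poisson_mass CARD('n) a"]])
    (auto simp: abs_mult)

lemma integrable_first_integral: "integrable lborel (first_integral t1 t2 y1 y2)"
  using first_integral_abs_le[OF t, of y1 y2] A_pos poisson_mass_pos[OF a_pos, of "CARD('n)"]
  by (intro Bochner_Integration.integrable_bound[OF integrable_mult_right[OF integrable_poisson[OF t(2) b_pos, of y2],
    of "A * poisson_mass CARD('n) a"]])
    (auto simp: abs_mult)

lemma integral_paraproduct_mult:
  assumes "square_integrable lborel f"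
  defines "k \<equiv> scale_index t1"
  shows "integrable lborel (\<lambda>p. first_integral t1 t2 (fst y) (snd y) (snd p) * dyadic_kernel k (fst y) (fst p) * f p)"
    (is "integrable _ ?g")
    and "(\<integral>p. first_integral t1 t2 (fst y) (snd y) (snd p) * dyadic_kernel k (fst y) (fst p) * f p \<partial>lborel)
      = (\<integral>z2. first_integral t1 t2 (fst y) (snd y) z2 * dyadic_average k (\<lambda>z. f (z, z2)) (fst y) \<partial>lborel)"
proof -
  have "square_integrable (lborel \<Otimes>\<^sub>M lborel) (\<lambda>p. dyadic_kernel k (fst y) (fst p)
    * first_integral t1 t2 (fst y) (snd y) (snd p))"
    by (intro lborel_pair.square_integrable_tensor square_integrable_dyadic_kernel square_integrable_first_integral)
  from square_integrable_mult[OF this[unfolded lborel_prod] assms(1)] show integrable: "integrable lborel ?g"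
    by (simp add: mult.commute[of "dyadic_kernel _ _ _"])
  show "(\<integral>p. ?g p \<partial>lborel) = (\<integral>z2. first_integral t1 t2 (fst y) (snd y) z2
    * dyadic_average k (\<lambda>z. f (z, z2)) (fst y) \<partial>lborel)"
    by (subst integral_lborel_snd[OF integrable]) (simp add: dyadic_average_def mult.assoc)
qed

lemma integral_paraproduct_mult_fst:
  assumes "square_integrable lborel g"
  defines "k \<equiv> scale_index t1"
  shows "integrable lborel (\<lambda>p. first_integral t1 t2 (fst y) (snd y) (snd p) * dyadic_kernel k (fst y) (fst p)
    * g (fst p))" (is "integrable _ ?g")
    and "(\<integral>p. first_integral t1 t2 (fst y) (snd y) (snd p) * dyadic_kernel k (fst y) (fst p) * g (fst p) \<partial>lborel)
      = (\<integral>z. K (t1, t2, y, z) \<partial>lborel) * dyadic_average k g (fst y)"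
proof -
  have "integrable (lborel \<Otimes>\<^sub>M lborel) (\<lambda>p. (dyadic_kernel k (fst y) (fst p) * g (fst p))
    * first_integral t1 t2 (fst y) (snd y) (snd p))"
    by (intro lborel_pair.integrable_tensor[of "\<lambda>z. dyadic_kernel k (fst y) z * g z"] integrable_first_integral
        square_integrable_mult square_integrable_dyadic_kernel assms(1))
  then show integrable: "integrable lborel ?g" by (simp add: lborel_prod mult_ac)
  show "(\<integral>p. ?g p \<partial>lborel) = (\<integral>z. K (t1, t2, y, z) \<partial>lborel) * dyadic_average k g (fst y)"
    by (subst integral_lborel_snd[OF integrable]) (simp add: dyadic_average_def mult.assoc integral_kernel)
qed

lemma kernel_decomposition:
  fixes f :: "(real^'n) \<times> (real^'m) \<Rightarrow> real"
  assumes f: "square_integrable lborel f"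
  shows "(\<integral>z. K (t1, t2, y, z) * f z \<partial>lborel)
    = (\<integral>p. K (t1, t2, y, p) * first_fluctuation (scale_index t1) f (fst y) p \<partial>lborel)
      + (\<integral>p. first_integral t1 t2 (fst y) (snd y) (snd p) * dyadic_kernel (scale_index t1) (fst y) (fst p)
          * second_fluctuation (scale_index t2) f (snd y) p \<partial>lborel)
      + (\<integral>z. K (t1, t2, y, z) \<partial>lborel) * rectangle_average (scale_index t1) (scale_index t2) f y"
proof -
  note [measurable] = borel_measurable_square_integrable_lborel[OF f]
  let ?P = "\<lambda>z2. dyadic_average (scale_index t1) (\<lambda>z. f (z, z2)) (fst y)"
  let ?G = "\<lambda>z1. dyadic_average (scale_index t2) (\<lambda>z. f (z1, z)) (snd y)"
  let ?I = "\<lambda>z2. first_integral t1 t2 (fst y) (snd y) z2" and ?k = "\<lambda>z1. dyadic_kernel (scale_index t1) (fst y) z1"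
  have "square_integrable (lborel \<Otimes>\<^sub>M lborel) f" "square_integrable (lborel \<Otimes>\<^sub>M lborel) (\<lambda>p. f (prod.swap p))"
    using f energy_lborel_swap[of f] unfolding square_integrable_def lborel_prod prod.swap_def by auto
  then have P: "square_integrable lborel ?P" and G: "square_integrable lborel ?G"
    using square_integrable_frozen_average[OF sigma_finite_lborel] unfolding frozen_average_def by fastforce+
  have P_integrable: "integrable lborel (\<lambda>z. poisson b t2 (snd y - z) * ?P z)"
    by (intro square_integrable_mult square_integrable_poisson t b_pos P)
  have average: "(\<integral>p. K (t1, t2, y, p) * ?P (snd p) \<partial>lborel) = (\<integral>z2. ?I z2 * ?P z2 \<partial>lborel)"
    by (rule integral_kernel_mult_snd[OF _ P_integrable]) measurable
  have "(\<integral>p. K (t1, t2, y, p) * first_fluctuation (scale_index t1) f (fst y) p \<partial>lborel)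
    = (\<integral>p. K (t1, t2, y, p) * f p \<partial>lborel) - (\<integral>z2. ?I z2 * ?P z2 \<partial>lborel)"
    unfolding first_fluctuation_def right_diff_distrib average[symmetric]
    by (intro Bochner_Integration.integral_diff square_integrable_mult square_integrable_kernel f
        integrable_kernel_mult_snd P_integrable) measurable
  moreover have "(\<integral>p. ?I (snd p) * ?k (fst p) * second_fluctuation (scale_index t2) f (snd y) p \<partial>lborel)
    = (\<integral>z2. ?I z2 * ?P z2 \<partial>lborel) - (\<integral>z. K (t1, t2, y, z) \<partial>lborel)
      * rectangle_average (scale_index t1) (scale_index t2) f y"
    unfolding second_fluctuation_def right_diff_distrib rectangle_average_def
    using integral_paraproduct_mult[OF f, of y] integral_paraproduct_mult_fst[OF G, of y] by simp
  ultimately show ?thesis by simp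
qed

end

end

definition bi_parameter_const :: "nat \<Rightarrow> nat \<Rightarrow> real \<Rightarrow> real \<Rightarrow> real \<Rightarrow> real \<Rightarrow> real" where
  "bi_parameter_const n m A a b D
    = 4 * (square_orthogonality_const n a * (A * sqrt (square_function_const m b))\<^sup>2)
      + 4 * (square_orthogonality_const m b * (A * sqrt (4 * carleson_const n a))\<^sup>2) + 32 * D"

locale bi_parameter_kernel =
  first_variable_kernel K A a b + swapped: first_variable_kernel "swap_kernel K" A b a
  for K :: "real \<times> real \<times> ((real^'n) \<times> (real^'m)) \<times> ((real^'n) \<times> (real^'m)) \<Rightarrow> real" and A a b +
  fixes D :: real
  assumes D_nonneg: "0 \<le> D" and carleson: "rectangle_carleson K D"
begin

lemma bi_parameter_const_nonneg: "0 \<le> bi_parameter_const CARD('n) CARD('m) A a b D"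
  unfolding bi_parameter_const_def
  using square_orthogonality_const_nonneg[OF a_pos] square_orthogonality_const_nonneg[OF b_pos] D_nonneg
  by (intro add_nonneg_nonneg mult_nonneg_nonneg) auto

lemma second_slice_almost_orthogonality:
  assumes f: "square_integrable lborel f"
  shows "scale_energy (\<lambda>t1 t2 y. \<integral>p. K (t1, t2, y, p) * first_fluctuation (scale_index t1) f (fst y) p \<partial>lborel)
    \<le> ennreal (square_orthogonality_const CARD('n) a * (A * sqrt (square_function_const CARD('m) b))\<^sup>2)
      * energy lborel f"
    (is "scale_energy ?T \<le> _")
proof -
  note [measurable] = borel_measurable_square_integrable_lborel[OF f]
  have energy: "energy lborel (\<lambda>p. f (prod.swap p)) = energy lborel f" by (rule energy_lborel_swap) measurable
  then have f_swap: "square_integrable lborel (\<lambda>p. f (prod.swap p))"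
    using f unfolding square_integrable_def prod.swap_def by auto
  have T_swap: "?T t1 t2 (prod.swap y)
    = (\<integral>p. swap_kernel K (t2, t1, y, p)
      * second_fluctuation (scale_index t1) (\<lambda>p. f (prod.swap p)) (snd y) p \<partial>lborel)" for t1 t2 y
  proof -
    have "(\<lambda>p. K (t1, t2, prod.swap y, p) * first_fluctuation (scale_index t1) f (fst (prod.swap y)) p) \<in>
      borel_measurable borel"
      by measurable
    from integral_lborel_swap[OF this] show ?thesis
      by (simp add: first_fluctuation_def second_fluctuation_def)
  qed
  have "scale_energy ?T = scale_energy (\<lambda>t2 t1 y. ?T t1 t2 (prod.swap y))"
    by (rule scale_energy_swap[symmetric]) measurable
  also have "\<dots> \<le> ennreal (square_orthogonality_const CARD('n) a * (A * sqrt (square_function_const CARD('m) b))\<^sup>2)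
    * energy lborel f"
    unfolding T_swap energy[symmetric] by (rule swapped.first_slice_almost_orthogonality[OF f_swap])
  finally show ?thesis .
qed

theorem square_function_bound:
  assumes f: "square_integrable lborel f"
  shows "scale_energy (\<lambda>t1 t2 y. \<integral>z. K (t1, t2, y, z) * f z \<partial>lborel)
    \<le> ennreal (bi_parameter_const CARD('n) CARD('m) A a b D) * energy lborel f"
proof -
  note [measurable] = borel_measurable_square_integrable_lborel[OF f]
  let ?p = "\<lambda>t1 t2 y. \<integral>p. K (t1, t2, y, p) * first_fluctuation (scale_index t1) f (fst y) p \<partial>lborel"
  let ?q = "\<lambda>t1 t2 y. \<integral>p. first_integral t1 t2 (fst y) (snd y) (snd p)
    * dyadic_kernel (scale_index t1) (fst y) (fst p)
      * second_fluctuation (scale_index t2) f (snd y) p \<partial>lborel"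
  let ?r = "\<lambda>t1 t2 y. (\<integral>z. K (t1, t2, y, z) \<partial>lborel) * rectangle_average (scale_index t1) (scale_index t2) f y"
  have pointwise: "ennreal ((x + y + z)\<^sup>2) \<le> 4 * ennreal (x\<^sup>2) + 4 * ennreal (y\<^sup>2) + 2 * ennreal (z\<^sup>2)" for x y z
  proof -
    have "ennreal ((x + y + z)\<^sup>2) \<le> 2 * ennreal ((x + y)\<^sup>2) + 2 * ennreal (z\<^sup>2)" by (rule ennreal_square_add_le)
    also have "\<dots> \<le> 2 * (2 * ennreal (x\<^sup>2) + 2 * ennreal (y\<^sup>2)) + 2 * ennreal (z\<^sup>2)"
      by (intro add_right_mono mult_left_mono ennreal_square_add_le) simp
    finally show ?thesis by (simp add: distrib_left mult.assoc[symmetric])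
  qed
  have "scale_energy (\<lambda>t1 t2 y. \<integral>z. K (t1, t2, y, z) * f z \<partial>lborel)
    \<le> (\<integral>\<^sup>+t1. \<integral>\<^sup>+t2. \<integral>\<^sup>+y. 4 * ennreal ((?p t1 t2 y)\<^sup>2) + 4 * ennreal ((?q t1 t2 y)\<^sup>2) + 2 * ennreal ((?r t1 t2 y)\<^sup>2)
        \<partial>lborel \<partial>scale_measure \<partial>scale_measure)"
    by (intro nn_integral_scale_mono nn_integral_mono) (simp only: kernel_decomposition[OF _ _ f] pointwise)
  also have "\<dots> = 4 * scale_energy ?p + 4 * scale_energy ?q + 2 * scale_energy ?r"
    by (simp add: nn_integral_add nn_integral_cmult)
  also have "\<dots> \<le> 4 * (ennreal (square_orthogonality_const CARD('n) a * (A * sqrt (square_function_const CARD('m) b))\<^sup>2)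
    * energy lborel f)
      + 4 * (ennreal (square_orthogonality_const CARD('m) b * (A * sqrt (4 * carleson_const CARD('n) a))\<^sup>2)
        * energy lborel f)
      + 2 * (ennreal D * (16 * energy lborel f))"
    by (intro add_mono mult_left_mono second_slice_almost_orthogonality first_paraproduct_almost_orthogonality
        rectangle_carleson_embedding K_measurable carleson f) auto
  also have "\<dots> = ennreal (bi_parameter_const CARD('n) CARD('m) A a b D) * energy lborel f"
  proof -
    have "2 * (ennreal D * (16 * energy lborel f)) = ennreal (32 * D) * energy lborel f"
      using D_nonneg by (simp add: ennreal_mult mult.assoc mult.left_commute[of 2]) (simp add: mult_ac)
    then show ?thesis
      using square_orthogonality_const_nonneg[OF a_pos, of "CARD('n)"]
        square_orthogonality_const_nonneg[OF b_pos, of "CARD('m)"] D_nonneg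
      by (simp add: bi_parameter_const_def ennreal_mult distrib_right mult.assoc)
  qed
  finally show ?thesis .
qed

end

subsection \<open>Weights\<close>

text \<open>By \<open>ennreal_weight_eq_poisson\<close> the weight of \<open>g\<^sup>*\<close>, divided by \<open>t\<^sup>n\<close>.\<close>

abbreviation gstar_weight :: "real \<Rightarrow> real \<Rightarrow> real^'n \<Rightarrow> real" where
  "gstar_weight lam \<equiv> poisson (real CARD('n) * lam - real CARD('n))"

abbreviation gstar_weight_mass :: "nat \<Rightarrow> real \<Rightarrow> real" where
  "gstar_weight_mass n lam \<equiv> poisson_mass n (real n * lam - real n)"

lemma ennreal_weight_eq_poisson:
  assumes t: "0 < t"
  shows "ennreal ((t / (t + infnorm (u::real^'n))) powr p / t ^ (CARD('n) + 1))
    = ennreal (1 / t) * ennreal (poisson (p - real CARD('n)) t u)"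
proof -
  have "0 < t + infnorm u" using t infnorm_pos_le[of u] by linarith
  then have "(t / (t + infnorm u)) powr p / t ^ (CARD('n) + 1) = 1 / t * poisson (p - real CARD('n)) t u"
    using t by (simp add: poisson_def powr_divide powr_diff powr_realpow)
  then show ?thesis using t by (simp only:) (intro ennreal_mult, auto)
qed

lemma nn_integral_scale_set:
  assumes [measurable]: "f \<in> borel_measurable borel" "W \<in> sets borel" and W: "W \<subseteq> {0<..}"
  shows "(\<integral>\<^sup>+t\<in>W. f t \<partial>scale_measure) = (\<integral>\<^sup>+t. indicator W t * (ennreal (1 / t) * f t) \<partial>lborel)"
  using W by (subst nn_integral_scale_measure) (auto intro!: nn_integral_cong simp: indicator_def)

lemma nn_integral_poisson_convolution_le:
  fixes g :: "real \<times> (real^'n) \<Rightarrow> ennreal"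
  assumes [measurable]: "g \<in> borel_measurable borel" and c: "0 < c"
  shows "(\<integral>\<^sup>+x. \<integral>\<^sup>+y. \<integral>\<^sup>+t. ennreal (poisson c t (x - y)) * g (t, y) \<partial>scale_measure \<partial>lborel \<partial>lborel)
    \<le> ennreal (poisson_mass CARD('n) c) * (\<integral>\<^sup>+y. \<integral>\<^sup>+t. g (t, y) \<partial>scale_measure \<partial>lborel)"
proof -
  have "(\<integral>\<^sup>+x. \<integral>\<^sup>+y. \<integral>\<^sup>+t. ennreal (poisson c t (x - y)) * g (t, y) \<partial>scale_measure \<partial>lborel \<partial>lborel)
    = (\<integral>\<^sup>+y. \<integral>\<^sup>+x. \<integral>\<^sup>+t. ennreal (poisson c t (x - y)) * g (t, y) \<partial>scale_measure \<partial>lborel \<partial>lborel)"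
    by (rule lborel_pair.Fubini') measurable
  also have "\<dots> = (\<integral>\<^sup>+y. \<integral>\<^sup>+t. \<integral>\<^sup>+x. ennreal (poisson c t (x - y)) * g (t, y) \<partial>lborel \<partial>scale_measure \<partial>lborel)"
    by (intro nn_integral_cong scale_lborel.Fubini') measurable
  also have "\<dots> \<le> (\<integral>\<^sup>+y. \<integral>\<^sup>+t. ennreal (poisson_mass CARD('n) c) * g (t, y) \<partial>scale_measure \<partial>lborel)"
  proof (rule nn_integral_mono, rule nn_integral_scale_mono)
    fix y :: "real^'n" and t :: real assume t: "0 < t"
    show "(\<integral>\<^sup>+x. ennreal (poisson c t (x - y)) * g (t, y) \<partial>lborel) \<le> ennreal (poisson_mass CARD('n) c) * g (t, y)"
      by (subst nn_integral_multc) (simp_all add: mult_right_mono nn_integral_poisson_shift_le(1)[OF t c])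
  qed
  also have "\<dots> = ennreal (poisson_mass CARD('n) c) * (\<integral>\<^sup>+y. \<integral>\<^sup>+t. g (t, y) \<partial>scale_measure \<partial>lborel)"
    by (simp add: nn_integral_cmult)
  finally show ?thesis .
qed

lemma poisson_ge_near:
  fixes u :: "real^'n"
  assumes t: "0 < t" and u: "infnorm u \<le> t" and p: "0 \<le> p"
  shows "1 / t ^ CARD('n) \<le> 2 powr p * poisson (p - real CARD('n)) t u"
proof -
  have pos: "0 < t + infnorm u" using t infnorm_pos_le[of u] by linarith
  have "(t + infnorm u) powr p \<le> (2 * t) powr p" using t u pos p by (intro powr_mono2) auto
  then have "1 \<le> 2 powr p * (t powr p / (t + infnorm u) powr p)" using pos t by (simp add: powr_mult field_simps)
  then have "1 * (1 / t ^ CARD('n)) \<le> 2 powr p * (t powr p / (t + infnorm u) powr p) * (1 / t ^ CARD('n))"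
    using t by (intro mult_right_mono) auto
  then show ?thesis using t by (simp add: poisson_def powr_diff powr_realpow mult.commute)
qed

lemma poisson_mass_hcube_ge:
  fixes u :: "real^'n"
  assumes u: "u \<in> hcube c l" and t: "0 < t" "t < l" and p: "0 \<le> p"
  shows "1 \<le> ennreal (2 powr p) * (\<integral>\<^sup>+x\<in>hcube c l. ennreal (poisson (p - real CARD('n)) t (x - u)) \<partial>lborel)"
proof -
  let ?B = "{x \<in> hcube c l. infnorm (x - u) \<le> t}"
  have B: "?B \<in> sets borel" by measurable
  have "1 = ennreal (1 / t ^ CARD('n)) * ennreal (t ^ CARD('n))"
    using t by (simp add: ennreal_mult[symmetric])
  also have "\<dots> \<le> ennreal (1 / t ^ CARD('n)) * emeasure lborel ?B"
    by (intro mult_left_mono emeasure_hcube_Int_ball_ge u t) simp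
  also have "\<dots> = (\<integral>\<^sup>+x. ennreal (1 / t ^ CARD('n)) * indicator ?B x \<partial>lborel)"
    using B by (intro nn_integral_cmult_indicator[symmetric]) simp
  also have "\<dots> \<le> (\<integral>\<^sup>+x. ennreal (2 powr p)
    * (ennreal (poisson (p - real CARD('n)) t (x - u)) * indicator (hcube c l) x) \<partial>lborel)"
  proof (rule nn_integral_mono)
    fix x
    show "ennreal (1 / t ^ CARD('n)) * indicator ?B x
      \<le> ennreal (2 powr p) * (ennreal (poisson (p - real CARD('n)) t (x - u)) * indicator (hcube c l) x)"
      using ennreal_leI[OF poisson_ge_near[OF t(1) _ p, of "x - u"]] by (cases "x \<in> ?B") (auto simp: ennreal_mult)
  qed
  also have "\<dots> = ennreal (2 powr p) * (\<integral>\<^sup>+x\<in>hcube c l. ennreal (poisson (p - real CARD('n)) t (x - u)) \<partial>lborel)"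
    by (rule nn_integral_cmult) measurable
  finally show ?thesis .
qed

lemma nn_integral_hcube_le_weighted:
  fixes g :: "real \<times> (real^'n) \<Rightarrow> ennreal"
  assumes [measurable]: "g \<in> borel_measurable borel" and p: "0 \<le> p"
  shows "(\<integral>\<^sup>+u\<in>hcube c l. (\<integral>\<^sup>+t\<in>{0<..l}. g (t, u) \<partial>scale_measure) \<partial>lborel)
    \<le> ennreal (2 powr p) * (\<integral>\<^sup>+x\<in>hcube c l. (\<integral>\<^sup>+t\<in>{0<..<l}.
        (\<integral>\<^sup>+y. ennreal (poisson (p - real CARD('n)) t y) * g (t, x - y) \<partial>lborel) \<partial>scale_measure) \<partial>lborel)"
proof -
  let ?Q = "hcube c l" and ?P = "\<lambda>t u. ennreal (poisson (p - real CARD('n)) t (u :: real^'n))"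
  let ?F = "\<lambda>u t x. ennreal (2 powr p) * (g (t, u) * indicator {0<..<l} t * (?P t (x - u) * indicator ?Q x))"
  have pointwise: "g (t, u) * indicator {0<..l} t * indicator ?Q u \<le> (\<integral>\<^sup>+x. ?F u t x \<partial>lborel)" if "t \<noteq> l" for t u
  proof (cases "u \<in> ?Q \<and> t \<in> {0<..<l}")
    case True
    then have "g (t, u) * 1 \<le> g (t, u) * (ennreal (2 powr p) * (\<integral>\<^sup>+x\<in>?Q. ?P t (x - u) \<partial>lborel))"
      by (intro mult_left_mono poisson_mass_hcube_ge p) auto
    then show ?thesis using True by (simp add: nn_integral_cmult mult.left_commute)
  qed (use that in \<open>auto simp: indicator_def\<close>)
  have "AE t in scale_measure. t \<noteq> l"
    using AE_lborel_singleton[of l] unfolding AE_scale_measure by eventually_elim simp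
  then have "(\<integral>\<^sup>+t. g (t, u) * indicator {0<..l} t * indicator ?Q u \<partial>scale_measure)
    \<le> (\<integral>\<^sup>+t. \<integral>\<^sup>+x. ?F u t x \<partial>lborel \<partial>scale_measure)" for u
    by (intro nn_integral_mono_AE, eventually_elim) (rule pointwise)
  then have "(\<integral>\<^sup>+u\<in>?Q. (\<integral>\<^sup>+t\<in>{0<..l}. g (t, u) \<partial>scale_measure) \<partial>lborel)
    \<le> (\<integral>\<^sup>+u. \<integral>\<^sup>+t. \<integral>\<^sup>+x. ?F u t x \<partial>lborel \<partial>scale_measure \<partial>lborel)"
    by (intro nn_integral_mono) (simp add: nn_integral_multc)
  also have "\<dots> = (\<integral>\<^sup>+u. \<integral>\<^sup>+x. \<integral>\<^sup>+t. ?F u t x \<partial>scale_measure \<partial>lborel \<partial>lborel)"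
    by (intro nn_integral_cong lborel_scale.Fubini') measurable
  also have "\<dots> = (\<integral>\<^sup>+x. \<integral>\<^sup>+u. \<integral>\<^sup>+t. ?F u t x \<partial>scale_measure \<partial>lborel \<partial>lborel)"
    by (rule lborel_pair.Fubini') measurable
  also have "\<dots> = (\<integral>\<^sup>+x. \<integral>\<^sup>+t. \<integral>\<^sup>+u. ?F u t x \<partial>lborel \<partial>scale_measure \<partial>lborel)"
    by (intro nn_integral_cong scale_lborel.Fubini') measurable
  also have "\<dots> = (\<integral>\<^sup>+x. \<integral>\<^sup>+t. \<integral>\<^sup>+y. ?F (x - y) t x \<partial>lborel \<partial>scale_measure \<partial>lborel)"
    by (intro nn_integral_cong nn_integral_lborel_reflect[symmetric]) measurable
  also have "\<dots> = ennreal (2 powr p)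
    * (\<integral>\<^sup>+x\<in>?Q. (\<integral>\<^sup>+t\<in>{0<..<l}. (\<integral>\<^sup>+y. ?P t y * g (t, x - y) \<partial>lborel) \<partial>scale_measure) \<partial>lborel)"
    by (simp add: nn_integral_cmult[symmetric] nn_integral_multc[symmetric] mult_ac del: nn_integral_cmult)
  finally show ?thesis .
qed

lemma ensqrt_power2: "(ensqrt v)\<^sup>2 = v"
  by (cases v) (auto simp: ensqrt_def ennreal_power)

lemma ensqrt_le_ennrealD:
  assumes "ensqrt v \<le> ennreal c" shows "v \<le> ennreal (c\<^sup>2)"
proof -
  have "ensqrt v \<le> ennreal \<bar>c\<bar>" by (rule order_trans[OF assms]) (simp add: ennreal_leI)
  then have "(ensqrt v)\<^sup>2 \<le> (ennreal \<bar>c\<bar>)\<^sup>2" by (rule power_mono) simp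
  then show ?thesis by (simp add: ensqrt_power2 ennreal_power)
qed

lemma ensqrt_le_ennrealI: "v \<le> ennreal (c\<^sup>2) \<Longrightarrow> 0 \<le> c \<Longrightarrow> ensqrt v \<le> ennreal c"
  by (cases v) (auto simp: ensqrt_def top_unique intro!: ennreal_leI real_le_lsqrt)

subsection \<open>From the assumptions on the kernel to bi-parameter kernels\<close>

definition truncated_kernel ::
  "('n::finite, 'm::finite) kernel \<Rightarrow> real \<times> real \<times> ((real^'n) \<times> (real^'m)) \<times> ((real^'n) \<times> (real^'m)) \<Rightarrow> complex" where
  "truncated_kernel K = (\<lambda>(t1, t2, x, y). if 0 < t1 \<and> 0 < t2 then K t1 t2 x y else 0)"

definition weighted_cube_testing :: "real \<Rightarrow> (real \<Rightarrow> real^'n \<Rightarrow> real^'n \<Rightarrow> complex) \<Rightarrow> real \<Rightarrow> bool" where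
  "weighted_cube_testing lam L B \<longleftrightarrow> (\<forall>c l. 0 < l \<longrightarrow>
    ensqrt (\<integral>\<^sup>+x. \<integral>\<^sup>+t. \<integral>\<^sup>+y. indicator (hcube c l) x * indicator {0<..<l} t *
        ennreal ((cmod (\<integral>z\<in>hcube c l. L t (x - y) z \<partial>lborel))\<^sup>2
          * (t / (t + infnorm y)) powr (real CARD('n) * lam) / t ^ (CARD('n) + 1))
      \<partial>lborel \<partial>lborel \<partial>lborel)
    \<le> ennreal (B * sqrt (measure lborel (hcube c l))))"

lemma weighted_cube_testing_scale:
  fixes L :: "real \<times> (real^'n) \<times> (real^'n) \<Rightarrow> complex"
  assumes [measurable]: "L \<in> borel_measurable borel" and L0: "\<And>t u z. 0 < t \<Longrightarrow> L (t, u, z) = L0 t u z"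
    and testing: "weighted_cube_testing lam L0 B" and l: "0 < l"
  shows "(\<integral>\<^sup>+x\<in>hcube c l. (\<integral>\<^sup>+t\<in>{0<..<l}. (\<integral>\<^sup>+y. ennreal (gstar_weight lam t y)
        * ennreal ((cmod (\<integral>z\<in>hcube c l. L (t, x - y, z) \<partial>lborel))\<^sup>2) \<partial>lborel) \<partial>scale_measure) \<partial>lborel)
    \<le> ennreal (B\<^sup>2 * l ^ CARD('n))"
proof -
  let ?Q = "hcube c l" and ?p = "real CARD('n) * lam"
  define G where "G = (\<lambda>q. ennreal ((cmod (\<integral>z\<in>?Q. L (fst q, snd q, z) \<partial>lborel))\<^sup>2))"
  have [measurable]: "G \<in> borel_measurable borel"
    unfolding G_def set_lebesgue_integral_def borel_prod[symmetric] by measurable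
  let ?P = "\<lambda>t y. ennreal (gstar_weight lam t (y :: real^'n))"
  let ?V = "\<integral>\<^sup>+x. \<integral>\<^sup>+t. \<integral>\<^sup>+y. indicator ?Q x * indicator {0<..<l} t *
    ennreal ((cmod (\<integral>z\<in>?Q. L0 t (x - y) z \<partial>lborel))\<^sup>2 * (t / (t + infnorm y)) powr ?p / t ^ (CARD('n) + 1)) \<partial>lborel
      \<partial>lborel \<partial>lborel"
  have weight: "indicator ?Q x * indicator {0<..<l} t * ennreal ((cmod (\<integral>z\<in>?Q. L0 t (x - y) z \<partial>lborel))\<^sup>2
      * (t / (t + infnorm y)) powr ?p / t ^ (CARD('n) + 1))
    = indicator {0<..<l} t * (ennreal (1 / t) * (?P t y * G (t, x - y))) * indicator ?Q x" for x y t
  proof (cases "t \<in> {0<..<l}")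
    case True
    then have t: "0 < t" by simp
    have "ennreal ((cmod (\<integral>z\<in>?Q. L0 t (x - y) z \<partial>lborel))\<^sup>2 * (t / (t + infnorm y)) powr ?p / t ^ (CARD('n) + 1))
      = G (t, x - y) * ennreal ((t / (t + infnorm y)) powr ?p / t ^ (CARD('n) + 1))"
      using t by (simp add: G_def L0[OF t] ennreal_mult[symmetric])
    then show ?thesis using True by (simp only: ennreal_weight_eq_poisson[OF t]) (simp add: mult_ac)
  qed simp
  have "(\<integral>\<^sup>+x\<in>?Q. (\<integral>\<^sup>+t\<in>{0<..<l}. (\<integral>\<^sup>+y. ?P t y * G (t, x - y) \<partial>lborel) \<partial>scale_measure) \<partial>lborel) = ?V"
    unfolding weight by (subst nn_integral_scale_set) (simp_all add: nn_integral_cmult nn_integral_multc subset_eq)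
  also have "\<dots> \<le> ennreal ((B * sqrt (measure lborel ?Q))\<^sup>2)"
    using testing l unfolding weighted_cube_testing_def by (intro ensqrt_le_ennrealD) blast
  also have "(B * sqrt (measure lborel ?Q))\<^sup>2 = B\<^sup>2 * l ^ CARD('n)"
    using emeasure_hcube[of l c] l by (simp add: measure_def power_mult_distrib)
  finally show ?thesis by (simp add: G_def)
qed

lemma cube_testing_of_weighted:
  fixes L :: "real \<times> (real^'n) \<times> (real^'n) \<Rightarrow> complex"
  assumes L[measurable]: "L \<in> borel_measurable borel" and L0: "\<And>t u z. 0 < t \<Longrightarrow> L (t, u, z) = L0 t u z"
    and integrable: "\<And>t u. 0 < t \<Longrightarrow> integrable lborel (\<lambda>z. L (t, u, z))"
    and testing: "weighted_cube_testing lam L0 (A * W)" and lam: "0 \<le> lam"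
    and r: "bounded_linear r" "\<And>z. \<bar>r z\<bar> \<le> cmod z"
    and C: "2 powr (real CARD('n) * lam) * A\<^sup>2 \<le> C\<^sup>2"
  shows "cube_testing (\<lambda>q. r (L q)) (C * W)"
  unfolding cube_testing_def
proof (intro allI)
  fix k :: int and x :: "real^'n"
  let ?Q = "hcube (dyadic_corner k x) (side_length k)" and ?p = "real CARD('n) * lam"
  have [measurable]: "r \<in> borel_measurable borel"
    using r(1) by (intro borel_measurable_continuous_onI linear_continuous_on)
  let ?g = "\<lambda>q. ennreal ((cmod (\<integral>z\<in>?Q. L (fst q, snd q, z) \<partial>lborel))\<^sup>2)"
  have g: "?g \<in> borel_measurable borel" unfolding set_lebesgue_integral_def borel_prod[symmetric] by measurable
  have "ennreal ((\<integral>z. indicator ?Q z * r (L (t, u, z)) \<partial>lborel)\<^sup>2) \<le> ?g (t, u)" if t: "0 < t" for t u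
  proof -
    have "integrable lborel (\<lambda>z. indicator ?Q z *\<^sub>R L (t, u, z))"
      using integrable_mult_indicator[OF _ integrable[OF t, of u], of ?Q] by simp
    from integral_bounded_linear[OF r(1) this]
    have "(\<integral>z. indicator ?Q z * r (L (t, u, z)) \<partial>lborel) = r (\<integral>z\<in>?Q. L (t, u, z) \<partial>lborel)"
      by (simp add: set_lebesgue_integral_def linear_simps(5)[OF r(1)])
    then show ?thesis using r(2) by (simp add: abs_le_square_iff[symmetric] ennreal_leI)
  qed
  then have "(\<integral>\<^sup>+u\<in>?Q. (\<integral>\<^sup>+t\<in>{0<..side_length k}. ennreal ((\<integral>z. indicator ?Q z * r (L (t, u, z)) \<partial>lborel)\<^sup>2)
    \<partial>scale_measure) \<partial>lborel)
    \<le> (\<integral>\<^sup>+u\<in>?Q. (\<integral>\<^sup>+t\<in>{0<..side_length k}. ?g (t, u) \<partial>scale_measure) \<partial>lborel)"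
    by (intro nn_integral_mono mult_right_mono nn_integral_scale_mono) auto
  also have "\<dots> \<le> ennreal (2 powr ?p) * (\<integral>\<^sup>+x\<in>?Q. (\<integral>\<^sup>+t\<in>{0<..<side_length k}.
      (\<integral>\<^sup>+y. ennreal (gstar_weight lam t y) * ?g (t, x - y) \<partial>lborel) \<partial>scale_measure) \<partial>lborel)"
    using lam by (intro nn_integral_hcube_le_weighted g) simp
  also have "\<dots> \<le> ennreal (2 powr ?p) * ennreal ((A * W)\<^sup>2 * side_length k ^ CARD('n))"
    using weighted_cube_testing_scale[OF L L0 testing, of "side_length k"] by (intro mult_left_mono) auto
  also have "\<dots> \<le> ennreal ((C * W)\<^sup>2 * side_length k ^ CARD('n))"
    using mult_right_mono[OF C, of "W\<^sup>2 * side_length k ^ CARD('n)"]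
    by (simp add: ennreal_mult[symmetric] ennreal_leI power_mult_distrib mult.assoc)
  finally show "(\<integral>\<^sup>+u\<in>dyadic_cube k x. (\<integral>\<^sup>+t\<in>{0<..side_length k}.
      ennreal ((\<integral>z. indicator (dyadic_cube k x) z * r (L (t, u, z)) \<partial>lborel)\<^sup>2) \<partial>scale_measure) \<partial>lborel)
    \<le> ennreal ((C * W)\<^sup>2 * side_length k ^ CARD('n))"
    by (simp add: dyadic_cube_eq_hcube)
qed

lemma borel_measurable_truncated_kernel: "kernel_measurable K \<Longrightarrow> truncated_kernel K \<in> borel_measurable borel"
  by (simp add: kernel_measurable_def truncated_kernel_def)

lemma truncated_kernel_eq: "0 < t1 \<Longrightarrow> 0 < t2 \<Longrightarrow> truncated_kernel K (t1, t2, x, y) = K t1 t2 x y"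
  by (simp add: truncated_kernel_def)

lemma assumption1_poisson:
  fixes K :: "('n::finite, 'm::finite) kernel"
  assumes "assumption1 A \<alpha> \<beta> K" and t: "0 < t1" "0 < t2"
  shows "cmod (K t1 t2 (y1, y2) (z1, z2)) \<le> A * poisson \<alpha> t1 (y1 - z1) * poisson \<beta> t2 (y2 - z2)"
    and "infnorm (z1 - z1') < t1 / 2 \<Longrightarrow> cmod (K t1 t2 (y1, y2) (z1, z2) - K t1 t2 (y1, y2) (z1', z2))
      \<le> A * holder_poisson \<alpha> t1 (z1 - z1') (y1 - z1) * poisson \<beta> t2 (y2 - z2)"
    and "infnorm (z2 - z2') < t2 / 2 \<Longrightarrow> cmod (K t1 t2 (y1, y2) (z1, z2) - K t1 t2 (y1, y2) (z1, z2'))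
      \<le> A * poisson \<alpha> t1 (y1 - z1) * holder_poisson \<beta> t2 (z2 - z2') (y2 - z2)"
    and "infnorm (z1 - z1') < t1 / 2 \<Longrightarrow> infnorm (z2 - z2') < t2 / 2 \<Longrightarrow>
      cmod (K t1 t2 (y1, y2) (z1, z2) - K t1 t2 (y1, y2) (z1, z2') - K t1 t2 (y1, y2) (z1', z2)
        + K t1 t2 (y1, y2) (z1', z2'))
      \<le> A * holder_poisson \<alpha> t1 (z1 - z1') (y1 - z1) * holder_poisson \<beta> t2 (z2 - z2') (y2 - z2)"
  using assms
  unfolding assumption1_def holder_poisson_eq[OF t(1), symmetric] holder_poisson_eq[OF t(2), symmetric]
  unfolding poisson_def by blast+

lemma assumption2_first_weighted_testing:
  fixes K :: "('n::finite, 'm::finite) kernel"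
  assumes a2: "assumption2 A \<alpha> \<beta> lam1 lam2 K" and t2: "0 < t2"
  shows "weighted_cube_testing lam1 (\<lambda>t1 u1 z1. K t1 t2 (u1, y2) (z1, z2)) (A * poisson \<beta> t2 (y2 - z2))"
    and "infnorm (z2 - z2') < t2 / 2 \<Longrightarrow>
      weighted_cube_testing lam1 (\<lambda>t1 u1 z1. K t1 t2 (u1, y2) (z1, z2) - K t1 t2 (u1, y2) (z1, z2'))
        (A * holder_poisson \<beta> t2 (z2 - z2') (y2 - z2))"
proof -
  note testing = a2[unfolded assumption2_def, THEN conjunct1, rule_format,
      where ?x2.0=y2 and ?y2.0=0 and ?z2.0=z2 and z2'=z2', OF _ t2, unfolded diff_zero holder_poisson_eq[OF t2]]
  have commute: "A * W * sqrt s = A * sqrt s * W" for W s :: real by simp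
  show "weighted_cube_testing lam1 (\<lambda>t1 u1 z1. K t1 t2 (u1, y2) (z1, z2)) (A * poisson \<beta> t2 (y2 - z2))"
    unfolding weighted_cube_testing_def commute poisson_def using testing by blast
  show "weighted_cube_testing lam1 (\<lambda>t1 u1 z1. K t1 t2 (u1, y2) (z1, z2) - K t1 t2 (u1, y2) (z1, z2'))
      (A * holder_poisson \<beta> t2 (z2 - z2') (y2 - z2))" if "infnorm (z2 - z2') < t2 / 2"
    unfolding weighted_cube_testing_def commute using testing that by blast
qed

lemma assumption2_second_weighted_testing:
  fixes K :: "('n::finite, 'm::finite) kernel"
  assumes a2: "assumption2 A \<alpha> \<beta> lam1 lam2 K" and t1: "0 < t1"
  shows "weighted_cube_testing lam2 (\<lambda>t2 u2 z2. K t1 t2 (y1, u2) (z1, z2)) (A * poisson \<alpha> t1 (y1 - z1))"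
    and "infnorm (z1 - z1') < t1 / 2 \<Longrightarrow>
      weighted_cube_testing lam2 (\<lambda>t2 u2 z2. K t1 t2 (y1, u2) (z1, z2) - K t1 t2 (y1, u2) (z1', z2))
        (A * holder_poisson \<alpha> t1 (z1 - z1') (y1 - z1))"
proof -
  note testing = a2[unfolded assumption2_def, THEN conjunct2, rule_format,
      where ?x1.0=y1 and ?y1.0=0 and ?z1.0=z1 and z1'=z1', OF _ t1, unfolded diff_zero holder_poisson_eq[OF t1]]
  have commute: "A * W * sqrt s = A * sqrt s * W" for W s :: real by simp
  show "weighted_cube_testing lam2 (\<lambda>t2 u2 z2. K t1 t2 (y1, u2) (z1, z2)) (A * poisson \<alpha> t1 (y1 - z1))"
    unfolding weighted_cube_testing_def commute poisson_def using testing by blast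
  show "weighted_cube_testing lam2 (\<lambda>t2 u2 z2. K t1 t2 (y1, u2) (z1, z2) - K t1 t2 (y1, u2) (z1', z2))
      (A * holder_poisson \<alpha> t1 (z1 - z1') (y1 - z1))" if "infnorm (z1 - z1') < t1 / 2"
    unfolding weighted_cube_testing_def commute using testing that by blast
qed

lemma integrable_complexI:
  assumes "integrable M (\<lambda>x. Re (g x))" "integrable M (\<lambda>x. Im (g x))"
  shows "integrable M g"
proof -
  have "integrable M (\<lambda>x. complex_of_real (Re (g x)) + \<i> * complex_of_real (Im (g x)))"
    using assms by (intro Bochner_Integration.integrable_add integrable_mult_right integrable_of_real)
  then show ?thesis by (simp add: complex_eq[symmetric])
qed

lemma product_kernel_of_assumption1:
  fixes K :: "('n::finite, 'm::finite) kernel"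
  assumes K: "kernel_measurable K" and a1: "assumption1 A \<alpha> \<beta> K" and ab: "0 < \<alpha>" "0 < \<beta>"
    and C: "A \<le> C" "0 < C" and r: "bounded_linear r" "\<And>z. \<bar>r z\<bar> \<le> cmod z"
  shows "product_kernel (\<lambda>q. r (truncated_kernel K q)) C \<alpha> \<beta>"
proof (rule product_kernel.intro)
  have [measurable]: "truncated_kernel K \<in> borel_measurable borel" "r \<in> borel_measurable borel"
    using borel_measurable_truncated_kernel[OF K] r(1)
    by (auto intro: borel_measurable_continuous_onI linear_continuous_on)
  show "(\<lambda>q. r (truncated_kernel K q)) \<in> borel_measurable borel" by measurable
  have bound: "\<bar>r z\<bar> \<le> C * X * Y" if "cmod z \<le> A * X * Y" "0 \<le> X" "0 \<le> Y" for z X Y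
  proof -
    have "\<bar>r z\<bar> \<le> A * X * Y" using r(2)[of z] that(1) by linarith
    also have "\<dots> \<le> C * X * Y" using C that by (intro mult_right_mono) auto
    finally show ?thesis .
  qed
  have linear: "r z - r w = r (z - w)" "r z + r w = r (z + w)" for z w
    using linear_simps(1,2)[OF r(1)] by auto
  fix t1 t2 :: real and y1 z1 z1' :: "real^'n" and y2 z2 z2' :: "real^'m" assume t: "0 < t1" "0 < t2"
  show "\<bar>r (truncated_kernel K (t1, t2, (y1, y2), (z1, z2)))\<bar> \<le> C * poisson \<alpha> t1 (y1 - z1) * poisson \<beta> t2 (y2 - z2)"
    using t by (simp add: truncated_kernel_eq bound[OF assumption1_poisson(1)[OF a1]])
  show "\<bar>r (truncated_kernel K (t1, t2, (y1, y2), (z1, z2))) - r (truncated_kernel K (t1, t2, (y1, y2), (z1', z2)))\<bar>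
      \<le> C * holder_poisson \<alpha> t1 (z1 - z1') (y1 - z1) * poisson \<beta> t2 (y2 - z2)" if "infnorm (z1 - z1') < t1 / 2"
    unfolding linear truncated_kernel_eq[OF t] by (intro bound assumption1_poisson(2)[OF a1] t that) auto
  show "\<bar>r (truncated_kernel K (t1, t2, (y1, y2), (z1, z2))) - r (truncated_kernel K (t1, t2, (y1, y2), (z1, z2')))\<bar>
      \<le> C * poisson \<alpha> t1 (y1 - z1) * holder_poisson \<beta> t2 (z2 - z2') (y2 - z2)" if "infnorm (z2 - z2') < t2 / 2"
    unfolding linear truncated_kernel_eq[OF t] by (intro bound assumption1_poisson(3)[OF a1] t that) auto
  show "\<bar>r (truncated_kernel K (t1, t2, (y1, y2), (z1, z2))) - r (truncated_kernel K (t1, t2, (y1, y2), (z1, z2')))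
      - r (truncated_kernel K (t1, t2, (y1, y2), (z1', z2))) + r (truncated_kernel K (t1, t2, (y1, y2), (z1', z2')))\<bar>
      \<le> C * holder_poisson \<alpha> t1 (z1 - z1') (y1 - z1) * holder_poisson \<beta> t2 (z2 - z2') (y2 - z2)"
    if "infnorm (z1 - z1') < t1 / 2" "infnorm (z2 - z2') < t2 / 2"
    unfolding linear truncated_kernel_eq[OF t] by (intro bound assumption1_poisson(4)[OF a1] t that) auto
qed (use ab C in auto)

lemma integrable_truncated_kernel:
  fixes K :: "('n::finite, 'm::finite) kernel"
  assumes K: "kernel_measurable K" and a1: "assumption1 A \<alpha> \<beta> K" and ab: "0 < \<alpha>" "0 < \<beta>" and t: "0 < t1" "0 < t2"
  shows "integrable lborel (\<lambda>z1. truncated_kernel K (t1, t2, (y1, y2), (z1, z2)))"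
    "integrable lborel (\<lambda>z2. truncated_kernel K (t1, t2, (y1, y2), (z1, z2)))"
    "integrable lborel (\<lambda>z. truncated_kernel K (t1, t2, y, z))"
proof -
  interpret re: product_kernel "\<lambda>q. Re (truncated_kernel K q)" "\<bar>A\<bar> + 1" \<alpha> \<beta>
    by (rule product_kernel_of_assumption1[OF K a1 ab _ _ bounded_linear_Re abs_Re_le_cmod]) auto
  interpret im: product_kernel "\<lambda>q. Im (truncated_kernel K q)" "\<bar>A\<bar> + 1" \<alpha> \<beta>
    by (rule product_kernel_of_assumption1[OF K a1 ab _ _ bounded_linear_Im abs_Im_le_cmod]) auto
  show "integrable lborel (\<lambda>z1. truncated_kernel K (t1, t2, (y1, y2), (z1, z2)))"
    by (intro integrable_complexI re.integrable_first_variable im.integrable_first_variable t)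
  show "integrable lborel (\<lambda>z2. truncated_kernel K (t1, t2, (y1, y2), (z1, z2)))"
    using product_kernel.integrable_first_variable[OF re.product_kernel_swap t(2,1), of y2 y1 z1]
      product_kernel.integrable_first_variable[OF im.product_kernel_swap t(2,1), of y2 y1 z1]
    by (intro integrable_complexI) simp_all
  show "integrable lborel (\<lambda>z. truncated_kernel K (t1, t2, y, z))"
    by (intro integrable_complexI re.integrable_kernel im.integrable_kernel t)
qed

lemma first_variable_kernel_of_assumptions:
  fixes K :: "('n::finite, 'm::finite) kernel"
  assumes K: "kernel_measurable K" and a1: "assumption1 A \<alpha> \<beta> K" and a2: "assumption2 A \<alpha> \<beta> lam1 lam2 K"
    and ab: "0 < \<alpha>" "0 < \<beta>" and lam: "0 \<le> lam1"
    and C: "A \<le> C" "0 < C" "2 powr (real CARD('n) * lam1) * A\<^sup>2 \<le> C\<^sup>2"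
    and r: "bounded_linear r" "\<And>z. \<bar>r z\<bar> \<le> cmod z"
  shows "first_variable_kernel (\<lambda>q. r (truncated_kernel K q)) C \<alpha> \<beta>"
proof (intro first_variable_kernel.intro first_variable_kernel_axioms.intro
  product_kernel_of_assumption1[OF K a1 ab C(1,2) r])
  note [measurable] = borel_measurable_truncated_kernel[OF K]
  have linear: "r z - r w = r (z - w)" for z w using linear_simps(2)[OF r(1)] by auto
  fix t2 :: real and y2 z2 z2' :: "real^'m" assume t2: "0 < t2"
  let ?L = "\<lambda>z2 (t1, u1, z1). truncated_kernel K (t1, t2, (u1, y2), (z1, z2))"
  have L: "?L z2 \<in> borel_measurable borel" for z2 unfolding borel_prod[symmetric] by measurable
  have integrable: "integrable lborel (\<lambda>z1. K t1 t2 (u1, y2) (z1, z2))" if "0 < t1" for t1 u1 z2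
    using integrable_truncated_kernel(1)[OF K a1 ab that t2] by (simp add: truncated_kernel_eq[OF that t2])
  have "cube_testing (\<lambda>q. r (?L z2 q)) (C * poisson \<beta> t2 (y2 - z2))"
    by (rule cube_testing_of_weighted[OF L _ _ assumption2_first_weighted_testing(1)[OF a2 t2] lam r C(3)])
      (simp_all add: truncated_kernel_eq[OF _ t2] integrable)
  then show "cube_testing (\<lambda>(t1, y1, z1). r (truncated_kernel K (t1, t2, (y1, y2), (z1, z2)))) (C
    * poisson \<beta> t2 (y2 - z2))"
    by (simp add: case_prod_unfold)
  assume d: "infnorm (z2 - z2') < t2 / 2"
  have "(\<lambda>q. ?L z2 q - ?L z2' q) \<in> borel_measurable borel" using L[of z2] L[of z2'] by (rule borel_measurable_diff)
  then have "cube_testing (\<lambda>q. r (?L z2 q - ?L z2' q)) (C * holder_poisson \<beta> t2 (z2 - z2') (y2 - z2))"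
    by (rule cube_testing_of_weighted[OF _ _ _ assumption2_first_weighted_testing(2)[OF a2 t2 d] lam r C(3)])
      (simp_all add: truncated_kernel_eq[OF _ t2] integrable)
  then show "cube_testing (\<lambda>(t1, y1, z1). r (truncated_kernel K (t1, t2, (y1, y2), (z1, z2)))
    - r (truncated_kernel K (t1, t2, (y1, y2), (z1, z2'))))
      (C * holder_poisson \<beta> t2 (z2 - z2') (y2 - z2))"
    by (simp add: case_prod_unfold linear)
qed

lemma swapped_first_variable_kernel_of_assumptions:
  fixes K :: "('n::finite, 'm::finite) kernel"
  assumes K: "kernel_measurable K" and a1: "assumption1 A \<alpha> \<beta> K" and a2: "assumption2 A \<alpha> \<beta> lam1 lam2 K"
    and ab: "0 < \<alpha>" "0 < \<beta>" and lam: "0 \<le> lam2"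
    and C: "A \<le> C" "0 < C" "2 powr (real CARD('m) * lam2) * A\<^sup>2 \<le> C\<^sup>2"
    and r: "bounded_linear r" "\<And>z. \<bar>r z\<bar> \<le> cmod z"
  shows "first_variable_kernel (swap_kernel (\<lambda>q. r (truncated_kernel K q))) C \<beta> \<alpha>"
proof (intro first_variable_kernel.intro first_variable_kernel_axioms.intro
    product_kernel.product_kernel_swap[OF product_kernel_of_assumption1[OF K a1 ab C(1,2) r]])
  note [measurable] = borel_measurable_truncated_kernel[OF K]
  have linear: "r z - r w = r (z - w)" for z w using linear_simps(2)[OF r(1)] by auto
  fix t1 :: real and y1 z1 z1' :: "real^'n" assume t1: "0 < t1"
  let ?L = "\<lambda>z1 (t2, u2, z2). truncated_kernel K (t1, t2, (y1, u2), (z1, z2))"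
  have L: "?L z1 \<in> borel_measurable borel" for z1 unfolding borel_prod[symmetric] by measurable
  have integrable: "integrable lborel (\<lambda>z2. K t1 t2 (y1, u2) (z1, z2))" if "0 < t2" for t2 u2 z1
    using integrable_truncated_kernel(2)[OF K a1 ab t1 that] by (simp add: truncated_kernel_eq[OF t1 that])
  have "cube_testing (\<lambda>q. r (?L z1 q)) (C * poisson \<alpha> t1 (y1 - z1))"
    by (rule cube_testing_of_weighted[OF L _ _ assumption2_second_weighted_testing(1)[OF a2 t1] lam r C(3)])
      (simp_all add: truncated_kernel_eq[OF t1] integrable)
  then show "cube_testing (\<lambda>(t2, y2, z2). swap_kernel (\<lambda>q. r (truncated_kernel K q)) (t2, t1, (y2, y1), (z2, z1))) (C
    * poisson \<alpha> t1 (y1 - z1))"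
    by (simp add: case_prod_unfold)
  assume d: "infnorm (z1 - z1') < t1 / 2"
  have "(\<lambda>q. ?L z1 q - ?L z1' q) \<in> borel_measurable borel" using L[of z1] L[of z1'] by (rule borel_measurable_diff)
  then have "cube_testing (\<lambda>q. r (?L z1 q - ?L z1' q)) (C * holder_poisson \<alpha> t1 (z1 - z1') (y1 - z1))"
    by (rule cube_testing_of_weighted[OF _ _ _ assumption2_second_weighted_testing(2)[OF a2 t1 d] lam r C(3)])
      (simp_all add: truncated_kernel_eq[OF t1] integrable)
  then show "cube_testing (\<lambda>(t2, y2, z2). swap_kernel (\<lambda>q. r (truncated_kernel K q)) (t2, t1, (y2, y1), (z2, z1))
        - swap_kernel (\<lambda>q. r (truncated_kernel K q)) (t2, t1, (y2, y1), (z2, z1')))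
      (C * holder_poisson \<alpha> t1 (z1 - z1') (y1 - z1))"
    by (simp add: case_prod_unfold linear)
qed

subsection \<open>The Carleson condition on dyadic rectangles\<close>

definition square_theta ::
  "('n::finite, 'm::finite) kernel \<Rightarrow> ((real^'n) \<times> (real^'m) \<Rightarrow> complex) \<Rightarrow> real \<times> real \<times> ((real^'n) \<times> (real^'m)) \<Rightarrow>
    ennreal" where
  "square_theta K f q = ennreal ((cmod (\<integral>z. truncated_kernel K (fst q, fst (snd q), snd (snd q), z) * f z \<partial>lborel))\<^sup>2)"

lemma borel_measurable_square_theta:
  assumes "kernel_measurable K" "f \<in> borel_measurable borel"
  shows "square_theta K f \<in> borel_measurable borel"
proof -
  note [measurable] = borel_measurable_truncated_kernel[OF assms(1)] assms(2)
  show ?thesis unfolding square_theta_def[abs_def] by measurable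
qed

lemma square_theta_eq: "0 < t1 \<Longrightarrow> 0 < t2 \<Longrightarrow> square_theta K f (t1, t2, y) = ennreal ((cmod (theta K t1 t2 f y))\<^sup>2)"
  by (simp add: square_theta_def theta_def truncated_kernel_eq)

lemma carleson_coeff_eq:
  fixes K :: "('n::finite, 'm::finite) kernel" and lam1 lam2 :: real
  assumes K: "kernel_measurable K" and pos: "0 < snd I" "0 < snd J"
  defines "P1 \<equiv> \<lambda>t x. ennreal (gstar_weight lam1 t (x :: real^'n))"
    and "P2 \<equiv> \<lambda>t x. ennreal (gstar_weight lam2 t (x :: real^'m))"
  shows "carleson_coeff K lam1 lam2 I J
    = (\<integral>\<^sup>+x2\<in>hcube (fst J) (snd J).
      (\<integral>\<^sup>+t2\<in>{snd J / 2<..<snd J}. (\<integral>\<^sup>+x1\<in>hcube (fst I) (snd I). (\<integral>\<^sup>+t1\<in>{snd I / 2<..<snd I}.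
        (\<integral>\<^sup>+y. P1 t1 (x1 - fst y) * P2 t2 (x2 - snd y) * square_theta K (\<lambda>_. 1) (t1, t2, y) \<partial>lborel)
      \<partial>scale_measure) \<partial>lborel) \<partial>scale_measure) \<partial>lborel)"
proof -
  let ?\<Theta> = "square_theta K (\<lambda>_. 1)"
  have [measurable]: "?\<Theta> \<in> borel_measurable borel" by (rule borel_measurable_square_theta[OF K]) simp
  have W: "{snd I / 2<..<snd I} \<subseteq> {0<..}" "{snd J / 2<..<snd J} \<subseteq> {0<..}" using pos by auto
  have integrand: "indicator (hcube (fst J) (snd J)) x2 * indicator ({snd J / 2<..<snd J}) t2
    * indicator (hcube (fst I) (snd I)) x1 * indicator ({snd I / 2<..<snd I}) t1
      * ennreal ((cmod (theta K t1 t2 (\<lambda>_. 1) y))\<^sup>2 * (t1 / (t1 + infnorm (x1 - fst y))) powr (real CARD('n) * lam1)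
        * (t2 / (t2 + infnorm (x2 - snd y))) powr (real CARD('m) * lam2) / (t1 ^ CARD('n) * t2 ^ CARD('m)) / t1 / t2)
    = indicator (hcube (fst J) (snd J)) x2
      * (indicator ({snd J / 2<..<snd J}) t2 * (ennreal (1 / t2) * (indicator (hcube (fst I) (snd I)) x1
      * (indicator ({snd I / 2<..<snd I}) t1
        * (ennreal (1 / t1) * (P1 t1 (x1 - fst y) * P2 t2 (x2 - snd y) * ?\<Theta> (t1, t2, y)))))))"
    for x2 t2 x1 t1 y
  proof (cases "t1 \<in> {snd I / 2<..<snd I} \<and> t2 \<in> {snd J / 2<..<snd J}")
    case True
    then have t: "0 < t1" "0 < t2" using W by auto
    let ?w1 = "(t1 / (t1 + infnorm (x1 - fst y))) powr (real CARD('n) * lam1) / t1 ^ (CARD('n) + 1)"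
      and ?w2 = "(t2 / (t2 + infnorm (x2 - snd y))) powr (real CARD('m) * lam2) / t2 ^ (CARD('m) + 1)"
    have "(cmod (theta K t1 t2 (\<lambda>_. 1) y))\<^sup>2 * (t1 / (t1 + infnorm (x1 - fst y))) powr (real CARD('n) * lam1)
        * (t2 / (t2 + infnorm (x2 - snd y))) powr (real CARD('m) * lam2) / (t1 ^ CARD('n) * t2 ^ CARD('m)) / t1 / t2
      = ?w1 * ?w2 * (cmod (theta K t1 t2 (\<lambda>_. 1) y))\<^sup>2" by (simp add: mult_ac)
    also have "ennreal \<dots> = ennreal ?w1 * ennreal ?w2 * ?\<Theta> (t1, t2, y)"
      unfolding square_theta_eq[OF t] using t
      by (simp only: ennreal_mult zero_le_power2 mult_nonneg_nonneg divide_nonneg_nonneg powr_ge_zero zero_le_power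
        less_imp_le)
    finally show ?thesis
      unfolding ennreal_weight_eq_poisson[OF t(1)] ennreal_weight_eq_poisson[OF t(2)] P1_def P2_def
      by (simp add: mult_ac)
  qed auto
  show ?thesis
    unfolding carleson_coeff_def integrand P1_def P2_def
    by (simp add: nn_integral_scale_set W nn_integral_cmult mult.commute[of _ "indicator (hcube _ _) _"])
qed

lemma carleson_coeff_eq_mass:
  fixes K :: "('n::finite, 'm::finite) kernel" and lam1 lam2 :: real
  assumes K: "kernel_measurable K" and pos: "0 < snd I" "0 < snd J"
  defines "M1 \<equiv> \<lambda>t y. \<integral>\<^sup>+x\<in>hcube (fst I) (snd I). ennreal (gstar_weight lam1 t (x - fst y :: real^'n)) \<partial>lborel"
    and "M2 \<equiv> \<lambda>t y. \<integral>\<^sup>+x\<in>hcube (fst J) (snd J). ennreal (gstar_weight lam2 t (x - snd y :: real^'m)) \<partial>lborel"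
    and "\<Theta> \<equiv> \<lambda>q. square_theta K (\<lambda>_. 1) q * indicator {snd I / 2<..<snd I} (fst q)
      * indicator {snd J / 2<..<snd J} (fst (snd q))"
  shows "carleson_coeff K lam1 lam2 I J
    = (\<integral>\<^sup>+t1. \<integral>\<^sup>+t2. \<integral>\<^sup>+y. M2 t2 y * (M1 t1 y * \<Theta> (t1, t2, y)) \<partial>lborel \<partial>scale_measure \<partial>scale_measure)"
proof -
  have [measurable]: "square_theta K (\<lambda>_. 1) \<in> borel_measurable borel"
    by (rule borel_measurable_square_theta[OF K]) simp
  have [measurable]: "\<Theta> \<in> borel_measurable borel" unfolding \<Theta>_def by measurable
  let ?P1 = "\<lambda>t y x. ennreal (gstar_weight lam1 t (x - fst y)) * indicator (hcube (fst I) (snd I)) (x :: real^'n)"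
    and ?P2 = "\<lambda>t y x. ennreal (gstar_weight lam2 t (x - snd y)) * indicator (hcube (fst J) (snd J)) (x :: real^'m)"
  let ?F = "\<lambda>x2 t2 x1 t1 y. ?P2 t2 y x2 * (?P1 t1 y x1 * \<Theta> (t1, t2, y))"
  have integrand: "?F x2 t2 x1 t1 y = indicator (hcube (fst J) (snd J)) x2 * (indicator {snd J / 2<..<snd J} t2
      * (indicator (hcube (fst I) (snd I)) x1 * (indicator {snd I / 2<..<snd I} t1
      * (ennreal (gstar_weight lam1 t1 (x1 - fst y))
        * ennreal (gstar_weight lam2 t2 (x2 - snd y)) * square_theta K (\<lambda>_. 1) (t1, t2, y)))))"
    for x2 t2 x1 t1 y by (simp add: \<Theta>_def mult_ac)
  have "carleson_coeff K lam1 lam2 I J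
    = (\<integral>\<^sup>+x2. \<integral>\<^sup>+t2. \<integral>\<^sup>+x1. \<integral>\<^sup>+t1. \<integral>\<^sup>+y. ?F x2 t2 x1 t1 y \<partial>lborel \<partial>scale_measure \<partial>lborel \<partial>scale_measure \<partial>lborel)"
    unfolding carleson_coeff_eq[OF K pos] integrand
    by (simp add: nn_integral_cmult mult.commute[of _ "indicator _ _"])
  also have "\<dots> = (\<integral>\<^sup>+x2. \<integral>\<^sup>+t2. \<integral>\<^sup>+t1. \<integral>\<^sup>+x1. \<integral>\<^sup>+y. ?F x2 t2 x1 t1 y \<partial>lborel \<partial>lborel \<partial>scale_measure
    \<partial>scale_measure \<partial>lborel)"
    by (intro nn_integral_cong scale_lborel.Fubini') measurable
  also have "\<dots> = (\<integral>\<^sup>+x2. \<integral>\<^sup>+t2. \<integral>\<^sup>+t1. \<integral>\<^sup>+y. \<integral>\<^sup>+x1. ?F x2 t2 x1 t1 y \<partial>lborel \<partial>lborel \<partial>scale_measure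
    \<partial>scale_measure \<partial>lborel)"
    by (intro nn_integral_cong lborel_pair.Fubini') measurable
  also have "\<dots> = (\<integral>\<^sup>+x2. \<integral>\<^sup>+t1. \<integral>\<^sup>+t2. \<integral>\<^sup>+y. \<integral>\<^sup>+x1. ?F x2 t2 x1 t1 y \<partial>lborel \<partial>lborel \<partial>scale_measure
    \<partial>scale_measure \<partial>lborel)"
    by (intro nn_integral_cong scale_scale.Fubini') measurable
  also have "\<dots> = (\<integral>\<^sup>+t1. \<integral>\<^sup>+x2. \<integral>\<^sup>+t2. \<integral>\<^sup>+y. \<integral>\<^sup>+x1. ?F x2 t2 x1 t1 y \<partial>lborel \<partial>lborel \<partial>scale_measure \<partial>lborel
    \<partial>scale_measure)"
    by (rule scale_lborel.Fubini') measurable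
  also have "\<dots> = (\<integral>\<^sup>+t1. \<integral>\<^sup>+t2. \<integral>\<^sup>+x2. \<integral>\<^sup>+y. \<integral>\<^sup>+x1. ?F x2 t2 x1 t1 y \<partial>lborel \<partial>lborel \<partial>lborel \<partial>scale_measure
    \<partial>scale_measure)"
    by (intro nn_integral_cong scale_lborel.Fubini') measurable
  also have "\<dots> = (\<integral>\<^sup>+t1. \<integral>\<^sup>+t2. \<integral>\<^sup>+y. \<integral>\<^sup>+x2. \<integral>\<^sup>+x1. ?F x2 t2 x1 t1 y \<partial>lborel \<partial>lborel \<partial>lborel \<partial>scale_measure
    \<partial>scale_measure)"
    by (intro nn_integral_cong lborel_pair.Fubini') measurable
  finally show ?thesis by (simp add: nn_integral_cmult nn_integral_multc M1_def M2_def)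
qed

definition whitney_region ::
  "(real^'n) \<times> real \<Rightarrow> (real^'m) \<times> real \<Rightarrow> (real \<times> real \<times> ((real^'n) \<times> (real^'m))) set" where
  "whitney_region I J = {(t1, t2, y). t1 \<in> {snd I / 2<..<snd I} \<and> t2 \<in> {snd J / 2<..<snd J}
    \<and> fst y \<in> hcube (fst I) (snd I) \<and> snd y \<in> hcube (fst J) (snd J)}"

lemma sets_whitney_region [measurable]: "whitney_region I J \<in> sets borel"
  unfolding whitney_region_def case_prod_unfold by measurable

lemma carleson_coeff_ge:
  fixes K :: "('n::finite, 'm::finite) kernel"
  assumes K: "kernel_measurable K" and pos: "0 < snd I" "0 < snd J" and lam: "0 \<le> lam1" "0 \<le> lam2"
  shows "(\<integral>\<^sup>+t1. \<integral>\<^sup>+t2. \<integral>\<^sup>+y. square_theta K (\<lambda>_. 1) (t1, t2, y) * indicator (whitney_region I J) (t1, t2, y)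
      \<partial>lborel \<partial>scale_measure \<partial>scale_measure)
    \<le> ennreal (2 powr (real CARD('n) * lam1) * 2 powr (real CARD('m) * lam2)) * carleson_coeff K lam1 lam2 I J"
proof -
  define \<Theta> where "\<Theta> = (\<lambda>q. square_theta K (\<lambda>_. 1) q * indicator {snd I / 2<..<snd I} (fst q)
    * indicator {snd J / 2<..<snd J} (fst (snd q)))"
  have [measurable]: "square_theta K (\<lambda>_. 1) \<in> borel_measurable borel"
    by (rule borel_measurable_square_theta[OF K]) simp
  have [measurable]: "\<Theta> \<in> borel_measurable borel" unfolding \<Theta>_def by measurable
  let ?Q1 = "hcube (fst I) (snd I)" and ?Q2 = "hcube (fst J) (snd J)"
  let ?P1 = "\<lambda>t y x. ennreal (gstar_weight lam1 t (x - fst y)) * indicator ?Q1 (x :: real^'n)"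
    and ?P2 = "\<lambda>t y x. ennreal (gstar_weight lam2 t (x - snd y)) * indicator ?Q2 (x :: real^'m)"
  let ?c = "ennreal (2 powr (real CARD('n) * lam1))" and ?d = "ennreal (2 powr (real CARD('m) * lam2))"
  have whitney: "square_theta K (\<lambda>_. 1) (t1, t2, y) * indicator (whitney_region I J) (t1, t2, y)
    = \<Theta> (t1, t2, y) * indicator ?Q1 (fst y) * indicator ?Q2 (snd y)" for t1 t2 y
    by (simp add: \<Theta>_def whitney_region_def indicator_def)
  have mass: "\<Theta> (t1, t2, y) * indicator ?Q1 (fst y) * indicator ?Q2 (snd y)
    \<le> ?d * (\<integral>\<^sup>+x2. ?P2 t2 y x2 \<partial>lborel) * (?c * (\<integral>\<^sup>+x1. ?P1 t1 y x1 \<partial>lborel) * \<Theta> (t1, t2, y))"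
    for t1 t2 y
  proof (cases "t1 \<in> {snd I / 2<..<snd I} \<and> t2 \<in> {snd J / 2<..<snd J} \<and> fst y \<in> ?Q1 \<and> snd y \<in> ?Q2")
    case True
    then have "1 \<le> ?c * (\<integral>\<^sup>+x1. ?P1 t1 y x1 \<partial>lborel)" "1 \<le> ?d * (\<integral>\<^sup>+x2. ?P2 t2 y x2 \<partial>lborel)"
      using pos lam by (intro poisson_mass_hcube_ge; auto)+
    then have "1 * (1 * \<Theta> (t1, t2, y))
      \<le> ?d * (\<integral>\<^sup>+x2. ?P2 t2 y x2 \<partial>lborel) * (?c * (\<integral>\<^sup>+x1. ?P1 t1 y x1 \<partial>lborel) * \<Theta> (t1, t2, y))"
      by (intro mult_mono) auto
    then show ?thesis using True by simp
  qed (auto simp: \<Theta>_def indicator_def)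
  have "(\<integral>\<^sup>+t1. \<integral>\<^sup>+t2. \<integral>\<^sup>+y. \<Theta> (t1, t2, y) * indicator ?Q1 (fst y)
    * indicator ?Q2 (snd y) \<partial>lborel \<partial>scale_measure \<partial>scale_measure)
    \<le> (\<integral>\<^sup>+t1. \<integral>\<^sup>+t2. \<integral>\<^sup>+y. (?d * ?c) * ((\<integral>\<^sup>+x2. ?P2 t2 y x2 \<partial>lborel) * ((\<integral>\<^sup>+x1. ?P1 t1 y x1 \<partial>lborel) * \<Theta> (t1, t2, y)))
      \<partial>lborel \<partial>scale_measure \<partial>scale_measure)"
    using mass by (intro nn_integral_mono) (simp add: mult_ac)
  also have "\<dots> = ?c * ?d * carleson_coeff K lam1 lam2 I J"
    unfolding carleson_coeff_eq_mass[OF K pos] by (simp add: nn_integral_cmult mult.commute) (simp add: \<Theta>_def mult_ac)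
  finally show ?thesis by (simp only: whitney) (simp add: ennreal_mult)
qed

definition dyadic_rectangles ::
  "((real^'n::finite) \<times> (real^'m::finite)) set \<Rightarrow> (((real^'n) \<times> real) \<times> ((real^'m) \<times> real)) set" where
  "dyadic_rectangles \<Omega> = {(I, J). I \<in> dyadic_grid 0 \<and> J \<in> dyadic_grid 0
    \<and> hcube (fst I) (snd I) \<times> hcube (fst J) (snd J) \<subseteq> \<Omega>}"

lemma dyadic_cube_in_dyadic_grid: "(dyadic_corner k y, side_length k) \<in> dyadic_grid 0"
  unfolding dyadic_grid_def std_dyadic_def dyadic_corner_def
  by (auto simp: vec_eq_iff intro!: exI[of _ k] exI[of _ "\<lambda>i. \<lfloor>y $ i / side_length k\<rfloor>"])

lemma dyadic_grid_side_pos: "I \<in> dyadic_grid w \<Longrightarrow> 0 < snd I"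
  unfolding dyadic_grid_def std_dyadic_def by auto

lemma countable_dyadic_grid: "countable (dyadic_grid (w :: real^'n))"
proof -
  let ?h = "\<lambda>(k::int, j::'n \<Rightarrow> int). (2 powr (real_of_int k) *\<^sub>R (\<chi> i. real_of_int (j i)) + w, 2 powr (real_of_int k))"
  have "dyadic_grid w \<subseteq> range ?h" unfolding dyadic_grid_def std_dyadic_def by auto
  moreover have "countable (UNIV :: ('n \<Rightarrow> int) set)"
    using countable_PiE[of "UNIV :: 'n set" "\<lambda>_. UNIV :: int set"] by (simp add: PiE_UNIV_domain)
  then have "countable (UNIV :: (int \<times> ('n \<Rightarrow> int)) set)"
    unfolding UNIV_Times_UNIV[symmetric] by (intro countable_SIGMA) auto
  ultimately show ?thesis by (rule countable_subset[OF _ countable_image])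
qed

lemma countable_dyadic_rectangles: "countable (dyadic_rectangles \<Omega>)"
  by (rule countable_subset[of _ "dyadic_grid 0 \<times> dyadic_grid 0"])
    (auto simp: dyadic_rectangles_def intro!: countable_SIGMA countable_dyadic_grid)

lemma dyadic_cube_Times_in_dyadic_rectangles:
  assumes "dyadic_cube k1 (fst y) \<times> dyadic_cube k2 (snd y) \<subseteq> \<Omega>"
  shows "((dyadic_corner k1 (fst y), side_length k1), (dyadic_corner k2 (snd y), side_length k2)) \<in>
    dyadic_rectangles \<Omega>"
  using assms by (simp add: dyadic_rectangles_def dyadic_cube_in_dyadic_grid dyadic_cube_eq_hcube)

lemma mem_hcube_dyadic_corner: "x \<in> hcube (dyadic_corner k x) (side_length k)"
  by (simp add: dyadic_cube_eq_hcube[symmetric])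

lemma assumption3_sum_le:
  fixes K :: "('n::finite, 'm::finite) kernel"
  assumes a3: "assumption3 A lam1 lam2 K" and S[measurable]: "\<And>k1 k2. S k1 k2 \<in> sets borel"
    and saturated: "\<And>k1 k2 y. y \<in> S k1 k2 \<Longrightarrow> dyadic_cube k1 (fst y) \<times> dyadic_cube k2 (snd y) \<subseteq> S k1 k2"
    and finite: "emeasure lborel (\<Union>k1 k2. S k1 k2) < \<infinity>"
  defines "\<Omega> \<equiv> \<Union>k1 k2. S k1 k2"
  shows "(\<Sum>\<^sub>\<infinity>IJ\<in>dyadic_rectangles \<Omega>. carleson_coeff K lam1 lam2 (fst IJ) (snd IJ)) \<le> ennreal \<bar>A\<bar> * emeasure lborel \<Omega>"
proof -
  have "\<exists>I\<in>dyadic_grid 0. \<exists>J\<in>dyadic_grid 0. y \<in> hcube (fst I) (snd I) \<times> hcube (fst J) (snd J)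
    \<and> hcube (fst I) (snd I) \<times> hcube (fst J) (snd J) \<subseteq> \<Omega>" if y: "y \<in> \<Omega>" for y
  proof -
    obtain k1 k2 where "y \<in> S k1 k2" using y unfolding \<Omega>_def by blast
    then have "dyadic_cube k1 (fst y) \<times> dyadic_cube k2 (snd y) \<subseteq> S k1 k2" by (rule saturated)
    also have "S k1 k2 \<subseteq> \<Omega>" unfolding \<Omega>_def by blast
    finally show ?thesis
      by (intro bexI[OF _ dyadic_cube_in_dyadic_grid[of k1 "fst y"]]
        bexI[OF _ dyadic_cube_in_dyadic_grid[of k2 "snd y"]])
        (simp add: dyadic_cube_eq_hcube mem_Times_iff mem_hcube_dyadic_corner)
  qed
  moreover have "\<Omega> \<in> sets lborel" unfolding \<Omega>_def by measurable
  ultimately have "(\<Sum>\<^sub>\<infinity>IJ\<in>dyadic_rectangles \<Omega>. carleson_coeff K lam1 lam2 (fst IJ) (snd IJ))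
    \<le> ennreal A * emeasure lborel \<Omega>"
    using a3 finite unfolding assumption3_def dyadic_rectangles_def \<Omega>_def[symmetric] by blast
  also have "\<dots> \<le> ennreal \<bar>A\<bar> * emeasure lborel \<Omega>" by (intro mult_right_mono ennreal_leI) auto
  finally show ?thesis .
qed

lemma indicator_saturated_le_whitney:
  assumes saturated: "\<And>k1 k2 y. y \<in> S k1 k2 \<Longrightarrow> dyadic_cube k1 (fst y) \<times> dyadic_cube k2 (snd y) \<subseteq> S k1 k2"
    and t1: "0 < t1" "t1 < side_length (scale_index t1)" and t2: "0 < t2" "t2 < side_length (scale_index t2)"
  shows "indicator (S (scale_index t1) (scale_index t2)) y
    \<le> (\<integral>\<^sup>+IJ. indicator (whitney_region (fst IJ) (snd IJ)) (t1, t2, y)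
      \<partial>count_space (dyadic_rectangles (\<Union>k1 k2. S k1 k2)))"
proof (cases "y \<in> S (scale_index t1) (scale_index t2)")
  case True
  let ?k = "scale_index t1" and ?j = "scale_index t2"
    and ?w = "\<lambda>IJ. indicator (whitney_region (fst IJ) (snd IJ)) (t1, t2, y) :: ennreal"
  let ?r = "((dyadic_corner ?k (fst y), side_length ?k), (dyadic_corner ?j (snd y), side_length ?j))"
  have "?r \<in> dyadic_rectangles (\<Union>k1 k2. S k1 k2)"
    using saturated[OF True] by (intro dyadic_cube_Times_in_dyadic_rectangles) blast
  then have "?w ?r \<le> (\<integral>\<^sup>+IJ. ?w IJ \<partial>count_space (dyadic_rectangles (\<Union>k1 k2. S k1 k2)))"
    by (rule nn_integral_ge_point)
  then show ?thesis
    using True t1 t2 scale_index_bounds(1)[OF t1(1)] scale_index_bounds(1)[OF t2(1)]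
    by (simp add: whitney_region_def mem_hcube_dyadic_corner)
qed simp

lemma assumption3_saturated_le:
  fixes K :: "('n::finite, 'm::finite) kernel"
  assumes K: "kernel_measurable K" and a3: "assumption3 A lam1 lam2 K" and lam: "0 \<le> lam1" "0 \<le> lam2"
    and S[measurable]: "\<And>k1 k2. S k1 k2 \<in> sets borel"
    and saturated: "\<And>k1 k2 y. y \<in> S k1 k2 \<Longrightarrow> dyadic_cube k1 (fst y) \<times> dyadic_cube k2 (snd y) \<subseteq> S k1 k2"
    and finite: "emeasure lborel (\<Union>k1 k2. S k1 k2) < \<infinity>"
  shows "(\<integral>\<^sup>+t1. \<integral>\<^sup>+t2. (\<integral>\<^sup>+y\<in>S (scale_index t1) (scale_index t2). square_theta K (\<lambda>_. 1) (t1, t2, y) \<partial>lborel)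
    \<partial>scale_measure \<partial>scale_measure)
    \<le> ennreal (2 powr (real CARD('n) * lam1) * 2 powr (real CARD('m) * lam2) * \<bar>A\<bar>)
      * emeasure lborel (\<Union>k1 k2. S k1 k2)"
proof -
  let ?\<Omega> = "\<Union>k1 k2. S k1 k2" and ?c = "2 powr (real CARD('n) * lam1) * 2 powr (real CARD('m) * lam2)"
  let ?R = "dyadic_rectangles ?\<Omega>" and ?\<Theta> = "square_theta K (\<lambda>_. 1)"
  have \<Theta>[measurable]: "?\<Theta> \<in> borel_measurable borel" by (rule borel_measurable_square_theta[OF K]) simp
  let ?H = "\<lambda>IJ t1 t2 y. ?\<Theta> (t1, t2, y) * indicator (whitney_region (fst IJ) (snd IJ)) (t1, t2, y)"
  have AE: "AE t in scale_measure. 0 < t \<and> t < side_length (scale_index t)"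
    using AE_scale_measure_pos AE_less_side_length_scale_index by eventually_elim simp
  have "(\<integral>\<^sup>+t1. \<integral>\<^sup>+t2. (\<integral>\<^sup>+y\<in>S (scale_index t1) (scale_index t2). ?\<Theta> (t1, t2, y) \<partial>lborel) \<partial>scale_measure \<partial>scale_measure)
    \<le> (\<integral>\<^sup>+t1. \<integral>\<^sup>+t2. \<integral>\<^sup>+y. \<integral>\<^sup>+IJ. ?H IJ t1 t2 y \<partial>count_space ?R \<partial>lborel \<partial>scale_measure \<partial>scale_measure)"
    by (rule nn_integral_mono_AE, use AE in eventually_elim, rule nn_integral_mono_AE, use AE in eventually_elim,
      rule nn_integral_mono)
      (simp add: nn_integral_cmult mult_left_mono indicator_saturated_le_whitney[OF saturated])
  also have "\<dots> = (\<integral>\<^sup>+t1. \<integral>\<^sup>+t2. \<integral>\<^sup>+IJ. \<integral>\<^sup>+y. ?H IJ t1 t2 y \<partial>lborel \<partial>count_space ?R \<partial>scale_measure \<partial>scale_measure)"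
    by (intro nn_integral_cong nn_integral_count_space_nn_integral countable_dyadic_rectangles) measurable
  also have "\<dots> = (\<integral>\<^sup>+t1. \<integral>\<^sup>+IJ. \<integral>\<^sup>+t2. \<integral>\<^sup>+y. ?H IJ t1 t2 y \<partial>lborel \<partial>scale_measure \<partial>count_space ?R \<partial>scale_measure)"
    by (intro nn_integral_cong nn_integral_count_space_nn_integral countable_dyadic_rectangles) measurable
  also have "\<dots> = (\<integral>\<^sup>+IJ. \<integral>\<^sup>+t1. \<integral>\<^sup>+t2. \<integral>\<^sup>+y. ?H IJ t1 t2 y \<partial>lborel \<partial>scale_measure \<partial>scale_measure \<partial>count_space ?R)"
    by (intro nn_integral_count_space_nn_integral countable_dyadic_rectangles) measurable
  also have "\<dots> \<le> (\<integral>\<^sup>+IJ. ennreal ?c * carleson_coeff K lam1 lam2 (fst IJ) (snd IJ) \<partial>count_space ?R)"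
    by (intro nn_integral_mono carleson_coeff_ge K lam) (auto simp: dyadic_rectangles_def dest: dyadic_grid_side_pos)
  also have "\<dots> \<le> ennreal ?c * (\<Sum>\<^sub>\<infinity>IJ\<in>?R. carleson_coeff K lam1 lam2 (fst IJ) (snd IJ))"
    by (simp add: nn_integral_cmult mult_left_mono nn_integral_count_space_le_infsum[OF countable_dyadic_rectangles])
  also have "\<dots> \<le> ennreal ?c * (ennreal \<bar>A\<bar> * emeasure lborel ?\<Omega>)"
    by (intro mult_left_mono assumption3_sum_le[OF a3 S saturated finite]) simp_all
  also have "\<dots> = ennreal (?c * \<bar>A\<bar>) * emeasure lborel ?\<Omega>" by (simp add: ennreal_mult mult.assoc)
  finally show ?thesis .
qed

lemma rectangle_carleson_of_assumption3:
  fixes K :: "('n::finite, 'm::finite) kernel"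
  assumes K: "kernel_measurable K" and a1: "assumption1 B \<alpha> \<beta> K" and a3: "assumption3 A lam1 lam2 K"
    and ab: "0 < \<alpha>" "0 < \<beta>" and lam: "0 \<le> lam1" "0 \<le> lam2"
    and r: "bounded_linear r" "\<And>z. \<bar>r z\<bar> \<le> cmod z"
  shows "rectangle_carleson (\<lambda>q. r (truncated_kernel K q))
    (2 powr (real CARD('n) * lam1) * 2 powr (real CARD('m) * lam2) * \<bar>A\<bar>)"
  unfolding rectangle_carleson_def
proof (intro allI impI)
  fix S :: "int \<Rightarrow> int \<Rightarrow> ((real^'n) \<times> (real^'m)) set"
  assume S: "\<forall>k1 k2. S k1 k2 \<in> sets borel"
    "\<forall>k1 k2. \<forall>y\<in>S k1 k2. dyadic_cube k1 (fst y) \<times> dyadic_cube k2 (snd y) \<subseteq> S k1 k2"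
    "emeasure lborel (\<Union>k1 k2. S k1 k2) < \<infinity>"
  have "ennreal ((\<integral>z. r (truncated_kernel K (t1, t2, y, z)) \<partial>lborel)\<^sup>2) \<le> square_theta K (\<lambda>_. 1) (t1, t2, y)"
    if t: "0 < t1" "0 < t2" for t1 t2 y
    using integral_bounded_linear[OF r(1) integrable_truncated_kernel(3)[OF K a1 ab t, of y]]
      r(2)[of "\<integral>z. truncated_kernel K (t1, t2, y, z) \<partial>lborel"]
    by (simp add: square_theta_def abs_le_square_iff[symmetric] ennreal_leI)
  then have "(\<integral>\<^sup>+t1. \<integral>\<^sup>+t2. (\<integral>\<^sup>+y\<in>S (scale_index t1) (scale_index t2).
      ennreal ((\<integral>z. r (truncated_kernel K (t1, t2, y, z)) \<partial>lborel)\<^sup>2) \<partial>lborel) \<partial>scale_measure \<partial>scale_measure)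
    \<le> (\<integral>\<^sup>+t1. \<integral>\<^sup>+t2. (\<integral>\<^sup>+y\<in>S (scale_index t1) (scale_index t2). square_theta K (\<lambda>_. 1) (t1, t2, y) \<partial>lborel)
      \<partial>scale_measure \<partial>scale_measure)"
    by (intro nn_integral_scale_mono nn_integral_mono mult_right_mono) auto
  also have "\<dots> \<le> ennreal (2 powr (real CARD('n) * lam1) * 2 powr (real CARD('m) * lam2) * \<bar>A\<bar>)
    * emeasure lborel (\<Union>k1 k2. S k1 k2)"
    using S by (intro assumption3_saturated_le[OF K a3 lam]) auto
  finally show "(\<integral>\<^sup>+t1. \<integral>\<^sup>+t2. (\<integral>\<^sup>+y\<in>S (scale_index t1) (scale_index t2).
      ennreal ((\<integral>z. r (truncated_kernel K (t1, t2, y, z)) \<partial>lborel)\<^sup>2) \<partial>lborel) \<partial>scale_measure \<partial>scale_measure)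
    \<le> ennreal (2 powr (real CARD('n) * lam1) * 2 powr (real CARD('m) * lam2) * \<bar>A\<bar>)
      * emeasure lborel (\<Union>k1 k2. S k1 k2)" .
qed

subsection \<open>The vertical square function\<close>

definition kernel_const :: "nat \<Rightarrow> nat \<Rightarrow> real \<Rightarrow> real \<Rightarrow> real \<Rightarrow> real" where
  "kernel_const n m A lam1 lam2 = (\<bar>A\<bar> + 1) * 2 powr (real n * lam1) * 2 powr (real m * lam2)"

definition vertical_const :: "nat \<Rightarrow> nat \<Rightarrow> real \<Rightarrow> real \<Rightarrow> real \<Rightarrow> real \<Rightarrow> real \<Rightarrow> real" where
  "vertical_const n m A \<alpha> \<beta> lam1 lam2 = 4 * bi_parameter_const n m (kernel_const n m A lam1 lam2) \<alpha> \<beta>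
    (2 powr (real n * lam1) * 2 powr (real m * lam2) * \<bar>A\<bar>)"

lemma kernel_const_bounds:
  assumes "0 \<le> lam1" "0 \<le> lam2"
  shows "0 < kernel_const n m A lam1 lam2" "A \<le> kernel_const n m A lam1 lam2"
    "2 powr (real n * lam1) * A\<^sup>2 \<le> (kernel_const n m A lam1 lam2)\<^sup>2"
    "2 powr (real m * lam2) * A\<^sup>2 \<le> (kernel_const n m A lam1 lam2)\<^sup>2"
proof -
  let ?x = "2 powr (real n * lam1)" and ?y = "2 powr (real m * lam2)" and ?C = "kernel_const n m A lam1 lam2"
  have x: "1 \<le> ?x" and y: "1 \<le> ?y" using assms by (auto intro!: ge_one_powr_ge_zero)
  have xy: "?x \<le> ?x * ?y" "?y \<le> ?x * ?y" "1 \<le> ?x * ?y"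
    using x y mult_mono[OF x y] mult_left_mono[OF y, of ?x] mult_right_mono[OF x, of ?y] by auto
  show "0 < ?C" by (simp add: kernel_const_def)
  have "\<bar>A\<bar> * 1 \<le> (\<bar>A\<bar> + 1) * (?x * ?y)" using xy by (intro mult_mono) auto
  then show "A \<le> ?C" by (simp add: kernel_const_def mult.assoc)
  have A: "A\<^sup>2 \<le> (\<bar>A\<bar> + 1)\<^sup>2" using power_mono[of "\<bar>A\<bar>" "\<bar>A\<bar> + 1" 2] by simp
  have square: "?x * ?y \<le> (?x * ?y)\<^sup>2" using mult_left_mono[OF xy(3), of "?x * ?y"] by (simp add: power2_eq_square)
  have "z * A\<^sup>2 \<le> ?C\<^sup>2" if "0 \<le> z" "z \<le> ?x * ?y" for z
  proof -
    have "z * A\<^sup>2 \<le> (?x * ?y)\<^sup>2 * (\<bar>A\<bar> + 1)\<^sup>2" using that square A by (intro mult_mono) auto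
    then show ?thesis by (simp add: kernel_const_def power_mult_distrib mult_ac)
  qed
  then show "?x * A\<^sup>2 \<le> ?C\<^sup>2" "?y * A\<^sup>2 \<le> ?C\<^sup>2" using xy by auto
qed

lemma bi_parameter_kernel_of_assumptions:
  fixes K :: "('n::finite, 'm::finite) kernel"
  assumes K: "kernel_measurable K" "assumption1 A \<alpha> \<beta> K" "assumption2 A \<alpha> \<beta> lam1 lam2 K" "assumption3 A lam1 lam2 K"
    and ab: "0 < \<alpha>" "0 < \<beta>" and lam: "0 \<le> lam1" "0 \<le> lam2"
    and r: "bounded_linear r" "\<And>z. \<bar>r z\<bar> \<le> cmod z"
  shows "bi_parameter_kernel (\<lambda>q. r (truncated_kernel K q)) (kernel_const CARD('n) CARD('m) A lam1 lam2) \<alpha> \<beta>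
    (2 powr (real CARD('n) * lam1) * 2 powr (real CARD('m) * lam2) * \<bar>A\<bar>)"
  using kernel_const_bounds[OF lam, where n="CARD('n)" and m="CARD('m)" and A=A]
  by (intro bi_parameter_kernel.intro bi_parameter_kernel_axioms.intro first_variable_kernel_of_assumptions[OF K(1-3)]
      swapped_first_variable_kernel_of_assumptions[OF K(1-3)] rectangle_carleson_of_assumption3[OF K(1,2,4)] ab lam r)
        auto

lemma cmod_integral_mult_square_le:
  fixes k f :: "'a \<Rightarrow> complex"
  assumes re: "integrable M (\<lambda>z. Re (k z) * Re (f z))" "integrable M (\<lambda>z. Im (k z) * Im (f z))"
    and im: "integrable M (\<lambda>z. Re (k z) * Im (f z))" "integrable M (\<lambda>z. Im (k z) * Re (f z))"
  shows "(cmod (\<integral>z. k z * f z \<partial>M))\<^sup>2 \<le> 2 * ((\<integral>z. Re (k z) * Re (f z) \<partial>M)\<^sup>2 + (\<integral>z. Im (k z) * Im (f z) \<partial>M)\<^sup>2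
    + (\<integral>z. Re (k z) * Im (f z) \<partial>M)\<^sup>2 + (\<integral>z. Im (k z) * Re (f z) \<partial>M)\<^sup>2)"
proof -
  have "integrable M (\<lambda>z. k z * f z)" using re im by (intro integrable_complexI) simp_all
  then have "Re (\<integral>z. k z * f z \<partial>M) = (\<integral>z. Re (k z) * Re (f z) \<partial>M) - (\<integral>z. Im (k z) * Im (f z) \<partial>M)"
    "Im (\<integral>z. k z * f z \<partial>M) = (\<integral>z. Re (k z) * Im (f z) \<partial>M) + (\<integral>z. Im (k z) * Re (f z) \<partial>M)"
    using re im by (simp_all flip: integral_Re integral_Im)
  then show ?thesis
    using square_diff_le[of "\<integral>z. Re (k z) * Re (f z) \<partial>M" "\<integral>z. Im (k z) * Im (f z) \<partial>M"]
      square_add_le[of "\<integral>z. Re (k z) * Im (f z) \<partial>M" "\<integral>z. Im (k z) * Re (f z) \<partial>M"]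
    by (simp add: cmod_power2 distrib_left)
qed

lemma L2_parts:
  assumes f: "L2 f"
  shows "square_integrable lborel (\<lambda>z. Re (f z))" "square_integrable lborel (\<lambda>z. Im (f z))"
    and "energy lborel (\<lambda>z. Re (f z)) + energy lborel (\<lambda>z. Im (f z)) = ennreal ((L2norm f)\<^sup>2)"
proof -
  have [measurable]: "f \<in> borel_measurable borel" using f by (simp add: L2_def)
  have "energy lborel (\<lambda>z. Re (f z)) + energy lborel (\<lambda>z. Im (f z)) = (\<integral>\<^sup>+y. ennreal ((cmod (f y))\<^sup>2) \<partial>lborel)"
    by (subst nn_integral_add[symmetric]) (auto simp: cmod_power2)
  also have "\<dots> = ennreal ((L2norm f)\<^sup>2)"
    using f unfolding L2norm_def L2_def by (subst nn_integral_eq_integral) auto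
  finally show parts: "energy lborel (\<lambda>z. Re (f z)) + energy lborel (\<lambda>z. Im (f z)) = ennreal ((L2norm f)\<^sup>2)" .
  have "energy lborel (\<lambda>z. Re (f z)) + energy lborel (\<lambda>z. Im (f z)) < \<infinity>" unfolding parts by simp
  then show "square_integrable lborel (\<lambda>z. Re (f z))" "square_integrable lborel (\<lambda>z. Im (f z))"
    by (auto simp: square_integrable_def)
qed

lemma square_theta_le_parts:
  fixes K :: "('n::finite, 'm::finite) kernel" and y :: "(real^'n) \<times> (real^'m)"
  assumes re: "product_kernel (\<lambda>q. Re (truncated_kernel K q)) C \<alpha> \<beta>"
    and im: "product_kernel (\<lambda>q. Im (truncated_kernel K q)) C \<alpha> \<beta>"
    and f: "L2 f" and t: "0 < t1" "0 < t2"
  defines "T \<equiv> \<lambda>k h. \<integral>z. k (truncated_kernel K (t1, t2, y, z)) * h (f z) \<partial>lborel"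
  shows "square_theta K f (t1, t2, y)
    \<le> 2 * (ennreal ((T Re Re)\<^sup>2) + ennreal ((T Im Im)\<^sup>2) + ennreal ((T Re Im)\<^sup>2) + ennreal ((T Im Re)\<^sup>2))"
proof -
  interpret re: product_kernel "\<lambda>q. Re (truncated_kernel K q)" C \<alpha> \<beta> by (rule re)
  interpret im: product_kernel "\<lambda>q. Im (truncated_kernel K q)" C \<alpha> \<beta> by (rule im)
  have "square_theta K f (t1, t2, y) \<le> ennreal (2 * ((T Re Re)\<^sup>2 + (T Im Im)\<^sup>2 + (T Re Im)\<^sup>2 + (T Im Re)\<^sup>2))"
    unfolding square_theta_def fst_conv snd_conv T_def
    by (intro ennreal_leI cmod_integral_mult_square_le re.integrable_kernel_mult im.integrable_kernel_mult t
        L2_parts(1,2)[OF f])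
  then show ?thesis by (simp add: ennreal_mult)
qed

theorem vertical_square_function_bound:
  fixes K :: "('n::finite, 'm::finite) kernel" and f :: "(real^'n) \<times> (real^'m) \<Rightarrow> complex"
  assumes K: "kernel_measurable K" "assumption1 A \<alpha> \<beta> K" "assumption2 A \<alpha> \<beta> lam1 lam2 K" "assumption3 A lam1 lam2 K"
    and ab: "0 < \<alpha>" "0 < \<beta>" and lam: "0 \<le> lam1" "0 \<le> lam2" and f: "L2 f"
  defines "C \<equiv> vertical_const CARD('n) CARD('m) A \<alpha> \<beta> lam1 lam2"
  shows "(\<integral>\<^sup>+t1. \<integral>\<^sup>+t2. \<integral>\<^sup>+y. square_theta K f (t1, t2, y) \<partial>lborel \<partial>scale_measure \<partial>scale_measure)
    \<le> ennreal (C * (L2norm f)\<^sup>2)"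
    and "0 \<le> C"
proof -
  let ?C = "kernel_const CARD('n) CARD('m) A lam1 lam2"
    and ?D = "2 powr (real CARD('n) * lam1) * 2 powr (real CARD('m) * lam2) * \<bar>A\<bar>"
  let ?B = "bi_parameter_const CARD('n) CARD('m) ?C \<alpha> \<beta> ?D"
  interpret re: bi_parameter_kernel "\<lambda>q. Re (truncated_kernel K q)" ?C \<alpha> \<beta> ?D
    by (rule bi_parameter_kernel_of_assumptions[OF K ab lam bounded_linear_Re abs_Re_le_cmod])
  interpret im: bi_parameter_kernel "\<lambda>q. Im (truncated_kernel K q)" ?C \<alpha> \<beta> ?D
    by (rule bi_parameter_kernel_of_assumptions[OF K ab lam bounded_linear_Im abs_Im_le_cmod])
  have B: "0 \<le> ?B" "C = 4 * ?B" using re.bi_parameter_const_nonneg by (simp_all add: C_def vertical_const_def)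
  then show "0 \<le> C" by simp
  note [measurable] = borel_measurable_truncated_kernel[OF K(1)]
    L2_parts(1,2)[OF f, THEN borel_measurable_square_integrable_lborel]
  let ?T = "\<lambda>k h t1 t2 y. \<integral>z. k (truncated_kernel K (t1, t2, y, z)) * h (f z) \<partial>lborel"
  let ?E = "\<lambda>k h t1 t2 y. ennreal ((?T k h t1 t2 y)\<^sup>2)"
  have "(\<integral>\<^sup>+t1. \<integral>\<^sup>+t2. \<integral>\<^sup>+y. square_theta K f (t1, t2, y) \<partial>lborel \<partial>scale_measure \<partial>scale_measure)
    \<le> (\<integral>\<^sup>+t1. \<integral>\<^sup>+t2. \<integral>\<^sup>+y. 2 * (?E Re Re t1 t2 y + ?E Im Im t1 t2 y + ?E Re Im t1 t2 y + ?E Im Re t1 t2 y) \<partial>lborel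
      \<partial>scale_measure \<partial>scale_measure)"
    by (intro nn_integral_scale_mono nn_integral_mono
        square_theta_le_parts[OF re.product_kernel_axioms im.product_kernel_axioms f])
  also have "\<dots> = 2 * (scale_energy (?T Re Re) + scale_energy (?T Im Im) + scale_energy (?T Re Im)
    + scale_energy (?T Im Re))"
    by (simp add: nn_integral_add nn_integral_cmult)
  also have "\<dots> \<le> 2 * (ennreal ?B * energy lborel (\<lambda>z. Re (f z)) + ennreal ?B * energy lborel (\<lambda>z. Im (f z))
      + ennreal ?B * energy lborel (\<lambda>z. Im (f z)) + ennreal ?B * energy lborel (\<lambda>z. Re (f z)))"
    by (intro mult_left_mono add_mono re.square_function_bound im.square_function_bound L2_parts(1,2)[OF f]) simp
  also have "\<dots> = 4 * ennreal ?B * (energy lborel (\<lambda>z. Re (f z)) + energy lborel (\<lambda>z. Im (f z)))"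
  proof -
    have "2 * (c * p + c * q + c * q + c * p) = 4 * c * (p + q)" for c p q :: ennreal
      by (simp add: distrib_left distrib_right mult_2 add_ac mult.assoc)
        (simp add: add.assoc[symmetric] flip: mult_2 distrib_right)
    then show ?thesis .
  qed
  also have "\<dots> = ennreal (C * (L2norm f)\<^sup>2)"
    unfolding L2_parts(3)[OF f] using B by (simp add: ennreal_mult)
  finally show "(\<integral>\<^sup>+t1. \<integral>\<^sup>+t2. \<integral>\<^sup>+y. square_theta K f (t1, t2, y) \<partial>lborel \<partial>scale_measure \<partial>scale_measure)
    \<le> ennreal (C * (L2norm f)\<^sup>2)" .
qed

subsection \<open>The weighted square function\<close>

lemma gstar_sq_eq:
  fixes K :: "('n::finite, 'm::finite) kernel"
  assumes K: "kernel_measurable K" and f: "f \<in> borel_measurable borel"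
  shows "gstar_sq K lam1 lam2 f (x1, x2)
    = (\<integral>\<^sup>+y2. \<integral>\<^sup>+t2. ennreal (gstar_weight lam2 t2 (x2 - y2))
      * (\<integral>\<^sup>+y1. \<integral>\<^sup>+t1. ennreal (gstar_weight lam1 t1 (x1 - y1)) * square_theta K f (t1, t2, (y1, y2))
          \<partial>scale_measure \<partial>lborel) \<partial>scale_measure \<partial>lborel)"
proof -
  note [measurable] = borel_measurable_square_theta[OF K f]
  let ?P1 = "\<lambda>t1 y1. ennreal (gstar_weight lam1 t1 (x1 - y1))"
  have inner: "(\<integral>\<^sup>+t1. indicator {0<..} t1 * ennreal ((t1 / (t1 + infnorm (x1 - y1))) powr (real CARD('n) * lam1)
      * (cmod (theta K t1 t2 f (y1, y2)))\<^sup>2 / t1 ^ (CARD('n) + 1)) \<partial>lborel)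
    = (\<integral>\<^sup>+t1. ?P1 t1 y1 * square_theta K f (t1, t2, (y1, y2)) \<partial>scale_measure)" if t2: "0 < t2" for t2 y1 y2
  proof (subst nn_integral_scale_measure, measurable, intro nn_integral_cong)
    fix t1 :: real
    let ?w = "(t1 / (t1 + infnorm (x1 - y1))) powr (real CARD('n) * lam1) / t1 ^ (CARD('n) + 1)"
    show "indicator {0<..} t1 * ennreal ((t1 / (t1 + infnorm (x1 - y1))) powr (real CARD('n) * lam1)
        * (cmod (theta K t1 t2 f (y1, y2)))\<^sup>2 / t1 ^ (CARD('n) + 1))
      = indicator {0<..} t1 * ennreal (1 / t1) * (?P1 t1 y1 * square_theta K f (t1, t2, (y1, y2)))"
    proof (cases "0 < t1")
      case True
      have "ennreal (?w * (cmod (theta K t1 t2 f (y1, y2)))\<^sup>2) = ennreal ?w * square_theta K f (t1, t2, (y1, y2))"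
        unfolding square_theta_eq[OF True t2] using True by (intro ennreal_mult) auto
      then show ?thesis unfolding ennreal_weight_eq_poisson[OF True] using True by (simp add: mult_ac)
    qed simp
  qed
  show ?thesis
    unfolding gstar_sq_def fst_conv snd_conv
  proof (intro nn_integral_cong, subst nn_integral_scale_measure, measurable, intro nn_integral_cong)
    fix y2 :: "real^'m" and t2 :: real
    show "indicator {0<..} t2 * ennreal
      ((t2 / (t2 + infnorm (x2 - y2))) powr (real CARD('m) * lam2) / t2 ^ (CARD('m) + 1))
        * (\<integral>\<^sup>+y1. \<integral>\<^sup>+t1. indicator {0<..} t1 * ennreal ((t1 / (t1 + infnorm (x1 - y1))) powr (real CARD('n) * lam1)
          * (cmod (theta K t1 t2 f (y1, y2)))\<^sup>2 / t1 ^ (CARD('n) + 1)) \<partial>lborel \<partial>lborel)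
      = indicator {0<..} t2 * ennreal (1 / t2) * (ennreal (gstar_weight lam2 t2 (x2 - y2))
        * (\<integral>\<^sup>+y1. \<integral>\<^sup>+t1. ?P1 t1 y1 * square_theta K f (t1, t2, (y1, y2)) \<partial>scale_measure \<partial>lborel))"
      by (cases "0 < t2") (simp_all only: inner ennreal_weight_eq_poisson, simp_all add: mult_ac)
  qed
qed

lemma nn_integral_scale_lborel_reorder:
  fixes g :: "real \<times> real \<times> ('a::euclidean_space \<times> 'b::euclidean_space) \<Rightarrow> ennreal"
  assumes [measurable]: "g \<in> borel_measurable borel"
  shows "(\<integral>\<^sup>+y2. \<integral>\<^sup>+t2. \<integral>\<^sup>+y1. \<integral>\<^sup>+t1. g (t1, t2, (y1, y2)) \<partial>scale_measure \<partial>lborel \<partial>scale_measure \<partial>lborel)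
    = (\<integral>\<^sup>+t1. \<integral>\<^sup>+t2. \<integral>\<^sup>+y. g (t1, t2, y) \<partial>lborel \<partial>scale_measure \<partial>scale_measure)"
proof -
  have "(\<integral>\<^sup>+y2. \<integral>\<^sup>+t2. \<integral>\<^sup>+y1. \<integral>\<^sup>+t1. g (t1, t2, (y1, y2)) \<partial>scale_measure \<partial>lborel \<partial>scale_measure \<partial>lborel)
    = (\<integral>\<^sup>+t2. \<integral>\<^sup>+y2. \<integral>\<^sup>+y1. \<integral>\<^sup>+t1. g (t1, t2, (y1, y2)) \<partial>scale_measure \<partial>lborel \<partial>lborel \<partial>scale_measure)"
    by (rule scale_lborel.Fubini') measurable
  also have "\<dots> = (\<integral>\<^sup>+t2. \<integral>\<^sup>+y. \<integral>\<^sup>+t1. g (t1, t2, y) \<partial>scale_measure \<partial>lborel \<partial>scale_measure)"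
    by (intro nn_integral_cong nn_integral_lborel_snd[symmetric]) measurable
  also have "\<dots> = (\<integral>\<^sup>+t2. \<integral>\<^sup>+t1. \<integral>\<^sup>+y. g (t1, t2, y) \<partial>lborel \<partial>scale_measure \<partial>scale_measure)"
    by (intro nn_integral_cong scale_lborel.Fubini') measurable
  also have "\<dots> = (\<integral>\<^sup>+t1. \<integral>\<^sup>+t2. \<integral>\<^sup>+y. g (t1, t2, y) \<partial>lborel \<partial>scale_measure \<partial>scale_measure)"
    by (rule scale_scale.Fubini') measurable
  finally show ?thesis .
qed

lemma nn_integral_gstar_sq_le:
  fixes K :: "('n::finite, 'm::finite) kernel"
  assumes K: "kernel_measurable K" and f: "f \<in> borel_measurable borel" and lam: "1 < lam1" "1 < lam2"
  shows "(\<integral>\<^sup>+x. gstar_sq K lam1 lam2 f x \<partial>lborel)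
    \<le> ennreal (gstar_weight_mass CARD('m) lam2 * gstar_weight_mass CARD('n) lam1)
      * (\<integral>\<^sup>+t1. \<integral>\<^sup>+t2. \<integral>\<^sup>+y. square_theta K f (t1, t2, y) \<partial>lborel \<partial>scale_measure \<partial>scale_measure)"
proof -
  note [measurable] = borel_measurable_square_theta[OF K f]
  have c: "0 < real CARD('n) * lam1 - real CARD('n)" "0 < real CARD('m) * lam2 - real CARD('m)" using lam by simp_all
  let ?\<Theta> = "\<lambda>t1 t2 y1 y2. square_theta K f (t1, t2, (y1, y2))"
  let ?h = "\<lambda>x1 t2 y2. \<integral>\<^sup>+y1. \<integral>\<^sup>+t1. ennreal (gstar_weight lam1 t1 (x1 - y1)) * ?\<Theta> t1 t2 y1 y2 \<partial>scale_measure \<partial>lborel"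
  have [measurable]: "gstar_sq K lam1 lam2 f \<in> borel_measurable borel"
  proof -
    have "gstar_sq K lam1 lam2 f = (\<lambda>x. \<integral>\<^sup>+y2. \<integral>\<^sup>+t2. ennreal (gstar_weight lam2 t2 (snd x - y2))
      * ?h (fst x) t2 y2 \<partial>scale_measure \<partial>lborel)"
      using gstar_sq_eq[OF K f] by (auto simp: fun_eq_iff)
    then show ?thesis by simp
  qed
  have "(\<integral>\<^sup>+x. gstar_sq K lam1 lam2 f x \<partial>lborel)
    = (\<integral>\<^sup>+x1. \<integral>\<^sup>+x2. \<integral>\<^sup>+y2. \<integral>\<^sup>+t2. ennreal (gstar_weight lam2 t2 (x2 - y2))
      * ?h x1 t2 y2 \<partial>scale_measure \<partial>lborel \<partial>lborel \<partial>lborel)"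
    by (subst nn_integral_lborel_fst) (simp_all add: gstar_sq_eq[OF K f])
  also have "\<dots> \<le> (\<integral>\<^sup>+x1. ennreal (gstar_weight_mass CARD('m) lam2)
    * (\<integral>\<^sup>+y2. \<integral>\<^sup>+t2. ?h x1 t2 y2 \<partial>scale_measure \<partial>lborel) \<partial>lborel)"
    using nn_integral_poisson_convolution_le[OF _ c(2), of "\<lambda>q. ?h _ (fst q) (snd q)"]
    by (intro nn_integral_mono) simp
  also have "\<dots> = ennreal (gstar_weight_mass CARD('m) lam2)
    * (\<integral>\<^sup>+y2. \<integral>\<^sup>+x1. \<integral>\<^sup>+t2. ?h x1 t2 y2 \<partial>scale_measure \<partial>lborel \<partial>lborel)"
    by (subst lborel_pair.Fubini') (simp_all add: nn_integral_cmult)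
  also have "\<dots> = ennreal (gstar_weight_mass CARD('m) lam2)
    * (\<integral>\<^sup>+y2. \<integral>\<^sup>+t2. \<integral>\<^sup>+x1. ?h x1 t2 y2 \<partial>lborel \<partial>scale_measure \<partial>lborel)"
    by (intro arg_cong[where f="(*) _"] nn_integral_cong scale_lborel.Fubini') measurable
  also have "\<dots> \<le> ennreal (gstar_weight_mass CARD('m) lam2)
      * (\<integral>\<^sup>+y2. \<integral>\<^sup>+t2. ennreal (gstar_weight_mass CARD('n) lam1)
        * (\<integral>\<^sup>+y1. \<integral>\<^sup>+t1. ?\<Theta> t1 t2 y1 y2 \<partial>scale_measure \<partial>lborel) \<partial>scale_measure \<partial>lborel)"
    using nn_integral_poisson_convolution_le[OF _ c(1), of "\<lambda>q. ?\<Theta> (fst q) _ (snd q) _"]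
    by (intro mult_left_mono nn_integral_mono) simp_all
  also have "\<dots> = ennreal (gstar_weight_mass CARD('m) lam2 * gstar_weight_mass CARD('n) lam1)
      * (\<integral>\<^sup>+y2. \<integral>\<^sup>+t2. \<integral>\<^sup>+y1. \<integral>\<^sup>+t1. ?\<Theta> t1 t2 y1 y2 \<partial>scale_measure \<partial>lborel \<partial>scale_measure \<partial>lborel)"
    using poisson_mass_pos[OF c(1), of "CARD('n)"] poisson_mass_pos[OF c(2), of "CARD('m)"]
    by (simp add: nn_integral_cmult ennreal_mult mult.assoc)
  also have "(\<integral>\<^sup>+y2. \<integral>\<^sup>+t2. \<integral>\<^sup>+y1. \<integral>\<^sup>+t1. ?\<Theta> t1 t2 y1 y2 \<partial>scale_measure \<partial>lborel \<partial>scale_measure \<partial>lborel)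
    = (\<integral>\<^sup>+t1. \<integral>\<^sup>+t2. \<integral>\<^sup>+y. square_theta K f (t1, t2, y) \<partial>lborel \<partial>scale_measure \<partial>scale_measure)"
    by (rule nn_integral_scale_lborel_reorder) measurable
  finally show ?thesis .
qed

theorem theorem1p1:
  fixes lam1 lam2 \<alpha> \<beta> :: real
  assumes "lam1 > 2" and "lam2 > 2"
    and "0 < \<alpha>" and "\<alpha> \<le> real CARD('n::finite) * (lam1 - 2) / 2"
    and "0 < \<beta>" and "\<beta> \<le> real CARD('m::finite) * (lam2 - 2) / 2"
  shows "\<forall>A::real. \<exists>C::real. \<forall>K :: ('n, 'm) kernel.
           kernel_measurable K \<and> assumption1 A \<alpha> \<beta> K \<and> assumption2 A \<alpha> \<beta> lam1 lam2 K
           \<and> assumption3 A lam1 lam2 K \<longrightarrow>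
           (\<forall>f :: (real^'n) \<times> (real^'m) \<Rightarrow> complex. L2 f \<longrightarrow>
              L2norm_nn (gstar K lam1 lam2 f) \<le> ennreal (C * L2norm f))"
proof (intro allI)
  fix A :: real
  let ?c = "gstar_weight_mass CARD('m) lam2 * gstar_weight_mass CARD('n) lam1"
    and ?B = "vertical_const CARD('n) CARD('m) A \<alpha> \<beta> lam1 lam2"
  have lam: "0 \<le> lam1" "0 \<le> lam2" "1 < lam1" "1 < lam2" using assms by auto
  then have c: "0 \<le> ?c" by (intro mult_nonneg_nonneg less_imp_le poisson_mass_pos) auto
  have "L2norm_nn (gstar K lam1 lam2 f) \<le> ennreal (sqrt (?c * ?B) * L2norm f)"
    if K: "kernel_measurable K" "assumption1 A \<alpha> \<beta> K" "assumption2 A \<alpha> \<beta> lam1 lam2 K" "assumption3 A lam1 lam2 K"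
      and f: "L2 f"
    for K :: "('n, 'm) kernel" and f
  proof -
    note vertical = vertical_square_function_bound[OF K assms(3,5) lam(1,2) f]
    have "(\<integral>\<^sup>+x. (gstar K lam1 lam2 f x)\<^sup>2 \<partial>lborel) = (\<integral>\<^sup>+x. gstar_sq K lam1 lam2 f x \<partial>lborel)"
      by (simp add: gstar_def ensqrt_power2)
    also have "\<dots> \<le> ennreal ?c * (\<integral>\<^sup>+t1. \<integral>\<^sup>+t2. \<integral>\<^sup>+y. square_theta K f (t1, t2, y) \<partial>lborel \<partial>scale_measure \<partial>scale_measure)"
      using f by (intro nn_integral_gstar_sq_le K lam) (simp add: L2_def)
    also have "\<dots> \<le> ennreal ?c * ennreal (?B * (L2norm f)\<^sup>2)" by (intro mult_left_mono vertical) simp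
    also have "\<dots> = ennreal ((sqrt (?c * ?B) * L2norm f)\<^sup>2)"
      using c vertical(2) by (simp only: ennreal_mult'[symmetric] power_mult_distrib real_sqrt_pow2 mult_nonneg_nonneg
        mult.assoc[of ?c])
    finally show ?thesis
      unfolding L2norm_nn_def using c vertical(2) by (intro ensqrt_le_ennrealI) (auto simp: L2norm_def)
  qed
  then show "\<exists>C. \<forall>K :: ('n, 'm) kernel. kernel_measurable K \<and> assumption1 A \<alpha> \<beta> K \<and> assumption2 A \<alpha> \<beta> lam1 lam2 K
      \<and> assumption3 A lam1 lam2 K \<longrightarrow> (\<forall>f. L2 f \<longrightarrow> L2norm_nn (gstar K lam1 lam2 f) \<le> ennreal (C * L2norm f))"
    by blast
qed

end
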